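(* Let $s\in(0,1)$, $1<p<\infty$, let $\Omega\subset\mathbb{H}^N$ be open and let $f\in C(\Omega)$. Let $K$ be a kernel satisfying the ellipticity, symmetry, left-translation invariance and continuity assumptions listed in the context, with associated operator $\mathcal{L}$. Let $u\in W^{s,p}_{\mathrm{loc}}(\Omega)\cap L^{p-1}_{sp}(\mathbb{H}^N)$. (a) If $u$ is a weak subsolution of $\mathcal{L}u=f$ in $\Omega$ and $u$ is upper semicontinuous in $\Omega$, then $u$ is a viscosity subsolution of $\mathcal{L}u=f$ in $\Omega$. (b) If $u$ is a weak supersolution of $\mathcal{L}u=f$ in $\Omega$ and $u$ is lower semicontinuous in $\Omega$, then $u$ is a viscosity supersolution of $\mathcal{L}u=f$ in $\Omega$. (c) If $u$ is a weak solution of $\mathcal{L}u=f$ in $\Omega$ and $u$ is continuous in $\Omega$, then $u$ is a viscosity solution of $\mathcal{L}u=f$ in $\Omega$.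
   Context: **Heisenberg group.** $\mathbb{H}^N$ is $\mathbb{R}^{2N+1}$ with points $\xi=(z,t)=(x,y,t)$, $x,y\in\mathbb{R}^N$, $t\in\mathbb{R}$, and group law $\xi\circ\xi'=(x+x',y+y',t+t'+2\langle x',y\rangle-2\langle x,y'\rangle)$; thus $\xi^{-1}=-\xi$. Dilations: $\Phi_\lambda(x,y,t)=(\lambda x,\lambda y,\lambda^2t)$; homogeneous dimension $Q=2N+2$. Homogeneous norm: $|\xi|_{\mathbb{H}^N}=(|z|^4+t^2)^{1/4}$; $(\xi,\eta)\mapsto|\eta^{-1}\circ\xi|_{\mathbb{H}^N}$ is a metric, $B(\xi_0,R)=B_R(\xi_0)=\{\xi:|\xi_0^{-1}\circ\xi|_{\mathbb{H}^N}<R\}$, and dist is with respect to this metric. Integration is with respect to Lebesgue (Haar) measure. Horizontal vector fields: $X_j=\partial_{x_j}+2y_j\partial_t$, $X_{N+j}=\partial_{y_j}-2x_j\partial_t$ ($1\le j\le N$); $\nabla_{\mathbb{H}^N}u=(X_1u,\dots,X_{2N}u)$, and $D^2_{\mathbb{H}^N}u=(X_iX_ju)_{1\le i,j\le 2N}$ is the horizontal Hessian. **Kernel and operator.** $p>1$, $s\in(0,1)$, $0<\lambda\le\Lambda$. $K$ is a positive function defined off the diagonal of $\mathbb{H}^N\times\mathbb{H}^N$ with $\lambda|\eta^{-1}\circ\xi|_{\mathbb{H}^N}^{-Q-sp}\le K(\xi,\eta)\le\Lambda|\eta^{-1}\circ\xi|_{\mathbb{H}^N}^{-Q-sp}$ for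 $\xi\ne\eta$; $K(\xi,\eta)=K(\eta,\xi)$; $K(\xi_0\circ\xi,\xi_0\circ\eta)=K(\xi,\eta)$ for all $\xi_0$; and $\xi\mapsto K(\xi,\eta)$ is continuous away from $\xi=\eta$. The operator is $$\mathcal{L}u(\xi)=2\,\mathrm{P.V.}\int_{\mathbb{H}^N}|u(\xi)-u(\eta)|^{p-2}(u(\xi)-u(\eta))K(\xi,\eta)\,d\eta=2\lim_{\varepsilon\to0}\int_{\mathbb{H}^N\setminus B(\xi,\varepsilon)}(\cdots)\,d\eta .$$ **Function spaces.** $W^{s,p}(U)=\{u\in L^p(U):\int_U\int_U\frac{|u(\xi)-u(\eta)|^p}{|\eta^{-1}\circ\xi|_{\mathbb{H}^N}^{Q+sp}}\,d\xi\,d\eta<\infty\}$; $W^{s,p}_{\mathrm{loc}}(\Omega)$ is its local version. $L^{m}_{\gamma}(\mathbb{H}^N)=\{v\in L^m_{\mathrm{loc}}(\mathbb{H}^N):\int_{\mathbb{H}^N}\frac{|v(\eta)|^m}{1+|\eta|_{\mathbb{H}^N}^{Q+\gamma}}\,d\eta<\infty\}$. **Weak solutions.** For $f\in L^p_{\mathrm{loc}}(\Omega)$, a function $u\in W^{s,p}_{\mathrm{loc}}(\Omega)\cap L^{p-1}_{sp}(\mathbb{H}^N)$ is a weak supersolution (subsolution) of $\mathcal{L}u=f$ in $\Omega$ if $$\iint_{\mathbb{H}^N\times\mathbb{H}^N}|u(\xi)-u(\eta)|^{p-2}(u(\xi)-u(\eta))(\phi(\xi)-\phi(\eta))K(\xi,\eta)\,d\eta\,d\xi\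 \ge(\le)\ \int f\phi\,d\xi$$ for all non-negative $\phi\in C_0^\infty(\Omega)$. A weak solution is both a weak sub- and supersolution. **The class $C^2_\beta$.** For $D$ open, $C^2_\beta(D)$ is the set of $\phi\in C^2(D)$ with $$\sup_{\xi\in D}\left[\frac{\min\{d_\phi(\xi),1\}^{\beta-1}}{|\nabla_{\mathbb{H}^N}\phi(\xi)|}+\frac{|D^2_{\mathbb{H}^N}\phi(\xi)|}{d_\phi(\xi)^{\beta-2}}\right]<\infty,$$ where $d_\phi(\xi)=\mathrm{dist}(\xi,N_\phi)$ and $N_\phi=\{\xi\in D:\nabla_{\mathbb{H}^N}\phi(\xi)=0\}$. **Viscosity solutions.** $u:\mathbb{H}^N\to[-\infty,\infty]$ is a viscosity supersolution (subsolution) of $\mathcal{L}u=f$ in $\Omega$ if: 1. $u<+\infty$ ($u>-\infty$) a.e. in $\mathbb{H}^N$ and $u>-\infty$ ($u<+\infty$) a.e. in $\Omega$; 2. $u$ is lower (upper) semicontinuous in $\Omega$; 3. whenever $\phi\in C^2(B_r(\xi_0))\cap L^{p-1}_{sp}(\mathbb{H}^N)$ for some $B_r(\xi_0)\subset\Omega$, $\phi(\xi_0)=u(\xi_0)$, $\phi\le u$ ($\phi\ge u$) in $\mathbb{H}^N$, and either (a) $p>\frac{2}{2-s}$ or $\nabla_{\mathbb{H}^N}\phi(\xi_0)\ne0$, or (b) $1<p\le\frac{2}{2-s}$, $\nabla_{\mathbb{H}^N}\phi(\xi_0)=0$, $\xi_0$ is an isolated critical point of $\phi$, and $\phi\in C^2_\beta(B_r(\xi_0))$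 for some $\beta>\frac{sp}{p-1}$, then $\mathcal{L}\phi_r(\xi_0)\ge(\le)f(\xi_0)$, where $\phi_r=\phi$ in $B_r(\xi_0)$ and $\phi_r=u$ elsewhere; 4. $u_-$ (respectively $u_+$) belongs to $L^{p-1}_{sp}(\mathbb{H}^N)$. A viscosity solution is both a viscosity sub- and supersolution.
   Formalization: In (a) and (b), u is also assumed to equal its essential upper (resp. lower) limit at every point of Ω; without this, changing a semicontinuous weak sub/supersolution at one point (e.g. u=0 except u(0)=-1, p=2, f=0, in (b)) makes the claim false. Part (c) needs no such assumption. *)

theory Defs
  imports "HOL-Analysis.Analysis"
begin

section \<open>The Heisenberg group\<close>

text \<open>
  Points are triples \<open>(x, y, t)\<close>; the type carries its Euclidean structure, so that
  \<^term>\<open>open\<close>, \<^term>\<open>compact\<close>, \<^term>\<open>continuous_on\<close> and \<^term>\<open>lebesgue\<close> are those of the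
  Euclidean space of dimension \<open>2 N + 1\<close> (the homogeneous metric induces the same topology).
  The unit of the group is \<open>0\<close> and the inverse of \<open>\<xi>\<close> is \<open>- \<xi>\<close>.
\<close>

type_synonym 'n heis = "(real ^ 'n) \<times> (real ^ 'n) \<times> real"

fun heis_mult :: "'n::finite heis \<Rightarrow> 'n heis \<Rightarrow> 'n heis" where
  "heis_mult (x, y, t) (x', y', t') =
     (x + x', y + y', t + t' + 2 * (x' \<bullet> y) - 2 * (x \<bullet> y'))"

lemma heis_mult_inverse: "heis_mult (- \<xi>) \<xi> = 0" "heis_mult \<xi> (- \<xi>) = 0"
  by (cases \<xi>; simp add: zero_prod_def inner_commute)+

definition hom_dim :: "'n::finite itself \<Rightarrow> real" where
  "hom_dim TY = 2 * real CARD('n) + 2"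

fun heis_norm :: "'n::finite heis \<Rightarrow> real" where
  "heis_norm (x, y, t) = root 4 (norm (x, y) ^ 4 + t\<^sup>2)"

definition heis_dist :: "'n::finite heis \<Rightarrow> 'n heis \<Rightarrow> real" where
  "heis_dist \<xi> \<eta> = heis_norm (heis_mult (- \<eta>) \<xi>)"

definition heis_ball :: "'n::finite heis \<Rightarrow> real \<Rightarrow> 'n heis set" where
  "heis_ball \<xi>0 r = {\<xi>. heis_dist \<xi> \<xi>0 < r}"

definition heis_setdist :: "'n::finite heis \<Rightarrow> 'n heis set \<Rightarrow> real" where
  "heis_setdist \<xi> A = (INF \<eta>\<in>A. heis_dist \<xi> \<eta>)"


section \<open>Differentiability\<close>

text \<open>Classical (Euclidean) \<open>C\<^sup>k\<close> regularity; intended for open \<open>D\<close>.\<close>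

primrec Ck_on :: "nat \<Rightarrow> 'a::real_normed_vector set \<Rightarrow> ('a \<Rightarrow> real) \<Rightarrow> bool" where
  "Ck_on 0 D f \<longleftrightarrow> continuous_on D f"
| "Ck_on (Suc k) D f \<longleftrightarrow>
     (\<forall>x\<in>D. f differentiable (at x)) \<and>
     (\<forall>v. Ck_on k D (\<lambda>x. frechet_derivative f (at x) v))"

definition test_function :: "'a::real_normed_vector set \<Rightarrow> ('a \<Rightarrow> real) \<Rightarrow> bool" where
  "test_function \<Omega> \<phi> \<longleftrightarrow>
     (\<forall>k. Ck_on k UNIV \<phi>) \<and>
     compact (closure {\<xi>. \<phi> \<xi> \<noteq> 0}) \<and> closure {\<xi>. \<phi> \<xi> \<noteq> 0} \<subseteq> \<Omega>"

text \<open>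
  The horizontal field \<open>X\<^sub>j\<close> has index \<^term>\<open>Inl j\<close> and \<open>X\<^sub>N\<^sub>+\<^sub>j\<close> has index \<^term>\<open>Inr j\<close>.
\<close>

fun hfield :: "'n::finite + 'n \<Rightarrow> ('n heis \<Rightarrow> real) \<Rightarrow> 'n heis \<Rightarrow> real" where
  "hfield (Inl j) u (x, y, t) =
     frechet_derivative u (at (x, y, t)) (axis j 1, 0, 2 * y $ j)"
| "hfield (Inr j) u (x, y, t) =
     frechet_derivative u (at (x, y, t)) (0, axis j 1, - 2 * x $ j)"

definition hgrad :: "('n::finite heis \<Rightarrow> real) \<Rightarrow> 'n heis \<Rightarrow> real ^ ('n + 'n)" where
  "hgrad u \<xi> = (\<chi> i. hfield i u \<xi>)"

definition hhess :: "('n::finite heis \<Rightarrow> real) \<Rightarrow> 'n heis \<Rightarrow> real ^ ('n + 'n) ^ ('n + 'n)" where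
  "hhess u \<xi> = (\<chi> i j. hfield i (hfield j u) \<xi>)"

definition crit_set :: "'n::finite heis set \<Rightarrow> ('n heis \<Rightarrow> real) \<Rightarrow> 'n heis set" where
  "crit_set D \<phi> = {\<xi>\<in>D. hgrad \<phi> \<xi> = 0}"

text \<open>
  The supremum is taken off the critical set, where both quotients have positive
  denominators. The class is only used for functions with a critical point in \<open>D\<close>,
  so the distance to an empty set plays no role.
\<close>

definition C2_beta :: "real \<Rightarrow> 'n::finite heis set \<Rightarrow> ('n heis \<Rightarrow> real) \<Rightarrow> bool" where
  "C2_beta \<beta> D \<phi> \<longleftrightarrow>
     Ck_on 2 D \<phi> \<and>
     bdd_above ((\<lambda>\<xi>. let d = heis_setdist \<xi> (crit_set D \<phi>) in
         min d 1 powr (\<beta> - 1) / norm (hgrad \<phi> \<xi>)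
         + norm (hhess \<phi> \<xi>) / d powr (\<beta> - 2)) ` (D - crit_set D \<phi>))"


section \<open>Function spaces\<close>

text \<open>
  Functions are extended-real valued throughout, since viscosity sub- and supersolutions
  (and the functions touching them) may take infinite values. Membership in any of the spaces
  below includes being finite almost everywhere, so that \<^term>\<open>real_of_ereal\<close> alters an
  integrand on a null set only.
\<close>

definition Lm_on :: "real \<Rightarrow> 'n::finite heis set \<Rightarrow> ('n heis \<Rightarrow> ereal) \<Rightarrow> bool" where
  "Lm_on m U v \<longleftrightarrow>
     v \<in> borel_measurable (lebesgue_on U) \<and>
     (AE \<xi> in lebesgue_on U. \<bar>v \<xi>\<bar> \<noteq> \<infinity>) \<and>
     (\<integral>\<^sup>+\<xi>\<in>U. ennreal (\<bar>real_of_ereal (v \<xi>)\<bar> powr m) \<partial>lebesgue) < \<infinity>"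

definition Lm_weighted :: "real \<Rightarrow> real \<Rightarrow> ('n::finite heis \<Rightarrow> ereal) \<Rightarrow> bool" where
  "Lm_weighted m \<gamma> v \<longleftrightarrow>
     (\<forall>C. compact C \<longrightarrow> Lm_on m C v) \<and>
     (\<integral>\<^sup>+\<eta>. ennreal (\<bar>real_of_ereal (v \<eta>)\<bar> powr m
        / (1 + heis_norm \<eta> powr (hom_dim TYPE('n) + \<gamma>))) \<partial>lebesgue) < \<infinity>"

definition Wsp_on :: "real \<Rightarrow> real \<Rightarrow> 'n::finite heis set \<Rightarrow> ('n heis \<Rightarrow> ereal) \<Rightarrow> bool" where
  "Wsp_on s p U u \<longleftrightarrow>
     Lm_on p U u \<and>
     (\<integral>\<^sup>+\<xi>\<in>U. (\<integral>\<^sup>+\<eta>\<in>U.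
        ennreal (\<bar>real_of_ereal (u \<xi>) - real_of_ereal (u \<eta>)\<bar> powr p
          / heis_dist \<xi> \<eta> powr (hom_dim TYPE('n) + s * p)) \<partial>lebesgue) \<partial>lebesgue) < \<infinity>"

definition Wsp_loc :: "real \<Rightarrow> real \<Rightarrow> 'n::finite heis set \<Rightarrow> ('n heis \<Rightarrow> ereal) \<Rightarrow> bool" where
  "Wsp_loc s p \<Omega> u \<longleftrightarrow>
     (\<forall>U. open U \<and> compact (closure U) \<and> closure U \<subseteq> \<Omega> \<longrightarrow> Wsp_on s p U u)"


section \<open>Kernel and operator\<close>

definition heis_kernel ::
    "real \<Rightarrow> real \<Rightarrow> real \<Rightarrow> real \<Rightarrow> ('n::finite heis \<Rightarrow> 'n heis \<Rightarrow> real) \<Rightarrow> bool" where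
  "heis_kernel s p lam Lam K \<longleftrightarrow>
     (\<forall>\<xi> \<eta>. \<xi> \<noteq> \<eta> \<longrightarrow>
        0 < K \<xi> \<eta> \<and>
        lam * heis_dist \<xi> \<eta> powr (- hom_dim TYPE('n) - s * p) \<le> K \<xi> \<eta> \<and>
        K \<xi> \<eta> \<le> Lam * heis_dist \<xi> \<eta> powr (- hom_dim TYPE('n) - s * p) \<and>
        K \<xi> \<eta> = K \<eta> \<xi> \<and>
        (\<forall>\<xi>0. K (heis_mult \<xi>0 \<xi>) (heis_mult \<xi>0 \<eta>) = K \<xi> \<eta>)) \<and>
     (\<forall>\<eta>. continuous_on (- {\<eta>}) (\<lambda>\<xi>. K \<xi> \<eta>))"

definition Jp :: "real \<Rightarrow> real \<Rightarrow> real" where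
  "Jp p a = \<bar>a\<bar> powr (p - 2) * a"

text \<open>
  \<open>has_op K p u \<xi> l\<close>: the principal value defining the operator at \<open>\<xi>\<close> exists and equals
  the real number \<open>l\<close>. Integrability off the balls is explicit because the Bochner integral
  of a non-integrable function is \<open>0\<close>.
\<close>

definition has_op ::
    "('n::finite heis \<Rightarrow> 'n heis \<Rightarrow> real) \<Rightarrow> real \<Rightarrow> ('n heis \<Rightarrow> ereal) \<Rightarrow> 'n heis \<Rightarrow> real \<Rightarrow> bool"
  where
  "has_op K p u \<xi> l \<longleftrightarrow>
     (let g = (\<lambda>\<eta>. Jp p (real_of_ereal (u \<xi>) - real_of_ereal (u \<eta>)) * K \<xi> \<eta>) in
       (\<forall>\<epsilon>>0. set_integrable lebesgue (- heis_ball \<xi> \<epsilon>) g) \<and>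
       ((\<lambda>\<epsilon>. 2 * (LINT \<eta>:- heis_ball \<xi> \<epsilon>|lebesgue. g \<eta>)) \<longlongrightarrow> l) (at_right 0))"


section \<open>Weak solutions\<close>

definition weak_form ::
    "('n::finite heis \<Rightarrow> 'n heis \<Rightarrow> real) \<Rightarrow> real \<Rightarrow> ('n heis \<Rightarrow> ereal) \<Rightarrow> ('n heis \<Rightarrow> real) \<Rightarrow> real"
  where
  "weak_form K p u \<phi> =
     (LINT (\<xi>, \<eta>)|lebesgue.
        Jp p (real_of_ereal (u \<xi>) - real_of_ereal (u \<eta>)) * (\<phi> \<xi> - \<phi> \<eta>) * K \<xi> \<eta>)"

definition weak_supersolution ::
    "('n::finite heis \<Rightarrow> 'n heis \<Rightarrow> real) \<Rightarrow> real \<Rightarrow> real \<Rightarrow> 'n heis set \<Rightarrow> ('n heis \<Rightarrow> real) \<Rightarrow>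
     ('n heis \<Rightarrow> ereal) \<Rightarrow> bool" where
  "weak_supersolution K s p \<Omega> f u \<longleftrightarrow>
     Wsp_loc s p \<Omega> u \<and> Lm_weighted (p - 1) (s * p) u \<and>
     (\<forall>\<phi>. test_function \<Omega> \<phi> \<and> (\<forall>\<xi>. 0 \<le> \<phi> \<xi>) \<longrightarrow>
        weak_form K p u \<phi> \<ge> (LINT \<xi>:\<Omega>|lebesgue. f \<xi> * \<phi> \<xi>))"

definition weak_subsolution ::
    "('n::finite heis \<Rightarrow> 'n heis \<Rightarrow> real) \<Rightarrow> real \<Rightarrow> real \<Rightarrow> 'n heis set \<Rightarrow> ('n heis \<Rightarrow> real) \<Rightarrow>
     ('n heis \<Rightarrow> ereal) \<Rightarrow> bool" where
  "weak_subsolution K s p \<Omega> f u \<longleftrightarrow>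
     Wsp_loc s p \<Omega> u \<and> Lm_weighted (p - 1) (s * p) u \<and>
     (\<forall>\<phi>. test_function \<Omega> \<phi> \<and> (\<forall>\<xi>. 0 \<le> \<phi> \<xi>) \<longrightarrow>
        weak_form K p u \<phi> \<le> (LINT \<xi>:\<Omega>|lebesgue. f \<xi> * \<phi> \<xi>))"

definition weak_solution ::
    "('n::finite heis \<Rightarrow> 'n heis \<Rightarrow> real) \<Rightarrow> real \<Rightarrow> real \<Rightarrow> 'n heis set \<Rightarrow> ('n heis \<Rightarrow> real) \<Rightarrow>
     ('n heis \<Rightarrow> ereal) \<Rightarrow> bool" where
  "weak_solution K s p \<Omega> f u \<longleftrightarrow>
     weak_subsolution K s p \<Omega> f u \<and> weak_supersolution K s p \<Omega> f u"


section \<open>Semicontinuity\<close>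

definition lsc_on :: "'a::topological_space set \<Rightarrow> ('a \<Rightarrow> ereal) \<Rightarrow> bool" where
  "lsc_on \<Omega> u \<longleftrightarrow> (\<forall>a. openin (top_of_set \<Omega>) {\<xi>\<in>\<Omega>. a < u \<xi>})"

definition usc_on :: "'a::topological_space set \<Rightarrow> ('a \<Rightarrow> ereal) \<Rightarrow> bool" where
  "usc_on \<Omega> u \<longleftrightarrow> (\<forall>a. openin (top_of_set \<Omega>) {\<xi>\<in>\<Omega>. u \<xi> < a})"

text \<open>
  A weak sub- or supersolution is determined up to null sets only, whereas the touching
  condition for viscosity solutions is pointwise: lowering a lower semicontinuous weak
  supersolution at a single point gives again a lower semicontinuous weak supersolution, but
  in general no viscosity supersolution. Semicontinuity of a weak supersolution (subsolution)
  is therefore understood for its canonical representative, whose values are the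
  essential lower (upper) limits.
\<close>

definition ess_liminf :: "('n::finite heis \<Rightarrow> ereal) \<Rightarrow> 'n heis \<Rightarrow> ereal" where
  "ess_liminf u \<xi> = Sup {a. \<exists>r>0. AE \<eta> in lebesgue. \<eta> \<in> heis_ball \<xi> r \<longrightarrow> a \<le> u \<eta>}"

definition ess_limsup :: "('n::finite heis \<Rightarrow> ereal) \<Rightarrow> 'n heis \<Rightarrow> ereal" where
  "ess_limsup u \<xi> = Inf {a. \<exists>r>0. AE \<eta> in lebesgue. \<eta> \<in> heis_ball \<xi> r \<longrightarrow> u \<eta> \<le> a}"


section \<open>Viscosity solutions\<close>

text \<open>
  \<open>visc_admissible s p \<phi> \<xi>0 r\<close>: the touching function \<open>\<phi>\<close> is (real-valued and) \<open>C\<^sup>2\<close> in the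
  ball, lies in the tail space, and satisfies one of the alternatives (a), (b) of the
  definition of viscosity sub- and supersolutions.
\<close>

definition visc_admissible ::
    "real \<Rightarrow> real \<Rightarrow> ('n::finite heis \<Rightarrow> ereal) \<Rightarrow> 'n heis \<Rightarrow> real \<Rightarrow> bool" where
  "visc_admissible s p \<phi> \<xi>0 r \<longleftrightarrow>
     (let g = (\<lambda>\<xi>. real_of_ereal (\<phi> \<xi>)) in
       (\<forall>\<xi>\<in>heis_ball \<xi>0 r. \<bar>\<phi> \<xi>\<bar> \<noteq> \<infinity>) \<and> Ck_on 2 (heis_ball \<xi>0 r) g \<and>
       Lm_weighted (p - 1) (s * p) \<phi> \<and>
       ((p > 2 / (2 - s) \<or> hgrad g \<xi>0 \<noteq> 0) \<or>
        (1 < p \<and> p \<le> 2 / (2 - s) \<and> hgrad g \<xi>0 = 0 \<and>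
         (\<exists>\<delta>>0. \<forall>\<xi>\<in>heis_ball \<xi>0 \<delta>. hgrad g \<xi> = 0 \<longrightarrow> \<xi> = \<xi>0) \<and>
         (\<exists>\<beta>>s * p / (p - 1). C2_beta \<beta> (heis_ball \<xi>0 r) g))))"

definition viscosity_supersolution ::
    "('n::finite heis \<Rightarrow> 'n heis \<Rightarrow> real) \<Rightarrow> real \<Rightarrow> real \<Rightarrow> 'n heis set \<Rightarrow> ('n heis \<Rightarrow> real) \<Rightarrow>
     ('n heis \<Rightarrow> ereal) \<Rightarrow> bool" where
  "viscosity_supersolution K s p \<Omega> f u \<longleftrightarrow>
     (AE \<xi> in lebesgue. u \<xi> < \<infinity>) \<and> (AE \<xi> in lebesgue. \<xi> \<in> \<Omega> \<longrightarrow> - \<infinity> < u \<xi>) \<and>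
     lsc_on \<Omega> u \<and>
     (\<forall>\<phi> \<xi>0 r. 0 < r \<and> heis_ball \<xi>0 r \<subseteq> \<Omega> \<and> \<phi> \<xi>0 = u \<xi>0 \<and> (\<forall>\<xi>. \<phi> \<xi> \<le> u \<xi>) \<and>
        visc_admissible s p \<phi> \<xi>0 r \<longrightarrow>
        (\<exists>l. has_op K p (\<lambda>\<xi>. if \<xi> \<in> heis_ball \<xi>0 r then \<phi> \<xi> else u \<xi>) \<xi>0 l \<and> l \<ge> f \<xi>0)) \<and>
     Lm_weighted (p - 1) (s * p) (\<lambda>\<xi>. max 0 (- u \<xi>))"

definition viscosity_subsolution ::
    "('n::finite heis \<Rightarrow> 'n heis \<Rightarrow> real) \<Rightarrow> real \<Rightarrow> real \<Rightarrow> 'n heis set \<Rightarrow> ('n heis \<Rightarrow> real) \<Rightarrow>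
     ('n heis \<Rightarrow> ereal) \<Rightarrow> bool" where
  "viscosity_subsolution K s p \<Omega> f u \<longleftrightarrow>
     (AE \<xi> in lebesgue. - \<infinity> < u \<xi>) \<and> (AE \<xi> in lebesgue. \<xi> \<in> \<Omega> \<longrightarrow> u \<xi> < \<infinity>) \<and>
     usc_on \<Omega> u \<and>
     (\<forall>\<phi> \<xi>0 r. 0 < r \<and> heis_ball \<xi>0 r \<subseteq> \<Omega> \<and> \<phi> \<xi>0 = u \<xi>0 \<and> (\<forall>\<xi>. \<phi> \<xi> \<ge> u \<xi>) \<and>
        visc_admissible s p \<phi> \<xi>0 r \<longrightarrow>
        (\<exists>l. has_op K p (\<lambda>\<xi>. if \<xi> \<in> heis_ball \<xi>0 r then \<phi> \<xi> else u \<xi>) \<xi>0 l \<and> l \<le> f \<xi>0)) \<and>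
     Lm_weighted (p - 1) (s * p) (\<lambda>\<xi>. max 0 (u \<xi>))"

definition viscosity_solution ::
    "('n::finite heis \<Rightarrow> 'n heis \<Rightarrow> real) \<Rightarrow> real \<Rightarrow> real \<Rightarrow> 'n heis set \<Rightarrow> ('n heis \<Rightarrow> real) \<Rightarrow>
     ('n heis \<Rightarrow> ereal) \<Rightarrow> bool" where
  "viscosity_solution K s p \<Omega> f u \<longleftrightarrow>
     viscosity_subsolution K s p \<Omega> f u \<and> viscosity_supersolution K s p \<Omega> f u"

end

theory Submission
 imports Defs
begin


text \<open>
 By left invariance the kernel is \<open>k (\<eta>\<^sup>-\<^sup>1 \<circ> \<xi>)\<close> with an even function \<open>k\<close>. Suppose that \<open>\<phi>\<close> touches a weak supersolution
 \<open>u\<close> from below at \<open>\<xi>\<^sub>0\<close> and that the principal value there is smaller than \<open>f \<xi>\<^sub>0\<close>. Lift \<open>\<phi>\<close> near \<open>\<xi>\<^sub>0\<close> by a small multiple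
 of a cutoff to get \<open>\<psi>\<close>. The singular part of the operator, applied to such lifts, is small uniformly near \<open>\<xi>\<^sub>0\<close>: the
 kernel being even, a term that is odd in the increment may be subtracted, and Taylor's formula along horizontal curves
 bounds the rest; at a critical point with \<open>p \<le> 2 / (2 - s)\<close> the class \<open>C\<^sup>2\<^sub>\<beta>\<close> enters here. The remaining part is continuous
 by dominated convergence. So \<open>\<psi>\<close> is a strict pointwise subsolution near \<open>\<xi>\<^sub>0\<close>. Testing the weak inequality with \<open>w = (\<psi> - u)\<^sub>+\<close>,
 which is upper semicontinuous and hence approximable by mollification, monotonicity of the nonlinearity gives \<open>w = 0\<close>
 almost everywhere. Then \<open>u\<close> exceeds \<open>\<phi>\<close> by a positive constant near \<open>\<xi>\<^sub>0\<close>, which contradicts \<open>u \<xi>\<^sub>0\<close> being the essential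
 lower limit.
\<close>

section \<open>The Heisenberg group\<close>

text \<open>The parameters are fixed in the order \<delta>, R, \<rho>, \<theta>. The lift is
  \<theta> times a cutoff of radius \<rho>, and the second-order bound of that cutoff blows up as
  \<rho> shrinks, so \<theta> comes last, whereas the radius R of the singular part depends on the
  allowed error alone. Hence estimates are needed that are uniform over a family of perturbed
  functions, not for \<phi> alone. The principal value never meets the weak form: the strict
  inequality is shown for all truncated operators with small truncation radius, and these converge
  absolutely and can be symmetrised. The class \<open>C2_beta\<close> speaks of horizontal
  derivatives only; vertical increments are recovered from them through commutators. For p < 2 the
  weight |g . z|^(p - 2) left by the nonlinearity is integrable because p - 2 > -1, and near a
  critical point it is used only within a radius comparable with the distance to that point. Since
  weak solutions are determined almost everywhere and touching is pointwise, u is replaced by a real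
  Borel function that keeps its finite values in the ball of contact. Subsolutions follow by
  changing signs.\<close>

definition horiz :: "'n::finite heis => (real ^ 'n) \<times> (real ^ 'n)" where
 "horiz \<xi> = (fst \<xi>, fst (snd \<xi>))"

definition vert :: "'n::finite heis => real" where
 "vert \<xi> = snd (snd \<xi>)"

text \<open>The symplectic form of the horizontal layer, in the normalisation of the group law. It
  is the only deviation of the product from vector addition.\<close>

definition omega :: "'n::finite heis => 'n heis => real" where
 "omega \<xi> \<eta> = 2 * (fst \<eta> \<bullet> fst (snd \<xi>)) - 2 * (fst \<xi> \<bullet> fst (snd \<eta>))"

lemma heis_mult_eq: "heis_mult \<xi> \<eta> = \<xi> + \<eta> + (0, 0, omega \<xi> \<eta>)"
 by (cases \<xi>; cases \<eta>) (simp add: omega_def)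

lemma horiz_mult [simp]: "horiz (heis_mult \<xi> \<eta>) = horiz \<xi> + horiz \<eta>"
 by (simp add: heis_mult_eq horiz_def)

lemma vert_mult [simp]: "vert (heis_mult \<xi> \<eta>) = vert \<xi> + vert \<eta> + omega \<xi> \<eta>"
 by (simp add: heis_mult_eq vert_def)

lemma horiz_simps [simp]: "horiz (- \<xi>) = - horiz \<xi>" "horiz 0 = 0"
 by (simp_all add: horiz_def zero_prod_def)

lemma vert_simps [simp]: "vert (- \<xi>) = - vert \<xi>" "vert 0 = 0"
 by (simp_all add: vert_def)

lemma omega_simps [simp]:
 "omega 0 \<eta> = 0" "omega \<xi> 0 = 0" "omega (- \<xi>) \<eta> = - omega \<xi> \<eta>" "omega \<xi> (- \<eta>) = - omega \<xi> \<eta>"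
 "omega \<xi> \<xi> = 0"
 by (simp_all add: omega_def inner_commute)

lemma heis_mult_assoc: "heis_mult (heis_mult a b) c = heis_mult a (heis_mult b c)"
 by (simp add: heis_mult_eq omega_def inner_add_left inner_add_right prod_eq_iff algebra_simps)

lemma heis_mult_0 [simp]: "heis_mult 0 \<xi> = \<xi>" "heis_mult \<xi> 0 = \<xi>"
 by (simp_all add: heis_mult_eq zero_prod_def[symmetric])

lemma heis_inv_cancel [simp]:
 "heis_mult (- \<xi>) \<xi> = 0" "heis_mult \<xi> (- \<xi>) = 0"
 "heis_mult (- \<xi>) (heis_mult \<xi> \<eta>) = \<eta>" "heis_mult \<xi> (heis_mult (- \<xi>) \<eta>) = \<eta>"
 by (simp_all add: heis_mult_inverse heis_mult_assoc[symmetric])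

lemma heis_mult_uminus: "- heis_mult a b = heis_mult (- b) (- a)"
 by (simp add: heis_mult_eq omega_def prod_eq_iff inner_commute)

lemma heis_diff_cancel [simp]:
 "heis_mult (- heis_mult \<zeta> \<eta>) (heis_mult \<zeta> \<xi>) = heis_mult (- \<eta>) \<xi>"
 by (simp add: heis_mult_uminus heis_mult_assoc)

lemma heis_eq_iff: "heis_mult (- \<eta>) \<xi> = 0 \<longleftrightarrow> \<xi> = \<eta>"
 by (metis heis_inv_cancel(1,4) heis_mult_0(2))

lemma continuous_horiz [continuous_intros]:
 "continuous_on S f ==> continuous_on S (\<lambda>x. horiz (f x))"
 unfolding horiz_def by (intro continuous_intros)

lemma continuous_vert [continuous_intros]:
 "continuous_on S f ==> continuous_on S (\<lambda>x. vert (f x))"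
 unfolding vert_def by (intro continuous_intros)

lemma continuous_heis_mult [continuous_intros]:
 "continuous_on S f ==> continuous_on S g ==> continuous_on S (\<lambda>x. heis_mult (f x) (g x))"
 unfolding heis_mult_eq omega_def by (intro continuous_intros)

section \<open>The homogeneous norm and the left-invariant metric\<close>

lemma heis_norm_alt: "heis_norm \<xi> = root 4 (norm (horiz \<xi>) ^ 4 + (vert \<xi>)\<^sup>2)"
 by (cases \<xi>) (simp add: horiz_def vert_def)

lemma heis_norm_nonneg [simp]: "0 \<le> heis_norm \<xi>"
 by (simp add: heis_norm_alt)

lemma heis_norm_pow4: "heis_norm \<xi> ^ 4 = norm (horiz \<xi>) ^ 4 + (vert \<xi>)\<^sup>2"
 by (simp add: heis_norm_alt real_root_pow_pos2)

text \<open>The squared norm is the Euclidean length of the planar vector (|z|^2, t); this reduces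
  the triangle inequality of the group to the one in the plane.\<close>

lemma heis_norm_pow2: "(heis_norm \<xi>)\<^sup>2 = norm ((norm (horiz \<xi>))\<^sup>2, vert \<xi>)"
proof -
 have "((heis_norm \<xi>)\<^sup>2)\<^sup>2 = (norm ((norm (horiz \<xi>))\<^sup>2, vert \<xi>))\<^sup>2"
  using heis_norm_pow4[of \<xi>] by (simp add: norm_Pair)
 then show ?thesis by (rule power2_eq_imp_eq) simp_all
qed

lemma heis_norm_0 [simp]: "heis_norm 0 = 0"
 by (simp add: heis_norm_alt)

lemma heis_norm_minus [simp]: "heis_norm (- \<xi>) = heis_norm \<xi>"
 by (simp add: heis_norm_alt)

lemma norm_horiz_le: "norm (horiz \<xi>) \<le> heis_norm \<xi>"
proof -
 have "norm (horiz \<xi>) ^ 4 \<le> heis_norm \<xi> ^ 4" by (simp add: heis_norm_pow4)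
 then show ?thesis by (simp add: power_mono_iff)
qed

lemma abs_vert_le: "\<bar>vert \<xi>\<bar> \<le> (heis_norm \<xi>)\<^sup>2"
 unfolding heis_norm_pow2 by (metis norm_snd_le real_norm_def)

lemma norm_heis_sq: "(norm \<xi>)\<^sup>2 = (norm (horiz \<xi>))\<^sup>2 + (vert \<xi>)\<^sup>2"
 by (cases \<xi>) (simp add: horiz_def vert_def norm_Pair)

lemma heis_eqI: "horiz \<xi> = horiz \<eta> ==> vert \<xi> = vert \<eta> ==> \<xi> = \<eta>"
 by (simp add: horiz_def vert_def prod_eq_iff)

lemma heis_norm_eq_0 [simp]: "heis_norm \<xi> = 0 \<longleftrightarrow> \<xi> = 0"
proof
 assume "heis_norm \<xi> = 0"
 then have "norm (horiz \<xi>) ^ 4 + (vert \<xi>)\<^sup>2 = 0" using heis_norm_pow4[of \<xi>] by simp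
 moreover have "0 \<le> norm (horiz \<xi>) ^ 4" "0 \<le> (vert \<xi>)\<^sup>2" by simp_all
 ultimately have "norm (horiz \<xi>) ^ 4 = 0" "(vert \<xi>)\<^sup>2 = 0" by linarith+
 then have "horiz \<xi> = 0" "vert \<xi> = 0" by simp_all
 then show "\<xi> = 0" by (intro heis_eqI) simp_all
qed simp

lemma heis_norm_pos: "\<xi> \<noteq> 0 ==> 0 < heis_norm \<xi>"
 using heis_norm_nonneg[of \<xi>] heis_norm_eq_0[of \<xi>] by linarith

lemma continuous_heis_norm [continuous_intros]:
 "continuous_on S f ==> continuous_on S (\<lambda>x. heis_norm (f x))"
 unfolding heis_norm_alt by (intro continuous_intros) 

text \<open>Bessel's inequality for the orthogonal pair \<open>(x', y')\<close>, \<open>(-y', x')\<close>.\<close>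
lemma symplectic_Cauchy_Schwarz:
 "(horiz \<xi> \<bullet> horiz \<eta>)\<^sup>2 + (omega \<xi> \<eta> / 2)\<^sup>2 \<le> (norm (horiz \<xi>))\<^sup>2 * (norm (horiz \<eta>))\<^sup>2"
proof -
 define z where "z = horiz \<xi>"
 define a where "a = horiz \<eta>"
 define b where "b = (- snd a, fst a)"
 define P where "P = z \<bullet> a"
 define R where "R = z \<bullet> b"
 have om: "omega \<xi> \<eta> / 2 = R"
  by (simp add: omega_def R_def z_def b_def a_def horiz_def inner_Pair inner_commute)
 have bb: "b \<bullet> b = a \<bullet> a" by (cases a) (simp add: b_def)
 have ab: "a \<bullet> b = 0" by (cases a) (simp add: b_def inner_commute)
 show ?thesis
 proof (cases "a \<bullet> a = 0")
  case True
  then have "a = 0" by simp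
  then show ?thesis using om by (simp add: R_def b_def a_def[symmetric] zero_prod_def[symmetric])
 next
  case False
  then have pos: "a \<bullet> a > 0" by (metis inner_ge_zero less_le)
  \<comment> \<open>\<open>?v\<close> is \<open>a \<bullet> a\<close> times the component of
    \<open>z\<close> orthogonal to \<open>a\<close> and \<open>b\<close>.\<close>
  let ?v = "(a \<bullet> a) *\<^sub>R z - P *\<^sub>R a - R *\<^sub>R b"
  have "?v \<bullet> ?v = (a \<bullet> a)\<^sup>2 * (z \<bullet> z) - (a \<bullet> a) * (P\<^sup>2 + R\<^sup>2)"
   using ab bb
   by (simp add: inner_diff_left inner_diff_right inner_commute[of a z] inner_commute[of b z]
     inner_commute[of b a] P_def[symmetric] R_def[symmetric] power2_eq_square algebra_simps)
  moreover have "?v \<bullet> ?v \<ge> 0" by simp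
  ultimately have "(a \<bullet> a) * (P\<^sup>2 + R\<^sup>2) \<le> (a \<bullet> a) * ((a \<bullet> a) * (z \<bullet> z))"
   by (simp add: power2_eq_square algebra_simps)
  then have "P\<^sup>2 + R\<^sup>2 \<le> (a \<bullet> a) * (z \<bullet> z)" using pos by simp
  then show ?thesis unfolding om
   by (simp add: P_def z_def[symmetric] a_def[symmetric] dot_square_norm mult.commute)
 qed
qed

text \<open>The planar vector (|z|^2, t) of a product is the sum of those of the factors and of (2 z
  . z', omega); the symplectic Cauchy-Schwarz inequality bounds the length of this third vector by 2
  |z| |z'|.\<close>

lemma heis_norm_triangle: "heis_norm (heis_mult \<xi> \<eta>) \<le> heis_norm \<xi> + heis_norm \<eta>"
proof -
 let ?z = "horiz \<xi>" and ?z' = "horiz \<eta>"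
 have eq: "((norm (?z + ?z'))\<^sup>2, vert \<xi> + vert \<eta> + omega \<xi> \<eta>)
  = ((norm ?z)\<^sup>2, vert \<xi>) + ((norm ?z')\<^sup>2, vert \<eta>) + (2 * (?z \<bullet> ?z'), omega \<xi> \<eta>)"
  by (simp add: power2_norm_eq_inner inner_add_left inner_add_right inner_commute)
 have "(norm (2 * (?z \<bullet> ?z'), omega \<xi> \<eta>))\<^sup>2 \<le> (2 * norm ?z * norm ?z')\<^sup>2"
  using symplectic_Cauchy_Schwarz[of \<xi> \<eta>] by (simp add: norm_Pair power_mult_distrib power_divide)
 then have "norm (2 * (?z \<bullet> ?z'), omega \<xi> \<eta>) \<le> 2 * norm ?z * norm ?z'"
  by (simp add: abs_le_square_iff[symmetric])
 also have "\<dots> \<le> 2 * heis_norm \<xi> * heis_norm \<eta>"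
  by (intro mult_mono mult_left_mono) (auto simp: norm_horiz_le)
 finally have 1: "norm (2 * (?z \<bullet> ?z'), omega \<xi> \<eta>) \<le> 2 * heis_norm \<xi> * heis_norm \<eta>" .
 have "(heis_norm (heis_mult \<xi> \<eta>))\<^sup>2 \<le> (heis_norm \<xi>)\<^sup>2 + (heis_norm \<eta>)\<^sup>2 + 2 * heis_norm \<xi> * heis_norm \<eta>"
  unfolding heis_norm_pow2[of "heis_mult \<xi> \<eta>"] horiz_mult vert_mult eq
  using norm_triangle_ineq[of "((norm ?z)\<^sup>2, vert \<xi>) + ((norm ?z')\<^sup>2, vert \<eta>)" "(2 * (?z \<bullet> ?z'), omega \<xi> \<eta>)"]
   norm_triangle_ineq[of "((norm ?z)\<^sup>2, vert \<xi>)" "((norm ?z')\<^sup>2, vert \<eta>)"] 1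
  by (simp add: heis_norm_pow2[symmetric])
 then have "(heis_norm (heis_mult \<xi> \<eta>))\<^sup>2 \<le> (heis_norm \<xi> + heis_norm \<eta>)\<^sup>2"
  by (simp add: power2_sum)
 then show ?thesis by (simp add: abs_le_square_iff[symmetric])
qed

lemma heis_dist_commute: "heis_dist \<xi> \<eta> = heis_dist \<eta> \<xi>"
 unfolding heis_dist_def by (metis heis_mult_uminus heis_norm_minus minus_minus)

lemma heis_dist_nonneg [simp]: "0 \<le> heis_dist \<xi> \<eta>"
 by (simp add: heis_dist_def)

lemma heis_dist_triangle: "heis_dist \<xi> \<zeta> \<le> heis_dist \<xi> \<eta> + heis_dist \<eta> \<zeta>"
 unfolding heis_dist_def
 using heis_norm_triangle[of "heis_mult (- \<zeta>) \<eta>" "heis_mult (- \<eta>) \<xi>"]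
 by (simp add: heis_mult_assoc)

lemma heis_dist_self [simp]: "heis_dist \<xi> \<xi> = 0"
 by (simp add: heis_dist_def)

lemma heis_dist_eq_0 [simp]: "heis_dist \<xi> \<eta> = 0 \<longleftrightarrow> \<xi> = \<eta>"
 by (simp add: heis_dist_def heis_eq_iff)

lemma heis_dist_mult [simp]: "heis_dist \<xi> (heis_mult \<xi> \<eta>) = heis_norm \<eta>"
 unfolding heis_dist_commute[of \<xi>] by (simp add: heis_dist_def)

lemma heis_dist_0 [simp]: "heis_dist \<xi> 0 = heis_norm \<xi>"
 by (simp add: heis_dist_def)

lemma heis_dist_translate [simp]: "heis_dist (heis_mult \<zeta> \<xi>) (heis_mult \<zeta> \<eta>) = heis_dist \<xi> \<eta>"
 by (simp add: heis_dist_def)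

lemma continuous_heis_dist [continuous_intros]:
 "continuous_on S f ==> continuous_on S g ==> continuous_on S (\<lambda>x. heis_dist (f x) (g x))"
 unfolding heis_dist_def by (intro continuous_intros)

lemma mem_heis_ball: "\<xi> \<in> heis_ball x0 r \<longleftrightarrow> heis_dist \<xi> x0 < r"
 by (simp add: heis_ball_def)

lemma open_heis_ball [simp]: "open (heis_ball x0 r)"
 unfolding heis_ball_def by (intro open_Collect_less continuous_intros)

lemma closed_heis_cball: "closed {\<xi>. heis_dist \<xi> x0 \<le> r}"
 by (intro closed_Collect_le continuous_intros)

lemma norm_heis_le: "norm \<xi> \<le> heis_norm \<xi> + (heis_norm \<xi>)\<^sup>2"
proof -
 have a: "(norm (horiz \<xi>))\<^sup>2 \<le> (heis_norm \<xi>)\<^sup>2" by (simp add: power_mono norm_horiz_le)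
 have b: "(vert \<xi>)\<^sup>2 \<le> ((heis_norm \<xi>)\<^sup>2)\<^sup>2" using power_mono[OF abs_vert_le, of \<xi> 2] by simp
 have "(norm \<xi>)\<^sup>2 \<le> (heis_norm \<xi>)\<^sup>2 + ((heis_norm \<xi>)\<^sup>2)\<^sup>2"
  unfolding norm_heis_sq using a b by linarith
 also have "\<dots> \<le> (heis_norm \<xi> + (heis_norm \<xi>)\<^sup>2)\<^sup>2"
  by (simp add: power2_sum)
 finally show ?thesis by (simp add: abs_le_square_iff[symmetric])
qed

lemma compact_heis_cball: "compact {\<xi>. heis_dist \<xi> x0 \<le> r}"
proof -
 have "compact {\<xi>::'n::finite heis. heis_norm \<xi> \<le> r}" (is "compact ?A")
 proof -
  have "closed ?A" by (intro closed_Collect_le continuous_intros)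
  moreover have "bounded ?A"
   unfolding bounded_iff
  proof (intro exI ballI)
   fix x assume "x \<in> ?A"
   then show "norm x \<le> r + r\<^sup>2"
    using norm_heis_le[of x] power_mono[of "heis_norm x" r 2] by auto
  qed
  ultimately show ?thesis by (simp add: compact_eq_bounded_closed)
 qed
 then have "compact (heis_mult x0 ` {\<xi>. heis_norm \<xi> \<le> r})"
  by (intro compact_continuous_image continuous_intros)
 also have "heis_mult x0 ` {\<xi>. heis_norm \<xi> \<le> r} = {\<xi>. heis_dist \<xi> x0 \<le> r}"
  by (force simp: heis_dist_def intro: image_eqI[where x = "heis_mult (- x0) \<eta>" for \<eta>])
 finally show ?thesis .
qed

text \<open>Left translation by \<open>x0\<close> is continuous, and near the unit the Euclidean
  norm is at most twice the homogeneous one. Together with the openness of the balls this identifies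
  the two topologies.\<close>

lemma heis_ball_subset_open:
 assumes "open S" "x0 \<in> S"
 obtains r where "0 < r" "heis_ball x0 r \<subseteq> S"
proof -
 have "continuous_on UNIV (heis_mult x0)" by (intro continuous_intros)
 then have "open (heis_mult x0 -` S)" using assms(1) by (simp add: open_vimage)
 moreover have "0 \<in> heis_mult x0 -` S" using assms(2) by simp
 ultimately obtain e where e: "0 < e" "ball 0 e \<subseteq> heis_mult x0 -` S"
  by (meson openE)
 define r where "r = min 1 (e / 2)"
 have r: "0 < r" using e by (simp add: r_def)
 have "heis_ball x0 r \<subseteq> S"
 proof
  fix \<xi> assume "\<xi> \<in> heis_ball x0 r"
  define \<zeta> where "\<zeta> = heis_mult (- x0) \<xi>"
  have n: "heis_norm \<zeta> < r" using \<open>\<xi> \<in> _\<close> by (simp add: mem_heis_ball heis_dist_def \<zeta>_def)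
  have "norm \<zeta> \<le> heis_norm \<zeta> + (heis_norm \<zeta>)\<^sup>2" by (rule norm_heis_le)
  also have "(heis_norm \<zeta>)\<^sup>2 \<le> heis_norm \<zeta>"
   using n by (simp add: power2_eq_square mult_left_le r_def)
  finally have "\<zeta> \<in> ball 0 e" using n by (simp add: r_def)
  then have "heis_mult x0 \<zeta> \<in> S" using e by auto
  then show "\<xi> \<in> S" by (simp add: \<zeta>_def)
 qed
 then show ?thesis using r that by blast
qed

declare heis_norm.simps [simp del] heis_mult.simps [simp del]


section \<open>Haar measure\<close>

abbreviation (input) borel_fun :: "('a::topological_space => 'b::topological_space) set" ("\<B>") where
 "\<B> \<equiv> borel_measurable borel"

abbreviation nnint :: "('a::euclidean_space => ennreal) => ennreal" (binder "NNINT " 10) where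
 "nnint f \<equiv> nn_integral lborel f"

lemma borel_measurable_heis_norm [measurable (raw)]:
 "f \<in> borel_measurable M ==> (\<lambda>x. heis_norm (f x)) \<in> borel_measurable M"
 by (rule borel_measurable_continuous_on[where f = heis_norm])
  (auto intro!: continuous_intros)

lemma borel_measurable_heis_mult [measurable (raw)]:
 "f \<in> borel_measurable M ==> g \<in> borel_measurable M
  ==> (\<lambda>x. heis_mult (f x) (g x)) \<in> borel_measurable M"
 by (rule borel_measurable_continuous_Pair[where H = heis_mult]) (auto intro!: continuous_intros)

lemma borel_measurable_heis_dist [measurable (raw)]:
 "f \<in> borel_measurable M ==> g \<in> borel_measurable M
  ==> (\<lambda>x. heis_dist (f x) (g x)) \<in> borel_measurable M"
 unfolding heis_dist_def by measurable

lemma borel_measurable_horiz [measurable (raw)]: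
 "f \<in> borel_measurable M ==> (\<lambda>x. horiz (f x)) \<in> borel_measurable M"
 by (rule borel_measurable_continuous_on[where f = horiz])
  (auto intro!: continuous_intros)

lemma heis_ball_sets [measurable]: "heis_ball x0 r \<in> sets borel"
 by simp

lemma nn_integral_heis:
 assumes [measurable]: "f \<in> borel_measurable (borel :: 'n::finite heis measure)"
 shows "(NNINT \<xi>. f \<xi>) = (NNINT x. (NNINT y. (NNINT t. f (x, y, t))))"
proof -
 have [measurable]: "f \<in> borel_measurable (borel \<Otimes>\<^sub>M (borel \<Otimes>\<^sub>M borel))"
  using assms by (simp add: borel_prod)
 have "(NNINT \<xi>. f \<xi>) = (\<integral>\<^sup>+\<xi>. f \<xi> \<partial>(lborel \<Otimes>\<^sub>M (lborel \<Otimes>\<^sub>M lborel)))"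
  by (simp add: lborel_prod)
 also have "\<dots> = (NNINT x. \<integral>\<^sup>+\<eta>. f (x, \<eta>) \<partial>(lborel \<Otimes>\<^sub>M lborel))"
  by (subst sigma_finite_measure.nn_integral_fst[symmetric])
   (auto simp: lborel_prod intro: sigma_finite_lborel)
 also have "\<dots> = (NNINT x. (NNINT y. (NNINT t. f (x, y, t))))"
  by (intro nn_integral_cong, subst lborel.nn_integral_fst[symmetric]) auto
 finally show ?thesis .
qed

section \<open>Invariance of Lebesgue measure under left translation and inversion\<close>

lemma nn_integral_lborel_translate:
 fixes f :: "'a::euclidean_space => ennreal"
 assumes [measurable]: "f \<in> \<B>"
 shows "(NNINT x. f (a + x)) = (NNINT x. f x)"
 by (subst (2) lborel_distr_plus[of a, symmetric]) (simp add: nn_integral_distr)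

lemma nn_integral_lborel_scale:
 fixes f :: "'a::euclidean_space => ennreal"
 assumes [measurable]: "f \<in> \<B>" and "c \<noteq> 0"
 shows "(NNINT x. f x) = ennreal (\<bar>c\<bar> ^ DIM('a)) * (NNINT x. f (c *\<^sub>R x))"
 by (subst lborel_affine[of c 0, OF assms(2)])
  (simp add: nn_integral_density nn_integral_distr nn_integral_cmult)

text \<open>Left translation shifts x and y by constants and, for fixed (x, y), also t; Tonelli
  reduces the claim to translation invariance in each variable.\<close>

lemma nn_integral_heis_mult:
 fixes f :: "'n::finite heis => ennreal"
 assumes [measurable]: "f \<in> \<B>"
 shows "(NNINT \<xi>. f (heis_mult a \<xi>)) = (NNINT \<xi>. f \<xi>)"
proof -
 obtain a1 a2 a3 where a: "a = (a1, a2, a3)" by (cases a)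
 have [measurable]: "f \<in> borel_measurable (borel \<Otimes>\<^sub>M (borel \<Otimes>\<^sub>M borel))"
  using assms by (simp add: borel_prod)
 have "(NNINT \<xi>. f (heis_mult a \<xi>)) =
  (NNINT x. (NNINT y. (NNINT t. f (a1 + x, a2 + y, (a3 + 2 * (x \<bullet> a2) - 2 * (a1 \<bullet> y)) + t))))"
  by (subst nn_integral_heis) (auto simp: a heis_mult.simps algebra_simps)
 also have "\<dots> = (NNINT x. (NNINT y. (NNINT t. f (a1 + x, a2 + y, t))))"
 proof (rule nn_integral_cong, rule nn_integral_cong)
  fix x y
  show "(NNINT t. f (a1 + x, a2 + y, (a3 + 2 * (x \<bullet> a2) - 2 * (a1 \<bullet> y)) + t))
    = (NNINT t. f (a1 + x, a2 + y, t))"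
   by (rule nn_integral_lborel_translate[of "\<lambda>t. f (a1 + x, a2 + y, t)"]) measurable
 qed
 also have "\<dots> = (NNINT x. (NNINT y. (NNINT t. f (a1 + x, y, t))))"
 proof (rule nn_integral_cong)
  fix x
  show "(NNINT y. (NNINT t. f (a1 + x, a2 + y, t)))
    = (NNINT y. (NNINT t. f (a1 + x, y, t)))"
   by (rule nn_integral_lborel_translate[of "\<lambda>y. NNINT t. f (a1 + x, y, t)"]) measurable
 qed
 also have "\<dots> = (NNINT x. (NNINT y. (NNINT t. f (x, y, t))))"
  by (rule nn_integral_lborel_translate[of "\<lambda>x. NNINT y. (NNINT t. f (x, y, t))"]) measurable
 also have "\<dots> = (NNINT \<xi>. f \<xi>)" by (simp add: nn_integral_heis)
 finally show ?thesis .
qed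

lemma nn_integral_lborel_uminus:
 fixes f :: "'a::euclidean_space => ennreal"
 assumes [measurable]: "f \<in> \<B>"
 shows "(NNINT x. f (- x)) = (NNINT x. f x)"
 using nn_integral_lborel_scale[of f "-1"] by simp

lemma distr_eq_lborelI:
 fixes T :: "'a::euclidean_space => 'a"
 assumes [measurable]: "T \<in> \<B>"
  and "\<And>f :: 'a => ennreal. f \<in> \<B> ==> (NNINT x. f (T x)) = (NNINT x. f x)"
 shows "distr lborel borel T = lborel"
proof (rule measure_eqI)
 fix A assume "A \<in> sets (distr lborel borel T)"
 then have [measurable]: "A \<in> sets borel" by simp
 have "emeasure (distr lborel borel T) A = (\<integral>\<^sup>+x. indicator A x \<partial>distr lborel borel T)"
  by (simp add: nn_integral_indicator)
 also have "\<dots> = (NNINT x. indicator A (T x))" by (subst nn_integral_distr) auto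
 also have "\<dots> = (NNINT x. indicator A x)" by (rule assms(2)) simp
 also have "\<dots> = emeasure lborel A" by (simp add: nn_integral_indicator)
 finally show "emeasure (distr lborel borel T) A = emeasure lborel A" .
qed simp

lemma lborel_distr_heis_mult: "distr lborel borel (heis_mult a) = (lborel :: 'n::finite heis measure)"
 by (rule distr_eq_lborelI) (auto simp: nn_integral_heis_mult)

lemma lborel_distr_minus: "distr lborel borel uminus = (lborel :: 'a::euclidean_space measure)"
 by (rule distr_eq_lborelI) (auto simp: nn_integral_lborel_uminus)

text \<open>The substitution that turns one form of the group convolution into the other.\<close>

lemma lborel_distr_heis_mult_minus:
 "distr lborel borel (\<lambda>\<eta>. heis_mult a (- \<eta>)) = (lborel :: 'n::finite heis measure)"
proof (rule distr_eq_lborelI)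
 fix f :: "'n heis => ennreal" assume [measurable]: "f \<in> \<B>"
 show "(NNINT x. f (heis_mult a (- x))) = (NNINT x. f x)"
  by (subst nn_integral_lborel_uminus[of "\<lambda>x. f (heis_mult a x)"]) (auto simp: nn_integral_heis_mult)
qed simp

section \<open>Dilations and the homogeneous dimension\<close>

definition dilate :: "real => 'n::finite heis => 'n heis" where
 "dilate c \<xi> = (c *\<^sub>R fst \<xi>, c *\<^sub>R fst (snd \<xi>), c\<^sup>2 * snd (snd \<xi>))"

lemma horiz_dilate [simp]: "horiz (dilate c \<xi>) = c *\<^sub>R horiz \<xi>"
 by (simp add: dilate_def horiz_def)

lemma vert_dilate [simp]: "vert (dilate c \<xi>) = c\<^sup>2 * vert \<xi>"
 by (simp add: dilate_def vert_def)

lemma heis_norm_dilate [simp]: "0 \<le> c ==> heis_norm (dilate c \<xi>) = c * heis_norm \<xi>"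
proof -
 assume c: "0 \<le> c"
 have "heis_norm (dilate c \<xi>) ^ 4 = (c * heis_norm \<xi>) ^ 4"
  using c unfolding power_mult_distrib heis_norm_pow4
  by (simp add: power_mult_distrib algebra_simps)
 then show ?thesis using c by (simp add: power_eq_iff_eq_base)
qed

lemma borel_measurable_dilate [measurable (raw)]:
 "f \<in> borel_measurable M ==> (\<lambda>x. dilate c (f x)) \<in> borel_measurable M"
 by (rule borel_measurable_continuous_on[where f = "dilate c"])
  (auto intro!: continuous_intros simp: dilate_def)

lemma hom_dim_ge: "4 \<le> hom_dim TYPE('n::finite)"
proof -
 have "1 \<le> CARD('n)" by (simp add: Suc_le_eq)
 then show ?thesis by (simp add: hom_dim_def)
qed

text \<open>The Jacobians c^2, c^N and c^N of the three variables multiply to c^Q with Q = 2 N +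
  2.\<close>

lemma nn_integral_dilate:
 fixes f :: "'n::finite heis => ennreal"
 assumes [measurable]: "f \<in> \<B>" and c: "0 < c"
 shows "(NNINT \<xi>. f \<xi>) = ennreal (c powr hom_dim TYPE('n)) * (NNINT \<xi>. f (dilate c \<xi>))"
proof -
 let ?N = "CARD('n)"
 have [measurable]: "f \<in> borel_measurable (borel \<Otimes>\<^sub>M (borel \<Otimes>\<^sub>M borel))"
  using assms by (simp add: borel_prod)
 have "(NNINT \<xi>. f \<xi>) = (NNINT x. (NNINT y. (NNINT t. f (x, y, t))))"
  by (rule nn_integral_heis) simp
 also have "\<dots> = (NNINT x. (NNINT y. ennreal (c\<^sup>2) * (NNINT t. f (x, y, c\<^sup>2 * t))))"
  using c by (intro nn_integral_cong, subst nn_integral_lborel_scale[of _ "c\<^sup>2"]) auto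
 also have "\<dots> = (NNINT x. ennreal (c\<^sup>2) * (NNINT y. (NNINT t. f (x, y, c\<^sup>2 * t))))"
  by (intro nn_integral_cong nn_integral_cmult) measurable
 also have "\<dots> = (NNINT x. ennreal (c\<^sup>2) * (ennreal (c ^ ?N) * (NNINT y. (NNINT t. f (x, c *\<^sub>R y, c\<^sup>2 * t)))))"
  using c by (intro nn_integral_cong, subst nn_integral_lborel_scale[of _ c]) auto
 also have "\<dots> = ennreal (c\<^sup>2 * c ^ ?N) * (NNINT x. (NNINT y. (NNINT t. f (x, c *\<^sub>R y, c\<^sup>2 * t))))"
  using c by (subst nn_integral_cmult[symmetric]) (auto simp: ennreal_mult mult.assoc)
 also have "\<dots> = ennreal (c\<^sup>2 * c ^ ?N) * (ennreal (c ^ ?N) * (NNINT x. (NNINT y. (NNINT t. f (c *\<^sub>R x, c *\<^sub>R y, c\<^sup>2 * t)))))"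
  using c by (subst nn_integral_lborel_scale[of _ c]) auto
 also have "(NNINT x. (NNINT y. (NNINT t. f (c *\<^sub>R x, c *\<^sub>R y, c\<^sup>2 * t)))) = (NNINT \<xi>. f (dilate c \<xi>))"
 proof -
  have "(\<lambda>\<xi>. f (dilate c \<xi>)) \<in> \<B>" by measurable
  then show ?thesis by (subst nn_integral_heis) (auto simp: dilate_def)
 qed
 also have "ennreal (c\<^sup>2 * c ^ ?N) * (ennreal (c ^ ?N) * (NNINT \<xi>. f (dilate c \<xi>)))
   = ennreal (c\<^sup>2 * c ^ ?N * c ^ ?N) * (NNINT \<xi>. f (dilate c \<xi>))"
  using c by (subst (2) ennreal_mult) (auto simp: mult.assoc)
 also have "c\<^sup>2 * c ^ ?N * c ^ ?N = c powr hom_dim TYPE('n)"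
 proof -
  have "hom_dim TYPE('n) = real (2 + ?N + ?N)" by (simp add: hom_dim_def)
  then have "c powr hom_dim TYPE('n) = c ^ (2 + ?N + ?N)"
   using c by (metis powr_realpow)
  then show ?thesis by (simp add: power_add power2_eq_square)
 qed
 finally show ?thesis .
qed

subsection \<open>Homogeneous integrals\<close>

text \<open>Scaling by c carries the unit shell to the shell at c; the Jacobian c^Q and the degree
  \<alpha> - Q of \<open>h\<close> leave the factor c^\<alpha>.\<close>

lemma nn_integral_shell:
 fixes h :: "'n::finite heis => real"
 assumes [measurable]: "h \<in> \<B>" and h0: "\<And>\<xi>. 0 \<le> h \<xi>"
  and hom: "\<And>c \<xi>. 0 < c ==> h (dilate c \<xi>) = c powr (\<alpha> - hom_dim TYPE('n)) * h \<xi>"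
  and A: "(NNINT \<xi>. ennreal (h \<xi>) * indicator {\<xi>. 1 \<le> heis_norm \<xi> \<and> heis_norm \<xi> \<le> 2} \<xi>) \<le> ennreal A"
  and c: "0 < c"
 shows "(NNINT \<xi>. ennreal (h \<xi>) * indicator {\<xi>. c \<le> heis_norm \<xi> \<and> heis_norm \<xi> \<le> 2 * c} \<xi>)
     \<le> ennreal (c powr \<alpha>) * ennreal A"
proof -
 let ?Q = "hom_dim TYPE('n)"
 have "(NNINT \<xi>. ennreal (h \<xi>) * indicator {\<xi>. c \<le> heis_norm \<xi> \<and> heis_norm \<xi> \<le> 2 * c} \<xi>)
  = ennreal (c powr ?Q) * (NNINT \<xi>. ennreal (h (dilate c \<xi>)) * indicator {\<xi>. c \<le> heis_norm \<xi> \<and> heis_norm \<xi> \<le> 2 * c} (dilate c \<xi>))"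
  by (rule nn_integral_dilate[OF _ c]) measurable
 also have "(NNINT \<xi>. ennreal (h (dilate c \<xi>)) * indicator {\<xi>. c \<le> heis_norm \<xi> \<and> heis_norm \<xi> \<le> 2 * c} (dilate c \<xi>))
  = (NNINT \<xi>. ennreal (c powr (\<alpha> - ?Q)) * (ennreal (h \<xi>) * indicator {\<xi>. 1 \<le> heis_norm \<xi> \<and> heis_norm \<xi> \<le> 2} \<xi>))"
  using c by (intro nn_integral_cong) (auto simp: hom ennreal_mult h0 mult.assoc indicator_def)
 also have "\<dots> = ennreal (c powr (\<alpha> - ?Q)) * (NNINT \<xi>. ennreal (h \<xi>) * indicator {\<xi>. 1 \<le> heis_norm \<xi> \<and> heis_norm \<xi> \<le> 2} \<xi>)"
  by (rule nn_integral_cmult) measurable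
 also have "ennreal (c powr ?Q) * \<dots> \<le> ennreal (c powr ?Q) * (ennreal (c powr (\<alpha> - ?Q)) * ennreal A)"
  by (intro mult_left_mono A) auto
 also have "\<dots> = ennreal (c powr \<alpha>) * ennreal A"
  by (simp add: ennreal_mult[symmetric] mult.assoc[symmetric] powr_add[symmetric])
 finally show ?thesis .
qed

text \<open>Dyadic summation: the shells cover \<open>S\<close> up to the origin, a null set, and
  scaling turns the total into the series with sum \<open>b\<close>. Leaving \<open>c\<close> and
  \<open>S\<close> free serves balls and complements of balls alike.\<close>

lemma nn_integral_shells:
 fixes h :: "'n::finite heis => real"
 assumes [measurable]: "h \<in> \<B>" and h0: "\<And>\<xi>. 0 \<le> h \<xi>"
  and hom: "\<And>c \<xi>. 0 < c ==> h (dilate c \<xi>) = c powr (\<alpha> - hom_dim TYPE('n)) * h \<xi>"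
  and A: "(NNINT \<xi>. ennreal (h \<xi>) * indicator {\<xi>. 1 \<le> heis_norm \<xi> \<and> heis_norm \<xi> \<le> 2} \<xi>) \<le> ennreal A"
  and A0: "0 \<le> A" and c: "\<And>k. 0 < c k"
  and S: "\<And>\<xi>. \<xi> \<in> S ==> \<xi> \<noteq> 0 ==> \<exists>k::nat. c k \<le> heis_norm \<xi> \<and> heis_norm \<xi> \<le> 2 * c k"
  and sm: "(\<lambda>k. c k powr \<alpha>) sums b"
 shows "(NNINT \<xi>. ennreal (h \<xi>) * indicator S \<xi>) \<le> ennreal (b * A)"
proof -
 let ?f = "\<lambda>k \<xi>. ennreal (h \<xi>) * indicator {\<xi>. c k \<le> heis_norm \<xi> \<and> heis_norm \<xi> \<le> 2 * c k} \<xi>"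
 have "AE \<xi> in lborel. \<xi> \<noteq> (0 :: 'n heis)" by (rule AE_lborel_singleton)
 then have "AE \<xi> in lborel. ennreal (h \<xi>) * indicator S \<xi> \<le> (\<Sum>k. ?f k \<xi>)"
 proof (eventually_elim)
  case (elim \<xi>)
  show ?case
  proof (cases "\<xi> \<in> S")
   case True
   then obtain k where "c k \<le> heis_norm \<xi>" "heis_norm \<xi> \<le> 2 * c k" using S elim by blast
   then have "ennreal (h \<xi>) * indicator S \<xi> = ?f k \<xi>" using True by simp
   also have "\<dots> = (\<Sum>j\<in>{k}. ?f j \<xi>)"
    by (subst sum.insert) (simp_all only: finite.emptyI empty_iff not_False_eq_True sum.empty add_0_right)
   also have "\<dots> \<le> (\<Sum>k. ?f k \<xi>)" by (rule sum_le_suminf) auto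
   finally show ?thesis .
  qed simp
 qed
 then have "(NNINT \<xi>. ennreal (h \<xi>) * indicator S \<xi>) \<le> (NNINT \<xi>. (\<Sum>k. ?f k \<xi>))"
  by (rule nn_integral_mono_AE)
 also have "\<dots> = (\<Sum>k. (NNINT \<xi>. ?f k \<xi>))" by (rule nn_integral_suminf) measurable
 also have "\<dots> \<le> (\<Sum>k. ennreal (c k powr \<alpha>) * ennreal A)"
  by (intro suminf_le nn_integral_shell[OF assms(1) h0 hom A c]) auto
 also have "\<dots> = (\<Sum>k. ennreal (c k powr \<alpha> * A))"
  by (simp add: ennreal_mult A0)
 also have "\<dots> = ennreal (b * A)"
  using sums_mult2[OF sm, of A] A0 by (intro suminf_ennreal_eq) auto
 finally show ?thesis .
qed

lemma real_pow2_bracket: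
 fixes x :: real assumes "1 \<le> x" shows "\<exists>k::nat. 2 ^ k \<le> x \<and> x \<le> 2 * 2 ^ k"
proof -
 define k where "k = nat \<lfloor>log 2 x\<rfloor>"
 have l: "0 \<le> log 2 x" using assms by simp
 have "real k \<le> log 2 x" "log 2 x \<le> real k + 1" using l unfolding k_def by linarith+
 then have "2 powr real k \<le> x" "x \<le> 2 powr (real k + 1)"
  using assms by (simp_all add: le_log_iff log_le_iff)
 then show ?thesis by (intro exI[of _ k]) (simp add: powr_realpow powr_add)
qed

lemma nn_integral_homogeneous_ball:
 fixes h :: "'n::finite heis => real"
 assumes "h \<in> \<B>" and "\<And>\<xi>. 0 \<le> h \<xi>"
  and "\<And>c \<xi>. 0 < c ==> h (dilate c \<xi>) = c powr (\<alpha> - hom_dim TYPE('n)) * h \<xi>"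
  and "(NNINT \<xi>. ennreal (h \<xi>) * indicator {\<xi>. 1 \<le> heis_norm \<xi> \<and> heis_norm \<xi> \<le> 2} \<xi>) \<le> ennreal A"
  and "0 \<le> A" and \<alpha>: "0 < \<alpha>" and R: "0 < R"
 shows "(NNINT \<xi>. ennreal (h \<xi>) * indicator {\<xi>. heis_norm \<xi> \<le> R} \<xi>)
   \<le> ennreal (R powr \<alpha> * (2 powr (-\<alpha>) / (1 - 2 powr (-\<alpha>))) * A)"
proof (rule nn_integral_shells[OF assms(1-5)])
 show "0 < R / 2 ^ Suc k" for k using R by simp
 show "\<exists>k. R / 2 ^ Suc k \<le> heis_norm \<xi> \<and> heis_norm \<xi> \<le> 2 * (R / 2 ^ Suc k)"
  if "\<xi> \<in> {\<xi>. heis_norm \<xi> \<le> R}" "\<xi> \<noteq> 0" for \<xi>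
 proof -
  have n: "0 < heis_norm \<xi>" "heis_norm \<xi> \<le> R" using that heis_norm_pos[OF that(2)] by auto
  then have "1 \<le> R / heis_norm \<xi>" by simp
  then obtain k where "2 ^ k \<le> R / heis_norm \<xi>" "R / heis_norm \<xi> \<le> 2 * 2 ^ k"
   using real_pow2_bracket by blast
  then show ?thesis using n by (intro exI[of _ k]) (auto simp: field_simps)
 qed
 have "2 powr (-\<alpha>) < 1" using \<alpha> by (simp add: powr_less_one)
 then have "(\<lambda>k. (2 powr (-\<alpha>)) ^ k) sums (1 / (1 - 2 powr (-\<alpha>)))" by (intro geometric_sums) auto
 then have "(\<lambda>k. R powr \<alpha> * 2 powr (-\<alpha>) * (2 powr (-\<alpha>)) ^ k) sums (R powr \<alpha> * 2 powr (-\<alpha>) * (1 / (1 - 2 powr (-\<alpha>))))"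
  by (rule sums_mult)
 moreover have "R powr \<alpha> * 2 powr (-\<alpha>) * (2 powr (-\<alpha>)) ^ k = (R / 2 ^ Suc k) powr \<alpha>" for k
 proof -
  have "(R / 2 ^ Suc k) powr \<alpha> = R powr \<alpha> * (2 ^ Suc k) powr (-\<alpha>)"
   using R by (simp add: powr_divide powr_minus_divide del: power_Suc)
  also have "((2::real) ^ Suc k) powr (-\<alpha>) = (2 powr (-\<alpha>)) ^ Suc k"
   by (simp add: powr_realpow[symmetric] powr_powr mult.commute del: power_Suc)
  finally show ?thesis by simp
 qed
 ultimately show "(\<lambda>k. (R / 2 ^ Suc k) powr \<alpha>) sums (R powr \<alpha> * (2 powr (-\<alpha>) / (1 - 2 powr (-\<alpha>))))"
  by simp
qed

lemma nn_integral_homogeneous_complement: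
 fixes h :: "'n::finite heis => real"
 assumes "h \<in> \<B>" and "\<And>\<xi>. 0 \<le> h \<xi>"
  and "\<And>c \<xi>. 0 < c ==> h (dilate c \<xi>) = c powr (\<alpha> - hom_dim TYPE('n)) * h \<xi>"
  and "(NNINT \<xi>. ennreal (h \<xi>) * indicator {\<xi>. 1 \<le> heis_norm \<xi> \<and> heis_norm \<xi> \<le> 2} \<xi>) \<le> ennreal A"
  and "0 \<le> A" and \<alpha>: "\<alpha> < 0" and R: "0 < R"
 shows "(NNINT \<xi>. ennreal (h \<xi>) * indicator {\<xi>. R \<le> heis_norm \<xi>} \<xi>)
   \<le> ennreal (R powr \<alpha> * (1 / (1 - 2 powr \<alpha>)) * A)"
proof (rule nn_integral_shells[OF assms(1-5)])
 show "0 < R * 2 ^ k" for k using R by simp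
 show "\<exists>k. R * 2 ^ k \<le> heis_norm \<xi> \<and> heis_norm \<xi> \<le> 2 * (R * 2 ^ k)"
  if "\<xi> \<in> {\<xi>. R \<le> heis_norm \<xi>}" "\<xi> \<noteq> 0" for \<xi>
 proof -
  have "1 \<le> heis_norm \<xi> / R" using that R by simp
  then obtain k where "2 ^ k \<le> heis_norm \<xi> / R" "heis_norm \<xi> / R \<le> 2 * 2 ^ k"
   using real_pow2_bracket by blast
  then show ?thesis using R by (intro exI[of _ k]) (auto simp: field_simps)
 qed
 have "2 powr \<alpha> < 1" using \<alpha> by (simp add: powr_less_one)
 then have "(\<lambda>k. R powr \<alpha> * (2 powr \<alpha>) ^ k) sums (R powr \<alpha> * (1 / (1 - 2 powr \<alpha>)))"
  by (intro sums_mult geometric_sums) auto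
 moreover have "R powr \<alpha> * (2 powr \<alpha>) ^ k = (R * 2 ^ k) powr \<alpha>" for k
  using R by (simp add: powr_mult powr_realpow[symmetric] powr_powr mult.commute)
 ultimately show "(\<lambda>k. (R * 2 ^ k) powr \<alpha>) sums (R powr \<alpha> * (1 / (1 - 2 powr \<alpha>)))"
  by simp
qed


section \<open>Integrability of powers of the norm and of a linear form\<close>

lemma powr_nonpos_le_one: "1 \<le> x ==> q \<le> 0 ==> x powr q \<le> (1 :: real)"
 using powr_mono[of q 0 x] by simp

text \<open>Averaging over translations by \<open>s g\<close>, \<open>0 \<le> s \<le> 1\<close>, reduces the integral to dimension one.\<close>
lemma nn_integral_abs_powr_le:
 fixes q c \<gamma> :: real
 assumes q: "-1 < q" "q < 0" and \<gamma>: "0 < \<gamma>"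
 shows "(NNINT s. ennreal (\<bar>c + s * \<gamma>\<bar> powr q) * indicator {0..1} s)
   \<le> ennreal ((1 + 2 / (q + 1)) * \<gamma> powr q)"
proof -
 have I: "(NNINT x. ennreal (x powr q) * indicator {0..1} x) = ennreal (1 / (q + 1))"
 proof -
  have "((\<lambda>x. if x \<in> {0..1} then x powr q else 0) has_integral 1 / (q + 1)) UNIV"
   using has_integral_powr_from_0[of q 1] q by (subst has_integral_restrict_UNIV) auto
  then have "(NNINT x. ennreal (if x \<in> {0..1} then x powr q else 0)) = ennreal (1 / (q + 1))"
   by (intro nn_integral_has_integral_lborel) auto
  then show ?thesis by (elim trans[rotated]) (auto intro!: nn_integral_cong simp: indicator_def)
 qed
 have I2: "(NNINT x. ennreal (\<bar>x\<bar> powr q) * indicator {-1..0} x) = ennreal (1 / (q + 1))"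
 proof -
  have "(NNINT x. ennreal (\<bar>x\<bar> powr q) * indicator {-1..0} x)
   = (NNINT x. ennreal (\<bar>- x\<bar> powr q) * indicator {-1..0} (- x))"
   by (rule nn_integral_lborel_uminus[symmetric]) measurable
  also have "\<dots> = (NNINT x. ennreal (x powr q) * indicator {0..1} x)"
   by (intro nn_integral_cong) (auto simp: indicator_def)
  finally show ?thesis by (simp only: I)
 qed
 \<comment> \<open>After division by \<gamma> the integral runs over an interval of length one.
   Where |x| > 1 the integrand is at most 1, and the part with |x| \<le> 1 contributes at most 2 /
   (q + 1); hence the constant.\<close>
 let ?d = "c / \<gamma>"
 have "(NNINT s. ennreal (\<bar>?d + s\<bar> powr q) * indicator {0..1} s)
   = (NNINT s. ennreal (\<bar>?d + s\<bar> powr q) * indicator {?d..?d+1} (?d + s))"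
  by (intro nn_integral_cong) (simp add: indicator_def)
 also have "\<dots> = (NNINT x. ennreal (\<bar>x\<bar> powr q) * indicator {?d..?d+1} x)"
  by (rule nn_integral_lborel_translate[of "\<lambda>x. ennreal (\<bar>x\<bar> powr q) * indicator {?d..?d+1} x"]) measurable
 also have "\<dots> \<le> (NNINT x. (ennreal (x powr q) * indicator {0..1} x + ennreal (\<bar>x\<bar> powr q) * indicator {-1..0} x) + indicator {?d..?d+1} x)"
 proof (rule nn_integral_mono)
  fix x :: real
  let ?A = "ennreal (x powr q) * indicator {0..1} x"
  let ?B = "ennreal (\<bar>x\<bar> powr q) * indicator {-1..0} x"
  let ?C = "indicator {?d..?d+1} x :: ennreal"
  have A: "y \<le> ?A + ?B + ?C" if "y \<le> ?A" for y using that by (intro add_increasing2) simp_all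
  have B: "y \<le> ?A + ?B + ?C" if "y \<le> ?B" for y
   using that by (intro add_increasing2[where c = ?C] add_increasing[where a = ?A]) simp_all
  have C: "y \<le> ?A + ?B + ?C" if "y \<le> ?C" for y using that by (intro add_increasing) simp_all
  have i: "ennreal (\<bar>x\<bar> powr q) * ?C \<le> ennreal (\<bar>x\<bar> powr q)" by (simp add: indicator_def)
  show "ennreal (\<bar>x\<bar> powr q) * ?C \<le> ?A + ?B + ?C"
  proof (cases "\<bar>x\<bar> \<le> 1")
   case True
   show ?thesis
   proof (cases "0 \<le> x")
    case T: True
    show ?thesis by (rule A) (use True T i in simp)
   next
    case F: False
    show ?thesis by (rule B) (use True F i in simp)
   qed
  next
   case False
   then have "\<bar>x\<bar> powr q \<le> 1" using q by (intro powr_nonpos_le_one) auto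
   then have "ennreal (\<bar>x\<bar> powr q) * ?C \<le> ennreal 1 * ?C" by (intro mult_right_mono ennreal_leI) auto
   then show ?thesis by (intro C) simp
  qed
 qed
 also have "\<dots> = ennreal (1 + 2 / (q + 1))"
 proof -
  have "(NNINT x. (ennreal (x powr q) * indicator {0..1} x + ennreal (\<bar>x\<bar> powr q) * indicator {-1..0} x) + indicator {?d..?d+1} x)
   = (ennreal (1 / (q + 1)) + ennreal (1 / (q + 1))) + ennreal 1"
   by (subst nn_integral_add, measurable, subst nn_integral_add, measurable) (simp add: I I2)
  also have "\<dots> = ennreal (1 / (q + 1) + 1 / (q + 1) + 1)"
  proof -
   have "0 \<le> 1 / (q + 1)" using q by simp
   then show ?thesis
    using ennreal_plus[of "1 / (q + 1)" "1 / (q + 1)"] ennreal_plus[of "1 / (q + 1) + 1 / (q + 1)" 1]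
    by (metis add_nonneg_nonneg zero_le_one)
  qed
  finally show ?thesis by (simp add: add.commute)
 qed
 finally have J: "(NNINT s. ennreal (\<bar>?d + s\<bar> powr q) * indicator {0..1} s) \<le> ennreal (1 + 2 / (q + 1))" .
 have "(NNINT s. ennreal (\<bar>c + s * \<gamma>\<bar> powr q) * indicator {0..1} s)
  = (NNINT s. ennreal (\<gamma> powr q) * (ennreal (\<bar>?d + s\<bar> powr q) * indicator {0..1} s))"
 proof (intro nn_integral_cong)
  fix s :: real
  have "c + s * \<gamma> = \<gamma> * (?d + s)" using \<gamma> by (simp add: field_simps)
  then have "\<bar>c + s * \<gamma>\<bar> powr q = \<gamma> powr q * \<bar>?d + s\<bar> powr q"
   using \<gamma> by (simp only: abs_mult) (simp add: powr_mult)
  then show "ennreal (\<bar>c + s * \<gamma>\<bar> powr q) * indicator {0..1} s = ennreal (\<gamma> powr q) * (ennreal (\<bar>?d + s\<bar> powr q) * indicator {0..1} s)"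
   by (simp add: ennreal_mult mult.assoc)
 qed
 also have "\<dots> = ennreal (\<gamma> powr q) * (NNINT s. ennreal (\<bar>?d + s\<bar> powr q) * indicator {0..1} s)"
  by (rule nn_integral_cmult) measurable
 also have "\<dots> \<le> ennreal (\<gamma> powr q) * ennreal (1 + 2 / (q + 1))"
  by (intro mult_left_mono J) simp
 also have "\<dots> = ennreal ((1 + 2 / (q + 1)) * \<gamma> powr q)"
  using q by (subst ennreal_mult[symmetric]) (auto simp: mult.commute simp del: ennreal_plus)
 finally show ?thesis .
qed

lemma emeasure_cball_finite: "emeasure lborel {\<xi>::'a::euclidean_space. norm \<xi> \<le> R} < \<infinity>"
 using emeasure_lborel_cball_finite[of 0 R] by (simp add: cball_def dist_norm)

text \<open>A translation by s e, with e the unit vector along v, enlarges the ball to radius R + 1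
  and replaces v . x by v . x + s |v|. Averaging over s in [0, 1] and exchanging the integrals
  leaves the one-dimensional bound, uniformly in x. \<open>L\<close> lets a caller keep its own
  notation for the linear form.\<close>

lemma nn_integral_inner_powr_le:
 fixes v :: "'a::euclidean_space"
 assumes q: "-1 < q" "q < 0" and v: "v \<noteq> 0" and L: "\<And>x. L x = v \<bullet> x"
 shows "(NNINT x. ennreal (\<bar>L x\<bar> powr q) * indicator {x. norm x \<le> R} x)
  \<le> ennreal ((1 + 2 / (q + 1)) * norm v powr q) * emeasure lborel {x::'a. norm x \<le> R + 1}"
proof -
 define e where "e = v /\<^sub>R norm v"
 have e: "norm e = 1" "v \<bullet> e = norm v" using v
  by (auto simp: e_def dot_square_norm power2_eq_square)
 let ?I = "NNINT x. ennreal (\<bar>L x\<bar> powr q) * indicator {x. norm x \<le> R} x"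
 let ?f = "\<lambda>s x. ennreal (\<bar>v \<bullet> x + s * norm v\<bar> powr q) * indicator {x. norm x \<le> R + 1} x * indicator {0..1::real} s"
 have 1: "?I \<le> (NNINT x. ennreal (\<bar>v \<bullet> x + s * norm v\<bar> powr q) * indicator {x. norm x \<le> R + 1} x)"
  if s: "s \<in> {0..1}" for s
 proof -
  have "?I = (NNINT x. ennreal (\<bar>L (s *\<^sub>R e + x)\<bar> powr q) * indicator {x. norm x \<le> R} (s *\<^sub>R e + x))"
   by (subst nn_integral_lborel_translate[symmetric, of _ "s *\<^sub>R e"]) (auto simp: L)
  also have "\<dots> \<le> (NNINT x. ennreal (\<bar>v \<bullet> x + s * norm v\<bar> powr q) * indicator {x. norm x \<le> R + 1} x)"
  proof (intro nn_integral_mono mult_mono)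
   fix x
   show "ennreal (\<bar>L (s *\<^sub>R e + x)\<bar> powr q) \<le> ennreal (\<bar>v \<bullet> x + s * norm v\<bar> powr q)"
    by (simp add: L inner_add_right e add.commute)
   have "norm x \<le> norm (s *\<^sub>R e + x) + norm (s *\<^sub>R e)"
    using norm_triangle_ineq4[of "s *\<^sub>R e + x" "s *\<^sub>R e"] by simp
   then have "norm x \<le> R + 1" if "norm (s *\<^sub>R e + x) \<le> R" using that e s by auto
   then show "indicator {x. norm x \<le> R} (s *\<^sub>R e + x) \<le> (indicator {x. norm x \<le> R + 1} x :: ennreal)"
    by (auto simp: indicator_def)
  qed auto
  finally show ?thesis .
 qed
 have "?I = (NNINT s. ?I * indicator {0..1::real} s)"
  by (simp add: nn_integral_cmult_indicator)
 also have "\<dots> \<le> (NNINT s. (NNINT x. ?f s x))"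
 proof (intro nn_integral_mono)
  fix s :: real
  show "?I * indicator {0..1} s \<le> (NNINT x. ?f s x)"
   using 1[of s] by (cases "s \<in> {0..1}") auto
 qed
 also have "\<dots> = (NNINT x. (NNINT s. ?f s x))"
  by (rule lborel_pair.Fubini') measurable
 also have "\<dots> = (NNINT x. (NNINT s. ennreal (\<bar>v \<bullet> x + s * norm v\<bar> powr q) * indicator {0..1} s) * indicator {x. norm x \<le> R + 1} x)"
  by (intro nn_integral_cong, subst nn_integral_multc[symmetric]) (auto simp: mult_ac)
 also have "\<dots> \<le> (NNINT x. ennreal ((1 + 2 / (q + 1)) * norm v powr q) * indicator {x::'a. norm x \<le> R + 1} x)"
 proof (intro nn_integral_mono mult_right_mono)
  fix x
  show "(NNINT s. ennreal (\<bar>v \<bullet> x + s * norm v\<bar> powr q) * indicator {0..1} s)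
    \<le> ennreal ((1 + 2 / (q + 1)) * norm v powr q)"
   using v by (intro nn_integral_abs_powr_le q) auto
 qed simp
 also have "\<dots> = ennreal ((1 + 2 / (q + 1)) * norm v powr q) * emeasure lborel {x::'a. norm x \<le> R + 1}"
  by (rule nn_integral_cmult_indicator) measurable
 finally show ?thesis .
qed

lemma heis_norm_le_norm: "heis_norm \<xi> \<le> R ==> norm \<xi> \<le> R + R\<^sup>2"
 using norm_heis_le[of \<xi>] power_mono[of "heis_norm \<xi>" R 2] by auto

text \<open>The conditional in the indicator joins both integrable regimes: balls for \<alpha> > 0,
  complements of balls for \<alpha> < 0, and the empty set for \<alpha> = 0. On the unit shell the
  integrand is bounded by \<open>M\<close> whatever the sign of the exponent.\<close>

lemma nn_integral_heis_norm_powr: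
 obtains C where "0 \<le> C" "\<And>R. 0 < R ==>
  (NNINT (\<xi>::'n::finite heis). ennreal (heis_norm \<xi> powr (\<alpha> - hom_dim TYPE('n))) * indicator {\<xi>. if 0 < \<alpha> then heis_norm \<xi> \<le> R else \<alpha> < 0 \<and> R \<le> heis_norm \<xi>} \<xi>)
   \<le> ennreal (C * R powr \<alpha>)"
proof -
 let ?h = "\<lambda>\<xi>::'n heis. heis_norm \<xi> powr (\<alpha> - hom_dim TYPE('n))"
 let ?B = "{\<xi>::'n heis. norm \<xi> \<le> 2 + 2\<^sup>2}"
 define M where "M = max 1 (2 powr (\<alpha> - hom_dim TYPE('n)))"
 have le: "x powr (\<alpha> - hom_dim TYPE('n)) \<le> M" if "1 \<le> x" "x \<le> 2" for x :: real
 proof (cases "\<alpha> - hom_dim TYPE('n) \<ge> 0")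
  case True
  then have "x powr (\<alpha> - hom_dim TYPE('n)) \<le> 2 powr (\<alpha> - hom_dim TYPE('n))"
   using that by (intro powr_mono2) auto
  then show ?thesis by (simp add: M_def)
 next
  case False
  then have "x powr (\<alpha> - hom_dim TYPE('n)) \<le> 1" using that by (intro powr_nonpos_le_one) auto
  then show ?thesis by (simp add: M_def)
 qed
 define A where "A = M * enn2real (emeasure lborel ?B)"
 have A0: "0 \<le> A" by (simp add: A_def M_def)
 have A: "(NNINT \<xi>. ennreal (?h \<xi>) * indicator {\<xi>. 1 \<le> heis_norm \<xi> \<and> heis_norm \<xi> \<le> 2} \<xi>) \<le> ennreal A"
 proof -
  have "(NNINT \<xi>. ennreal (?h \<xi>) * indicator {\<xi>. 1 \<le> heis_norm \<xi> \<and> heis_norm \<xi> \<le> 2} \<xi>)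
   \<le> (NNINT \<xi>. ennreal M * indicator ?B \<xi>)"
   using heis_norm_le_norm[of _ 2]
   by (intro nn_integral_mono) (auto simp: indicator_def intro!: ennreal_leI le)
  also have "\<dots> = ennreal M * emeasure lborel ?B" by (rule nn_integral_cmult_indicator) measurable
  also have "\<dots> = ennreal A"
   using emeasure_cball_finite[of "2 + 2\<^sup>2", where 'a = "'n heis"] unfolding A_def
   by (subst ennreal_mult) (auto simp: M_def less_top)
  finally show ?thesis .
 qed
 have hom: "?h (dilate c \<xi>) = c powr (\<alpha> - hom_dim TYPE('n)) * ?h \<xi>" if "0 < c" for c \<xi>
  using that by (simp add: powr_mult)
 consider "0 < \<alpha>" | "\<alpha> < 0" | "\<alpha> = 0" by linarith
 then show ?thesis
 proof cases
  case 1
  let ?c = "2 powr (-\<alpha>) / (1 - 2 powr (-\<alpha>))"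
  have "2 powr (-\<alpha>) < 1" using 1 by (simp add: powr_less_one)
  then have c: "0 \<le> ?c" by simp
  show ?thesis
  proof (rule that[of "?c * A"])
   show "0 \<le> ?c * A" using c A0 by (rule mult_nonneg_nonneg)
   show "(NNINT \<xi>. ennreal (?h \<xi>) * indicator {\<xi>. if 0 < \<alpha> then heis_norm \<xi> \<le> R else \<alpha> < 0 \<and> R \<le> heis_norm \<xi>} \<xi>)
     \<le> ennreal (?c * A * R powr \<alpha>)" if "0 < R" for R
    using nn_integral_homogeneous_ball[of ?h, OF _ _ hom A A0 1 that] 1 by (simp add: mult_ac)
  qed
 next
  case 2
  let ?c = "1 / (1 - 2 powr \<alpha>)"
  have "2 powr \<alpha> < 1" using 2 by (simp add: powr_less_one)
  then have c: "0 \<le> ?c" by simp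
  show ?thesis
  proof (rule that[of "?c * A"])
   show "0 \<le> ?c * A" using c A0 by (rule mult_nonneg_nonneg)
   show "(NNINT \<xi>. ennreal (?h \<xi>) * indicator {\<xi>. if 0 < \<alpha> then heis_norm \<xi> \<le> R else \<alpha> < 0 \<and> R \<le> heis_norm \<xi>} \<xi>)
     \<le> ennreal (?c * A * R powr \<alpha>)" if "0 < R" for R
    using nn_integral_homogeneous_complement[of ?h, OF _ _ hom A A0 2 that] 2 by (simp add: mult_ac)
  qed
 next
  case 3
  then show ?thesis by (intro that[of 0]) auto
 qed
qed

text \<open>The integrand is homogeneous of degree \<alpha> - Q but singular on the hyperplane g . z
  = 0; q > -1 makes it integrable over the unit shell, and \<alpha> - q \<le> Q makes the power of
  the norm at most 1 there. The explicit factor |g|^q is what later meets a lower bound on the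
  gradient.\<close>

lemma nn_integral_inner_horiz:
 assumes q: "-1 < q" "q < 0" and \<alpha>: "0 < \<alpha>" "\<alpha> - q \<le> hom_dim TYPE('n::finite)"
 obtains C where "0 \<le> C" "\<And>R (g :: (real ^ 'n) \<times> (real ^ 'n)). 0 < R ==> g \<noteq> 0 ==>
  (NNINT \<xi>. ennreal (\<bar>g \<bullet> horiz \<xi>\<bar> powr q * heis_norm \<xi> powr (\<alpha> - q - hom_dim TYPE('n))) * indicator {\<xi>. heis_norm \<xi> \<le> R} \<xi>)
   \<le> ennreal (C * norm g powr q * R powr \<alpha>)"
proof -
 let ?B = "{\<xi>::'n heis. norm \<xi> \<le> (2 + 2\<^sup>2) + 1}"
 define m where "m = enn2real (emeasure lborel ?B)"
 define c where "c = 2 powr (-\<alpha>) / (1 - 2 powr (-\<alpha>))"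
 have "2 powr (-\<alpha>) < 1" using \<alpha> by (simp add: powr_less_one)
 then have c: "0 \<le> c" by (simp add: c_def)
 let ?C = "c * ((1 + 2 / (q + 1)) * m)"
 show ?thesis
 proof (rule that[of ?C])
  show "0 \<le> ?C" using c q by (simp add: m_def)
  fix R :: real and g :: "(real ^ 'n) \<times> (real ^ 'n)" assume R: "0 < R" and g: "g \<noteq> 0"
  let ?h = "\<lambda>\<xi>::'n heis. \<bar>g \<bullet> horiz \<xi>\<bar> powr q * heis_norm \<xi> powr (\<alpha> - q - hom_dim TYPE('n))"
  define v :: "'n heis" where "v = (fst g, snd g, 0)"
  have v: "v \<bullet> \<xi> = g \<bullet> horiz \<xi>" for \<xi>
   by (cases \<xi>; cases g) (simp add: v_def horiz_def)
  have nv: "norm v = norm g" by (cases g) (simp add: v_def norm_Pair)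
  have v0: "v \<noteq> 0" using g nv by auto
  define A where "A = (1 + 2 / (q + 1)) * norm g powr q * m"
  have A0: "0 \<le> A" using q by (simp add: A_def m_def)
  have A: "(NNINT \<xi>. ennreal (?h \<xi>) * indicator {\<xi>. 1 \<le> heis_norm \<xi> \<and> heis_norm \<xi> \<le> 2} \<xi>) \<le> ennreal A"
  proof -
   have "(NNINT \<xi>. ennreal (?h \<xi>) * indicator {\<xi>. 1 \<le> heis_norm \<xi> \<and> heis_norm \<xi> \<le> 2} \<xi>)
    \<le> (NNINT \<xi>. ennreal (\<bar>g \<bullet> horiz \<xi>\<bar> powr q) * indicator {\<xi>. norm \<xi> \<le> 2 + 2\<^sup>2} \<xi>)"
   proof (intro nn_integral_mono)
    fix \<xi> :: "'n heis"
    show "ennreal (?h \<xi>) * indicator {\<xi>. 1 \<le> heis_norm \<xi> \<and> heis_norm \<xi> \<le> 2} \<xi>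
     \<le> ennreal (\<bar>g \<bullet> horiz \<xi>\<bar> powr q) * indicator {\<xi>. norm \<xi> \<le> 2 + 2\<^sup>2} \<xi>"
    proof (cases "1 \<le> heis_norm \<xi> \<and> heis_norm \<xi> \<le> 2")
     case True
     then have "heis_norm \<xi> powr (\<alpha> - q - hom_dim TYPE('n)) \<le> 1"
      using \<alpha> by (intro powr_nonpos_le_one) auto
     then have "?h \<xi> \<le> \<bar>g \<bullet> horiz \<xi>\<bar> powr q" by (simp add: mult_left_le)
     then show ?thesis using True heis_norm_le_norm[of \<xi> 2] by (auto intro!: ennreal_leI)
    qed auto
   qed
   also have "\<dots> \<le> ennreal ((1 + 2 / (q + 1)) * norm v powr q) * emeasure lborel ?B"
    by (rule nn_integral_inner_powr_le[OF q v0]) (simp add: v)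
   also have "\<dots> = ennreal A"
    using emeasure_cball_finite[of "2 + 2\<^sup>2 + 1", where 'a = "'n heis"] q unfolding A_def m_def
    by (subst ennreal_mult) (auto simp: less_top nv)
   finally show ?thesis .
  qed
  have hom: "?h (dilate c \<xi>) = c powr (\<alpha> - hom_dim TYPE('n)) * ?h \<xi>" if "0 < c" for c \<xi>
  proof -
   have "?h (dilate c \<xi>) = (c powr q * c powr (\<alpha> - q - hom_dim TYPE('n))) * ?h \<xi>"
    using that by (simp add: powr_mult abs_mult)
   then show ?thesis by (simp add: powr_add[symmetric])
  qed
  have "(NNINT \<xi>. ennreal (?h \<xi>) * indicator {\<xi>. heis_norm \<xi> \<le> R} \<xi>)
   \<le> ennreal (R powr \<alpha> * c * A)"
   unfolding c_def
   by (rule nn_integral_homogeneous_ball[OF _ _ hom A A0 \<alpha>(1) R]) auto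
  then show "(NNINT \<xi>. ennreal (?h \<xi>) * indicator {\<xi>. heis_norm \<xi> \<le> R} \<xi>)
   \<le> ennreal (?C * norm g powr q * R powr \<alpha>)"
   by (simp add: A_def mult_ac)
 qed
qed


section \<open>The nonlinearity\<close>

declare split_paired_All [simp del] split_paired_Ex [simp del]

lemma Jp_0 [simp]: "Jp p 0 = 0"
 by (simp add: Jp_def)

lemma Jp_minus [simp]: "Jp p (- a) = - Jp p a"
 by (simp add: Jp_def)

lemma powr_minus_one_mult: "0 \<le> x ==> x powr (p - 1) = x powr (p - 2) * (x :: real)"
 using powr_mult_base[of x "p - 2"] by (simp add: mult.commute add.commute)

lemma abs_Jp: "\<bar>Jp p a\<bar> = \<bar>a\<bar> powr (p - 1)"
 by (simp add: Jp_def abs_mult powr_minus_one_mult)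

lemma Jp_pos: "0 \<le> a ==> Jp p a = a powr (p - 1)"
 using abs_Jp[of p a] by (simp add: Jp_def)

lemma Jp_neg: "a \<le> 0 ==> Jp p a = - ((- a) powr (p - 1))"
 using Jp_pos[of "- a" p] by simp

lemma borel_measurable_Jp [measurable (raw)]:
 "f \<in> borel_measurable M ==> (\<lambda>x. Jp p (f x)) \<in> borel_measurable M"
 unfolding Jp_def by measurable

lemma Jp_mono:
 assumes "1 < p" "a \<le> b" shows "Jp p a \<le> Jp p b"
proof -
 consider "0 \<le> a" | "a \<le> 0" "0 \<le> b" | "b \<le> 0" using assms(2) by linarith
 then show ?thesis
 proof cases
  case 1 then show ?thesis using assms by (simp add: Jp_pos powr_mono2)
 next
  case 2
  have "Jp p a \<le> 0" using 2 by (simp add: Jp_neg)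
  moreover have "0 \<le> Jp p b" using 2 by (simp add: Jp_pos)
  ultimately show ?thesis by linarith
 next
  case 3 then show ?thesis using assms by (simp add: Jp_neg powr_mono2)
 qed
qed

text \<open>The difference estimates for \<open>Jp\<close> are invariant under changing both signs,
  so the second argument may be taken nonnegative.\<close>

lemma Jp_wlog:
 assumes "\<And>x y. P x y ==> P (- x) (- y)"
  and "\<And>x y. 0 \<le> y ==> P x y"
 shows "P (x :: real) (y :: real)"
proof (cases "0 \<le> y")
 case False
 then have "P (- x) (- y)" by (intro assms(2)) auto
 then show ?thesis using assms(1)[of "- x" "- y"] by simp
qed (rule assms(2))

text \<open>For \<open>p < 2\<close>, with \<open>0 powr (p - 2) = 0\<close> excluded by \<open>y \<noteq> 0\<close>.\<close>
lemma Jp_diff_sing: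
 assumes p: "1 < p" "p \<le> 2" and y: "y \<noteq> 0"
 shows "\<bar>Jp p x - Jp p y\<bar> \<le> 2 * \<bar>y\<bar> powr (p - 2) * \<bar>x - y\<bar>"
proof -
 have "y \<noteq> 0 --> \<bar>Jp p x - Jp p y\<bar> \<le> 2 * \<bar>y\<bar> powr (p - 2) * \<bar>x - y\<bar>"
 proof (rule Jp_wlog[where P = "\<lambda>x y. y \<noteq> 0 --> \<bar>Jp p x - Jp p y\<bar> \<le> 2 * \<bar>y\<bar> powr (p - 2) * \<bar>x - y\<bar>"])
  show "y \<noteq> 0 --> \<bar>Jp p x - Jp p y\<bar> \<le> 2 * \<bar>y\<bar> powr (p - 2) * \<bar>x - y\<bar>" if "0 \<le> y" for x y :: real
  proof
   assume "y \<noteq> 0"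
   with that have y: "0 < y" by simp
   have yq: "y powr (p - 1) = y powr (p - 2) * y" using y by (intro powr_minus_one_mult) simp
   have anti: "x powr (p - 2) \<le> y powr (p - 2)" if "y \<le> x" for x
    using that y p by (intro powr_mono2') auto
   show "\<bar>Jp p x - Jp p y\<bar> \<le> 2 * \<bar>y\<bar> powr (p - 2) * \<bar>x - y\<bar>"
   proof (cases "0 \<le> x")
    case x: True
    have xq: "x powr (p - 1) = x powr (p - 2) * x" using x by (intro powr_minus_one_mult) simp
    have "\<bar>x powr (p - 1) - y powr (p - 1)\<bar> \<le> y powr (p - 2) * \<bar>x - y\<bar>"
    proof (cases "y \<le> x")
     case True
     have "x powr (p - 1) \<le> y powr (p - 2) * x"
      unfolding xq by (intro mult_right_mono anti True x)
     moreover have "y powr (p - 1) \<le> x powr (p - 1)" using True y p by (intro powr_mono2) auto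
     ultimately show ?thesis using True by (simp add: yq algebra_simps)
    next
     case False
     have "y powr (p - 2) * x \<le> x powr (p - 1)"
     proof (cases "x = 0")
      case F: False
      show ?thesis unfolding xq using False F x p by (intro mult_right_mono powr_mono2') auto
     qed simp
     moreover have "x powr (p - 1) \<le> y powr (p - 1)" using False x p by (intro powr_mono2) auto
     ultimately show ?thesis using False by (simp add: yq algebra_simps)
    qed
    also have "\<dots> \<le> 2 * y powr (p - 2) * \<bar>x - y\<bar>" by (simp add: mult_right_mono)
    finally show ?thesis using x y by (simp add: Jp_pos)
   next
    case x: False
    define z where "z = - x"
    have z: "0 < z" using x by (simp add: z_def)
    have zq: "z powr (p - 1) = z powr (p - 2) * z" using z by (intro powr_minus_one_mult) simp
    have "z powr (p - 1) \<le> y powr (p - 2) * (z + y)"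
    proof (cases "y \<le> z")
     case True
     have "z powr (p - 2) * z \<le> y powr (p - 2) * (z + y)"
      using z y by (intro mult_mono anti True) auto
     then show ?thesis by (simp add: zq)
    next
     case False
     then have "z powr (p - 1) \<le> y powr (p - 1)" using z p by (intro powr_mono2) auto
     also have "\<dots> \<le> y powr (p - 2) * (z + y)" unfolding yq using z by (intro mult_left_mono) auto
     finally show ?thesis .
    qed
    moreover have "y powr (p - 1) \<le> y powr (p - 2) * (z + y)"
     unfolding yq using z by (intro mult_left_mono) auto
    moreover have "Jp p x - Jp p y = - (z powr (p - 1) + y powr (p - 1))"
     using z y by (simp add: Jp_neg Jp_pos z_def)
    moreover have "0 \<le> z powr (p - 1)" "0 \<le> y powr (p - 1)" by simp_all
    ultimately have "\<bar>Jp p x - Jp p y\<bar> \<le> 2 * (y powr (p - 2) * (z + y))" by linarith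
    then show ?thesis using z y by (simp add: z_def)
   qed
  qed
 qed (auto simp: abs_minus_commute)
 then show ?thesis using y by simp
qed

lemma powr_add_le:
 fixes a b q :: real
 assumes "0 \<le> a" "0 \<le> b" "0 < q" "q \<le> 1"
 shows "(a + b) powr q \<le> a powr q + b powr q"
proof (cases "a = 0 \<or> b = 0")
 case False
 then have ab: "0 < a" "0 < b" using assms by auto
 have 1: "x powr q = x * x powr (q - 1)" if "0 < x" for x :: real
  using that powr_add[of x 1 "q - 1"] by simp
 have "(a + b) powr q = a * (a + b) powr (q - 1) + b * (a + b) powr (q - 1)"
  using ab by (simp add: 1 algebra_simps)
 also have "\<dots> \<le> a * a powr (q - 1) + b * b powr (q - 1)"
  using ab assms by (intro add_mono mult_left_mono powr_mono2') auto
 finally show ?thesis using ab by (simp add: 1)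
qed auto

text \<open>For equal signs, subadditivity of the power p - 1 \<le> 1. For opposite signs each of
  the two powers is at most |x - y|^(p - 1), which accounts for the factor 2.\<close>

lemma Jp_diff_holder:
 assumes p: "1 < p" "p \<le> 2"
 shows "\<bar>Jp p x - Jp p y\<bar> \<le> 2 * \<bar>x - y\<bar> powr (p - 1)"
proof (rule Jp_wlog[where P = "\<lambda>x y. \<bar>Jp p x - Jp p y\<bar> \<le> 2 * \<bar>x - y\<bar> powr (p - 1)"])
 have d: "\<bar>a powr (p - 1) - b powr (p - 1)\<bar> \<le> \<bar>a - b\<bar> powr (p - 1)" if "0 \<le> a" "0 \<le> b" for a b :: real
  using powr_add_le[of "a - b" b "p - 1"] powr_add_le[of "b - a" a "p - 1"] that p
   powr_mono2[of "p - 1" a b] powr_mono2[of "p - 1" b a]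
  by (cases "a \<le> b") auto
 show "\<bar>Jp p x - Jp p y\<bar> \<le> 2 * \<bar>x - y\<bar> powr (p - 1)" if y: "0 \<le> y" for x y :: real
 proof (cases "0 \<le> x")
  case True
  have "\<bar>x - y\<bar> powr (p - 1) \<ge> 0" by simp
  then show ?thesis using d[OF True y] True y unfolding Jp_pos[OF True] Jp_pos[OF y] by linarith
 next
  case False
  have "(- x) powr (p - 1) \<le> \<bar>x - y\<bar> powr (p - 1)" "y powr (p - 1) \<le> \<bar>x - y\<bar> powr (p - 1)"
   using False y p by (auto intro!: powr_mono2)
  moreover have "0 \<le> (- x) powr (p - 1)" "0 \<le> y powr (p - 1)" by simp_all
  moreover have "Jp p x = - ((- x) powr (p - 1))" "Jp p y = y powr (p - 1)"
   using False y by (simp_all add: Jp_neg Jp_pos)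
  ultimately show ?thesis by linarith
 qed
qed (auto simp: abs_minus_commute)

text \<open>For equal signs the mean value theorem, for opposite signs the identity |x - y| = |x| +
  |y|. The factor \<open>p\<close> dominates both the p - 1 of the derivative and the 1 of the
  remaining cases.\<close>

lemma Jp_diff_lip:
 assumes p: "2 \<le> p"
 shows "\<bar>Jp p x - Jp p y\<bar> \<le> p * (\<bar>x\<bar> + \<bar>y\<bar>) powr (p - 2) * \<bar>x - y\<bar>"
proof -
 have le: "b powr (p - 1) - a powr (p - 1) \<le> p * (a + b) powr (p - 2) * (b - a)"
  if ab: "0 \<le> a" "a \<le> b" for a b :: real
 proof (cases "a = b")
  case False
  then have lt: "a < b" using ab by simp
  show ?thesis
  proof (cases "a = 0")
   case True
   have "b powr (p - 1) = b powr (p - 2) * b" using ab by (intro powr_minus_one_mult) auto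
   moreover have "1 * (b powr (p - 2) * b) \<le> p * (b powr (p - 2) * b)"
    using p ab by (intro mult_right_mono) auto
   ultimately show ?thesis using True p by simp
  next
   case False
   then have a: "0 < a" using ab by simp
   have "\<exists>z>a. z < b \<and> b powr (p - 1) - a powr (p - 1) = (b - a) * ((p - 1) * z powr (p - 1 - 1))"
   proof (rule MVT2[OF lt])
    fix x assume "a \<le> x" "x \<le> b"
    then show "((\<lambda>z. z powr (p - 1)) has_real_derivative (p - 1) * x powr (p - 1 - 1)) (at x)"
     using a by (intro has_real_derivative_powr) auto
   qed
   then obtain z where z: "a < z" "z < b" "b powr (p - 1) - a powr (p - 1) = (b - a) * ((p - 1) * z powr (p - 1 - 1))"
    by blast
   have "(p - 1) * z powr (p - 1 - 1) \<le> p * (a + b) powr (p - 2)"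
    using z a p by (intro mult_mono) (auto intro!: powr_mono2)
   then show ?thesis using z lt by (simp add: mult.commute mult_left_mono)
  qed
 qed simp
 show ?thesis
 proof (rule Jp_wlog[where P = "\<lambda>x y. \<bar>Jp p x - Jp p y\<bar> \<le> p * (\<bar>x\<bar> + \<bar>y\<bar>) powr (p - 2) * \<bar>x - y\<bar>"])
  show "\<bar>Jp p x - Jp p y\<bar> \<le> p * (\<bar>x\<bar> + \<bar>y\<bar>) powr (p - 2) * \<bar>x - y\<bar>" if y: "0 \<le> y" for x y :: real
  proof (cases "0 \<le> x")
   case x: True
   show ?thesis
   proof (cases "x \<le> y")
    case True
    have "x powr (p - 1) \<le> y powr (p - 1)" using x True p by (intro powr_mono2) auto
    then show ?thesis using le[OF x True] x y True by (simp add: Jp_pos)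
   next
    case False
    have "y powr (p - 1) \<le> x powr (p - 1)" using y False p by (intro powr_mono2) auto
    then show ?thesis using le[of y x] x y False by (simp add: Jp_pos add.commute)
   qed
  next
   case False
   define z where "z = - x"
   have z: "0 < z" using False by (simp add: z_def)
   have "z powr (p - 1) \<le> (z + y) powr (p - 2) * z"
    using z y p by (subst powr_minus_one_mult) (auto intro!: mult_right_mono powr_mono2)
   moreover have "y powr (p - 1) \<le> (z + y) powr (p - 2) * y"
    using z y p by (subst powr_minus_one_mult) (auto intro!: mult_right_mono powr_mono2)
   moreover have "Jp p x - Jp p y = - (z powr (p - 1) + y powr (p - 1))"
    using z y by (simp add: Jp_neg Jp_pos z_def)
   moreover have "1 * ((z + y) powr (p - 2) * (z + y)) \<le> p * ((z + y) powr (p - 2) * (z + y))"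
    using p z y by (intro mult_right_mono) auto
   moreover have "0 \<le> z powr (p - 1)" "0 \<le> y powr (p - 1)" by simp_all
   ultimately have "\<bar>Jp p x - Jp p y\<bar> \<le> p * ((z + y) powr (p - 2) * (z + y))"
    unfolding distrib_left by linarith
   moreover have "\<bar>x\<bar> + \<bar>y\<bar> = z + y" "\<bar>x - y\<bar> = z + y" using z y by (simp_all add: z_def)
   ultimately show ?thesis by (simp add: mult.assoc)
  qed
 qed (auto simp: abs_minus_commute)
qed

lemma abs_diff_powr_le:
 fixes a b q :: real
 assumes "0 < q"
 shows "\<bar>a - b\<bar> powr q \<le> 2 powr q * (\<bar>a\<bar> powr q + \<bar>b\<bar> powr q)"
proof -
 define m where "m = max \<bar>a\<bar> \<bar>b\<bar>"
 have "\<bar>a - b\<bar> powr q \<le> (2 * m) powr q" using assms by (intro powr_mono2) (auto simp: m_def)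
 also have "\<dots> = 2 powr q * m powr q" by (simp add: m_def powr_mult)
 also have "m powr q \<le> \<bar>a\<bar> powr q + \<bar>b\<bar> powr q" by (auto simp: m_def max_def)
 finally show ?thesis by simp
qed

section \<open>The singular part of the operator\<close>

text \<open>Stands for all truncations of the principal value at once: vanishing within some radius
  \<epsilon> makes the integrals converge absolutely, while the bounds to come involve only L,
  \<gamma> and R. Evenness lets odd terms integrate to zero.\<close>

definition near_kernel :: "real => real => real => ('n::finite heis => real) => bool" where
 "near_kernel L \<gamma> R \<kappa> \<longleftrightarrow> \<kappa> \<in> \<B> \<and>
  (\<forall>\<eta>. 0 \<le> \<kappa> \<eta> \<and> \<kappa> \<eta> \<le> L * heis_norm \<eta> powr (-\<gamma>) \<and> \<kappa> (- \<eta>) = \<kappa> \<eta>) \<and>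
  (\<exists>\<epsilon>>0. \<forall>\<eta>. heis_norm \<eta> < \<epsilon> --> \<kappa> \<eta> = 0) \<and> (\<forall>\<eta>. R \<le> heis_norm \<eta> --> \<kappa> \<eta> = 0)"

definition near_int :: "real => ('n::finite heis => real) => 'n heis => ('n heis => real) => real" where
 "near_int p \<psi> \<xi> \<kappa> = (LBINT \<eta>. Jp p (\<psi> \<xi> - \<psi> (heis_mult \<xi> \<eta>)) * \<kappa> \<eta>)"

lemma integral_odd_zero:
 fixes f :: "'a::euclidean_space => real"
 assumes [measurable]: "f \<in> \<B>" and "\<And>x. f (- x) = - f x"
 shows "(LBINT x. f x) = 0"
proof -
 have "(LBINT x. f x) = (LINT x|distr lborel borel uminus. f x)"
  by (simp add: lborel_distr_minus)
 also have "\<dots> = (LBINT x. f (- x))" by (rule integral_distr) auto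
 also have "\<dots> = - (LBINT x. f x)" by (simp add: assms(2))
 finally show ?thesis by simp
qed

text \<open>Subtracting an odd function does not change the integral against an even kernel.\<close>
lemma near_bound:
 fixes A U B :: "'n::finite heis => real"
 assumes \<kappa>: "near_kernel L \<gamma> R \<kappa>" and L: "0 \<le> L" and R: "0 < R"
  and [measurable]: "A \<in> \<B>" "U \<in> \<B>" "B \<in> \<B>"
  and odd: "\<And>\<eta>. U (- \<eta>) = - U \<eta>" and bdd: "\<And>\<eta>. heis_norm \<eta> < R ==> \<bar>U \<eta>\<bar> \<le> b"
  and AB: "AE \<eta> in lborel. heis_norm \<eta> < R --> \<bar>A \<eta> - U \<eta>\<bar> \<le> B \<eta>"
  and B0: "\<And>\<eta>. 0 \<le> B \<eta>"
  and I: "(NNINT \<eta>. ennreal (B \<eta> * heis_norm \<eta> powr (-\<gamma>)) * indicator {\<eta>. heis_norm \<eta> \<le> R} \<eta>) \<le> ennreal w"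
  and w: "0 \<le> w"
 shows "\<bar>LBINT \<eta>. A \<eta> * \<kappa> \<eta>\<bar> \<le> L * w"
proof -
 have [measurable]: "\<kappa> \<in> \<B>" using \<kappa> by (simp add: near_kernel_def)
 obtain \<epsilon> where \<epsilon>: "0 < \<epsilon>" "\<And>\<eta>. heis_norm \<eta> < \<epsilon> ==> \<kappa> \<eta> = 0"
  using \<kappa> by (auto simp: near_kernel_def)
 have k0: "0 \<le> \<kappa> \<eta>" "\<kappa> \<eta> \<le> L * heis_norm \<eta> powr (-\<gamma>)" "\<kappa> (- \<eta>) = \<kappa> \<eta>" "R \<le> heis_norm \<eta> ==> \<kappa> \<eta> = 0" for \<eta>
  using \<kappa> by (auto simp: near_kernel_def)
 \<comment> \<open>\<open>m\<close> bounds the power of the norm between \<epsilon> and R for either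
   sign of \<gamma>. It depends on \<epsilon> and only serves the integrability of the odd term; the
   final bound comes from \<open>I\<close>.\<close>
 define m where "m = max (\<epsilon> powr (-\<gamma>)) (R powr (-\<gamma>))"
 have km: "\<kappa> \<eta> \<le> L * m" for \<eta>
 proof (cases "\<epsilon> \<le> heis_norm \<eta> \<and> heis_norm \<eta> < R")
  case True
  have "heis_norm \<eta> powr (-\<gamma>) \<le> m"
  proof (cases "0 \<le> - \<gamma>")
   case T: True
   then have "heis_norm \<eta> powr (-\<gamma>) \<le> R powr (-\<gamma>)" using True by (intro powr_mono2) auto
   then show ?thesis by (simp add: m_def)
  next
   case F: False
   then have "heis_norm \<eta> powr (-\<gamma>) \<le> \<epsilon> powr (-\<gamma>)" using True \<epsilon>(1) by (intro powr_mono2') auto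
   then show ?thesis by (simp add: m_def)
  qed
  then show ?thesis using k0(2)[of \<eta>] L by (meson mult_left_mono order_trans)
 next
  case False
  then have "\<kappa> \<eta> = 0" using \<epsilon>(2)[of \<eta>] k0(4)[of \<eta>] by (meson not_le)
  then show ?thesis using L by (simp add: m_def le_max_iff_disj)
 qed
 have fin: "emeasure lborel {\<eta>::'n heis. heis_norm \<eta> \<le> R} < \<infinity>"
  using compact_heis_cball[of 0 R] by (auto dest!: compact_imp_bounded emeasure_bounded_finite)
 have iU: "integrable lborel (\<lambda>\<eta>. U \<eta> * \<kappa> \<eta>)"
 proof (rule Bochner_Integration.integrable_bound)
  show "integrable lborel (\<lambda>\<eta>. indicator {\<eta>::'n heis. heis_norm \<eta> \<le> R} \<eta> * (\<bar>b\<bar> * (L * m)))"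
   using fin by (intro integrable_real_mult_indicator[THEN integrable_mult_left] integrable_mult_left integrable_real_indicator) auto
  show "AE \<eta> in lborel. norm (U \<eta> * \<kappa> \<eta>) \<le> norm (indicator {\<eta>::'n heis. heis_norm \<eta> \<le> R} \<eta> * (\<bar>b\<bar> * (L * m)))"
  proof (rule AE_I2)
   fix \<eta> :: "'n heis"
   show "norm (U \<eta> * \<kappa> \<eta>) \<le> norm (indicator {\<eta>::'n heis. heis_norm \<eta> \<le> R} \<eta> * (\<bar>b\<bar> * (L * m)))"
   proof (cases "heis_norm \<eta> < R")
    case True
    have "\<bar>U \<eta>\<bar> * \<kappa> \<eta> \<le> \<bar>b\<bar> * (L * m)"
     using bdd[OF True] km[of \<eta>] k0(1)[of \<eta>] by (intro mult_mono) auto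
    moreover have "0 \<le> m" by (simp add: m_def le_max_iff_disj)
    ultimately show ?thesis using True k0(1)[of \<eta>] L by (simp add: abs_mult)
   next
    case False
    then show ?thesis using k0(4)[of \<eta>] by simp
   qed
  qed
 qed measurable
 have U0: "(LBINT \<eta>. U \<eta> * \<kappa> \<eta>) = 0"
  by (rule integral_odd_zero) (auto simp: odd k0)
 have nn: "(NNINT \<eta>. ennreal (norm ((A \<eta> - U \<eta>) * \<kappa> \<eta>))) \<le> ennreal (L * w)"
 proof -
  have "(NNINT \<eta>. ennreal (norm ((A \<eta> - U \<eta>) * \<kappa> \<eta>)))
   \<le> (NNINT \<eta>. ennreal L * (ennreal (B \<eta> * heis_norm \<eta> powr (-\<gamma>)) * indicator {\<eta>. heis_norm \<eta> \<le> R} \<eta>))"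
   using AB
  proof (intro nn_integral_mono_AE, eventually_elim)
   case (elim \<eta>)
   show ?case
   proof (cases "heis_norm \<eta> < R")
    case True
    have "norm ((A \<eta> - U \<eta>) * \<kappa> \<eta>) = \<bar>A \<eta> - U \<eta>\<bar> * \<kappa> \<eta>" by (simp add: abs_mult k0)
    also have "\<dots> \<le> B \<eta> * (L * heis_norm \<eta> powr (-\<gamma>))"
     using elim True k0 B0 by (intro mult_mono) auto
    finally show ?thesis using True L B0 by (simp add: ennreal_mult[symmetric] ennreal_leI mult_ac)
   next
    case False
    then show ?thesis using k0(4)[of \<eta>] by simp
   qed
  qed
  also have "\<dots> = ennreal L * (NNINT \<eta>. (ennreal (B \<eta> * heis_norm \<eta> powr (-\<gamma>)) * indicator {\<eta>. heis_norm \<eta> \<le> R} \<eta>))"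
   by (rule nn_integral_cmult) measurable
  also have "\<dots> \<le> ennreal L * ennreal w" by (intro mult_left_mono I) auto
  also have "\<dots> = ennreal (L * w)" using L w by (simp add: ennreal_mult)
  finally show ?thesis .
 qed
 have iA: "integrable lborel (\<lambda>\<eta>. (A \<eta> - U \<eta>) * \<kappa> \<eta>)"
  using nn by (intro integrableI_bounded) (auto simp: less_top[symmetric] top_unique)
 have "(LBINT \<eta>. A \<eta> * \<kappa> \<eta>) = (LBINT \<eta>. (A \<eta> - U \<eta>) * \<kappa> \<eta> + U \<eta> * \<kappa> \<eta>)"
  by (intro Bochner_Integration.integral_cong) (auto simp: algebra_simps)
 also have "\<dots> = (LBINT \<eta>. (A \<eta> - U \<eta>) * \<kappa> \<eta>)"
  using iA iU U0 by (subst Bochner_Integration.integral_add) auto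
 finally have eq: "(LBINT \<eta>. A \<eta> * \<kappa> \<eta>) = (LBINT \<eta>. (A \<eta> - U \<eta>) * \<kappa> \<eta>)" .
 have "ennreal (norm (LBINT \<eta>. (A \<eta> - U \<eta>) * \<kappa> \<eta>)) \<le> (NNINT \<eta>. ennreal (norm ((A \<eta> - U \<eta>) * \<kappa> \<eta>)))"
  by (rule integral_norm_bound_ennreal[OF iA])
 also note nn
 finally show ?thesis using L w unfolding eq by (simp add: ennreal_le_iff)
qed


section \<open>Horizontal expansions and uniform rates for the singular part\<close>

text \<open>A first-order expansion with remainder of homogeneous order two. No derivative is
  mentioned, so it also fits cutoffs built from squared positive parts and can be carried through
  sums and compositions.\<close>

definition jet :: "('n::finite heis => real) => 'n heis => (real ^ 'n) \<times> (real ^ 'n) => real => real => bool" where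
 "jet \<psi> \<xi> g M R \<longleftrightarrow>
  (\<forall>\<eta>. heis_norm \<eta> < R --> \<bar>\<psi> (heis_mult \<xi> \<eta>) - \<psi> \<xi> - g \<bullet> horiz \<eta>\<bar> \<le> M * (heis_norm \<eta>)\<^sup>2)"

text \<open>The constants depend neither on the function nor on the point nor on the truncation
  inside the kernel. The positive power of R allows any prescribed error to be met by shrinking
  R.\<close>

definition near_class :: "real => real => real => (real => ('n::finite heis => real) => 'n heis => bool) => bool" where
 "near_class p s L P \<longleftrightarrow> (\<exists>c\<ge>0. \<exists>\<alpha>>0. \<forall>R \<psi> \<xi> \<kappa>. 0 < R \<and> R \<le> 1 \<and> \<psi> \<in> \<B> \<and> P R \<psi> \<xi> \<and>
  near_kernel L (hom_dim TYPE('n) + s * p) R \<kappa> --> \<bar>near_int p \<psi> \<xi> \<kappa>\<bar> \<le> c * R powr \<alpha>)"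

lemma inner_horiz_bound: "\<bar>g \<bullet> horiz \<eta>\<bar> \<le> norm g * heis_norm \<eta>"
 by (meson Cauchy_Schwarz_ineq2 mult_left_mono norm_ge_zero norm_horiz_le order_trans)

text \<open>The odd function \<open>Jp p (- (g \<bullet> horiz \<eta>))\<close> is subtracted. An
  error of order a against a kernel of order -Q - s p leaves the norm to the power a - s p - Q,
  which is integrable near the unit since a > s p.\<close>

lemma near_power_bound:
 assumes p: "1 < p" and a: "s * p < a"
 obtains C where "0 \<le> C" "\<And>R b \<psi> (\<xi> :: 'n::finite heis) g \<kappa> L. 0 < R ==> \<psi> \<in> \<B> ==> 0 \<le> b ==> 0 \<le> L ==>
  near_kernel L (hom_dim TYPE('n) + s * p) R \<kappa> ==>
  (\<And>\<eta>. heis_norm \<eta> < R ==> \<bar>Jp p (\<psi> \<xi> - \<psi> (heis_mult \<xi> \<eta>)) - Jp p (- (g \<bullet> horiz \<eta>))\<bar> \<le> b * heis_norm \<eta> powr a) ==>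
  \<bar>near_int p \<psi> \<xi> \<kappa>\<bar> \<le> L * (b * C * R powr (a - s * p))"
proof -
 have \<alpha>: "0 < a - s * p" using a by simp
 obtain C where C: "0 \<le> C" "\<And>R. 0 < R ==>
  (NNINT (\<xi>::'n heis). ennreal (heis_norm \<xi> powr ((a - s * p) - hom_dim TYPE('n))) * indicator {\<xi>. heis_norm \<xi> \<le> R} \<xi>)
   \<le> ennreal (C * R powr (a - s * p))"
  using nn_integral_heis_norm_powr[of "a - s * p", where 'n = 'n] \<alpha> by (auto cong: if_cong)
 show ?thesis
 proof (rule that[OF C(1)])
  fix R b L :: real and \<psi> and \<xi> :: "'n heis" and g and \<kappa> :: "'n heis => real"
  assume R: "0 < R" and [measurable]: "\<psi> \<in> \<B>" and b: "0 \<le> b" and L: "0 \<le> L"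
   and \<kappa>: "near_kernel L (hom_dim TYPE('n) + s * p) R \<kappa>"
   and bd: "\<And>\<eta>. heis_norm \<eta> < R ==> \<bar>Jp p (\<psi> \<xi> - \<psi> (heis_mult \<xi> \<eta>)) - Jp p (- (g \<bullet> horiz \<eta>))\<bar> \<le> b * heis_norm \<eta> powr a"
  let ?\<gamma> = "hom_dim TYPE('n) + s * p"
  have I: "(NNINT (\<eta>::'n heis). ennreal (b * heis_norm \<eta> powr a * heis_norm \<eta> powr (- ?\<gamma>)) * indicator {\<eta>. heis_norm \<eta> \<le> R} \<eta>)
   \<le> ennreal (b * C * R powr (a - s * p))"
  proof -
   have "(NNINT (\<eta>::'n heis). ennreal (b * heis_norm \<eta> powr a * heis_norm \<eta> powr (- ?\<gamma>)) * indicator {\<eta>. heis_norm \<eta> \<le> R} \<eta>)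
    = (NNINT (\<eta>::'n heis). ennreal b * (ennreal (heis_norm \<eta> powr ((a - s * p) - hom_dim TYPE('n))) * indicator {\<eta>. heis_norm \<eta> \<le> R} \<eta>))"
    using b by (intro nn_integral_cong) (simp add: ennreal_mult[symmetric] mult.assoc powr_add[symmetric] indicator_def algebra_simps)
   also have "\<dots> = ennreal b * (NNINT (\<eta>::'n heis). ennreal (heis_norm \<eta> powr ((a - s * p) - hom_dim TYPE('n))) * indicator {\<eta>. heis_norm \<eta> \<le> R} \<eta>)"
    by (rule nn_integral_cmult) measurable
   also have "\<dots> \<le> ennreal b * ennreal (C * R powr (a - s * p))" by (intro mult_left_mono C R) simp
   also have "\<dots> = ennreal (b * C * R powr (a - s * p))" using b C by (simp add: ennreal_mult[symmetric] mult.assoc)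
   finally show ?thesis .
  qed
  show "\<bar>near_int p \<psi> \<xi> \<kappa>\<bar> \<le> L * (b * C * R powr (a - s * p))"
   unfolding near_int_def
  proof (rule near_bound[OF \<kappa> L R _ _ _ _ _ _ _ I, of _ "\<lambda>\<eta>. Jp p (- (g \<bullet> horiz \<eta>))" "(norm g * R) powr (p - 1)"])
   show "\<bar>Jp p (- (g \<bullet> horiz \<eta>))\<bar> \<le> (norm g * R) powr (p - 1)" if "heis_norm \<eta> < R" for \<eta>
    unfolding abs_Jp
   proof (rule powr_mono2)
    have "norm g * heis_norm \<eta> \<le> norm g * R" using that by (intro mult_left_mono) auto
    then show "\<bar>- (g \<bullet> horiz \<eta>)\<bar> \<le> norm g * R" using inner_horiz_bound[of g \<eta>] by simp
   qed (use p in auto)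
   show "AE \<eta> in lborel. heis_norm \<eta> < R --> \<bar>Jp p (\<psi> \<xi> - \<psi> (heis_mult \<xi> \<eta>)) - Jp p (- (g \<bullet> horiz \<eta>))\<bar> \<le> b * heis_norm \<eta> powr a"
    using bd by auto
  qed (use b C in \<open>auto\<close>)
 qed
qed

text \<open>Increments are of order one and Taylor errors of order two. For p \<ge> 2 the Lipschitz
  bound yields order (p - 2) + 2 = p > s p. For p < 2 the Hoelder bound yields order 2 (p - 1), and
  this exceeds s p exactly when p > 2 / (2 - s).\<close>

lemma near_class_smooth:
 assumes p: "1 < p" and s: "0 < s" "s < 1" and ps: "2 / (2 - s) < p" and M: "0 \<le> M" and L: "0 \<le> L"
 shows "near_class p s L (\<lambda>R \<psi> (\<xi>::'n::finite heis). \<exists>g. jet \<psi> \<xi> g M R \<and> norm g \<le> M)"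
proof (cases "2 \<le> p")
 case True
 have a: "s * p < p" using s p by simp
 obtain C where C: "0 \<le> C" "\<And>R b \<psi> (\<xi> :: 'n heis) g \<kappa> L. 0 < R ==> \<psi> \<in> \<B> ==> 0 \<le> b ==> 0 \<le> L ==>
  near_kernel L (hom_dim TYPE('n) + s * p) R \<kappa> ==>
  (\<And>\<eta>. heis_norm \<eta> < R ==> \<bar>Jp p (\<psi> \<xi> - \<psi> (heis_mult \<xi> \<eta>)) - Jp p (- (g \<bullet> horiz \<eta>))\<bar> \<le> b * heis_norm \<eta> powr p) ==>
  \<bar>near_int p \<psi> \<xi> \<kappa>\<bar> \<le> L * (b * C * R powr (p - s * p))"
  using near_power_bound[OF p a, where 'n = 'n] by blast
 define b where "b = p * (3 * M) powr (p - 2) * M"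
 have b: "0 \<le> b" using p M by (simp add: b_def)
 show ?thesis unfolding near_class_def
 proof (rule exI[of _ "L * (b * C)"], rule conjI[rotated], rule exI[of _ "p - s * p"], rule conjI[rotated], intro allI impI, elim conjE exE)
  fix R \<psi> and \<xi> :: "'n heis" and \<kappa> :: "'n heis => real" and g
  assume R: "0 < R" "R \<le> 1" and \<psi>: "\<psi> \<in> \<B>" and j: "jet \<psi> \<xi> g M R" and g: "norm g \<le> M"
   and \<kappa>: "near_kernel L (hom_dim TYPE('n) + s * p) R \<kappa>"
  have "\<bar>near_int p \<psi> \<xi> \<kappa>\<bar> \<le> L * (b * C * R powr (p - s * p))"
  proof (rule C(2)[OF R(1) \<psi> b L \<kappa>])
   fix \<eta> :: "'n heis" assume n: "heis_norm \<eta> < R"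
   let ?x = "\<psi> \<xi> - \<psi> (heis_mult \<xi> \<eta>)" and ?y = "- (g \<bullet> horiz \<eta>)" and ?N = "heis_norm \<eta>"
   have e: "\<bar>?x - ?y\<bar> \<le> M * ?N\<^sup>2" using j n unfolding jet_def by (force simp: abs_le_iff)
   have "?N\<^sup>2 \<le> ?N" using n R by (simp add: power2_eq_square mult_left_le)
   then have "M * ?N\<^sup>2 \<le> M * ?N" by (rule mult_left_mono) (rule M)
   moreover have y: "\<bar>?y\<bar> \<le> M * ?N"
    using inner_horiz_bound[of g \<eta>] mult_right_mono[OF g, of ?N] by simp
   ultimately have xy: "\<bar>?x\<bar> + \<bar>?y\<bar> \<le> 3 * M * ?N" using e by linarith
   have "\<bar>Jp p ?x - Jp p ?y\<bar> \<le> p * (\<bar>?x\<bar> + \<bar>?y\<bar>) powr (p - 2) * \<bar>?x - ?y\<bar>"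
    by (rule Jp_diff_lip[OF True])
   also have "\<dots> \<le> p * (3 * M * ?N) powr (p - 2) * (M * ?N\<^sup>2)"
    using True xy e M by (intro mult_mono powr_mono2) auto
   also have "\<dots> = b * (?N powr (p - 2) * ?N * ?N)"
    using M by (simp add: powr_mult b_def power2_eq_square)
   also have "?N powr (p - 2) * ?N * ?N = ?N powr p"
    using powr_mult_base[of ?N "p - 2"] powr_mult_base[of ?N "p - 1"] by (simp add: mult.commute)
   finally show "\<bar>Jp p ?x - Jp p ?y\<bar> \<le> b * ?N powr p" .
  qed
  then show "\<bar>near_int p \<psi> \<xi> \<kappa>\<bar> \<le> L * (b * C) * R powr (p - s * p)" by (simp add: mult.assoc)
 qed (use a L b C in auto)
next
 case False
 have a: "s * p < 2 * (p - 1)"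
 proof -
  have "2 < p * (2 - s)" using ps s by (simp add: divide_less_eq)
  then show ?thesis by (simp add: algebra_simps)
 qed
 obtain C where C: "0 \<le> C" "\<And>R b \<psi> (\<xi> :: 'n heis) g \<kappa> L. 0 < R ==> \<psi> \<in> \<B> ==> 0 \<le> b ==> 0 \<le> L ==>
  near_kernel L (hom_dim TYPE('n) + s * p) R \<kappa> ==>
  (\<And>\<eta>. heis_norm \<eta> < R ==> \<bar>Jp p (\<psi> \<xi> - \<psi> (heis_mult \<xi> \<eta>)) - Jp p (- (g \<bullet> horiz \<eta>))\<bar> \<le> b * heis_norm \<eta> powr (2 * (p - 1))) ==>
  \<bar>near_int p \<psi> \<xi> \<kappa>\<bar> \<le> L * (b * C * R powr (2 * (p - 1) - s * p))"
  using near_power_bound[OF p a, where 'n = 'n] by blast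
 define b where "b = 2 * M powr (p - 1)"
 have b: "0 \<le> b" by (simp add: b_def)
 show ?thesis unfolding near_class_def
 proof (rule exI[of _ "L * (b * C)"], rule conjI[rotated], rule exI[of _ "2 * (p - 1) - s * p"], rule conjI[rotated], intro allI impI, elim conjE exE)
  fix R \<psi> and \<xi> :: "'n heis" and \<kappa> :: "'n heis => real" and g
  assume R: "0 < R" "R \<le> 1" and \<psi>: "\<psi> \<in> \<B>" and j: "jet \<psi> \<xi> g M R" and g: "norm g \<le> M"
   and \<kappa>: "near_kernel L (hom_dim TYPE('n) + s * p) R \<kappa>"
  have "\<bar>near_int p \<psi> \<xi> \<kappa>\<bar> \<le> L * (b * C * R powr (2 * (p - 1) - s * p))"
  proof (rule C(2)[OF R(1) \<psi> b L \<kappa>])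
   fix \<eta> :: "'n heis" assume n: "heis_norm \<eta> < R"
   let ?x = "\<psi> \<xi> - \<psi> (heis_mult \<xi> \<eta>)" and ?y = "- (g \<bullet> horiz \<eta>)" and ?N = "heis_norm \<eta>"
   have e: "\<bar>?x - ?y\<bar> \<le> M * ?N\<^sup>2" using j n unfolding jet_def by (force simp: abs_le_iff)
   have "\<bar>Jp p ?x - Jp p ?y\<bar> \<le> 2 * \<bar>?x - ?y\<bar> powr (p - 1)"
    using p False by (intro Jp_diff_holder) auto
   also have "\<dots> \<le> 2 * (M * ?N\<^sup>2) powr (p - 1)"
    using p e by (intro mult_left_mono powr_mono2) auto
   also have "\<dots> = b * (?N powr (p - 1) * ?N powr (p - 1))"
    using M by (simp add: powr_mult b_def power2_eq_square)
   also have "?N powr (p - 1) * ?N powr (p - 1) = ?N powr (2 * (p - 1))"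
    by (simp add: powr_add[symmetric])
   finally show "\<bar>Jp p ?x - Jp p ?y\<bar> \<le> b * ?N powr (2 * (p - 1))" .
  qed
  then show "\<bar>near_int p \<psi> \<xi> \<kappa>\<bar> \<le> L * (b * C) * R powr (2 * (p - 1) - s * p)" by (simp add: mult.assoc)
 qed (use a L b C in auto)
qed

lemma AE_inner_horiz: "g \<noteq> 0 ==> AE \<eta> in lborel. g \<bullet> horiz (\<eta> :: 'n::finite heis) \<noteq> 0"
proof -
 assume g: "g \<noteq> 0"
 define v :: "'n heis" where "v = (fst g, snd g, 0)"
 have v: "v \<bullet> \<xi> = g \<bullet> horiz \<xi>" for \<xi>
  by (cases \<xi>; cases g) (simp add: v_def horiz_def)
 have "v \<noteq> 0" using g by (auto simp: v_def zero_prod_def prod_eq_iff)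
 then have "negligible {\<xi>. v \<bullet> \<xi> = 0}" by (intro negligible_hyperplane) auto
 then have "AE \<xi> in lebesgue. v \<bullet> \<xi> \<noteq> 0"
  by (auto simp: negligible_iff_null_sets AE_iff_null)
 then have "AE \<xi> in lborel. v \<bullet> \<xi> \<noteq> 0"
  by (subst (asm) AE_completion_iff) auto
 then show ?thesis by (simp add: v)
qed

text \<open>Inside the radius \<open>\<tau>\<close> the gradient term is used, with \<open>p < 2\<close>; outside it only the size of the increment.\<close>
definition sing_jet :: "real => real => real => real => real => real => ('n::finite heis => real) => 'n heis => bool" where
 "sing_jet p s \<alpha> \<beta> M R \<psi> \<xi> \<longleftrightarrow> (\<exists>g m \<tau>. 0 \<le> \<tau> \<and> \<tau> \<le> R \<and> 0 \<le> m \<and>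
  (0 < \<tau> --> g \<noteq> 0 \<and> jet \<psi> \<xi> g m \<tau> \<and> m * norm g powr (p - 2) * \<tau> powr (p - s * p) \<le> M * R powr \<alpha>) \<and>
  (\<forall>\<eta>. \<tau> \<le> heis_norm \<eta> \<and> heis_norm \<eta> < R --> \<bar>\<psi> (heis_mult \<xi> \<eta>) - \<psi> \<xi>\<bar> \<le> M * heis_norm \<eta> powr \<beta>))"

text \<open>The odd term is subtracted only within radius \<tau>. There the error is of size m |g .
  z|^(p - 2) |\<eta>|^2, with integral of size m |g|^(p - 2) \<tau>^(p - s p), the quantity bounded
  in \<open>sing_jet\<close>. Outside, the increment itself is of order \<beta>, which gives order
  \<beta> (p - 1) > s p.\<close>

lemma near_class_sing:
 assumes p: "1 < p" "p < 2" and s: "0 < s" "s < 1" and \<alpha>: "0 < \<alpha>" "\<alpha> \<le> \<beta> * (p - 1) - s * p"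
  and M: "0 \<le> M" and L: "0 \<le> L"
 shows "near_class p s L (\<lambda>R \<psi> (\<xi>::'n::finite heis). sing_jet p s \<alpha> \<beta> M R \<psi> \<xi>)"
proof -
 let ?Q = "hom_dim TYPE('n)"
 let ?\<gamma> = "?Q + s * p"
 define \<alpha>' where "\<alpha>' = \<beta> * (p - 1) - s * p"
 have \<alpha>': "0 < \<alpha>'" "\<alpha> \<le> \<alpha>'" using \<alpha> by (simp_all add: \<alpha>'_def)
 obtain C1 where C1: "0 \<le> C1" "\<And>R. 0 < R ==>
  (NNINT (\<xi>::'n heis). ennreal (heis_norm \<xi> powr (\<alpha>' - ?Q)) * indicator {\<xi>. heis_norm \<xi> \<le> R} \<xi>)
   \<le> ennreal (C1 * R powr \<alpha>')"
  using nn_integral_heis_norm_powr[of \<alpha>', where 'n = 'n] \<alpha>' by (auto cong: if_cong)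
 have sp: "0 < p - s * p" using s p by simp
 have "p - s * p - (p - 2) \<le> ?Q" using hom_dim_ge[where 'n = 'n] mult_pos_pos[of s p] s p by linarith
 then obtain C2 where C2: "0 \<le> C2" "\<And>R (g :: (real ^ 'n) \<times> (real ^ 'n)). 0 < R ==> g \<noteq> 0 ==>
  (NNINT \<xi>. ennreal (\<bar>g \<bullet> horiz \<xi>\<bar> powr (p - 2) * heis_norm \<xi> powr (p - s * p - (p - 2) - ?Q)) * indicator {\<xi>. heis_norm \<xi> \<le> R} \<xi>)
   \<le> ennreal (C2 * norm g powr (p - 2) * R powr (p - s * p))"
  using nn_integral_inner_horiz[of "p - 2" "p - s * p", where 'n = 'n] p sp by auto
 define c where "c = 2 * M * C2 + M powr (p - 1) * C1"
 have c: "0 \<le> c" using M C1 C2 by (simp add: c_def)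
 show ?thesis unfolding near_class_def
 proof (rule exI[of _ "L * c"], rule conjI[rotated], rule exI[of _ \<alpha>], rule conjI[rotated], intro allI impI, elim conjE exE)
  fix R \<psi> and \<xi> :: "'n heis" and \<kappa> :: "'n heis => real"
  assume R: "0 < R" "R \<le> 1" and [measurable]: "\<psi> \<in> \<B>" and cj: "sing_jet p s \<alpha> \<beta> M R \<psi> \<xi>"
   and \<kappa>: "near_kernel L ?\<gamma> R \<kappa>"
  obtain g m \<tau> where \<tau>: "0 \<le> \<tau>" "\<tau> \<le> R" and m: "0 \<le> m" and g0: "0 < \<tau> ==> g \<noteq> 0" and j: "0 < \<tau> ==> jet \<psi> \<xi> g m \<tau>"
   and g: "0 < \<tau> ==> m * norm g powr (p - 2) * \<tau> powr (p - s * p) \<le> M * R powr \<alpha>"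
   and far: "\<And>\<eta>. \<tau> \<le> heis_norm \<eta> ==> heis_norm \<eta> < R ==> \<bar>\<psi> (heis_mult \<xi> \<eta>) - \<psi> \<xi>\<bar> \<le> M * heis_norm \<eta> powr \<beta>"
   using cj unfolding sing_jet_def by blast
  define B1 where "B1 = (\<lambda>\<eta>::'n heis. 2 * m * \<bar>g \<bullet> horiz \<eta>\<bar> powr (p - 2) * (heis_norm \<eta>)\<^sup>2 * indicator {\<eta>. heis_norm \<eta> < \<tau>} \<eta>)"
  define B2 where "B2 = (\<lambda>\<eta>::'n heis. M powr (p - 1) * heis_norm \<eta> powr (\<beta> * (p - 1)))"
  have [measurable]: "B1 \<in> \<B>" "B2 \<in> \<B>"
   unfolding B1_def B2_def by measurable
  have B10: "0 \<le> B1 \<eta>" and B20: "0 \<le> B2 \<eta>" for \<eta> using m by (simp_all add: B1_def B2_def)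
  define U where "U = (\<lambda>\<eta>. Jp p (- (g \<bullet> horiz \<eta>)) * indicator {\<eta>::'n heis. heis_norm \<eta> < \<tau>} \<eta>)"
  have I2: "(NNINT \<eta>. ennreal (B2 \<eta> * heis_norm \<eta> powr (- ?\<gamma>)) * indicator {\<eta>. heis_norm \<eta> \<le> R} \<eta>)
   \<le> ennreal (M powr (p - 1) * C1 * R powr \<alpha>)"
  proof -
   have "(NNINT \<eta>. ennreal (B2 \<eta> * heis_norm \<eta> powr (- ?\<gamma>)) * indicator {\<eta>. heis_norm \<eta> \<le> R} \<eta>)
    = (NNINT (\<eta>::'n heis). ennreal (M powr (p - 1)) * (ennreal (heis_norm \<eta> powr (\<alpha>' - ?Q)) * indicator {\<eta>. heis_norm \<eta> \<le> R} \<eta>))"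
    by (intro nn_integral_cong)
     (simp add: B2_def \<alpha>'_def ennreal_mult[symmetric] mult.assoc powr_add[symmetric] indicator_def algebra_simps)
   also have "\<dots> = ennreal (M powr (p - 1)) * (NNINT (\<eta>::'n heis). ennreal (heis_norm \<eta> powr (\<alpha>' - ?Q)) * indicator {\<eta>. heis_norm \<eta> \<le> R} \<eta>)"
    by (rule nn_integral_cmult) measurable
   also have "\<dots> \<le> ennreal (M powr (p - 1)) * ennreal (C1 * R powr \<alpha>')"
    by (intro mult_left_mono C1 R) simp
   also have "\<dots> = ennreal (M powr (p - 1) * C1 * R powr \<alpha>')" using C1 by (simp add: ennreal_mult[symmetric] mult.assoc)
   also have "\<dots> \<le> ennreal (M powr (p - 1) * C1 * R powr \<alpha>)"
    using C1 R \<alpha>' by (intro ennreal_leI mult_left_mono powr_mono') auto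
   finally show ?thesis .
  qed
  have I1: "(NNINT \<eta>. ennreal (B1 \<eta> * heis_norm \<eta> powr (- ?\<gamma>)) * indicator {\<eta>. heis_norm \<eta> \<le> R} \<eta>)
   \<le> ennreal (2 * M * C2 * R powr \<alpha>)"
  proof (cases "0 < \<tau>")
   case False
   then have "\<not> heis_norm \<eta> < \<tau>" for \<eta> :: "'n heis" using \<tau> heis_norm_nonneg[of \<eta>] by linarith
   then have "B1 \<eta> = 0" for \<eta> by (simp add: B1_def)
   then show ?thesis by simp
  next
   case True
   let ?D = "2 * m"
   have pt: "B1 \<eta> * heis_norm \<eta> powr (- ?\<gamma>) \<le> ?D * (\<bar>g \<bullet> horiz \<eta>\<bar> powr (p - 2) * heis_norm \<eta> powr (p - s * p - (p - 2) - ?Q)) * indicator {\<eta>. heis_norm \<eta> \<le> \<tau>} \<eta>" for \<eta> :: "'n heis"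
   proof -
    have "(heis_norm \<eta>)\<^sup>2 * heis_norm \<eta> powr (- ?\<gamma>) = heis_norm \<eta> powr (p - s * p - (p - 2) - ?Q)"
     using powr_mult_base[of "heis_norm \<eta>" "- ?\<gamma>"] powr_mult_base[of "heis_norm \<eta>" "1 - ?\<gamma>"]
     by (simp add: power2_eq_square mult.assoc algebra_simps)
    then have "B1 \<eta> * heis_norm \<eta> powr (- ?\<gamma>) = ?D * (\<bar>g \<bullet> horiz \<eta>\<bar> powr (p - 2) * heis_norm \<eta> powr (p - s * p - (p - 2) - ?Q)) * indicator {\<eta>. heis_norm \<eta> < \<tau>} \<eta>"
     by (simp add: B1_def mult_ac)
    also have "\<dots> \<le> ?D * (\<bar>g \<bullet> horiz \<eta>\<bar> powr (p - 2) * heis_norm \<eta> powr (p - s * p - (p - 2) - ?Q)) * indicator {\<eta>. heis_norm \<eta> \<le> \<tau>} \<eta>"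
     using m by (intro mult_left_mono) (auto simp: indicator_def)
    finally show ?thesis .
   qed
   have "(NNINT \<eta>. ennreal (B1 \<eta> * heis_norm \<eta> powr (- ?\<gamma>)) * indicator {\<eta>. heis_norm \<eta> \<le> R} \<eta>)
    \<le> (NNINT \<eta>. ennreal ?D * (ennreal (\<bar>g \<bullet> horiz \<eta>\<bar> powr (p - 2) * heis_norm \<eta> powr (p - s * p - (p - 2) - ?Q)) * indicator {\<eta>. heis_norm \<eta> \<le> \<tau>} \<eta>))"
   proof (intro nn_integral_mono)
    fix \<eta> :: "'n heis"
    have "ennreal (B1 \<eta> * heis_norm \<eta> powr (- ?\<gamma>)) * indicator {\<eta>. heis_norm \<eta> \<le> R} \<eta>
     \<le> ennreal (B1 \<eta> * heis_norm \<eta> powr (- ?\<gamma>))" by (simp add: indicator_def)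
    also have "\<dots> \<le> ennreal (?D * (\<bar>g \<bullet> horiz \<eta>\<bar> powr (p - 2) * heis_norm \<eta> powr (p - s * p - (p - 2) - ?Q)) * indicator {\<eta>. heis_norm \<eta> \<le> \<tau>} \<eta>)"
     by (intro ennreal_leI pt)
    also have "\<dots> = ennreal ?D * (ennreal (\<bar>g \<bullet> horiz \<eta>\<bar> powr (p - 2) * heis_norm \<eta> powr (p - s * p - (p - 2) - ?Q)) * indicator {\<eta>. heis_norm \<eta> \<le> \<tau>} \<eta>)"
     using m by (auto simp: indicator_def ennreal_mult mult.assoc)
    finally show "ennreal (B1 \<eta> * heis_norm \<eta> powr (- ?\<gamma>)) * indicator {\<eta>. heis_norm \<eta> \<le> R} \<eta>
     \<le> ennreal ?D * (ennreal (\<bar>g \<bullet> horiz \<eta>\<bar> powr (p - 2) * heis_norm \<eta> powr (p - s * p - (p - 2) - ?Q)) * indicator {\<eta>. heis_norm \<eta> \<le> \<tau>} \<eta>)" .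
   qed
   also have "\<dots> = ennreal ?D * (NNINT \<eta>. ennreal (\<bar>g \<bullet> horiz \<eta>\<bar> powr (p - 2) * heis_norm \<eta> powr (p - s * p - (p - 2) - ?Q)) * indicator {\<eta>. heis_norm \<eta> \<le> \<tau>} \<eta>)"
    by (rule nn_integral_cmult) measurable
   also have "\<dots> \<le> ennreal ?D * ennreal (C2 * norm g powr (p - 2) * \<tau> powr (p - s * p))"
    by (intro mult_left_mono C2 True g0) simp
   also have "\<dots> = ennreal (?D * (C2 * norm g powr (p - 2) * \<tau> powr (p - s * p)))"
    using m C2 by (simp add: ennreal_mult)
   also have "\<dots> \<le> ennreal (2 * M * C2 * R powr \<alpha>)"
   proof (rule ennreal_leI)
    have "?D * (C2 * norm g powr (p - 2) * \<tau> powr (p - s * p)) = 2 * C2 * (m * norm g powr (p - 2) * \<tau> powr (p - s * p))"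
     by simp
    also have "\<dots> \<le> 2 * C2 * (M * R powr \<alpha>)" using C2 by (intro mult_left_mono g True) auto
    finally show "?D * (C2 * norm g powr (p - 2) * \<tau> powr (p - s * p)) \<le> 2 * M * C2 * R powr \<alpha>"
     by (simp add: mult_ac)
   qed
   finally show ?thesis .
  qed
  have I: "(NNINT \<eta>. ennreal ((B1 \<eta> + B2 \<eta>) * heis_norm \<eta> powr (- ?\<gamma>)) * indicator {\<eta>. heis_norm \<eta> \<le> R} \<eta>)
   \<le> ennreal (c * R powr \<alpha>)"
  proof -
   have "(NNINT \<eta>. ennreal ((B1 \<eta> + B2 \<eta>) * heis_norm \<eta> powr (- ?\<gamma>)) * indicator {\<eta>. heis_norm \<eta> \<le> R} \<eta>)
   = (NNINT \<eta>. ennreal (B1 \<eta> * heis_norm \<eta> powr (- ?\<gamma>)) * indicator {\<eta>. heis_norm \<eta> \<le> R} \<eta>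
     + ennreal (B2 \<eta> * heis_norm \<eta> powr (- ?\<gamma>)) * indicator {\<eta>. heis_norm \<eta> \<le> R} \<eta>)"
    using B10 B20 by (intro nn_integral_cong) (simp add: distrib_right)
   also have "\<dots> = (NNINT \<eta>. ennreal (B1 \<eta> * heis_norm \<eta> powr (- ?\<gamma>)) * indicator {\<eta>. heis_norm \<eta> \<le> R} \<eta>)
    + (NNINT \<eta>. ennreal (B2 \<eta> * heis_norm \<eta> powr (- ?\<gamma>)) * indicator {\<eta>. heis_norm \<eta> \<le> R} \<eta>)"
    by (rule nn_integral_add) measurable
   also have "\<dots> \<le> ennreal (2 * M * C2 * R powr \<alpha>) + ennreal (M powr (p - 1) * C1 * R powr \<alpha>)"
    by (intro add_mono I1 I2)
   also have "\<dots> = ennreal (c * R powr \<alpha>)"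
    using M C1 C2 by (simp add: c_def ennreal_plus[symmetric] distrib_right del: ennreal_plus)
   finally show ?thesis .
  qed
  have "\<bar>near_int p \<psi> \<xi> \<kappa>\<bar> \<le> L * (c * R powr \<alpha>)"
   unfolding near_int_def
  proof (rule near_bound[OF \<kappa> L R(1) _ _ _ _ _ _ _ I, of _ U "(norm g * R) powr (p - 1)"])
   show "\<bar>U \<eta>\<bar> \<le> (norm g * R) powr (p - 1)" if "heis_norm \<eta> < R" for \<eta>
   proof -
    have "\<bar>U \<eta>\<bar> \<le> \<bar>Jp p (- (g \<bullet> horiz \<eta>))\<bar>" by (simp add: U_def indicator_def)
    also have "\<dots> \<le> (norm g * R) powr (p - 1)"
     unfolding abs_Jp
    proof (rule powr_mono2)
     have "norm g * heis_norm \<eta> \<le> norm g * R" using that by (intro mult_left_mono) auto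
     then show "\<bar>- (g \<bullet> horiz \<eta>)\<bar> \<le> norm g * R" using inner_horiz_bound[of g \<eta>] by simp
    qed (use p in auto)
    finally show ?thesis .
   qed
   \<comment> \<open>\<open>Jp_diff_sing\<close> needs a nonzero second argument; the exceptional
     hyperplane is a null set.\<close>
   have "AE \<eta> in lborel. 0 < \<tau> --> g \<bullet> horiz (\<eta> :: 'n heis) \<noteq> 0"
    using AE_inner_horiz[OF g0] by (cases "0 < \<tau>") auto
   then show "AE \<eta> in lborel. heis_norm \<eta> < R --> \<bar>Jp p (\<psi> \<xi> - \<psi> (heis_mult \<xi> \<eta>)) - U \<eta>\<bar> \<le> B1 \<eta> + B2 \<eta>"
   proof (eventually_elim, intro impI)
    fix \<eta> :: "'n heis" assume nz: "0 < \<tau> --> g \<bullet> horiz \<eta> \<noteq> 0" and n: "heis_norm \<eta> < R"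
    let ?x = "\<psi> \<xi> - \<psi> (heis_mult \<xi> \<eta>)" and ?y = "- (g \<bullet> horiz \<eta>)" and ?N = "heis_norm \<eta>"
    show "\<bar>Jp p ?x - U \<eta>\<bar> \<le> B1 \<eta> + B2 \<eta>"
    proof (cases "?N < \<tau>")
     case True
     then have t0: "0 < \<tau>" using heis_norm_nonneg[of \<eta>] by linarith
     have e: "\<bar>?x - ?y\<bar> \<le> m * ?N\<^sup>2"
      using j[OF t0] True unfolding jet_def by (force simp: abs_le_iff)
     have "\<bar>Jp p ?x - Jp p ?y\<bar> \<le> 2 * \<bar>?y\<bar> powr (p - 2) * \<bar>?x - ?y\<bar>"
      using p nz t0 by (intro Jp_diff_sing) auto
     also have "\<dots> \<le> 2 * \<bar>?y\<bar> powr (p - 2) * (m * ?N\<^sup>2)"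
      by (intro mult_left_mono e) auto
     also have "\<dots> = B1 \<eta>" using True by (simp add: B1_def mult_ac)
     finally show ?thesis using True B20[of \<eta>] by (simp add: U_def)
    next
     case False
     then have "\<bar>?x\<bar> \<le> M * ?N powr \<beta>" using far[of \<eta>] n by (simp add: abs_minus_commute)
     then have "\<bar>?x\<bar> powr (p - 1) \<le> (M * ?N powr \<beta>) powr (p - 1)" using p by (intro powr_mono2) auto
     also have "\<dots> = B2 \<eta>" using M by (simp add: B2_def powr_mult powr_powr)
     finally show ?thesis using False B10[of \<eta>] by (simp add: U_def abs_Jp)
    qed
   qed
  qed (use B10 B20 c in \<open>auto simp: U_def indicator_def\<close>)
  then show "\<bar>near_int p \<psi> \<xi> \<kappa>\<bar> \<le> L * c * R powr \<alpha>" by (simp add: mult.assoc)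
 qed (use \<alpha> L c in auto)
qed


section \<open>Taylor expansion along horizontal curves\<close>

text \<open>The coefficient of the vertical derivative in X_i, so that X_i is the constant direction
  \<open>hbasis i\<close> plus \<open>hcoef i\<close> times \<open>tvec\<close>. As
  \<open>hcoef i\<close> is linear in the point, the product rule applies directly.\<close>

definition hcoef :: "'n::finite + 'n => 'n heis => real" where
 "hcoef i \<xi> = (case i of Inl j => 2 * fst (snd \<xi>) $ j | Inr j => - 2 * fst \<xi> $ j)"

definition hbasis :: "'n::finite + 'n => 'n heis" where
 "hbasis i = (case i of Inl j => (axis j 1, 0, 0) | Inr j => (0, axis j 1, 0))"

definition tvec :: "'n::finite heis" where "tvec = (0, 0, 1)"

definition hcomp :: "(real ^ 'n::finite) \<times> (real ^ 'n) => 'n + 'n => real" where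
 "hcomp z i = (case i of Inl j => fst z $ j | Inr j => snd z $ j)"

text \<open>The horizontal gradient as a pair, so that it can be paired with
  \<open>horiz \<eta>\<close>; it has the same norm as \<open>hgrad\<close>.\<close>

definition hgr :: "('n::finite heis => real) => 'n heis => (real ^ 'n) \<times> (real ^ 'n)" where
 "hgr u \<xi> = (\<chi> j. hfield (Inl j) u \<xi>, \<chi> j. hfield (Inr j) u \<xi>)"

definition lift :: "(real ^ 'n::finite) \<times> (real ^ 'n) => 'n heis" where
 "lift z = (fst z, snd z, 0)"

lemma lift_0 [simp]: "lift 0 = 0"
 by (simp add: lift_def zero_prod_def)

lemma hfield_eq: "hfield i u \<xi> = frechet_derivative u (at \<xi>) (hbasis i + hcoef i \<xi> *\<^sub>R tvec)"
 by (cases i; cases \<xi>) (simp_all add: hbasis_def hcoef_def tvec_def)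

lemma abs_hcomp_le: "\<bar>hcomp z i\<bar> \<le> norm z"
proof (cases i)
 case (Inl j)
 have "\<bar>fst z $ j\<bar> \<le> norm (fst z)" by (rule component_le_norm_cart)
 also have "\<dots> \<le> norm z" by (metis norm_fst_le prod.collapse)
 finally show ?thesis by (simp add: hcomp_def Inl)
next
 case (Inr j)
 have "\<bar>snd z $ j\<bar> \<le> norm (snd z)" by (rule component_le_norm_cart)
 also have "\<dots> \<le> norm z" by (metis norm_snd_le prod.collapse)
 finally show ?thesis by (simp add: hcomp_def Inr)
qed

lemma sum_sum_type:
 fixes f :: "'n::finite + 'n => 'b::comm_monoid_add"
 shows "(\<Sum>i\<in>UNIV. f i) = (\<Sum>j\<in>UNIV. f (Inl j)) + (\<Sum>j\<in>UNIV. f (Inr j))"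
 by (subst UNIV_Plus_UNIV[symmetric], subst sum.Plus) auto

lemma hgr_inner: "hgr u \<xi> \<bullet> z = (\<Sum>i\<in>UNIV. hcomp z i * hfield i u \<xi>)"
 by (cases z) (simp add: hgr_def sum_sum_type hcomp_def inner_vec_def mult.commute)

lemma norm_hgrad: "norm (hgrad u \<xi>) = norm (hgr u \<xi>)"
proof -
 have "(norm (hgrad u \<xi>))\<^sup>2 = (norm (hgr u \<xi>))\<^sup>2"
  by (simp add: power2_norm_eq_inner hgrad_def hgr_def inner_vec_def sum_sum_type)
 then show ?thesis by simp
qed

lemma hgrad_eq_0: "hgrad u \<xi> = 0 \<longleftrightarrow> hgr u \<xi> = 0"
 using norm_hgrad[of u \<xi>] by (metis norm_eq_zero)

lemma axis_sum: "(\<Sum>j\<in>UNIV. a $ j *\<^sub>R axis j 1) = (a :: real ^ 'n::finite)"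
 by (simp add: vec_eq_iff axis_def if_distrib cong: if_cong)

lemma hvec_sum: "lift z + omega \<xi> (lift z) *\<^sub>R tvec = (\<Sum>i\<in>UNIV. hcomp z i *\<^sub>R (hbasis i + hcoef i \<xi> *\<^sub>R tvec))"
proof -
 have 1: "(\<Sum>j\<in>UNIV. (fst z $ j *\<^sub>R axis j 1, 0, 0)) = ((fst z, 0, 0) :: 'a heis)"
  by (simp add: axis_sum prod_eq_iff fst_sum snd_sum)
 have 2: "(\<Sum>j\<in>UNIV. (0, snd z $ j *\<^sub>R axis j 1, 0)) = ((0, snd z, 0) :: 'a heis)"
  by (simp add: axis_sum prod_eq_iff fst_sum snd_sum)
 have 3: "(\<Sum>j\<in>UNIV. fst z $ j * (2 * fst (snd \<xi>) $ j)) = 2 * (fst z \<bullet> fst (snd \<xi>))"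
  by (simp add: inner_vec_def sum_distrib_left mult_ac)
 have 4: "(\<Sum>j\<in>UNIV. snd z $ j * (- 2 * fst \<xi> $ j)) = - 2 * (fst \<xi> \<bullet> snd z)"
  by (simp add: inner_vec_def sum_distrib_left mult_ac)
 have A: "(\<Sum>i\<in>UNIV. hcomp z i *\<^sub>R hbasis i) = lift z"
  unfolding sum_sum_type by (simp add: hcomp_def hbasis_def 1 2 lift_def)
 have B: "(\<Sum>i\<in>UNIV. hcomp z i * hcoef i \<xi>) = omega \<xi> (lift z)"
  unfolding sum_sum_type hcomp_def hcoef_def sum.case 3 4 by (simp add: omega_def lift_def)
 show ?thesis
  unfolding scaleR_add_right sum.distrib scaleR_scaleR scaleR_sum_left[symmetric] A B ..
qed

text \<open>Horizontal curves with constant coefficients are straight lines in these coordinates;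
  their velocity depends on the starting point.\<close>

lemma heis_mult_lift: "heis_mult \<xi> (lift (c *\<^sub>R z)) = \<xi> + c *\<^sub>R (lift z + omega \<xi> (lift z) *\<^sub>R tvec)"
 by (simp add: heis_mult_eq lift_def omega_def tvec_def prod_eq_iff algebra_simps)

lemma hderiv_sum:
 assumes "u differentiable (at \<xi>)"
 shows "frechet_derivative u (at \<xi>) (lift z + omega \<xi> (lift z) *\<^sub>R tvec) = (\<Sum>i\<in>UNIV. hcomp z i * hfield i u \<xi>)"
proof -
 interpret linear "frechet_derivative u (at \<xi>)" using assms by (rule linear_frechet_derivative)
 show ?thesis by (simp add: hvec_sum sum scaleR hfield_eq)
qed

text \<open>The symplectic form vanishes on (z, z) and ignores the vertical coordinate, so the
  horizontal direction belonging to z is the same at all points of the line. Hence the derivative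
  along the line is the combination of the X_i with coefficients z everywhere on it.\<close>

lemma omega_shift: "omega (\<xi> + c *\<^sub>R (lift z + d *\<^sub>R tvec)) (lift z) = omega \<xi> (lift z)"
 by (simp add: omega_def lift_def tvec_def inner_add_left inner_add_right inner_commute algebra_simps)

lemma DERIV_horizontal:
 assumes "u differentiable (at (heis_mult \<xi> (lift (c *\<^sub>R z))))"
 shows "((\<lambda>c. u (heis_mult \<xi> (lift (c *\<^sub>R z)))) has_real_derivative
  (\<Sum>i\<in>UNIV. hcomp z i * hfield i u (heis_mult \<xi> (lift (c *\<^sub>R z))))) (at c)"
proof -
 define v where "v = lift z + omega \<xi> (lift z) *\<^sub>R tvec"
 have eq: "heis_mult \<xi> (lift (c *\<^sub>R z)) = \<xi> + c *\<^sub>R v" for c by (simp add: heis_mult_lift v_def)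
 have d: "(u has_derivative frechet_derivative u (at (\<xi> + c *\<^sub>R v))) (at (\<xi> + c *\<^sub>R v))"
  using assms unfolding eq by (simp add: frechet_derivative_works)
 have "((\<lambda>c. u (\<xi> + c *\<^sub>R v)) has_derivative (\<lambda>h. frechet_derivative u (at (\<xi> + c *\<^sub>R v)) (h *\<^sub>R v))) (at c)"
 proof -
  have "((\<lambda>c. \<xi> + c *\<^sub>R v) has_derivative (\<lambda>h. h *\<^sub>R v)) (at c)" by (auto intro!: derivative_eq_intros)
  from has_derivative_compose[OF this, of u] d show ?thesis by blast
 qed
 moreover have "frechet_derivative u (at (\<xi> + c *\<^sub>R v)) (h *\<^sub>R v) = frechet_derivative u (at (\<xi> + c *\<^sub>R v)) v * h" for h
 proof -
  interpret linear "frechet_derivative u (at (\<xi> + c *\<^sub>R v))" using d by (rule has_derivative_linear)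
  show ?thesis by (simp add: scaleR)
 qed
 ultimately have "((\<lambda>c. u (\<xi> + c *\<^sub>R v)) has_real_derivative frechet_derivative u (at (\<xi> + c *\<^sub>R v)) v) (at c)"
  by (simp add: has_field_derivative_def)
 moreover have "v = lift z + omega (\<xi> + c *\<^sub>R v) (lift z) *\<^sub>R tvec"
  by (simp add: v_def omega_shift)
 then have "frechet_derivative u (at (\<xi> + c *\<^sub>R v)) v = (\<Sum>i\<in>UNIV. hcomp z i * hfield i u (\<xi> + c *\<^sub>R v))"
  using hderiv_sum[of u "\<xi> + c *\<^sub>R v" z] assms unfolding eq by simp
 ultimately show ?thesis unfolding eq by simp
qed

locale C2_function =
 fixes D :: "'n::finite heis set" and u :: "'n heis => real"
 assumes D: "open D" and C2: "Ck_on 2 D u"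
begin

lemma diff1: "\<xi> \<in> D ==> u differentiable (at \<xi>)"
 using C2 by (simp add: numeral_2_eq_2)

lemma diff2: "\<xi> \<in> D ==> (\<lambda>x. frechet_derivative u (at x) v) differentiable (at \<xi>)"
 using C2 by (simp add: numeral_2_eq_2)

lemma cont2: "continuous_on D (\<lambda>x. frechet_derivative (\<lambda>x. frechet_derivative u (at x) v) (at x) w)"
 using C2 by (simp add: numeral_2_eq_2)

lemma continuous_u: "continuous_on D u"
 using diff1 by (auto intro!: differentiable_imp_continuous_on differentiable_at_imp_differentiable_on simp: differentiable_on_def intro: differentiable_at_withinI)

lemma hfield_split:
 assumes "\<xi> \<in> D"
 shows "hfield i u \<xi> = frechet_derivative u (at \<xi>) (hbasis i) + hcoef i \<xi> * frechet_derivative u (at \<xi>) tvec"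
proof -
 interpret linear "frechet_derivative u (at \<xi>)" by (rule linear_frechet_derivative[OF diff1[OF assms]])
 show ?thesis by (simp add: hfield_eq add scaleR)
qed

lemma hcoef_linear: "linear (hcoef i)"
 by (cases i; rule linearI) (simp_all add: hcoef_def algebra_simps)

lemma has_derivative_hcoef: "(hcoef i has_derivative hcoef i) F"
 by (rule linear_imp_has_derivative[OF hcoef_linear])

lemma has_derivative_hfield:
 assumes "\<xi> \<in> D"
 shows "(hfield i u has_derivative (\<lambda>w. frechet_derivative (\<lambda>x. frechet_derivative u (at x) (hbasis i)) (at \<xi>) w
  + (hcoef i \<xi> * frechet_derivative (\<lambda>x. frechet_derivative u (at x) tvec) (at \<xi>) w
    + hcoef i w * frechet_derivative u (at \<xi>) tvec))) (at \<xi>)"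
proof -
 have d: "((\<lambda>x. frechet_derivative u (at x) v) has_derivative frechet_derivative (\<lambda>x. frechet_derivative u (at x) v) (at \<xi>)) (at \<xi>)" for v
  using diff2[OF assms] by (simp add: frechet_derivative_works)
 have "((\<lambda>x. frechet_derivative u (at x) (hbasis i) + hcoef i x * frechet_derivative u (at x) tvec) has_derivative
  (\<lambda>w. frechet_derivative (\<lambda>x. frechet_derivative u (at x) (hbasis i)) (at \<xi>) w
  + (hcoef i \<xi> * frechet_derivative (\<lambda>x. frechet_derivative u (at x) tvec) (at \<xi>) w
    + hcoef i w * frechet_derivative u (at \<xi>) tvec))) (at \<xi>)"
  by (intro has_derivative_add has_derivative_mult d has_derivative_hcoef)
 then show ?thesis
  by (rule has_derivative_transform_within_open[OF _ D assms]) (simp add: hfield_split)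
qed

lemma hfield_differentiable: "\<xi> \<in> D ==> hfield i u differentiable (at \<xi>)"
 using has_derivative_hfield unfolding differentiable_def by blast

lemma continuous_hgr: "continuous_on D (hgr u)"
proof -
 have "continuous_on D (hfield i u)" for i
  by (rule differentiable_imp_continuous_on)
   (auto simp: differentiable_on_def intro: differentiable_at_withinI hfield_differentiable)
 then show ?thesis unfolding hgr_def
  by (intro continuous_intros)
qed

lemma continuous_D1: "continuous_on D (\<lambda>x. frechet_derivative u (at x) v)"
 by (rule differentiable_imp_continuous_on)
  (auto simp: differentiable_on_def intro: differentiable_at_withinI diff2)

text \<open>The product rule writes X_i X_j u through Euclidean second derivatives and one first
  vertical derivative, with coefficients that are polynomial in the point.\<close>

lemma continuous_hhess: "continuous_on D (hhess u)"
proof -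
 let ?D2 = "\<lambda>v w x. frechet_derivative (\<lambda>x. frechet_derivative u (at x) v) (at x) w"
 have eq: "hfield i (hfield j u) x = (?D2 (hbasis j) (hbasis i) x + hcoef i x * ?D2 (hbasis j) tvec x)
  + (hcoef j x * (?D2 tvec (hbasis i) x + hcoef i x * ?D2 tvec tvec x)
    + (hcoef j (hbasis i) + hcoef i x * hcoef j tvec) * frechet_derivative u (at x) tvec)"
  if "x \<in> D" for i j x
 proof -
  have l: "linear (frechet_derivative (\<lambda>x. frechet_derivative u (at x) v) (at x))" for v
   by (rule linear_frechet_derivative[OF diff2[OF that]])
  have "frechet_derivative (hfield j u) (at x) = (\<lambda>w. ?D2 (hbasis j) w x
  + (hcoef j x * ?D2 tvec w x + hcoef j w * frechet_derivative u (at x) tvec))"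
   by (rule frechet_derivative_at[symmetric, OF has_derivative_hfield[OF that]])
  then have "hfield i (hfield j u) x = ?D2 (hbasis j) (hbasis i + hcoef i x *\<^sub>R tvec) x
  + (hcoef j x * ?D2 tvec (hbasis i + hcoef i x *\<^sub>R tvec) x
    + hcoef j (hbasis i + hcoef i x *\<^sub>R tvec) * frechet_derivative u (at x) tvec)"
   by (simp only: hfield_eq[of i "hfield j u"])
  then show ?thesis
   by (simp only: linear_add[OF l] linear_scale[OF l] linear_add[OF hcoef_linear] linear_scale[OF hcoef_linear] real_scaleR_def)
 qed
 have c: "continuous_on D (hcoef i)" for i :: "'n + 'n"
  by (rule has_derivative_continuous_on, rule has_derivative_hcoef)
 have "continuous_on D (hfield i (hfield j u))" for i j
  by (rule continuous_on_cong[THEN iffD2, OF refl eq])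
   (auto intro!: continuous_intros c cont2 continuous_D1)
 then show ?thesis unfolding hhess_def by (intro continuous_intros)
qed

text \<open>Each of the (2 N)^2 entries is bounded by the norm of the matrix; this count is the
  origin of the constant in all Taylor estimates below.\<close>

lemma abs_hess_sum_le:
 "\<bar>\<Sum>j\<in>UNIV. hcomp w j * (\<Sum>i\<in>UNIV. hcomp z i * hfield i (hfield j u) \<xi>)\<bar>
  \<le> (2 * real CARD('n))\<^sup>2 * (norm w * norm z * norm (hhess u \<xi>))"
proof -
 have h: "\<bar>hfield i (hfield j u) \<xi>\<bar> \<le> norm (hhess u \<xi>)" for i j
 proof -
  have "\<bar>hhess u \<xi> $ i $ j\<bar> \<le> norm (hhess u \<xi> $ i)" by (rule component_le_norm_cart)
  also have "\<dots> \<le> norm (hhess u \<xi>)" by (rule Finite_Cartesian_Product.norm_nth_le)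
  finally show ?thesis by (simp add: hhess_def)
 qed
 have "\<bar>\<Sum>j\<in>UNIV. hcomp w j * (\<Sum>i\<in>UNIV. hcomp z i * hfield i (hfield j u) \<xi>)\<bar>
  = \<bar>\<Sum>j\<in>UNIV. \<Sum>i\<in>UNIV. hcomp w j * (hcomp z i * hfield i (hfield j u) \<xi>)\<bar>"
  by (simp add: sum_distrib_left)
 also have "\<dots> \<le> (\<Sum>j\<in>(UNIV :: ('n + 'n) set). \<Sum>i\<in>(UNIV :: ('n + 'n) set). norm w * (norm z * norm (hhess u \<xi>)))"
  by (intro order_trans[OF sum_abs] sum_mono)
   (auto simp: abs_mult intro!: mult_mono abs_hcomp_le h)
 also have "\<dots> = (2 * real CARD('n))\<^sup>2 * (norm w * norm z * norm (hhess u \<xi>))"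
  by (simp add: power2_eq_square mult_ac)
 finally show ?thesis .
qed

lemma hgr_horizontal:
 fixes M :: real
 assumes S: "\<And>c. 0 \<le> c ==> c \<le> 1 ==> heis_mult \<xi> (lift (c *\<^sub>R z)) \<in> D \<and> norm (hhess u (heis_mult \<xi> (lift (c *\<^sub>R z)))) \<le> M"
  and c: "0 \<le> c" "c \<le> 1"
 shows "\<bar>(hgr u (heis_mult \<xi> (lift (c *\<^sub>R z))) - hgr u \<xi>) \<bullet> w\<bar> \<le> (2 * real CARD('n))\<^sup>2 * (norm w * norm z * M)"
proof (cases "c = 0")
 case True
 have "0 \<le> M" using S[of 0] norm_ge_zero order_trans by (metis order_refl zero_le_one)
 then show ?thesis using True by simp
next
 case False
 then have c0: "0 < c" using c by simp
 let ?x = "\<lambda>c. heis_mult \<xi> (lift (c *\<^sub>R z))"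
 have 0: "?x 0 = \<xi>" by simp
 have "\<exists>t>0. t < c \<and> hgr u (?x c) \<bullet> w - hgr u (?x 0) \<bullet> w
  = (c - 0) * (\<Sum>j\<in>UNIV. hcomp w j * (\<Sum>i\<in>UNIV. hcomp z i * hfield i (hfield j u) (?x t)))"
  unfolding hgr_inner
  by (rule MVT2[OF c0]) (use S c in \<open>auto intro!: derivative_eq_intros DERIV_horizontal hfield_differentiable simp: mult.commute\<close>)
 then obtain t where t: "0 < t" "t < c" "hgr u (?x c) \<bullet> w - hgr u \<xi> \<bullet> w
  = c * (\<Sum>j\<in>UNIV. hcomp w j * (\<Sum>i\<in>UNIV. hcomp z i * hfield i (hfield j u) (?x t)))"
  by (auto simp: 0)
 have "\<bar>hgr u (?x c) \<bullet> w - hgr u \<xi> \<bullet> w\<bar> \<le> 1 * ((2 * real CARD('n))\<^sup>2 * (norm w * norm z * norm (hhess u (?x t))))"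
  unfolding t(3) abs_mult using c by (intro mult_mono abs_hess_sum_le) auto
 also have "\<dots> \<le> 1 * ((2 * real CARD('n))\<^sup>2 * (norm w * norm z * M))"
  using S[of t] t c by (intro mult_left_mono) auto
 finally show ?thesis by (simp add: inner_diff_left)
qed

text \<open>One mean value theorem produces the gradient at an intermediate point of the line;
  \<open>hgr_horizontal\<close>, a second one, compares it with the gradient at the start.\<close>

lemma taylor_horizontal:
 fixes M :: real
 assumes S: "\<And>c. 0 \<le> c ==> c \<le> 1 ==> heis_mult \<xi> (lift (c *\<^sub>R z)) \<in> D \<and> norm (hhess u (heis_mult \<xi> (lift (c *\<^sub>R z)))) \<le> M"
 shows "\<bar>u (heis_mult \<xi> (lift z)) - u \<xi> - hgr u \<xi> \<bullet> z\<bar> \<le> (2 * real CARD('n))\<^sup>2 * ((norm z)\<^sup>2 * M)"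
proof -
 let ?x = "\<lambda>c. heis_mult \<xi> (lift (c *\<^sub>R z))"
 have 0: "?x 0 = \<xi>" "?x 1 = heis_mult \<xi> (lift z)" by simp_all
 have "\<exists>t>0. t < 1 \<and> u (?x 1) - u (?x 0) = (1 - 0) * (\<Sum>i\<in>UNIV. hcomp z i * hfield i u (?x t))"
  by (rule MVT2) (use S in \<open>auto intro!: DERIV_horizontal diff1\<close>)
 then obtain t where t: "0 < t" "t < 1" "u (heis_mult \<xi> (lift z)) - u \<xi> = hgr u (?x t) \<bullet> z"
  by (auto simp: 0 hgr_inner)
 have "u (heis_mult \<xi> (lift z)) - u \<xi> - hgr u \<xi> \<bullet> z = (hgr u (?x t) - hgr u \<xi>) \<bullet> z"
  using t by (simp add: inner_diff_left)
 then show ?thesis using hgr_horizontal[OF S, of t z] t by (simp add: power2_eq_square)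
qed

end

lemma heis_norm_lift [simp]: "heis_norm (lift z) = norm z"
proof -
 have "heis_norm (lift z) ^ 4 = norm z ^ 4"
  unfolding heis_norm_pow4 by (simp add: lift_def horiz_def vert_def)
 then show ?thesis by (simp add: power_eq_iff_eq_base)
qed

text \<open>A vertical increment is reached by a closed horizontal polygon with four edges (a commutator).\<close>
lemma vertical_commutator:
 fixes \<xi> :: "'n::finite heis"
 assumes "e \<bullet> e = 1"
 shows "heis_mult (heis_mult (heis_mult (heis_mult \<xi> (lift (a *\<^sub>R (e, 0)))) (lift (b *\<^sub>R (0, e))))
   (lift (- (a *\<^sub>R (e, 0))))) (lift (- (b *\<^sub>R (0, e)))) = heis_mult \<xi> (0, 0, - 4 * a * b)"
 using assms by (simp add: heis_mult_eq lift_def omega_def prod_eq_iff inner_add_left inner_add_right algebra_simps)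

context C2_function
begin

text \<open>The first-order terms of the four edges cancel in pairs up to changes of the gradient
  between vertices. With edges of length a = sqrt |t| / 2 there are four Taylor errors and four
  gradient changes, each a constant times a^2 M, and 8 a^2 = 2 |t|. Thus the horizontal Hessian
  controls the vertical increment without any vertical derivative.\<close>

lemma vertical_increment:
 fixes M :: real
 assumes S: "\<And>x. heis_dist x \<xi> \<le> 2 * sqrt \<bar>t\<bar> ==> x \<in> D \<and> norm (hhess u x) \<le> M"
 shows "\<bar>u (heis_mult \<xi> (0, 0, t)) - u \<xi>\<bar> \<le> 2 * ((2 * real CARD('n))\<^sup>2 * (M * \<bar>t\<bar>))"
proof -
 define a where "a = sqrt \<bar>t\<bar> / 2"
 \<comment> \<open>The sign makes - 4 a b = t, as the commutator formula requires.\<close>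
 define b where "b = - sgn t * a"
 define e :: "real ^ 'n" where "e = axis undefined 1"
 have e: "e \<bullet> e = 1" by (simp add: e_def inner_axis)
 have ne: "norm e = 1" by (simp add: e_def)
 define z1 where "z1 = a *\<^sub>R (e, 0 :: real ^ 'n)"
 define z2 where "z2 = b *\<^sub>R (0 :: real ^ 'n, e)"
 have a0: "0 \<le> a" by (simp add: a_def)
 have ab: "\<bar>b\<bar> \<le> a" using a0 by (simp add: b_def abs_mult sgn_if)
 have n1: "norm z1 \<le> a" using a0 by (simp add: z1_def norm_Pair ne)
 have n2: "norm z2 \<le> a" using ab by (simp add: z2_def norm_Pair ne)
 have "norm (hhess u \<xi>) \<le> M" using S[of \<xi>] by simp
 then have M: "0 \<le> M" by (rule order_trans[OF norm_ge_zero])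
 define x1 where "x1 = heis_mult \<xi> (lift z1)"
 define x2 where "x2 = heis_mult x1 (lift z2)"
 define x3 where "x3 = heis_mult x2 (lift (- z1))"
 define x4 where "x4 = heis_mult x3 (lift (- z2))"
 have aa: "a * a = \<bar>t\<bar> / 4" by (simp add: a_def)
 have four: "- 4 * a * b = t"
 proof -
  have "- 4 * a * b = 4 * (a * a) * sgn t" by (simp add: b_def)
  then show ?thesis unfolding aa by (simp add: abs_mult_sgn)
 qed
 have x4: "x4 = heis_mult \<xi> (0, 0, t)"
  unfolding x4_def x3_def x2_def x1_def z1_def z2_def vertical_commutator[OF e] four ..
 have step: "heis_dist (heis_mult x (lift z)) \<xi> \<le> heis_dist x \<xi> + norm z" for x z
  using heis_dist_triangle[of "heis_mult x (lift z)" \<xi> x] heis_dist_commute[of x "heis_mult x (lift z)"] by simp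
 have d1: "heis_dist x1 \<xi> \<le> a" using step[of \<xi> z1] n1 by (simp add: x1_def)
 have d2: "heis_dist x2 \<xi> \<le> 2 * a" using step[of x1 z2] d1 n2 by (simp add: x2_def)
 have d3: "heis_dist x3 \<xi> \<le> 3 * a" using step[of x2 "- z1"] d2 n1 by (simp add: x3_def)
 have SS: "heis_mult x (lift (c *\<^sub>R z)) \<in> D \<and> norm (hhess u (heis_mult x (lift (c *\<^sub>R z)))) \<le> M"
  if "heis_dist x \<xi> \<le> 3 * a" "norm z \<le> a" "0 \<le> c" "c \<le> 1" for x z c
 proof (rule S)
  have "norm (c *\<^sub>R z) \<le> 1 * a" unfolding norm_scaleR using that by (intro mult_mono) auto
  then show "heis_dist (heis_mult x (lift (c *\<^sub>R z))) \<xi> \<le> 2 * sqrt \<bar>t\<bar>"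
   using step[of x "c *\<^sub>R z"] that by (simp add: a_def)
 qed
 define C where "C = (2 * real CARD('n))\<^sup>2"
 have C: "0 \<le> C" by (simp add: C_def)
 have T: "\<bar>u (heis_mult x (lift z)) - u x - hgr u x \<bullet> z\<bar> \<le> C * (a\<^sup>2 * M)"
  if "heis_dist x \<xi> \<le> 3 * a" "norm z \<le> a" for x z
 proof -
  have "\<bar>u (heis_mult x (lift z)) - u x - hgr u x \<bullet> z\<bar> \<le> C * ((norm z)\<^sup>2 * M)"
   unfolding C_def using taylor_horizontal[OF SS[OF that]] by simp
  also have "\<dots> \<le> C * (a\<^sup>2 * M)"
   using that M C by (intro mult_left_mono mult_right_mono power_mono) auto
  finally show ?thesis .
 qed
 have G: "\<bar>hgr u (heis_mult x (lift z)) \<bullet> w - hgr u x \<bullet> w\<bar> \<le> C * (a\<^sup>2 * M)"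
  if "heis_dist x \<xi> \<le> 3 * a" "norm z \<le> a" "norm w \<le> a" for x z w
 proof -
  have "\<bar>(hgr u (heis_mult x (lift (1 *\<^sub>R z))) - hgr u x) \<bullet> w\<bar> \<le> C * (norm w * norm z * M)"
   unfolding C_def using hgr_horizontal[OF SS[OF that(1,2)], of 1 w] by simp
  also have "\<dots> \<le> C * (a * a * M)"
   using that M C a0 by (intro mult_left_mono mult_right_mono mult_mono) auto
  finally show ?thesis by (simp add: power2_eq_square inner_diff_left)
 qed
 let ?K = "C * (a\<^sup>2 * M)"
 have e1: "\<bar>u x1 - u \<xi> - hgr u \<xi> \<bullet> z1\<bar> \<le> ?K" unfolding x1_def by (rule T) (use a0 n1 in auto)
 have e2: "\<bar>u x2 - u x1 - hgr u x1 \<bullet> z2\<bar> \<le> ?K" unfolding x2_def by (rule T) (use a0 d1 n2 in auto)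
 have e3: "\<bar>u x3 - u x2 - hgr u x2 \<bullet> (- z1)\<bar> \<le> ?K" unfolding x3_def by (rule T) (use a0 d2 n1 in auto)
 have e4: "\<bar>u x4 - u x3 - hgr u x3 \<bullet> (- z2)\<bar> \<le> ?K" unfolding x4_def by (rule T) (use a0 d3 n2 in auto)
 have g1: "\<bar>hgr u x1 \<bullet> z1 - hgr u \<xi> \<bullet> z1\<bar> \<le> ?K" unfolding x1_def by (rule G) (use a0 n1 in auto)
 have g2: "\<bar>hgr u x2 \<bullet> z1 - hgr u x1 \<bullet> z1\<bar> \<le> ?K" unfolding x2_def by (rule G) (use a0 d1 n1 n2 in auto)
 have g3: "\<bar>hgr u x2 \<bullet> z2 - hgr u x1 \<bullet> z2\<bar> \<le> ?K" unfolding x2_def by (rule G) (use a0 d1 n1 n2 in auto)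
 have g4: "\<bar>hgr u x3 \<bullet> z2 - hgr u x2 \<bullet> z2\<bar> \<le> ?K" unfolding x3_def by (rule G) (use a0 d2 n1 n2 in auto)
 have "\<bar>u x4 - u \<xi>\<bar> \<le> 8 * ?K"
  using e1 e2 e3 e4 g1 g2 g3 g4 unfolding inner_minus_right by linarith
 also have "8 * ?K = 2 * (C * (M * \<bar>t\<bar>))" using aa by (simp add: power2_eq_square)
 finally show ?thesis by (simp add: x4 C_def)
qed

text \<open>The point is reached by a horizontal segment followed by a vertical increment. Radius 3
  |\<eta>| contains both paths: |z| \<le> |\<eta>| for the segment and 2 sqrt |t| \<le> 2 |\<eta>|
  more for the polygon. The factor 3 is one horizontal error plus the 2 of the vertical
  increment.\<close>

lemma taylor_heis:
 fixes M :: real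
 assumes S: "\<And>x. heis_dist x \<xi> \<le> 3 * heis_norm \<eta> ==> x \<in> D \<and> norm (hhess u x) \<le> M"
 shows "\<bar>u (heis_mult \<xi> \<eta>) - u \<xi> - hgr u \<xi> \<bullet> horiz \<eta>\<bar> \<le> (3 * (2 * real CARD('n))\<^sup>2 * M) * (heis_norm \<eta>)\<^sup>2"
proof -
 let ?z = "horiz \<eta>" and ?t = "vert \<eta>" and ?N = "heis_norm \<eta>"
 define C where "C = (2 * real CARD('n))\<^sup>2"
 have C: "0 \<le> C" by (simp add: C_def)
 have "norm (hhess u \<xi>) \<le> M" using S[of \<xi>] by simp
 then have M: "0 \<le> M" by (rule order_trans[OF norm_ge_zero])
 have \<eta>: "heis_mult \<xi> \<eta> = heis_mult (heis_mult \<xi> (lift ?z)) (0, 0, ?t)"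
  by (simp add: heis_mult_assoc) (simp add: heis_mult_eq lift_def omega_def horiz_def vert_def prod_eq_iff)
 have step: "heis_dist (heis_mult x (lift z)) \<xi> \<le> heis_dist x \<xi> + norm z" for x z
  using heis_dist_triangle[of "heis_mult x (lift z)" \<xi> x] heis_dist_commute[of x "heis_mult x (lift z)"] by simp
 have sq: "sqrt \<bar>?t\<bar> \<le> ?N" using abs_vert_le[of \<eta>] by (intro real_le_lsqrt) auto
 have "\<bar>u (heis_mult \<xi> (lift ?z)) - u \<xi> - hgr u \<xi> \<bullet> ?z\<bar> \<le> C * ((norm ?z)\<^sup>2 * M)"
  unfolding C_def
 proof (rule taylor_horizontal, rule S)
  fix c :: real assume c: "0 \<le> c" "c \<le> 1"
  have "norm (c *\<^sub>R ?z) \<le> 1 * ?N" unfolding norm_scaleR using c by (intro mult_mono norm_horiz_le) auto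
  then show "heis_dist (heis_mult \<xi> (lift (c *\<^sub>R ?z))) \<xi> \<le> 3 * ?N" using step[of \<xi> "c *\<^sub>R ?z"] heis_norm_nonneg[of \<eta>] heis_dist_self[of \<xi>] by linarith
 qed
 also have "\<dots> \<le> C * (?N\<^sup>2 * M)"
  using C M by (intro mult_left_mono mult_right_mono power_mono norm_horiz_le) auto
 finally have 1: "\<bar>u (heis_mult \<xi> (lift ?z)) - u \<xi> - hgr u \<xi> \<bullet> ?z\<bar> \<le> C * (?N\<^sup>2 * M)" .
 have "\<bar>u (heis_mult \<xi> \<eta>) - u (heis_mult \<xi> (lift ?z))\<bar> \<le> 2 * (C * (M * \<bar>?t\<bar>))"
  unfolding \<eta> C_def
 proof (rule vertical_increment, rule S)
  fix x assume "heis_dist x (heis_mult \<xi> (lift ?z)) \<le> 2 * sqrt \<bar>?t\<bar>"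
  then show "heis_dist x \<xi> \<le> 3 * ?N"
   using heis_dist_triangle[of x \<xi> "heis_mult \<xi> (lift ?z)"] step[of \<xi> ?z] sq norm_horiz_le[of \<eta>] heis_dist_self[of \<xi>] by linarith
 qed
 also have "\<dots> \<le> 2 * (C * (M * ?N\<^sup>2))"
  using C M by (intro mult_left_mono abs_vert_le) auto
 finally have 2: "\<bar>u (heis_mult \<xi> \<eta>) - u (heis_mult \<xi> (lift ?z))\<bar> \<le> 2 * (C * (?N\<^sup>2 * M))" by (simp add: mult.commute)
 have "3 * (C * (?N\<^sup>2 * M)) = (3 * C * M) * ?N\<^sup>2" by simp
 then show ?thesis using 1 2 unfolding C_def by linarith
qed

lemma bounded_on_cball:
 assumes "\<And>x. heis_dist x x0 \<le> r ==> x \<in> D"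
 shows "\<exists>M\<ge>0. \<forall>x. heis_dist x x0 \<le> r --> norm (hhess u x) \<le> M \<and> norm (hgr u x) \<le> M \<and> \<bar>u x\<bar> \<le> M"
proof -
 let ?B = "{x. heis_dist x x0 \<le> r}"
 have B: "?B \<subseteq> D" using assms by auto
 have "bounded (hhess u ` ?B)" "bounded (hgr u ` ?B)" "bounded (u ` ?B)"
  by (intro compact_imp_bounded compact_continuous_image compact_heis_cball
    continuous_on_subset[OF _ B] continuous_hhess continuous_hgr continuous_u)+
 then obtain M1 M2 M3 where "\<forall>x\<in>?B. norm (hhess u x) \<le> M1" "\<forall>x\<in>?B. norm (hgr u x) \<le> M2" "\<forall>x\<in>?B. norm (u x) \<le> M3"
  by (auto simp: bounded_iff)
 then show ?thesis by (intro exI[of _ "max 0 (max M1 (max M2 M3))"]) (auto simp: le_max_iff_disj)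
qed

text \<open>Taylor's formula with radius at most r / 8 looks three times as far; from a centre
  within r / 8 of \<open>x0\<close> it stays in the compact ball of radius r / 2, on which the
  derivatives are bounded.\<close>

lemma jet_uniform:
 assumes r: "0 < r" and B: "\<And>x. heis_dist x x0 < r ==> x \<in> D"
 obtains M where "0 \<le> M" "\<And>\<xi> R. heis_dist \<xi> x0 \<le> r / 8 ==> R \<le> r / 8 ==> jet u \<xi> (hgr u \<xi>) M R \<and> norm (hgr u \<xi>) \<le> M"
proof -
 have B': "x \<in> D" if "heis_dist x x0 \<le> r / 2" for x
  using that r by (intro B) linarith
 obtain M where M: "0 \<le> M" "\<And>x. heis_dist x x0 \<le> r / 2 ==> norm (hhess u x) \<le> M \<and> norm (hgr u x) \<le> M \<and> \<bar>u x\<bar> \<le> M"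
  using bounded_on_cball[OF B'] by blast
 let ?C = "3 * (2 * real CARD('n))\<^sup>2"
 have C: "1 \<le> ?C"
 proof -
  have "1 \<le> CARD('n)" by (simp add: Suc_le_eq)
  then have "1 \<le> 2 * real CARD('n)" by linarith
  then have "1\<^sup>2 \<le> (2 * real CARD('n))\<^sup>2" by (rule power_mono) simp
  then show ?thesis unfolding one_power2 by linarith
 qed
 have MC: "M \<le> ?C * M" using mult_right_mono[OF C M(1)] by simp
 show ?thesis
 proof (rule that[of "?C * M"])
  show "0 \<le> ?C * M" using MC M by linarith
  fix \<xi> R assume \<xi>: "heis_dist \<xi> x0 \<le> r / 8" and R: "R \<le> r / 8"
  have "jet u \<xi> (hgr u \<xi>) (?C * M) R" unfolding jet_def
  proof (intro allI impI taylor_heis)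
   fix \<eta> x assume n: "heis_norm \<eta> < R" "heis_dist x \<xi> \<le> 3 * heis_norm \<eta>"
   have "heis_dist x x0 \<le> r / 2" using heis_dist_triangle[of x x0 \<xi>] n \<xi> R by linarith
   moreover from this have "heis_dist x x0 < r" using r by linarith
   ultimately show "x \<in> D \<and> norm (hhess u x) \<le> M" using M(2) B by blast
  qed
  moreover have "norm (hgr u \<xi>) \<le> ?C * M"
  proof -
   have "heis_dist \<xi> x0 \<le> r / 2" using \<xi> r by linarith
   then have "norm (hgr u \<xi>) \<le> M" using M(2) by blast
   then show ?thesis using MC by linarith
  qed
  ultimately show "jet u \<xi> (hgr u \<xi>) (?C * M) R \<and> norm (hgr u \<xi>) \<le> ?C * M" ..
 qed
qed

end

section \<open>A cut-off function\<close>

lemma jet_add: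
 assumes "jet u \<xi> g M R" "jet v \<xi> h L R"
 shows "jet (\<lambda>x. u x + v x) \<xi> (g + h) (M + L) R"
 unfolding jet_def
proof (intro allI impI)
 fix \<eta> :: "'a heis" assume "heis_norm \<eta> < R"
 then have "\<bar>u (heis_mult \<xi> \<eta>) - u \<xi> - g \<bullet> horiz \<eta>\<bar> \<le> M * (heis_norm \<eta>)\<^sup>2"
  "\<bar>v (heis_mult \<xi> \<eta>) - v \<xi> - h \<bullet> horiz \<eta>\<bar> \<le> L * (heis_norm \<eta>)\<^sup>2"
  using assms by (auto simp: jet_def)
 then show "\<bar>u (heis_mult \<xi> \<eta>) + v (heis_mult \<xi> \<eta>) - (u \<xi> + v \<xi>) - (g + h) \<bullet> horiz \<eta>\<bar> \<le> (M + L) * (heis_norm \<eta>)\<^sup>2"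
  unfolding inner_add_left distrib_right by linarith
qed

lemma jet_scale:
 assumes "jet u \<xi> g M R"
 shows "jet (\<lambda>x. c * u x) \<xi> (c *\<^sub>R g) (\<bar>c\<bar> * M) R"
 unfolding jet_def
proof (intro allI impI)
 fix \<eta> :: "'a heis" assume "heis_norm \<eta> < R"
 then have "\<bar>u (heis_mult \<xi> \<eta>) - u \<xi> - g \<bullet> horiz \<eta>\<bar> \<le> M * (heis_norm \<eta>)\<^sup>2"
  using assms by (auto simp: jet_def)
 then have "\<bar>c\<bar> * \<bar>u (heis_mult \<xi> \<eta>) - u \<xi> - g \<bullet> horiz \<eta>\<bar> \<le> \<bar>c\<bar> * (M * (heis_norm \<eta>)\<^sup>2)"
  by (rule mult_left_mono) simp
 then show "\<bar>c * u (heis_mult \<xi> \<eta>) - c * u \<xi> - (c *\<^sub>R g) \<bullet> horiz \<eta>\<bar> \<le> \<bar>c\<bar> * M * (heis_norm \<eta>)\<^sup>2"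
  unfolding abs_mult[symmetric] by (simp add: algebra_simps)
qed

lemma jet_const: "0 \<le> M ==> jet (\<lambda>x. c) \<xi> 0 M R"
 by (simp add: jet_def)

lemma jet_mono: "jet u \<xi> g M R ==> M \<le> M' ==> R' \<le> R ==> jet u \<xi> g M' R'"
 unfolding jet_def by (meson less_le_trans mult_right_mono order_trans zero_le_power2)

text \<open>The derivative of the squared positive part is Lipschitz, which is all the regularity a
  \<open>jet\<close> requires.\<close>

definition possq :: "real => real" where "possq y = (max 0 y)\<^sup>2"

lemma possq_taylor: "\<bar>possq (a + h) - possq a - 2 * max 0 a * h\<bar> \<le> h\<^sup>2"
proof -
 consider "0 \<le> a" "0 \<le> a + h" | "a < 0" "a + h < 0" | "0 \<le> a" "a + h < 0" | "a < 0" "0 \<le> a + h" by linarith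
 then show ?thesis
 proof cases
  case 3
  have "possq (a + h) - possq a - 2 * max 0 a * h = - (a * (a + 2 * h))" using 3 by (simp add: possq_def power2_eq_square algebra_simps)
  moreover have "a * (a + 2 * h) \<le> 0" using 3 by (intro mult_nonneg_nonpos) auto
  then have "h\<^sup>2 - \<bar>a * (a + 2 * h)\<bar> = (a + h)\<^sup>2"
   unfolding abs_of_nonpos[OF \<open>a * (a + 2 * h) \<le> 0\<close>] by (simp add: power2_eq_square algebra_simps)
  ultimately show ?thesis using zero_le_power2[of "a + h"] by linarith
 next
  case 4
  have "(a + h)\<^sup>2 \<le> h\<^sup>2" using 4 by (intro power_mono) auto
  then show ?thesis using 4 by (simp add: possq_def)
 qed (auto simp: possq_def power2_eq_square algebra_simps)
qed

text \<open>The chain rule for jets: 2 B M is the outer derivative times the inner remainder, and (G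
  + M)^2 is the quadratic remainder of \<open>possq\<close> at an increment of size at most (G + M)
  |\<eta>|.\<close>

lemma jet_possq:
 assumes j: "jet u \<xi> g M 1" and b: "\<bar>u \<xi>\<bar> \<le> B" "norm g \<le> G" and M: "0 \<le> M"
 shows "jet (\<lambda>x. possq (u x)) \<xi> ((2 * max 0 (u \<xi>)) *\<^sub>R g) (2 * B * M + (G + M)\<^sup>2) 1"
 unfolding jet_def
proof (intro allI impI)
 fix \<eta> :: "'a heis" assume n: "heis_norm \<eta> < 1"
 let ?N = "heis_norm \<eta>"
 define h where "h = u (heis_mult \<xi> \<eta>) - u \<xi>"
 have e: "\<bar>h - g \<bullet> horiz \<eta>\<bar> \<le> M * ?N\<^sup>2" using j n by (simp add: jet_def h_def)
 have "?N\<^sup>2 \<le> ?N" using n by (simp add: power2_eq_square mult_left_le)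
 then have "M * ?N\<^sup>2 \<le> M * ?N" using M by (rule mult_left_mono)
 moreover have "\<bar>g \<bullet> horiz \<eta>\<bar> \<le> G * ?N"
  using inner_horiz_bound[of g \<eta>] mult_right_mono[OF b(2), of ?N] by simp
 ultimately have "\<bar>h\<bar> \<le> (G + M) * ?N" using e unfolding distrib_right by linarith
 then have h2: "h\<^sup>2 \<le> (G + M)\<^sup>2 * ?N\<^sup>2" using power_mono[of "\<bar>h\<bar>" "(G + M) * ?N" 2] by (simp add: power_mult_distrib)
 have m: "\<bar>2 * max 0 (u \<xi>)\<bar> \<le> 2 * B" using b(1) by auto
 have "\<bar>2 * max 0 (u \<xi>) * (h - g \<bullet> horiz \<eta>)\<bar> \<le> 2 * B * (M * ?N\<^sup>2)"
  unfolding abs_mult[of "2 * max 0 (u \<xi>)"] using b(1) by (intro mult_mono e m) auto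
 moreover have "\<bar>possq (u \<xi> + h) - possq (u \<xi>) - 2 * max 0 (u \<xi>) * h\<bar> \<le> h\<^sup>2" by (rule possq_taylor)
 moreover have "u \<xi> + h = u (heis_mult \<xi> \<eta>)" by (simp add: h_def)
 moreover have "possq (u (heis_mult \<xi> \<eta>)) - possq (u \<xi>) - (2 * max 0 (u \<xi>)) *\<^sub>R g \<bullet> horiz \<eta>
  = (possq (u (heis_mult \<xi> \<eta>)) - possq (u \<xi>) - 2 * max 0 (u \<xi>) * h) + 2 * max 0 (u \<xi>) * (h - g \<bullet> horiz \<eta>)"
  by (simp add: algebra_simps)
 ultimately show "\<bar>possq (u (heis_mult \<xi> \<eta>)) - possq (u \<xi>) - (2 * max 0 (u \<xi>)) *\<^sub>R g \<bullet> horiz \<eta>\<bar>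
  \<le> (2 * B * M + (G + M)\<^sup>2) * ?N\<^sup>2"
  using h2 unfolding distrib_right by (simp add: mult.assoc)
qed

text \<open>The fourth power of the norm is a polynomial, so its expansion is exact: the horizontal
  gradient is 4 |z|^2 z + 2 t k, where pairing with k gives the symplectic form. Of the four
  remaining terms two are at most 9 and two at most 2 times A^2 |\<eta>|^2, in total 22.\<close>

lemma jet_norm4:
 fixes \<zeta> :: "'n::finite heis"
 assumes A: "heis_norm \<zeta> \<le> A" "1 \<le> A"
 shows "\<exists>g. jet (\<lambda>x. heis_norm (heis_mult (- x0) x) ^ 4) (heis_mult x0 \<zeta>) g (22 * A\<^sup>2) 1 \<and> norm g \<le> 8 * A ^ 3"
proof -
 let ?z = "horiz \<zeta>" and ?t = "vert \<zeta>"
 define k :: "(real ^ 'n) \<times> (real ^ 'n)" where "k = (2 *\<^sub>R snd ?z, - 2 *\<^sub>R fst ?z)"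
 define g where "g = (4 * (norm ?z)\<^sup>2) *\<^sub>R ?z + (2 * ?t) *\<^sub>R k"
 have k: "k \<bullet> horiz \<eta> = omega \<zeta> \<eta>" for \<eta>
  by (simp add: k_def omega_def horiz_def inner_commute)
 have nk: "norm k = 2 * norm ?z"
 proof (rule power2_eq_imp_eq)
  show "(norm k)\<^sup>2 = (2 * norm ?z)\<^sup>2"
   unfolding k_def norm_Pair norm_prod_def[of ?z] by (simp add: power_mult_distrib)
 qed auto
 have z: "norm ?z \<le> A" using norm_horiz_le[of \<zeta>] A by linarith
 have t: "\<bar>?t\<bar> \<le> A\<^sup>2" using abs_vert_le[of \<zeta>] power_mono[OF A(1), of 2] by simp
 have "norm g \<le> norm ((4 * (norm ?z)\<^sup>2) *\<^sub>R ?z) + norm ((2 * ?t) *\<^sub>R k)" unfolding g_def by (rule norm_triangle_ineq)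
 also have "\<dots> = 4 * ((norm ?z)\<^sup>2 * norm ?z) + 4 * (\<bar>?t\<bar> * norm ?z)" by (simp add: nk abs_mult)
 also have "\<dots> \<le> 4 * (A\<^sup>2 * A) + 4 * (A\<^sup>2 * A)"
  using z t A by (intro add_mono mult_left_mono mult_mono power_mono) auto
 also have "\<dots> = 8 * A ^ 3" by (simp add: power3_eq_cube power2_eq_square)
 finally have g: "norm g \<le> 8 * A ^ 3" .
 have "jet (\<lambda>x. heis_norm (heis_mult (- x0) x) ^ 4) (heis_mult x0 \<zeta>) g (22 * A\<^sup>2) 1"
  unfolding jet_def heis_mult_assoc heis_inv_cancel
 proof (intro allI impI)
  fix \<eta> :: "'n heis" assume n1: "heis_norm \<eta> < 1"
  let ?y = "horiz \<eta>" and ?s = "vert \<eta>" and ?N = "heis_norm \<eta>" and ?o = "omega \<zeta> \<eta>"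
  have y: "norm ?y \<le> ?N" by (rule norm_horiz_le)
  have s: "\<bar>?s\<bar> \<le> ?N\<^sup>2" by (rule abs_vert_le)
  have NN: "?N\<^sup>2 \<le> A * ?N" unfolding power2_eq_square using n1 A by (intro mult_right_mono) auto
  have zy: "\<bar>?z \<bullet> ?y\<bar> \<le> A * ?N"
   using Cauchy_Schwarz_ineq2[of ?z ?y] mult_mono[OF z y] A by simp
  have o: "\<bar>?o\<bar> \<le> 2 * (A * ?N)"
   using Cauchy_Schwarz_ineq2[of k ?y] mult_mono[OF z y] A unfolding k nk by simp
  have y2: "(norm ?y)\<^sup>2 \<le> ?N\<^sup>2" using y by (intro power_mono) auto
  have a1: "(2 * (?z \<bullet> ?y) + (norm ?y)\<^sup>2)\<^sup>2 \<le> 9 * (A\<^sup>2 * ?N\<^sup>2)"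
  proof -
   have "\<bar>2 * (?z \<bullet> ?y) + (norm ?y)\<^sup>2\<bar> \<le> 3 * (A * ?N)" using zy y2 NN zero_le_power2[of "norm ?y"] by linarith
   then have "\<bar>2 * (?z \<bullet> ?y) + (norm ?y)\<^sup>2\<bar>\<^sup>2 \<le> (3 * (A * ?N))\<^sup>2" by (rule power_mono) simp
   then show ?thesis by (simp add: power_mult_distrib)
  qed
  have a2: "(?s + ?o)\<^sup>2 \<le> 9 * (A\<^sup>2 * ?N\<^sup>2)"
  proof -
   have "\<bar>?s + ?o\<bar> \<le> 3 * (A * ?N)" using s o NN by linarith
   then have "\<bar>?s + ?o\<bar>\<^sup>2 \<le> (3 * (A * ?N))\<^sup>2" by (rule power_mono) simp
   then show ?thesis by (simp add: power_mult_distrib)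
  qed
  have a3: "\<bar>2 * ((norm ?z)\<^sup>2 * (norm ?y)\<^sup>2)\<bar> \<le> 2 * (A\<^sup>2 * ?N\<^sup>2)"
   using z y2 A by (simp add: mult_mono power_mono)
  have a4: "\<bar>2 * (?t * ?s)\<bar> \<le> 2 * (A\<^sup>2 * ?N\<^sup>2)"
   using mult_mono[OF t s] by (simp add: abs_mult)
  have n4: "heis_norm (heis_mult \<zeta> \<eta>) ^ 4 - heis_norm \<zeta> ^ 4 - g \<bullet> horiz \<eta>
   = (2 * (?z \<bullet> ?y) + (norm ?y)\<^sup>2)\<^sup>2 + 2 * ((norm ?z)\<^sup>2 * (norm ?y)\<^sup>2) + 2 * (?t * ?s) + (?s + ?o)\<^sup>2"
  proof -
   have "norm (?z + ?y) ^ 4 = ((norm (?z + ?y))\<^sup>2)\<^sup>2" by simp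
   also have "(norm (?z + ?y))\<^sup>2 = (norm ?z)\<^sup>2 + 2 * (?z \<bullet> ?y) + (norm ?y)\<^sup>2"
    by (simp add: power2_norm_eq_inner inner_add_left inner_add_right inner_commute)
   finally have e1: "norm (?z + ?y) ^ 4 = ((norm ?z)\<^sup>2 + 2 * (?z \<bullet> ?y) + (norm ?y)\<^sup>2)\<^sup>2" .
   have e2: "norm ?z ^ 4 = ((norm ?z)\<^sup>2)\<^sup>2" by simp
   have e3: "g \<bullet> ?y = 4 * (norm ?z)\<^sup>2 * (?z \<bullet> ?y) + 2 * ?t * ?o"
    by (simp add: g_def inner_add_left k)
   show ?thesis unfolding heis_norm_pow4 horiz_mult vert_mult e1 e2 e3
    by (simp add: power2_eq_square algebra_simps)
  qed
  show "\<bar>heis_norm (heis_mult \<zeta> \<eta>) ^ 4 - heis_norm \<zeta> ^ 4 - g \<bullet> horiz \<eta>\<bar> \<le> 22 * A\<^sup>2 * ?N\<^sup>2"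
   unfolding n4 using a1 a2 a3 a4 zero_le_power2[of "2 * (?z \<bullet> ?y) + (norm ?y)\<^sup>2"] zero_le_power2[of "?s + ?o"]
   by linarith
 qed
 then show ?thesis using g by blast
qed

text \<open>The inner \<open>possq\<close> vanishes while d^4 \<le> \<rho>^4 / 2, in particular for
  d \<le> \<rho> / 2, and has reached 1 / 4 at d = \<rho>, where the outer one becomes 0. Only the
  fourth power of the distance enters, whose jet is explicit.\<close>

definition cutoff :: "'n::finite heis => real => 'n heis => real" where
 "cutoff x0 \<rho> \<xi> = possq (1 - 4 * possq (heis_dist \<xi> x0 ^ 4 / \<rho> ^ 4 - 1 / 2))"

lemma continuous_cutoff: "continuous_on S (cutoff x0 \<rho>)"
 unfolding cutoff_def possq_def by (cases "\<rho> = 0") (auto intro!: continuous_intros)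

lemma cutoff_nonneg: "0 \<le> cutoff x0 \<rho> \<xi>"
 by (simp add: cutoff_def possq_def)

lemma cutoff_le_1: "cutoff x0 \<rho> \<xi> \<le> 1"
proof -
 have "0 \<le> possq y" for y by (simp add: possq_def)
 then have "max 0 (1 - 4 * possq y) \<le> 1" for y by (simp add: add_increasing)
 then show ?thesis unfolding cutoff_def by (subst possq_def) (simp add: power_le_one)
qed

lemma cutoff_eq_1: assumes "heis_dist \<xi> x0 \<le> \<rho> / 2" "0 < \<rho>" shows "cutoff x0 \<rho> \<xi> = 1"
proof -
 have "heis_dist \<xi> x0 ^ 4 \<le> (\<rho> / 2) ^ 4" using assms by (intro power_mono) auto
 moreover have "(\<rho> / 2) ^ 4 = \<rho> ^ 4 / 16" by (simp add: power_divide)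
 moreover have "0 < \<rho> ^ 4" using assms by simp
 ultimately have "heis_dist \<xi> x0 ^ 4 \<le> 1 / 2 * \<rho> ^ 4" by linarith
 then have "heis_dist \<xi> x0 ^ 4 / \<rho> ^ 4 \<le> 1 / 2" using \<open>0 < \<rho> ^ 4\<close> by (simp add: divide_le_eq)
 then show ?thesis by (simp add: cutoff_def possq_def)
qed

lemma cutoff_eq_0: assumes "\<rho> \<le> heis_dist \<xi> x0" "0 < \<rho>" shows "cutoff x0 \<rho> \<xi> = 0"
proof -
 have "\<rho> ^ 4 \<le> heis_dist \<xi> x0 ^ 4" using assms by (intro power_mono) auto
 then have "1 \<le> heis_dist \<xi> x0 ^ 4 / \<rho> ^ 4" using assms by (simp add: field_simps)
 then have "1 / 2 \<le> max 0 (heis_dist \<xi> x0 ^ 4 / \<rho> ^ 4 - 1 / 2)" by linarith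
 then have "(1/2)\<^sup>2 \<le> possq (heis_dist \<xi> x0 ^ 4 / \<rho> ^ 4 - 1 / 2)"
  unfolding possq_def by (intro power_mono) auto
 then show ?thesis by (simp add: cutoff_def possq_def power2_eq_square)
qed

lemma abs_double_pos_part: "\<bar>x\<bar> \<le> B ==> \<bar>2 * max 0 x\<bar> \<le> 2 * (B :: real)"
 by (auto simp: max_def)

text \<open>The jet of the polynomial is carried through both squared positive parts. The bound is
  uniform in the point but grows with \<open>b\<close>, that is with \<rho>^(-4); this is why
  \<theta> has to be chosen after \<rho>.\<close>

lemma jet_cutoff:
 assumes \<rho>: "0 < \<rho>" "\<rho> \<le> 1"
 obtains M where "0 \<le> M" "\<And>\<xi>. heis_dist \<xi> x0 \<le> 1 ==> \<exists>g. jet (cutoff x0 \<rho>) \<xi> g M 1 \<and> norm g \<le> M"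
proof -
 define b where "b = 1 / \<rho> ^ 4"
 have b: "0 \<le> b" using \<rho> by (simp add: b_def)
 define M1 where "M1 = 2 * (b + 1 / 2) * (b * 22) + (b * 8 + b * 22)\<^sup>2"
 define B1 where "B1 = (b + 1 / 2)\<^sup>2"
 define G1 where "G1 = 2 * (b + 1 / 2) * (b * 8)"
 define M2 where "M2 = 2 * (1 + 4 * B1) * (4 * M1) + (4 * G1 + 4 * M1)\<^sup>2"
 define G2 where "G2 = 2 * (1 + 4 * B1) * (4 * G1)"
 have nn: "0 \<le> M1" "0 \<le> B1" "0 \<le> G1" using b by (simp_all add: M1_def B1_def G1_def)
 then have nn2: "0 \<le> M2" "0 \<le> G2" by (simp_all add: M2_def G2_def)
 show ?thesis
 proof (rule that[of "M2 + G2"])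
  show "0 \<le> M2 + G2" using nn2 by simp
  fix \<xi> assume d: "heis_dist \<xi> x0 \<le> 1"
  define P where "P = (\<lambda>x. heis_dist x x0 ^ 4)"
  have "\<exists>g. jet P \<xi> g 22 1 \<and> norm g \<le> 8"
   using jet_norm4[of "heis_mult (- x0) \<xi>" 1 x0] d by (simp add: P_def heis_dist_def)
  then obtain g where g: "jet P \<xi> g 22 1" "norm g \<le> 8" by blast
  let ?F = "\<lambda>x. b * P x + (- 1 / 2)"
  have P1: "0 \<le> P \<xi>" "P \<xi> \<le> 1" using d by (simp_all add: P_def power_le_one)
  have F: "\<bar>?F \<xi>\<bar> \<le> b + 1 / 2"
  proof -
   have "0 \<le> b * P \<xi>" "b * P \<xi> \<le> b * 1" using mult_left_mono[OF P1(2) b] b P1(1) by simp_all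
   then show ?thesis by linarith
  qed
  have "jet ?F \<xi> (b *\<^sub>R g + 0) (\<bar>b\<bar> * 22 + 0) 1"
   by (intro jet_add jet_scale jet_const g) simp
  then have jF: "jet ?F \<xi> (b *\<^sub>R g) (b * 22) 1" using b by simp
  have gF: "norm (b *\<^sub>R g) \<le> b * 8" using b g by (simp add: mult_left_mono)
  let ?H = "\<lambda>x. possq (?F x)"
  let ?h = "(2 * max 0 (?F \<xi>)) *\<^sub>R (b *\<^sub>R g)"
  have jH: "jet ?H \<xi> ?h M1 1"
   unfolding M1_def by (rule jet_possq[OF jF F gF]) (use b in simp)
  have gH: "norm ?h \<le> G1"
  proof -
   have "norm ?h = \<bar>2 * max 0 (?F \<xi>)\<bar> * norm (b *\<^sub>R g)" by (rule norm_scaleR)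
   also have "\<dots> \<le> 2 * (b + 1 / 2) * (b * 8)"
   proof (intro mult_mono gF)
    show "\<bar>2 * max 0 (?F \<xi>)\<bar> \<le> 2 * (b + 1 / 2)"
     by (rule abs_double_pos_part[OF F])
   qed (use b in auto)
   finally show ?thesis by (simp add: G1_def)
  qed
  have BH: "\<bar>?H \<xi>\<bar> \<le> B1"
  proof -
   have "(max 0 (?F \<xi>))\<^sup>2 \<le> (b + 1 / 2)\<^sup>2" using F by (intro power_mono) auto
   then show ?thesis by (simp add: possq_def B1_def)
  qed
  let ?E = "\<lambda>x. 1 + (- 4) * ?H x"
  have "jet ?E \<xi> (0 + (- 4) *\<^sub>R ?h) (0 + \<bar>- 4\<bar> * M1) 1"
   by (intro jet_add jet_const jet_scale jH) simp
  then have jE: "jet ?E \<xi> ((- 4) *\<^sub>R ?h) (4 * M1) 1" by simp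
  have gE: "norm ((- 4) *\<^sub>R ?h) \<le> 4 * G1" using gH by (subst norm_scaleR) simp
  have BE: "\<bar>?E \<xi>\<bar> \<le> 1 + 4 * B1" using BH by linarith
  have j: "jet (\<lambda>x. possq (?E x)) \<xi> ((2 * max 0 (?E \<xi>)) *\<^sub>R ((- 4) *\<^sub>R ?h)) M2 1"
   unfolding M2_def by (rule jet_possq[OF jE BE gE]) (use nn in simp)
  have "norm ((2 * max 0 (?E \<xi>)) *\<^sub>R ((- 4) *\<^sub>R ?h)) = \<bar>2 * max 0 (?E \<xi>)\<bar> * norm ((- 4) *\<^sub>R ?h)" by (rule norm_scaleR)
  also have "\<dots> \<le> 2 * (1 + 4 * B1) * (4 * G1)"
  proof (intro mult_mono gE)
   show "\<bar>2 * max 0 (?E \<xi>)\<bar> \<le> 2 * (1 + 4 * B1)"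
    by (rule abs_double_pos_part[OF BE])
  qed (use nn in auto)
  finally have g2: "norm ((2 * max 0 (?E \<xi>)) *\<^sub>R ((- 4) *\<^sub>R ?h)) \<le> G2" by (simp only: G2_def)
  have eq: "(\<lambda>x. possq (?E x)) = cutoff x0 \<rho>"
   by (simp add: fun_eq_iff cutoff_def P_def b_def)
  show "\<exists>g. jet (cutoff x0 \<rho>) \<xi> g (M2 + G2) 1 \<and> norm g \<le> M2 + G2"
   using jet_mono[OF j[unfolded eq], of "M2 + G2" 1] g2 nn2 by (meson add_increasing add_increasing2 order_refl order_trans)
 qed
qed


section \<open>Uniform smallness of the singular part for the touching functions\<close>

text \<open>The values are prescribed in the ball of radius r only, so \<psi> may follow u
  elsewhere. \<theta> = 0 is included and covers the touching function itself.\<close>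

abbreviation near_small :: "real => real => real => real => 'n::finite heis => ('n heis => real) => real => real => real => real => bool" where
 "near_small p s L r x0 g \<delta> R \<rho> \<theta>0 \<equiv> (\<forall>\<theta> \<xi> \<psi> \<kappa>. 0 \<le> \<theta> \<and> \<theta> \<le> \<theta>0 \<and> heis_dist \<xi> x0 \<le> \<rho> \<and> \<psi> \<in> \<B> \<and>
  (\<forall>x\<in>heis_ball x0 r. \<psi> x = g x + \<theta> * cutoff x0 \<rho> x) \<and> near_kernel L (hom_dim TYPE('n) + s * p) R \<kappa>
  --> \<bar>near_int p \<psi> \<xi> \<kappa>\<bar> \<le> \<delta>)"

definition near_uniform :: "real => real => real => real => 'n::finite heis => ('n heis => real) => bool" where
 "near_uniform p s L r x0 g \<longleftrightarrow> (\<forall>\<delta>>0. \<exists>R0>0. \<forall>R. 0 < R \<and> R \<le> R0 --> (\<exists>\<rho>0>0. \<forall>\<rho>. 0 < \<rho> \<and> \<rho> \<le> \<rho>0 -->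
  (\<exists>\<theta>0>0. near_small p s L r x0 g \<delta> R \<rho> \<theta>0)))"

text \<open>The rate c R^\<alpha> meets the error by restricting R; for this \<open>R0\<close>
  includes the solution of (c + 1) R^\<alpha> = \<delta>. What remains is that the perturbed
  functions belong to the class once \<rho> and \<theta> are small.\<close>

lemma near_uniformI:
 fixes x0 :: "'n::finite heis"
 assumes nc: "near_class p s L P" and R1: "0 < R1" "R1 \<le> 1"
  and P: "\<And>R. 0 < R ==> R \<le> R1 ==> \<exists>\<rho>0>0. \<forall>\<rho>. 0 < \<rho> \<and> \<rho> \<le> \<rho>0 -->
  (\<exists>\<theta>0>0. \<forall>\<theta> \<xi> \<psi>. 0 \<le> \<theta> \<and> \<theta> \<le> \<theta>0 \<and> heis_dist \<xi> x0 \<le> \<rho> \<and>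
    (\<forall>x\<in>heis_ball x0 r. \<psi> x = g x + \<theta> * cutoff x0 \<rho> x) --> P R \<psi> \<xi>)"
 shows "near_uniform p s L r x0 g"
 unfolding near_uniform_def
proof (intro allI impI)
 fix \<delta> :: real assume \<delta>: "0 < \<delta>"
 obtain c \<alpha> where c: "0 \<le> c" and \<alpha>: "0 < \<alpha>"
  and near: "\<And>R \<psi> (\<xi> :: 'n heis) \<kappa>. 0 < R ==> R \<le> 1 ==> \<psi> \<in> \<B> ==> P R \<psi> \<xi> ==>
   near_kernel L (hom_dim TYPE('n) + s * p) R \<kappa> ==> \<bar>near_int p \<psi> \<xi> \<kappa>\<bar> \<le> c * R powr \<alpha>"
  using nc unfolding near_class_def by blast
 define R0 where "R0 = min R1 ((\<delta> / (c + 1)) powr (1 / \<alpha>))"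
 have R0: "0 < R0" using R1 \<delta> c by (simp add: R0_def)
 have small: "c * R powr \<alpha> \<le> \<delta>" if "0 < R" "R \<le> R0" for R
 proof -
  have "R powr \<alpha> \<le> ((\<delta> / (c + 1)) powr (1 / \<alpha>)) powr \<alpha>"
   using that \<alpha> by (intro powr_mono2) (auto simp: R0_def)
  also have "\<dots> = \<delta> / (c + 1)" using \<alpha> \<delta> c by (simp add: powr_powr)
  finally have "c * R powr \<alpha> \<le> c * (\<delta> / (c + 1))" using c by (intro mult_left_mono)
  also have "\<dots> \<le> \<delta>" using c \<delta> by (simp add: field_simps)
  finally show ?thesis .
 qed
 show "\<exists>R0>0. \<forall>R. 0 < R \<and> R \<le> R0 --> (\<exists>\<rho>0>0. \<forall>\<rho>. 0 < \<rho> \<and> \<rho> \<le> \<rho>0 -->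
  (\<exists>\<theta>0>0. near_small p s L r x0 g \<delta> R \<rho> \<theta>0))"
 proof (rule exI[of _ R0], rule conjI[rotated], intro allI impI, elim conjE)
  fix R assume R: "0 < R" "R \<le> R0"
  then have R': "R \<le> R1" "R \<le> 1" using R1 by (auto simp: R0_def)
  obtain \<rho>0 where \<rho>0: "0 < \<rho>0" and P': "\<And>\<rho>. 0 < \<rho> ==> \<rho> \<le> \<rho>0 ==>
   \<exists>\<theta>0>0. \<forall>\<theta> \<xi> \<psi>. 0 \<le> \<theta> \<and> \<theta> \<le> \<theta>0 \<and> heis_dist \<xi> x0 \<le> \<rho> \<and>
    (\<forall>x\<in>heis_ball x0 r. \<psi> x = g x + \<theta> * cutoff x0 \<rho> x) --> P R \<psi> \<xi>"
   using P[OF R(1) R'(1)] by blast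
  show "\<exists>\<rho>0>0. \<forall>\<rho>. 0 < \<rho> \<and> \<rho> \<le> \<rho>0 -->
  (\<exists>\<theta>0>0. near_small p s L r x0 g \<delta> R \<rho> \<theta>0)"
  proof (rule exI[of _ \<rho>0], rule conjI[rotated], intro allI impI, elim conjE)
   fix \<rho> assume "0 < \<rho>" "\<rho> \<le> \<rho>0"
   from P'[OF this] obtain \<theta>0 where \<theta>0: "0 < \<theta>0" and P'': "\<And>\<theta> \<xi> \<psi>. 0 \<le> \<theta> ==> \<theta> \<le> \<theta>0 ==> heis_dist \<xi> x0 \<le> \<rho> ==>
    (\<forall>x\<in>heis_ball x0 r. \<psi> x = g x + \<theta> * cutoff x0 \<rho> x) ==> P R \<psi> \<xi>" by blast
   show "\<exists>\<theta>0>0. near_small p s L r x0 g \<delta> R \<rho> \<theta>0"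
   proof (rule exI[of _ \<theta>0], rule conjI[rotated], intro allI impI, elim conjE)
    fix \<theta> \<xi> \<psi> and \<kappa> :: "'n heis => real"
    assume a: "0 \<le> \<theta>" "\<theta> \<le> \<theta>0" "heis_dist \<xi> x0 \<le> \<rho>" and m: "\<psi> \<in> \<B>"
     and e: "\<forall>x\<in>heis_ball x0 r. \<psi> x = g x + \<theta> * cutoff x0 \<rho> x" and k: "near_kernel L (hom_dim TYPE('n) + s * p) R \<kappa>"
    show "\<bar>near_int p \<psi> \<xi> \<kappa>\<bar> \<le> \<delta>"
     using near[OF R(1) R'(2) m P''[OF a e] k] small[OF R] by linarith
   qed (rule \<theta>0)
  qed (rule \<rho>0)
 qed (rule R0)
qed

lemma jet_cong:
 assumes "jet f \<xi> g M R" "\<And>\<eta>. heis_norm \<eta> < R ==> h (heis_mult \<xi> \<eta>) = f (heis_mult \<xi> \<eta>)" "h \<xi> = f \<xi>"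
 shows "jet h \<xi> g M R"
 using assms by (simp add: jet_def)

lemma heis_dist_mult_le: "heis_dist (heis_mult \<xi> \<eta>) x0 \<le> heis_dist \<xi> x0 + heis_norm \<eta>"
 using heis_dist_triangle[of "heis_mult \<xi> \<eta>" x0 \<xi>] heis_dist_commute[of \<xi> "heis_mult \<xi> \<eta>"] by simp

lemma perturbed_jet:
 fixes x0 :: "'n::finite heis"
 assumes "jet g \<xi> a M R" "jet (cutoff x0 \<rho>) \<xi> b N R" "0 \<le> \<theta>"
  and e: "\<forall>x\<in>heis_ball x0 r. \<psi> x = g x + \<theta> * cutoff x0 \<rho> x" and d: "heis_dist \<xi> x0 + R \<le> r" and R: "0 < R"
 shows "jet \<psi> \<xi> (a + \<theta> *\<^sub>R b) (M + \<theta> * N) R"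
proof (rule jet_cong[where f = "\<lambda>x. g x + \<theta> * cutoff x0 \<rho> x"])
 show "jet (\<lambda>x. g x + \<theta> * cutoff x0 \<rho> x) \<xi> (a + \<theta> *\<^sub>R b) (M + \<theta> * N) R"
  using jet_add[OF assms(1) jet_scale[OF assms(2), of \<theta>]] assms(3) by simp
 show "\<psi> (heis_mult \<xi> \<eta>) = g (heis_mult \<xi> \<eta>) + \<theta> * cutoff x0 \<rho> (heis_mult \<xi> \<eta>)" if "heis_norm \<eta> < R" for \<eta>
 proof -
  have "heis_mult \<xi> \<eta> \<in> heis_ball x0 r"
   using heis_dist_mult_le[of \<xi> \<eta> x0] that d by (simp add: mem_heis_ball)
  then show ?thesis using e by blast
 qed
 have "\<xi> \<in> heis_ball x0 r" using d R by (simp add: mem_heis_ball)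
 then show "\<psi> \<xi> = g \<xi> + \<theta> * cutoff x0 \<rho> \<xi>" using e by blast
qed

lemma near_uniform_smooth:
 fixes x0 :: "'n::finite heis"
 assumes p: "1 < p" and s: "0 < s" "s < 1" and ps: "2 / (2 - s) < p" and L: "0 \<le> L"
  and r: "0 < r" and C2: "C2_function (heis_ball x0 r) g"
 shows "near_uniform p s L r x0 g"
proof -
 interpret C2_function "heis_ball x0 r" g by (rule C2)
 obtain M where M: "0 \<le> M" and j: "\<And>\<xi> R. heis_dist \<xi> x0 \<le> r / 8 ==> R \<le> r / 8 ==> jet g \<xi> (hgr g \<xi>) M R \<and> norm (hgr g \<xi>) \<le> M"
  using jet_uniform[OF r, of x0] by (auto simp: mem_heis_ball)
 have M1: "0 \<le> M + 1" using M by simp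
 have R1: "0 < min 1 (r / 8)" "min 1 (r / 8) \<le> 1" using r by auto
 show ?thesis
 proof (rule near_uniformI[OF near_class_smooth[OF p s ps M1 L] R1])
  fix R assume R: "0 < R" "R \<le> min 1 (r / 8)"
  show "\<exists>\<rho>0>0. \<forall>\<rho>. 0 < \<rho> \<and> \<rho> \<le> \<rho>0 -->
  (\<exists>\<theta>0>0. \<forall>\<theta> \<xi> \<psi>. 0 \<le> \<theta> \<and> \<theta> \<le> \<theta>0 \<and> heis_dist \<xi> x0 \<le> \<rho> \<and>
    (\<forall>x\<in>heis_ball x0 r. \<psi> x = g x + \<theta> * cutoff x0 \<rho> x) --> (\<exists>g. jet \<psi> \<xi> g (M + 1) R \<and> norm g \<le> M + 1))"
  proof (rule exI[of _ "min 1 (r / 8)"], rule conjI[rotated], intro allI impI, elim conjE)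
   fix \<rho> :: real assume \<rho>: "0 < \<rho>" "\<rho> \<le> min 1 (r / 8)"
   obtain N where N: "0 \<le> N" and jc: "\<And>\<xi>. heis_dist \<xi> x0 \<le> 1 ==> \<exists>b. jet (cutoff x0 \<rho>) \<xi> b N 1 \<and> norm b \<le> N"
    using jet_cutoff[of \<rho> x0] \<rho> by auto
   show "\<exists>\<theta>0>0. \<forall>\<theta> \<xi> \<psi>. 0 \<le> \<theta> \<and> \<theta> \<le> \<theta>0 \<and> heis_dist \<xi> x0 \<le> \<rho> \<and>
    (\<forall>x\<in>heis_ball x0 r. \<psi> x = g x + \<theta> * cutoff x0 \<rho> x) --> (\<exists>g. jet \<psi> \<xi> g (M + 1) R \<and> norm g \<le> M + 1)"
   \<comment> \<open>With \<theta> N \<le> 1 the perturbation changes the gradient and the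
     second-order constant by at most 1, hence the class with M + 1.\<close>
   proof (rule exI[of _ "1 / (N + 1)"], rule conjI[rotated], intro allI impI, elim conjE)
    show "0 < 1 / (N + 1)" using N by simp
    fix \<theta> \<xi> \<psi> assume \<theta>: "0 \<le> \<theta>" "\<theta> \<le> 1 / (N + 1)" and d: "heis_dist \<xi> x0 \<le> \<rho>"
     and e: "\<forall>x\<in>heis_ball x0 r. \<psi> x = g x + \<theta> * cutoff x0 \<rho> x"
    have "\<theta> * N \<le> 1 / (N + 1) * N" using \<theta> N by (intro mult_right_mono)
    also have "\<dots> \<le> 1" using N by simp
    finally have tN: "\<theta> * N \<le> 1" .
    have d1: "heis_dist \<xi> x0 \<le> 1" using d \<rho> by simp
    obtain b where b: "jet (cutoff x0 \<rho>) \<xi> b N 1" "norm b \<le> N" using jc[OF d1] by blast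
    have jg: "jet g \<xi> (hgr g \<xi>) M R" "norm (hgr g \<xi>) \<le> M" using j[of \<xi> R] d \<rho> R by auto
    have "jet \<psi> \<xi> (hgr g \<xi> + \<theta> *\<^sub>R b) (M + \<theta> * N) R"
     by (rule perturbed_jet[OF jg(1) jet_mono[OF b(1)] \<theta>(1) e]) (use d \<rho> R r in auto)
    then have 1: "jet \<psi> \<xi> (hgr g \<xi> + \<theta> *\<^sub>R b) (M + 1) R"
     by (rule jet_mono) (use tN in auto)
    have "norm (hgr g \<xi> + \<theta> *\<^sub>R b) \<le> norm (hgr g \<xi>) + \<theta> * norm b"
     using norm_triangle_ineq[of "hgr g \<xi>" "\<theta> *\<^sub>R b"] \<theta> by simp
    also have "\<dots> \<le> M + \<theta> * N" using jg b \<theta> by (intro add_mono mult_left_mono) auto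
    finally show "\<exists>g. jet \<psi> \<xi> g (M + 1) R \<and> norm g \<le> M + 1" using 1 tN by force
   qed
  qed (use r in auto)
 qed
qed

text \<open>Near \<open>x0\<close> the gradient stays above 2 c and the perturbation moves it by at
  most c, so |g|^(p - 2) stays bounded although p < 2. Then \<open>sing_jet\<close> holds with
  \<tau> = R, for which the condition on the outer range is vacuous.\<close>

lemma near_uniform_noncritical:
 fixes x0 :: "'n::finite heis"
 assumes p: "1 < p" "p < 2" and s: "0 < s" "s < 1" and L: "0 \<le> L"
  and r: "0 < r" and C2: "C2_function (heis_ball x0 r) g" and nz: "hgr g x0 \<noteq> 0"
 shows "near_uniform p s L r x0 g"
proof -
 interpret C2_function "heis_ball x0 r" g by (rule C2)
 obtain M where M: "0 \<le> M" and j: "\<And>\<xi> R. heis_dist \<xi> x0 \<le> r / 8 ==> R \<le> r / 8 ==> jet g \<xi> (hgr g \<xi>) M R \<and> norm (hgr g \<xi>) \<le> M"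
  using jet_uniform[OF r, of x0] by (auto simp: mem_heis_ball)
 define c where "c = norm (hgr g x0) / 3"
 have c: "0 < c" using nz by (simp add: c_def)
 have "open {x \<in> heis_ball x0 r. 2 * c < norm (hgr g x)}"
  using continuous_on_open_vimage[THEN iffD1, OF open_heis_ball continuous_on_norm[OF continuous_hgr], rule_format, of "{2 * c<..}"]
  by (simp add: vimage_def Int_def conj_commute)
 moreover have "x0 \<in> {x \<in> heis_ball x0 r. 2 * c < norm (hgr g x)}" using r c by (simp add: mem_heis_ball c_def)
 ultimately obtain \<rho>1 where \<rho>1: "0 < \<rho>1" "heis_ball x0 \<rho>1 \<subseteq> {x \<in> heis_ball x0 r. 2 * c < norm (hgr g x)}"
  by (rule heis_ball_subset_open)
 define \<alpha> where "\<alpha> = p - s * p"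
 have \<alpha>: "0 < \<alpha>" using p s by (simp add: \<alpha>_def)
 \<comment> \<open>Chosen to make \<beta> (p - 1) - s p equal to \<alpha>; with \<tau> = R no growth
   of this order has to be proved.\<close>
 define \<beta> where "\<beta> = p / (p - 1)"
 have \<beta>: "\<alpha> \<le> \<beta> * (p - 1) - s * p" using p by (simp add: \<alpha>_def \<beta>_def)
 define K where "K = (M + 1) * c powr (p - 2)"
 have K: "0 \<le> K" using M by (simp add: K_def)
 have R1: "0 < min 1 (r / 8)" "min 1 (r / 8) \<le> 1" using r by auto
 show ?thesis
 proof (rule near_uniformI[OF near_class_sing[OF p s \<alpha> \<beta> K L] R1])
  fix R assume R: "0 < R" "R \<le> min 1 (r / 8)"
  show "\<exists>\<rho>0>0. \<forall>\<rho>. 0 < \<rho> \<and> \<rho> \<le> \<rho>0 -->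
  (\<exists>\<theta>0>0. \<forall>\<theta> \<xi> \<psi>. 0 \<le> \<theta> \<and> \<theta> \<le> \<theta>0 \<and> heis_dist \<xi> x0 \<le> \<rho> \<and>
    (\<forall>x\<in>heis_ball x0 r. \<psi> x = g x + \<theta> * cutoff x0 \<rho> x) --> sing_jet p s \<alpha> \<beta> K R \<psi> \<xi>)"
  proof (rule exI[of _ "min (\<rho>1 / 2) (min 1 (r / 8))"], rule conjI[rotated], intro allI impI, elim conjE)
   fix \<rho> :: real assume \<rho>: "0 < \<rho>" "\<rho> \<le> min (\<rho>1 / 2) (min 1 (r / 8))"
   obtain N where N: "0 \<le> N" and jc: "\<And>\<xi>. heis_dist \<xi> x0 \<le> 1 ==> \<exists>b. jet (cutoff x0 \<rho>) \<xi> b N 1 \<and> norm b \<le> N"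
    using jet_cutoff[of \<rho> x0] \<rho> by auto
   show "\<exists>\<theta>0>0. \<forall>\<theta> \<xi> \<psi>. 0 \<le> \<theta> \<and> \<theta> \<le> \<theta>0 \<and> heis_dist \<xi> x0 \<le> \<rho> \<and>
    (\<forall>x\<in>heis_ball x0 r. \<psi> x = g x + \<theta> * cutoff x0 \<rho> x) --> sing_jet p s \<alpha> \<beta> K R \<psi> \<xi>"
   proof (rule exI[of _ "min 1 c / (N + 1)"], rule conjI[rotated], intro allI impI, elim conjE)
    show "0 < min 1 c / (N + 1)" using N c by simp
    fix \<theta> \<xi> \<psi> assume \<theta>: "0 \<le> \<theta>" "\<theta> \<le> min 1 c / (N + 1)" and d: "heis_dist \<xi> x0 \<le> \<rho>"
     and e: "\<forall>x\<in>heis_ball x0 r. \<psi> x = g x + \<theta> * cutoff x0 \<rho> x"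
    have "\<theta> * N \<le> min 1 c / (N + 1) * N" using \<theta> N by (intro mult_right_mono)
    also have "\<dots> = min 1 c * (N / (N + 1))" by simp
    also have "\<dots> \<le> min 1 c * 1" using N c by (intro mult_left_mono) auto
    finally have tN: "\<theta> * N \<le> 1" "\<theta> * N \<le> c" by auto
    have d1: "heis_dist \<xi> x0 \<le> 1" using d \<rho> by simp
    obtain b where b: "jet (cutoff x0 \<rho>) \<xi> b N 1" "norm b \<le> N" using jc[OF d1] by blast
    have jg: "jet g \<xi> (hgr g \<xi>) M R" using j[of \<xi> R] d \<rho> R by auto
    have "jet \<psi> \<xi> (hgr g \<xi> + \<theta> *\<^sub>R b) (M + \<theta> * N) R"
     by (rule perturbed_jet[OF jg(1) jet_mono[OF b(1)] \<theta>(1) e]) (use d \<rho> R r in auto)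
    then have 1: "jet \<psi> \<xi> (hgr g \<xi> + \<theta> *\<^sub>R b) (M + 1) R"
     by (rule jet_mono) (use tN in auto)
    have "\<xi> \<in> heis_ball x0 \<rho>1" using d \<rho> \<rho>1 by (simp add: mem_heis_ball)
    then have "2 * c < norm (hgr g \<xi>)" using \<rho>1 by blast
    moreover have "norm (\<theta> *\<^sub>R b) \<le> c"
    proof -
     have "norm (\<theta> *\<^sub>R b) \<le> \<theta> * N" using \<theta> b by (simp add: mult_left_mono)
     then show ?thesis using tN by linarith
    qed
    moreover have "norm (hgr g \<xi>) \<le> norm (hgr g \<xi> + \<theta> *\<^sub>R b) + norm (\<theta> *\<^sub>R b)"
     using norm_triangle_ineq4[of "hgr g \<xi> + \<theta> *\<^sub>R b" "\<theta> *\<^sub>R b"] by simp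
    ultimately have 2: "c \<le> norm (hgr g \<xi> + \<theta> *\<^sub>R b)" by linarith
    have "norm (hgr g \<xi> + \<theta> *\<^sub>R b) powr (p - 2) \<le> c powr (p - 2)"
     using 2 c p by (intro powr_mono2') auto
    then have 3: "(M + 1) * norm (hgr g \<xi> + \<theta> *\<^sub>R b) powr (p - 2) * R powr (p - s * p) \<le> K * R powr \<alpha>"
     unfolding K_def \<alpha>_def using M by (intro mult_right_mono mult_left_mono) auto
    show "sing_jet p s \<alpha> \<beta> K R \<psi> \<xi>" unfolding sing_jet_def
     by (rule exI[of _ "hgr g \<xi> + \<theta> *\<^sub>R b"], rule exI[of _ "M + 1"], rule exI[of _ R], use R M 1 2 3 c in auto)
   qed
  qed (use r \<rho>1 in auto)
 qed
qed

text \<open>The split radius is \<tau> = d / 4, with d the distance from \<xi> to the critical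
  point. Inside, the Hessian is of order \<tau>^(\<beta> - 2) and the gradient at least of order
  \<tau>^(\<beta> - 1), so the exponents (\<beta> - 2) + (\<beta> - 1) (p - 2) + p - s p add up to
  \<beta> (p - 1) - s p > 0. Outside, d \<le> 4 |\<eta>|, and growth of order \<beta> about
  \<open>x0\<close> bounds the increments by |\<eta>|^\<beta>.\<close>

lemma near_uniform_critical_aux:
 fixes x0 :: "'n::finite heis"
 assumes p: "1 < p" "p < 2" and s: "0 < s" "s < 1" and L: "0 \<le> L"
  and r: "0 < r" and C2: "C2_function (heis_ball x0 r) g" and z: "hgr g x0 = 0"
  and \<beta>: "2 \<le> \<beta>" "s * p < \<beta> * (p - 1)" and \<delta>1: "0 < \<delta>1" "\<delta>1 \<le> r" "\<delta>1 \<le> 1" and c1: "0 < c1" and M1: "0 \<le> M1"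
  and grad: "\<And>\<xi>. 0 < heis_dist \<xi> x0 ==> heis_dist \<xi> x0 < \<delta>1 ==> c1 * heis_dist \<xi> x0 powr (\<beta> - 1) \<le> norm (hgr g \<xi>)"
  and hess: "\<And>\<xi> \<epsilon>. 0 < \<epsilon> ==> \<epsilon> < \<delta>1 ==> heis_dist \<xi> x0 \<le> \<epsilon> ==> norm (hhess g \<xi>) \<le> M1 * \<epsilon> powr (\<beta> - 2)"
 shows "near_uniform p s L r x0 g"
proof -
 interpret C2_function "heis_ball x0 r" g by (rule C2)
 define n2 where "n2 = 3 * (2 * real CARD('n))\<^sup>2"
 have n2: "0 \<le> n2" by (simp add: n2_def)
 \<comment> \<open>7 = 4 + 3: Taylor's formula at \<xi> with radius \<tau> reaches 3 \<tau> from
   \<xi>, which lies at distance 4 \<tau> from \<open>x0\<close>. The expansion at \<open>x0\<close>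
   itself needs only the factor 3.\<close>
 define K where "K = n2 * (M1 * 7 powr (\<beta> - 2))"
 have K: "0 \<le> K" using n2 M1 by (simp add: K_def)
 have growth: "\<bar>g x - g x0\<bar> \<le> K * heis_dist x x0 powr \<beta>" if "heis_dist x x0 < \<delta>1 / 3" for x
 proof (cases "x = x0")
  case False
  define \<eta> where "\<eta> = heis_mult (- x0) x"
  have x: "x = heis_mult x0 \<eta>" by (simp add: \<eta>_def)
  have d: "heis_norm \<eta> = heis_dist x x0" by (simp add: \<eta>_def heis_dist_def)
  have pos: "0 < heis_norm \<eta>" using False d heis_dist_eq_0[of x x0] heis_dist_nonneg[of x x0] by linarith
  let ?N = "heis_norm \<eta>"
  have "\<bar>g (heis_mult x0 \<eta>) - g x0 - hgr g x0 \<bullet> horiz \<eta>\<bar> \<le> (3 * (2 * real CARD('n))\<^sup>2 * (M1 * (3 * ?N) powr (\<beta> - 2))) * ?N\<^sup>2"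
  proof (rule taylor_heis)
   fix y assume y: "heis_dist y x0 \<le> 3 * ?N"
   have "3 * ?N < \<delta>1" using that d by simp
   then show "y \<in> heis_ball x0 r \<and> norm (hhess g y) \<le> M1 * (3 * ?N) powr (\<beta> - 2)"
    using hess[of "3 * ?N" y] y pos \<delta>1 by (simp add: mem_heis_ball)
  qed
  also have "\<dots> = n2 * (M1 * (3 powr (\<beta> - 2))) * (?N * ?N * ?N powr (\<beta> - 2))"
   using pos by (simp add: n2_def powr_mult power2_eq_square)
  also have "?N * ?N * ?N powr (\<beta> - 2) = ?N powr \<beta>"
   using powr_mult_base[of ?N "\<beta> - 2"] powr_mult_base[of ?N "\<beta> - 1"] pos by (simp add: mult.assoc)
  also have "n2 * (M1 * (3 powr (\<beta> - 2))) * ?N powr \<beta> \<le> K * ?N powr \<beta>"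
   unfolding K_def using n2 M1 \<beta> by (intro mult_right_mono mult_left_mono powr_mono2) auto
  finally show ?thesis by (simp add: x[symmetric] z d)
 qed simp
 define \<alpha> where "\<alpha> = \<beta> * (p - 1) - s * p"
 have \<alpha>: "0 < \<alpha>" "\<alpha> \<le> \<beta> * (p - 1) - s * p" using \<beta> by (simp_all add: \<alpha>_def)
 define C where "C = (K + 1) * (c1 / 2) powr (p - 2) + (2 * K * 5 powr \<beta> + 1)"
 have C: "0 \<le> C" "(K + 1) * (c1 / 2) powr (p - 2) \<le> C" "2 * K * 5 powr \<beta> + 1 \<le> C" using K by (simp_all add: C_def add_increasing)
 \<comment> \<open>With \<rho> \<le> R \<le> \<delta>1 / 20, distances up to 5 R stay below
   \<delta>1 / 3, where \<open>growth\<close> holds, and 7 \<tau> stays below \<delta>1.\<close>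
 define R1 where "R1 = \<delta>1 / 20"
 have R1: "0 < R1" "R1 \<le> 1" using \<delta>1 by (simp_all add: R1_def)
 show ?thesis
 proof (rule near_uniformI[OF near_class_sing[OF p s \<alpha> C(1) L] R1])
  fix R assume R: "0 < R" "R \<le> R1"
  have R20: "R \<le> \<delta>1 / 20" using R by (simp add: R1_def)
  show "\<exists>\<rho>0>0. \<forall>\<rho>. 0 < \<rho> \<and> \<rho> \<le> \<rho>0 -->
  (\<exists>\<theta>0>0. \<forall>\<theta> \<xi> \<psi>. 0 \<le> \<theta> \<and> \<theta> \<le> \<theta>0 \<and> heis_dist \<xi> x0 \<le> \<rho> \<and>
    (\<forall>x\<in>heis_ball x0 r. \<psi> x = g x + \<theta> * cutoff x0 \<rho> x) --> sing_jet p s \<alpha> \<beta> C R \<psi> \<xi>)"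
  proof (rule exI[of _ R], rule conjI[rotated], intro allI impI, elim conjE)
   fix \<rho> :: real assume \<rho>: "0 < \<rho>" "\<rho> \<le> R"
   have \<rho>1: "\<rho> \<le> 1" using \<rho> R R1 by simp
   obtain N where N: "0 \<le> N" and jc: "\<And>\<xi>. heis_dist \<xi> x0 \<le> 1 ==> \<exists>b. jet (cutoff x0 \<rho>) \<xi> b N 1 \<and> norm b \<le> N"
    using jet_cutoff[OF \<rho>(1) \<rho>1, of x0] by auto
   \<comment> \<open>The cutoff is 1 up to distance \<rho> / 2, so an increment that it notices has
     d \<ge> \<rho> / 4 or |\<eta>| \<ge> \<rho> / 4. In the outer range |\<eta>| \<ge> d / 4, hence
     |\<eta>| \<ge> \<sigma> in both cases.\<close>
   define \<sigma> where "\<sigma> = \<rho> / 16"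
   have \<sigma>: "0 < \<sigma>" using \<rho> by (simp add: \<sigma>_def)
   \<comment> \<open>The powers of \<sigma> keep the cutoff subordinate to the touching function: in
     the increments, in the second-order constant, and by taking at most half of the lower bound for
     the gradient.\<close>
   define \<theta>0 where "\<theta>0 = min (\<sigma> powr \<beta>) (min (\<sigma> powr (\<beta> - 2)) (c1 / 2 * \<sigma> powr (\<beta> - 1)) / (N + 1))"
   have \<theta>0: "0 < \<theta>0" using \<sigma> c1 N by (simp add: \<theta>0_def)
   show "\<exists>\<theta>0>0. \<forall>\<theta> \<xi> \<psi>. 0 \<le> \<theta> \<and> \<theta> \<le> \<theta>0 \<and> heis_dist \<xi> x0 \<le> \<rho> \<and>
    (\<forall>x\<in>heis_ball x0 r. \<psi> x = g x + \<theta> * cutoff x0 \<rho> x) --> sing_jet p s \<alpha> \<beta> C R \<psi> \<xi>"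
   proof (rule exI[of _ \<theta>0], rule conjI[rotated], intro allI impI, elim conjE)
    fix \<theta> \<xi> \<psi> assume \<theta>: "0 \<le> \<theta>" "\<theta> \<le> \<theta>0" and d: "heis_dist \<xi> x0 \<le> \<rho>"
     and e: "\<forall>x\<in>heis_ball x0 r. \<psi> x = g x + \<theta> * cutoff x0 \<rho> x"
    let ?d = "heis_dist \<xi> x0"
    define \<tau> where "\<tau> = ?d / 4"
    have \<tau>: "0 \<le> \<tau>" "\<tau> \<le> R" using d \<rho> by (simp_all add: \<tau>_def)
    let ?m = "min (\<sigma> powr (\<beta> - 2)) (c1 / 2 * \<sigma> powr (\<beta> - 1))"
    have "\<theta> \<le> ?m / (N + 1)" using \<theta> by (simp add: \<theta>0_def)
    then have "\<theta> * N \<le> ?m / (N + 1) * N" using N by (intro mult_right_mono)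
    also have "\<dots> = ?m * (N / (N + 1))" by simp
    also have "\<dots> \<le> ?m * 1" using N c1 by (intro mult_left_mono) auto
    finally have tN: "\<theta> * N \<le> \<sigma> powr (\<beta> - 2)" "\<theta> * N \<le> c1 / 2 * \<sigma> powr (\<beta> - 1)" by auto
    have ts: "\<theta> \<le> \<sigma> powr \<beta>" using \<theta> by (simp add: \<theta>0_def)
    have in_ball: "heis_mult \<xi> \<eta> \<in> heis_ball x0 r" if "heis_norm \<eta> < R" for \<eta>
     using heis_dist_mult_le[of \<xi> \<eta> x0] that d \<rho> R20 \<delta>1 by (simp add: mem_heis_ball)
    have \<xi>in: "\<xi> \<in> heis_ball x0 r" using in_ball[of 0] R by simp
    have far: "\<bar>\<psi> (heis_mult \<xi> \<eta>) - \<psi> \<xi>\<bar> \<le> C * heis_norm \<eta> powr \<beta>" if n: "\<tau> \<le> heis_norm \<eta>" "heis_norm \<eta> < R" for \<eta>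
    proof -
     let ?N = "heis_norm \<eta>"
     have d4: "?d \<le> 4 * ?N" using n by (simp add: \<tau>_def)
     have d5: "heis_dist (heis_mult \<xi> \<eta>) x0 \<le> 5 * ?N" using heis_dist_mult_le[of \<xi> \<eta> x0] d4 by linarith
     have lt: "5 * ?N < \<delta>1 / 3" using n R20 \<delta>1 by linarith
     have "\<bar>g (heis_mult \<xi> \<eta>) - g x0\<bar> \<le> K * heis_dist (heis_mult \<xi> \<eta>) x0 powr \<beta>" using d5 lt by (intro growth) linarith
     also have "\<dots> \<le> K * (5 * ?N) powr \<beta>" using d5 \<beta> K by (intro mult_left_mono powr_mono2) auto
     finally have g1: "\<bar>g (heis_mult \<xi> \<eta>) - g x0\<bar> \<le> K * (5 * ?N) powr \<beta>" .
     have "\<bar>g \<xi> - g x0\<bar> \<le> K * ?d powr \<beta>" using d4 lt heis_norm_nonneg[of \<eta>] by (intro growth) linarith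
     also have "\<dots> \<le> K * (5 * ?N) powr \<beta>"
     proof (intro mult_left_mono powr_mono2)
      show "?d \<le> 5 * ?N" using d4 heis_norm_nonneg[of \<eta>] by linarith
     qed (use \<beta> K in auto)
     finally have "\<bar>g \<xi> - g x0\<bar> \<le> K * (5 * ?N) powr \<beta>" .
     with g1 have g2: "\<bar>g (heis_mult \<xi> \<eta>) - g \<xi>\<bar> \<le> 2 * K * 5 powr \<beta> * ?N powr \<beta>" by (simp add: powr_mult)
     have c2: "\<bar>\<theta> * (cutoff x0 \<rho> (heis_mult \<xi> \<eta>) - cutoff x0 \<rho> \<xi>)\<bar> \<le> ?N powr \<beta>"
     proof (cases "?d < \<rho> / 4 \<and> ?N < \<rho> / 4")
      case True
      then have "heis_dist (heis_mult \<xi> \<eta>) x0 \<le> \<rho> / 2" "?d \<le> \<rho> / 2"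
       using heis_dist_mult_le[of \<xi> \<eta> x0] heis_norm_nonneg[of \<eta>] by linarith+
      then show ?thesis using \<rho> by (simp add: cutoff_eq_1)
     next
      case False
      then have sN: "\<sigma> \<le> ?N" using n \<rho> by (auto simp: \<sigma>_def \<tau>_def)
      have "\<bar>cutoff x0 \<rho> (heis_mult \<xi> \<eta>) - cutoff x0 \<rho> \<xi>\<bar> \<le> 1"
       using cutoff_nonneg[of x0 \<rho> \<xi>] cutoff_le_1[of x0 \<rho> \<xi>]
        cutoff_nonneg[of x0 \<rho> "heis_mult \<xi> \<eta>"] cutoff_le_1[of x0 \<rho> "heis_mult \<xi> \<eta>"] by linarith
      then have "\<bar>\<theta> * (cutoff x0 \<rho> (heis_mult \<xi> \<eta>) - cutoff x0 \<rho> \<xi>)\<bar> \<le> \<theta>"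
       using \<theta> by (simp add: abs_mult mult_left_le)
      also have "\<theta> \<le> \<sigma> powr \<beta>" by (rule ts)
      also have "\<dots> \<le> ?N powr \<beta>" using sN \<sigma> \<beta> by (intro powr_mono2) auto
      finally show ?thesis .
     qed
     have "\<psi> (heis_mult \<xi> \<eta>) - \<psi> \<xi> = (g (heis_mult \<xi> \<eta>) - g \<xi>) + \<theta> * (cutoff x0 \<rho> (heis_mult \<xi> \<eta>) - cutoff x0 \<rho> \<xi>)"
      using e in_ball[OF n(2)] \<xi>in by (simp add: right_diff_distrib)
     then have "\<bar>\<psi> (heis_mult \<xi> \<eta>) - \<psi> \<xi>\<bar> \<le> (2 * K * 5 powr \<beta> + 1) * ?N powr \<beta>" using g2 c2 unfolding distrib_right by linarith
     also have "\<dots> \<le> C * ?N powr \<beta>" by (intro mult_right_mono C) simp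
     finally show ?thesis .
    qed
    show "sing_jet p s \<alpha> \<beta> C R \<psi> \<xi>"
    proof (cases "0 < \<tau>")
     case False
     then have "\<tau> = 0" using \<tau> by simp
     then show ?thesis unfolding sing_jet_def using \<tau> R far
      by (intro exI[of _ 0] exI[of _ "0 :: real"]) auto
    next
     case True
     have d0: "0 < ?d" using True by (simp add: \<tau>_def)
     have d7: "7 * \<tau> < \<delta>1" using d \<rho> R20 \<delta>1 by (simp add: \<tau>_def)
     have jg: "jet g \<xi> (hgr g \<xi>) (K * \<tau> powr (\<beta> - 2)) \<tau>"
      unfolding jet_def
     proof (intro allI impI)
      fix \<eta> :: "'n heis" assume n: "heis_norm \<eta> < \<tau>"
      have "\<bar>g (heis_mult \<xi> \<eta>) - g \<xi> - hgr g \<xi> \<bullet> horiz \<eta>\<bar> \<le> (3 * (2 * real CARD('n))\<^sup>2 * (M1 * (7 * \<tau>) powr (\<beta> - 2))) * (heis_norm \<eta>)\<^sup>2"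
      proof (rule taylor_heis)
       fix y assume y: "heis_dist y \<xi> \<le> 3 * heis_norm \<eta>"
       have "heis_dist y x0 \<le> 7 * \<tau>" using heis_dist_triangle[of y x0 \<xi>] y n by (simp add: \<tau>_def)
       then show "y \<in> heis_ball x0 r \<and> norm (hhess g y) \<le> M1 * (7 * \<tau>) powr (\<beta> - 2)"
        using hess[of "7 * \<tau>" y] d7 True \<delta>1 by (simp add: mem_heis_ball)
      qed
      also have "3 * (2 * real CARD('n))\<^sup>2 * (M1 * (7 * \<tau>) powr (\<beta> - 2)) = K * \<tau> powr (\<beta> - 2)"
       using True by (simp add: K_def n2_def powr_mult)
      finally show "\<bar>g (heis_mult \<xi> \<eta>) - g \<xi> - hgr g \<xi> \<bullet> horiz \<eta>\<bar> \<le> K * \<tau> powr (\<beta> - 2) * (heis_norm \<eta>)\<^sup>2" .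
     qed
     have gg: "c1 * \<tau> powr (\<beta> - 1) \<le> norm (hgr g \<xi>)"
     proof -
      have "c1 * \<tau> powr (\<beta> - 1) \<le> c1 * ?d powr (\<beta> - 1)"
       using True c1 \<beta> by (intro mult_left_mono powr_mono2) (auto simp: \<tau>_def)
      also have "\<dots> \<le> norm (hgr g \<xi>)" using d0 d \<rho> R20 \<delta>1 by (intro grad) auto
      finally show ?thesis .
     qed
     obtain b m where b: "jet (cutoff x0 \<rho>) \<xi> b m \<tau>" "0 \<le> m" "\<theta> * m \<le> \<tau> powr (\<beta> - 2)" "\<theta> * norm b \<le> c1 / 2 * \<tau> powr (\<beta> - 1)"
     proof (cases "?d < \<rho> / 4")
      case T: True
      have "jet (cutoff x0 \<rho>) \<xi> 0 0 \<tau>" unfolding jet_def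
      proof (intro allI impI)
       fix \<eta> :: "'n heis" assume "heis_norm \<eta> < \<tau>"
       then have "heis_dist (heis_mult \<xi> \<eta>) x0 \<le> \<rho> / 2" "?d \<le> \<rho> / 2"
        using heis_dist_mult_le[of \<xi> \<eta> x0] T \<rho>(1) unfolding \<tau>_def by linarith+
       then show "\<bar>cutoff x0 \<rho> (heis_mult \<xi> \<eta>) - cutoff x0 \<rho> \<xi> - 0 \<bullet> horiz \<eta>\<bar> \<le> 0 * (heis_norm \<eta>)\<^sup>2"
        using \<rho> by (simp add: cutoff_eq_1)
      qed
      then show ?thesis using c1 by (intro that[of 0 0]) auto
     next
      case F: False
      have st: "\<sigma> \<le> \<tau>" using F by (simp add: \<sigma>_def \<tau>_def)
      have d1: "?d \<le> 1" using d \<rho>1 by simp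
      obtain b where b: "jet (cutoff x0 \<rho>) \<xi> b N 1" "norm b \<le> N" using jc[OF d1] by blast
      have t1: "\<tau> \<le> 1" using d1 by (simp add: \<tau>_def)
      have 1: "\<sigma> powr (\<beta> - 2) \<le> \<tau> powr (\<beta> - 2)" using st \<sigma> \<beta> by (intro powr_mono2) auto
      have "c1 / 2 * \<sigma> powr (\<beta> - 1) \<le> c1 / 2 * \<tau> powr (\<beta> - 1)" using st \<sigma> \<beta> c1 by (intro mult_left_mono powr_mono2) auto
      moreover have "\<theta> * norm b \<le> \<theta> * N" using b \<theta> by (intro mult_left_mono) auto
      ultimately show ?thesis using jet_mono[OF b(1) order_refl t1] N tN 1 by (intro that[of b N]) auto
     qed
     let ?g = "hgr g \<xi> + \<theta> *\<^sub>R b" and ?M = "(K + 1) * \<tau> powr (\<beta> - 2)"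
     have "jet \<psi> \<xi> ?g (K * \<tau> powr (\<beta> - 2) + \<theta> * m) \<tau>"
      by (rule perturbed_jet[OF jg b(1) \<theta>(1) e _ True]) (use d \<rho> R20 \<delta>1 in \<open>simp add: \<tau>_def\<close>)
     then have j: "jet \<psi> \<xi> ?g ?M \<tau>" by (rule jet_mono) (use b in \<open>auto simp: distrib_right\<close>)
     have "norm (hgr g \<xi>) \<le> norm ?g + norm (\<theta> *\<^sub>R b)"
      using norm_triangle_ineq4[of "hgr g \<xi> + \<theta> *\<^sub>R b" "\<theta> *\<^sub>R b"] by simp
     then have g2: "c1 / 2 * \<tau> powr (\<beta> - 1) \<le> norm ?g" using gg b(4) \<theta> by simp
     have pos: "0 < c1 / 2 * \<tau> powr (\<beta> - 1)" using True c1 by simp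
     have "norm ?g powr (p - 2) \<le> (c1 / 2 * \<tau> powr (\<beta> - 1)) powr (p - 2)"
      using g2 pos p by (intro powr_mono2') auto
     also have "\<dots> = (c1 / 2) powr (p - 2) * \<tau> powr ((\<beta> - 1) * (p - 2))"
      unfolding powr_mult powr_powr ..
     finally have g3: "norm ?g powr (p - 2) \<le> (c1 / 2) powr (p - 2) * \<tau> powr ((\<beta> - 1) * (p - 2))" .
     have "?M * norm ?g powr (p - 2) * \<tau> powr (p - s * p)
      \<le> ?M * ((c1 / 2) powr (p - 2) * \<tau> powr ((\<beta> - 1) * (p - 2))) * \<tau> powr (p - s * p)"
      using K by (intro mult_right_mono mult_left_mono g3) auto
     also have "\<dots> = (K + 1) * (c1 / 2) powr (p - 2) * (\<tau> powr (\<beta> - 2) * \<tau> powr ((\<beta> - 1) * (p - 2)) * \<tau> powr (p - s * p))"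
      by (simp only: mult_ac)
     also have "\<tau> powr (\<beta> - 2) * \<tau> powr ((\<beta> - 1) * (p - 2)) * \<tau> powr (p - s * p) = \<tau> powr \<alpha>"
      by (simp add: powr_add[symmetric] \<alpha>_def algebra_simps)
     also have "(K + 1) * (c1 / 2) powr (p - 2) * \<tau> powr \<alpha> \<le> C * R powr \<alpha>"
      using C \<tau> \<alpha> by (intro mult_mono powr_mono2) auto
     finally have "?M * norm ?g powr (p - 2) * \<tau> powr (p - s * p) \<le> C * R powr \<alpha>" .
     moreover have "?g \<noteq> 0" using g2 pos by auto
     ultimately have "0 \<le> \<tau> \<and> \<tau> \<le> R \<and> 0 \<le> ?M \<and>
      (0 < \<tau> --> ?g \<noteq> 0 \<and> jet \<psi> \<xi> ?g ?M \<tau> \<and> ?M * norm ?g powr (p - 2) * \<tau> powr (p - s * p) \<le> C * R powr \<alpha>) \<and>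
      (\<forall>\<eta>. \<tau> \<le> heis_norm \<eta> \<and> heis_norm \<eta> < R --> \<bar>\<psi> (heis_mult \<xi> \<eta>) - \<psi> \<xi>\<bar> \<le> C * heis_norm \<eta> powr \<beta>)"
      using \<tau> j far K by simp
     then show ?thesis unfolding sing_jet_def by blast
    qed
   qed (rule \<theta>0)
  qed (rule R(1))
 qed
qed


text \<open>Near an isolated critical point the distance to the critical set is the distance to
  \<open>x0\<close>, so the supremum defining \<open>C2_beta\<close> becomes a lower bound for the
  gradient and an upper bound for the Hessian in powers of that distance.\<close>

lemma near_uniform_critical:
 fixes x0 :: "'n::finite heis"
 assumes p: "1 < p" "p \<le> 2 / (2 - s)" and s: "0 < s" "s < 1" and L: "0 \<le> L"
  and r: "0 < r" and loc: "C2_function (heis_ball x0 r) g" and z: "hgrad g x0 = 0"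
  and iso: "0 < \<delta>0" "\<And>\<xi>. \<xi> \<in> heis_ball x0 \<delta>0 ==> hgrad g \<xi> = 0 ==> \<xi> = x0"
  and \<beta>: "s * p / (p - 1) < \<beta>" and cb: "C2_beta \<beta> (heis_ball x0 r) g"
 shows "near_uniform p s L r x0 g"
proof -
 interpret C2_function "heis_ball x0 r" g by (rule loc)
 let ?D = "heis_ball x0 r"
 let ?S = "crit_set ?D g"
 have ps: "p * (2 - s) \<le> 2" using p s by (simp add: le_divide_eq)
 have \<beta>2: "s * p < \<beta> * (p - 1)" using \<beta> p by (simp add: divide_less_eq)
 \<comment> \<open>In this range of p the bound \<beta> > s p / (p - 1) forces \<beta> > 2, so the
   Hessian bound tends to zero at the critical point.\<close>
 have "2 * (p - 1) \<le> s * p" using ps by (simp add: algebra_simps)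
 then have "2 * (p - 1) < \<beta> * (p - 1)" using \<beta>2 by linarith
 then have \<beta>1: "2 < \<beta>" by (rule mult_right_less_imp_less) (use p in simp)
 have p2: "p < 2"
 proof -
  have "2 / (2 - s) < 2" using s by (simp add: divide_less_eq)
  then show ?thesis using p by linarith
 qed
 have in0: "x0 \<in> ?D" using r by (simp add: mem_heis_ball)
 have S0: "x0 \<in> ?S" using z in0 by (simp add: crit_set_def)
 obtain B where B: "\<And>\<xi>. \<xi> \<in> ?D - ?S ==>
  min (heis_setdist \<xi> ?S) 1 powr (\<beta> - 1) / norm (hgrad g \<xi>)
   + norm (hhess g \<xi>) / heis_setdist \<xi> ?S powr (\<beta> - 2) \<le> B"
  using cb unfolding C2_beta_def bdd_above_def Let_def by fast
 \<comment> \<open>Any other critical point lies at distance at least \<delta>0 from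
   \<open>x0\<close>; within \<delta>0 / 2 of \<open>x0\<close> it cannot be the nearer one.\<close>
 define \<delta>1 where "\<delta>1 = min (\<delta>0 / 2) (min r 1)"
 have \<delta>1: "0 < \<delta>1" "\<delta>1 \<le> r" "\<delta>1 \<le> 1" "\<delta>1 \<le> \<delta>0 / 2" using iso r by (auto simp: \<delta>1_def)
 have sd: "heis_setdist \<xi> ?S = heis_dist \<xi> x0" if "heis_dist \<xi> x0 < \<delta>1" for \<xi>
  unfolding heis_setdist_def
 proof (rule cInf_eq_minimum)
  show "heis_dist \<xi> x0 \<in> heis_dist \<xi> ` ?S" using S0 by blast
  fix y assume "y \<in> heis_dist \<xi> ` ?S"
  then obtain \<eta> where \<eta>: "\<eta> \<in> ?S" "y = heis_dist \<xi> \<eta>" by blast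
  show "heis_dist \<xi> x0 \<le> y"
  proof (cases "\<eta> = x0")
   case False
   then have "\<eta> \<notin> heis_ball x0 \<delta>0" using iso(2)[of \<eta>] \<eta> by (auto simp: crit_set_def)
   then have "\<delta>0 \<le> heis_dist \<eta> x0" by (simp add: mem_heis_ball)
   also have "\<dots> \<le> heis_dist \<xi> \<eta> + heis_dist \<xi> x0" using heis_dist_triangle[of \<eta> x0 \<xi>] heis_dist_commute[of \<eta> \<xi>] by simp
   finally show ?thesis using that \<delta>1 \<eta> by linarith
  qed (simp add: \<eta>)
 qed
 have main: "(1 / (\<bar>B\<bar> + 1)) * heis_dist \<xi> x0 powr (\<beta> - 1) \<le> norm (hgr g \<xi>) \<and> norm (hhess g \<xi>) \<le> \<bar>B\<bar> * heis_dist \<xi> x0 powr (\<beta> - 2)"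
  if d: "0 < heis_dist \<xi> x0" "heis_dist \<xi> x0 < \<delta>1" for \<xi>
 proof -
  let ?d = "heis_dist \<xi> x0"
  have inD: "\<xi> \<in> ?D" using d \<delta>1 by (simp add: mem_heis_ball)
  have "\<xi> \<in> heis_ball x0 \<delta>0" using d \<delta>1 iso by (simp add: mem_heis_ball)
  then have nz: "hgrad g \<xi> \<noteq> 0" using iso(2)[of \<xi>] d by auto
  then have mem: "\<xi> \<in> ?D - ?S" using inD by (simp add: crit_set_def)
  have m1: "min ?d 1 = ?d" using d \<delta>1 by simp
  have b: "?d powr (\<beta> - 1) / norm (hgrad g \<xi>) + norm (hhess g \<xi>) / ?d powr (\<beta> - 2) \<le> B"
   using B[OF mem] unfolding sd[OF d(2)] m1 .
  have nn: "0 \<le> ?d powr (\<beta> - 1) / norm (hgrad g \<xi>)" "0 \<le> norm (hhess g \<xi>) / ?d powr (\<beta> - 2)" by simp_all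
  have "?d powr (\<beta> - 1) / norm (hgrad g \<xi>) \<le> \<bar>B\<bar> + 1" using b nn by linarith
  then have 1: "?d powr (\<beta> - 1) \<le> (\<bar>B\<bar> + 1) * norm (hgrad g \<xi>)" using nz by (simp add: divide_le_eq)
  have "norm (hhess g \<xi>) / ?d powr (\<beta> - 2) \<le> \<bar>B\<bar>" using b nn by linarith
  moreover have "0 < ?d powr (\<beta> - 2)" using d(1) unfolding powr_gt_zero by linarith
  ultimately have 2: "norm (hhess g \<xi>) \<le> \<bar>B\<bar> * ?d powr (\<beta> - 2)" by (simp only: pos_divide_le_eq)
  have "(1 / (\<bar>B\<bar> + 1)) * ?d powr (\<beta> - 1) \<le> (1 / (\<bar>B\<bar> + 1)) * ((\<bar>B\<bar> + 1) * norm (hgrad g \<xi>))"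
   using 1 by (intro mult_left_mono) auto
  also have "\<dots> = norm (hgr g \<xi>)" by (simp add: norm_hgrad)
  finally show ?thesis using 2 by blast
 qed
 have hess: "norm (hhess g \<xi>) \<le> \<bar>B\<bar> * \<epsilon> powr (\<beta> - 2)" if \<epsilon>: "0 < \<epsilon>" "\<epsilon> < \<delta>1" "heis_dist \<xi> x0 \<le> \<epsilon>" for \<xi> \<epsilon>
 proof (cases "\<xi> = x0")
  case False
  then have d: "0 < heis_dist \<xi> x0" using heis_dist_eq_0[of \<xi> x0] heis_dist_nonneg[of \<xi> x0] by linarith
  then have "norm (hhess g \<xi>) \<le> \<bar>B\<bar> * heis_dist \<xi> x0 powr (\<beta> - 2)" using main[of \<xi>] \<epsilon> by simp
  also have "\<dots> \<le> \<bar>B\<bar> * \<epsilon> powr (\<beta> - 2)" using d \<epsilon> \<beta>1 by (intro mult_left_mono powr_mono2) auto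
  finally show ?thesis .
 next
  case True
  show ?thesis
  \<comment> \<open>The supremum leaves out the critical set, so at \<open>x0\<close> itself the
    bound has to come from nearby points, by continuity of the Hessian.\<close>
  proof (rule ccontr)
   let ?b = "\<bar>B\<bar> * \<epsilon> powr (\<beta> - 2)"
   assume "\<not> norm (hhess g \<xi>) \<le> ?b"
   then have c: "x0 \<in> {x \<in> ?D. ?b < norm (hhess g x)}" using in0 True by simp
   have "open {x \<in> ?D. ?b < norm (hhess g x)}"
    using continuous_on_open_vimage[THEN iffD1, OF open_heis_ball continuous_on_norm[OF continuous_hhess], rule_format, of "{?b<..}"]
    by (simp add: vimage_def Int_def conj_commute)
   then obtain t where t: "0 < t" "heis_ball x0 t \<subseteq> {x \<in> ?D. ?b < norm (hhess g x)}"
    using c by (rule heis_ball_subset_open)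
   define a where "a = min \<epsilon> (t / 2)"
   have a: "0 < a" "a \<le> \<epsilon>" "a < t" using t \<epsilon> by (auto simp: a_def)
   define x where "x = heis_mult x0 (lift (a *\<^sub>R (axis undefined 1, 0)) :: 'n heis)"
   have "heis_dist x x0 = a"
    unfolding x_def heis_dist_commute[of _ x0] heis_dist_mult heis_norm_lift using a by (simp add: norm_Pair)
   then have x: "0 < heis_dist x x0" "heis_dist x x0 \<le> \<epsilon>" "heis_dist x x0 < t" using a by auto
   then have "norm (hhess g x) \<le> \<bar>B\<bar> * heis_dist x x0 powr (\<beta> - 2)" using main[of x] \<epsilon> by simp
   also have "\<dots> \<le> ?b" using x \<beta>1 by (intro mult_left_mono powr_mono2) auto
   finally have "norm (hhess g x) \<le> ?b" .
   moreover have "x \<in> heis_ball x0 t" using x by (simp add: mem_heis_ball)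
   ultimately show False using t by fastforce
  qed
 qed
 show ?thesis
 proof (rule near_uniform_critical_aux[OF p(1) p2 s L r loc _ _ \<beta>2 \<delta>1(1-3), of "1 / (\<bar>B\<bar> + 1)" "\<bar>B\<bar>"])
  show "hgr g x0 = 0" using z by (simp add: hgrad_eq_0)
 qed (use \<beta>1 main hess in auto)
qed

lemma near_uniform_admissible:
 fixes x0 :: "'n::finite heis"
 assumes p: "1 < p" and s: "0 < s" "s < 1" and L: "0 \<le> L" and r: "0 < r"
  and adm: "visc_admissible s p \<phi> x0 r"
 shows "near_uniform p s L r x0 (\<lambda>\<xi>. real_of_ereal (\<phi> \<xi>))"
proof -
 let ?g = "\<lambda>\<xi>. real_of_ereal (\<phi> \<xi>)"
 have a: "Ck_on 2 (heis_ball x0 r) ?g"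
  "(p > 2 / (2 - s) \<or> hgrad ?g x0 \<noteq> 0) \<or>
    (1 < p \<and> p \<le> 2 / (2 - s) \<and> hgrad ?g x0 = 0 \<and>
    (\<exists>\<delta>>0. \<forall>\<xi>\<in>heis_ball x0 \<delta>. hgrad ?g \<xi> = 0 --> \<xi> = x0) \<and>
    (\<exists>\<beta>>s * p / (p - 1). C2_beta \<beta> (heis_ball x0 r) ?g))"
  using adm unfolding visc_admissible_def Let_def by blast+
 have C2: "C2_function (heis_ball x0 r) ?g" by unfold_locales (simp_all add: a(1))
 consider "2 / (2 - s) < p" | "p \<le> 2 / (2 - s)" "hgrad ?g x0 \<noteq> 0" | "p \<le> 2 / (2 - s)" "hgrad ?g x0 = 0"
  by linarith
 then show ?thesis
 proof cases
  case 1
  show ?thesis by (rule near_uniform_smooth[OF p s 1 L r C2])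
 next
  case 2
  have "2 / (2 - s) < 2" using s by (simp add: divide_less_eq)
  then have "p < 2" using 2 by linarith
  then show ?thesis using near_uniform_noncritical[OF p _ s L r C2] 2 by (simp add: hgrad_eq_0)
 next
  case 3
  then obtain \<delta> \<beta> where "0 < \<delta>" "\<forall>\<xi>\<in>heis_ball x0 \<delta>. hgrad ?g \<xi> = 0 --> \<xi> = x0"
   "s * p / (p - 1) < \<beta>" "C2_beta \<beta> (heis_ball x0 r) ?g" using a(2) by auto
  then show ?thesis using near_uniform_critical[OF p 3(1) s L r C2 3(2)] by blast
 qed
qed


section \<open>Smooth functions\<close>

lemma Ck_SucI:
 assumes "\<And>x. (f has_derivative F x) (at x)" "\<And>v. Ck_on k UNIV (\<lambda>x. F x v)"
 shows "Ck_on (Suc k) UNIV f"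
proof -
 have "frechet_derivative f (at x) = F x" for x
  using frechet_derivative_at[OF assms(1)] by simp
 then show ?thesis using assms by (auto simp: differentiable_def)
qed

lemma Ck_has_derivative: "Ck_on (Suc k) UNIV f ==> (f has_derivative frechet_derivative f (at x)) (at x)"
 by (simp add: frechet_derivative_works)

lemma differentiable_UNIV_continuous:
 fixes f :: "'a::real_normed_vector => 'b::real_normed_vector"
 assumes "\<And>x. f differentiable (at x)" shows "continuous_on UNIV f"
 using assms by (intro differentiable_imp_continuous_on) (auto simp: differentiable_on_def)

lemma Ck_Suc_imp: "Ck_on (Suc k) UNIV f ==> Ck_on k UNIV f"
proof (induction k arbitrary: f)
 case 0
 then show ?case by (auto intro: differentiable_UNIV_continuous)
next
 case (Suc k)
 have "\<forall>v. Ck_on (Suc k) UNIV (\<lambda>x. frechet_derivative f (at x) v)" using Suc.prems unfolding Ck_on.simps(2)[of "Suc k"] by blast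
 then have "\<forall>v. Ck_on k UNIV (\<lambda>x. frechet_derivative f (at x) v)" using Suc.IH by blast
 then show ?case using Suc.prems by simp
qed

lemma Ck_add: "Ck_on k UNIV f ==> Ck_on k UNIV g ==> Ck_on k UNIV (\<lambda>x. f x + g x)"
proof (induction k arbitrary: f g)
 case 0
 then show ?case by (auto intro: continuous_intros)
next
 case (Suc k)
 show ?case
 proof (rule Ck_SucI)
  show "((\<lambda>x. f x + g x) has_derivative (\<lambda>h. frechet_derivative f (at x) h + frechet_derivative g (at x) h)) (at x)" for x
   using Suc.prems by (intro has_derivative_add Ck_has_derivative)
  show "Ck_on k UNIV (\<lambda>x. frechet_derivative f (at x) v + frechet_derivative g (at x) v)" for v
   using Suc.prems by (intro Suc.IH) auto
 qed
qed

lemma Ck_mult: "Ck_on k UNIV f ==> Ck_on k UNIV g ==> Ck_on k UNIV (\<lambda>x. f x * g x)"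
proof (induction k arbitrary: f g)
 case 0
 then show ?case by (auto intro: continuous_intros)
next
 case (Suc k)
 show ?case
 proof (rule Ck_SucI)
  show "((\<lambda>x. f x * g x) has_derivative (\<lambda>h. f x * frechet_derivative g (at x) h + frechet_derivative f (at x) h * g x)) (at x)" for x
   using Suc.prems by (intro has_derivative_mult Ck_has_derivative)
  show "Ck_on k UNIV (\<lambda>x. f x * frechet_derivative g (at x) v + frechet_derivative f (at x) v * g x)" for v
   using Suc.prems by (intro Ck_add Suc.IH) (auto intro: Ck_Suc_imp simp del: Ck_on.simps(2), auto)
 qed
qed

lemma Ck_const: "Ck_on k UNIV (\<lambda>x. c)"
proof (induction k arbitrary: c)
 case (Suc k)
 show ?case by (rule Ck_SucI[OF has_derivative_const]) (rule Suc.IH)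
qed simp

lemma Ck_linear: "bounded_linear f ==> Ck_on k UNIV f"
proof (cases k)
 case 0
 then show "bounded_linear f ==> Ck_on k UNIV f" by (simp add: linear_continuous_on)
next
 case (Suc j)
 then show "bounded_linear f ==> Ck_on k UNIV f"
  by (auto simp del: Ck_on.simps intro!: Ck_SucI[OF bounded_linear_imp_has_derivative] Ck_const)
qed

section \<open>A smooth bump function\<close>

text \<open>x^(-m) exp(-1/x), extended by 0. The powers are included because the derivative of one
  member is then a combination of two others, which lets an induction on the order of
  differentiability close.\<close>

definition flat :: "nat => real => real" where
 "flat m x = (if 0 < x then inverse x ^ m * exp (- inverse x) else 0)"

lemma power_exp_bound: "0 \<le> y ==> y ^ k * exp (- y) \<le> fact k" for y :: real
proof -
 assume y: "0 \<le> y"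
 have "y ^ k / fact k \<le> (\<Sum>n\<in>{k}. y ^ n / fact n)" by simp
 also have "\<dots> \<le> (\<Sum>n. y ^ n / fact n)"
  using y summable_exp[of y] by (intro sum_le_suminf) (auto simp: divide_inverse mult.commute)
 also have "\<dots> = exp y" by (simp add: exp_def divide_inverse mult.commute)
 finally have "y ^ k \<le> exp y * fact k" by (simp add: divide_le_eq)
 then show ?thesis by (simp add: exp_minus field_simps)
qed

lemma DERIV_flat: "(flat m has_real_derivative (flat (m + 2) x - real m * flat (m + 1) x)) (at x)"
proof -
 consider "0 < x" | "x < 0" | "x = 0" by linarith
 then show ?thesis
 proof cases
  case 1
  have e1: "((\<lambda>x. inverse x ^ m) has_real_derivative - real m * inverse x ^ (m + 1)) (at x)"
  proof -
   have "(inverse has_real_derivative - (inverse x ^ Suc (Suc 0))) (at x)" using 1 by (intro DERIV_inverse) simp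
   from DERIV_power[OF this, of m] have "((\<lambda>x. inverse x ^ m) has_real_derivative
    real m * (- (inverse x ^ Suc (Suc 0)) * inverse x ^ (m - Suc 0))) (at x)" by simp
   moreover have "real m * (- (inverse x ^ Suc (Suc 0)) * inverse x ^ (m - Suc 0)) = - real m * inverse x ^ (m + 1)"
    by (cases m) (simp_all only: of_nat_0 mult_zero_left minus_zero diff_Suc_1 power_Suc power_0 add_Suc_right add_0_right One_nat_def mult_ac mult_minus_left mult_minus_right diff_Suc_Suc diff_zero)
   ultimately show ?thesis by (simp only:)
  qed
  have e2: "((\<lambda>x. exp (- inverse x)) has_real_derivative exp (- inverse x) * inverse x ^ 2) (at x)"
   using 1 by (auto intro!: derivative_eq_intros simp: power2_eq_square)
  have d: "((\<lambda>x. inverse x ^ m * exp (- inverse x)) has_real_derivative (flat (m + 2) x - real m * flat (m + 1) x)) (at x)"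
   by (rule DERIV_cong[OF DERIV_mult[OF e1 e2]]) (use 1 in \<open>simp add: flat_def power_add power2_eq_square\<close>)
  show ?thesis
   by (rule has_field_derivative_transform_within[OF d 1]) (use 1 in \<open>auto simp: flat_def dist_real_def\<close>)
 next
  case 2
  have d: "((\<lambda>x. 0) has_real_derivative 0) (at x)" by simp
  have "(flat m has_real_derivative 0) (at x)"
   by (rule has_field_derivative_transform_within[OF d, of "- x"]) (use 2 in \<open>auto simp: flat_def dist_real_def\<close>)
  then show ?thesis using 2 by (simp add: flat_def)
 next
  case 3
  \<comment> \<open>Two powers more than m in the bound by a factorial give quadratic decay at 0,
    hence derivative 0 there.\<close>
  have b: "\<bar>flat m y\<bar> \<le> fact (m + 2) * y\<^sup>2" for y
  proof (cases "0 < y")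
   case True
   have "inverse y ^ (m + 2) * exp (- inverse y) \<le> fact (m + 2)" using True by (intro power_exp_bound) simp
   then have "(inverse y ^ (m + 2) * exp (- inverse y)) * y\<^sup>2 \<le> fact (m + 2) * y\<^sup>2" by (intro mult_right_mono) auto
   moreover have "(inverse y ^ (m + 2) * exp (- inverse y)) * y\<^sup>2 = inverse y ^ m * exp (- inverse y)"
    using True by (simp add: power_add power2_eq_square field_simps)
   moreover have "flat m y = inverse y ^ m * exp (- inverse y)" "0 \<le> flat m y" using True by (simp_all add: flat_def)
   ultimately show ?thesis by linarith
  qed (simp add: flat_def)
  have "(flat m has_real_derivative 0) (at 0)"
   unfolding DERIV_def
  proof (rule tendsto_rabs_zero_cancel, rule tendsto_sandwich[OF _ _ tendsto_const])
   show "\<forall>\<^sub>F h in at 0. 0 \<le> \<bar>(flat m (0 + h) - flat m 0) / h\<bar>" by simp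
   show "\<forall>\<^sub>F h in at 0. \<bar>(flat m (0 + h) - flat m 0) / h\<bar> \<le> fact (m + 2) * \<bar>h\<bar>"
   proof (rule always_eventually, rule allI)
    fix h :: real
    show "\<bar>(flat m (0 + h) - flat m 0) / h\<bar> \<le> fact (m + 2) * \<bar>h\<bar>"
     using b[of h] by (cases "h = 0") (auto simp: flat_def divide_le_eq power2_eq_square abs_mult[symmetric] mult.assoc simp del: fact_Suc)
   qed
   show "((\<lambda>h. fact (m + 2) * \<bar>h\<bar>) \<longlongrightarrow> 0) (at (0::real))"
    by (intro tendsto_eq_intros) auto
  qed
  then show ?thesis using 3 by (simp add: flat_def)
 qed
qed

definition bump :: "nat => real => 'a::euclidean_space => real" where
 "bump m c x = flat m (c - x \<bullet> x)"

text \<open>Differentiation stays within the family up to linear factors, so the induction on k runs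
  over all m simultaneously.\<close>

lemma Ck_bump: "Ck_on k UNIV (bump m c :: 'a::euclidean_space => real)"
proof (induction k arbitrary: m)
 case 0
 have "continuous_on UNIV (flat m)" using DERIV_flat by (intro differentiable_UNIV_continuous) (auto simp: real_differentiable_def)
 then have "continuous_on UNIV (\<lambda>x::'a. flat m (c - x \<bullet> x))"
  by (rule continuous_on_compose2) (auto intro!: continuous_intros)
 then show ?case by (simp add: bump_def[abs_def])
next
 case (Suc k)
 show ?case
 proof (rule Ck_SucI)
  show "(bump m c has_derivative (\<lambda>v. (bump (m + 2) c x + (- real m) * bump (m + 1) c x) * ((- 2) * (x \<bullet> v)))) (at x)" for x :: 'a
  proof -
   have "((\<lambda>x. c - x \<bullet> x) has_derivative (\<lambda>v. - 2 * (x \<bullet> v))) (at x)"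
    by (auto intro!: derivative_eq_intros simp: inner_commute)
   from has_derivative_compose[OF this DERIV_flat[unfolded has_field_derivative_def, of m "c - x \<bullet> x"]]
   show ?thesis by (simp add: bump_def[abs_def])
  qed
  show "Ck_on k UNIV (\<lambda>x. (bump (m + 2) c x + (- real m) * bump (m + 1) c x) * ((- 2) * ((x::'a) \<bullet> v)))" for v
   by (intro Ck_mult Ck_add Ck_const Suc.IH Ck_linear bounded_linear_inner_left)
 qed
qed

lemma bump_nonneg: "0 \<le> bump m c x"
 by (simp add: bump_def flat_def)

lemma bump_eq_0: "c \<le> x \<bullet> x ==> bump m c x = 0"
 by (simp add: bump_def flat_def)

lemma bump_pos: "x \<bullet> x < c ==> 0 < bump m c x"
 by (simp add: bump_def flat_def)

definition smooth :: "('a::real_normed_vector => real) => bool" where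
 "smooth f \<longleftrightarrow> (\<forall>k. Ck_on k UNIV f)"

lemma smooth_continuous: "smooth f ==> continuous_on UNIV f"
 unfolding smooth_def by (metis Ck_on.simps(1))

lemma smooth_has_derivative: "smooth f ==> (f has_derivative frechet_derivative f (at x)) (at x)"
 unfolding smooth_def using Ck_has_derivative by blast

lemma smooth_deriv: "smooth f ==> smooth (\<lambda>x. frechet_derivative f (at x) v)"
 unfolding smooth_def by (metis Ck_on.simps(2))

lemma smooth_mult: "smooth f ==> smooth g ==> smooth (\<lambda>x. f x * g x)"
 by (simp add: smooth_def Ck_mult)

lemma smooth_const: "smooth (\<lambda>x. c)"
 by (simp add: smooth_def Ck_const)

subsection \<open>Convolution\<close>

text \<open>With the variable on the left, derivatives fall on g alone. After inversion of the
  integration variable the same integral averages left translates of w, and these are what a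
  left-invariant kernel does not notice.\<close>

definition conv :: "('n::finite heis => real) => ('n heis => real) => 'n heis => real" where
 "conv g w \<xi> = (LBINT \<sigma>. g (heis_mult \<xi> (- \<sigma>)) * w \<sigma>)"

text \<open>Bounded, with bounded support. The class is closed under multiplication by continuous
  functions, in particular by the factors \<open>omega v\<close> that differentiating a convolution
  produces.\<close>

definition tame :: "('a::euclidean_space => real) => bool" where
 "tame w \<longleftrightarrow> w \<in> \<B> \<and> (\<exists>b. \<forall>x. \<bar>w x\<bar> \<le> b) \<and> (\<exists>A. \<forall>x. A < norm x --> w x = 0)"

lemma tame_bounds:
 assumes "tame w"
 obtains b A where "0 < b" "0 < A" "\<And>x. \<bar>w x\<bar> \<le> b" "\<And>x. A < norm x ==> w x = 0"
proof -
 obtain b A where "\<And>x. \<bar>w x\<bar> \<le> b" "\<And>x. A < norm x ==> w x = 0"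
  using assms unfolding tame_def by auto
 then show ?thesis by (intro that[of "max 1 b" "max 1 A"]) (auto simp: le_max_iff_disj)
qed

lemma tame_measurable: "tame w ==> w \<in> \<B>"
 by (simp add: tame_def)

lemma tame_mult_continuous:
 fixes w :: "'a::euclidean_space => real"
 assumes w: "tame w" and f: "continuous_on UNIV f"
 shows "tame (\<lambda>x. f x * w x)"
proof -
 obtain b A where bA: "0 < b" "0 < A" "\<And>x. \<bar>w x\<bar> \<le> b" "\<And>x. A < norm x ==> w x = 0"
  using tame_bounds[OF w] by blast
 have "bounded (f ` cball 0 A)"
  by (intro compact_imp_bounded compact_continuous_image continuous_on_subset[OF f]) auto
 then obtain c where "\<forall>y\<in>f ` cball 0 A. norm y \<le> c" unfolding bounded_iff by blast
 then have c: "\<bar>f x\<bar> \<le> c" if "norm x \<le> A" for x using that by simp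
 have [measurable]: "f \<in> \<B>" "w \<in> \<B>"
  using f w by (auto intro: borel_measurable_continuous_onI tame_measurable)
 have "\<bar>f x * w x\<bar> \<le> \<bar>c\<bar> * b" for x
 proof (cases "norm x \<le> A")
  case True
  then show ?thesis unfolding abs_mult using c[OF True] bA by (intro mult_mono) auto
 qed (use bA in auto)
 then show ?thesis unfolding tame_def using bA by (intro conjI exI[of _ "\<bar>c\<bar> * b"] exI[of _ A]) auto
qed

lemma tame_integrable: "tame w ==> integrable lborel (w :: 'a::euclidean_space => real)"
proof -
 assume w: "tame w"
 obtain b A where bA: "0 < b" "0 < A" "\<And>x. \<bar>w x\<bar> \<le> b" "\<And>x. A < norm x ==> w x = 0"
  using tame_bounds[OF w] by blast
 have [measurable]: "w \<in> \<B>" using w by (rule tame_measurable)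
 show ?thesis
 proof (rule Bochner_Integration.integrable_bound)
  show "integrable lborel (\<lambda>x::'a. indicator (cball 0 A) x * b)"
   by (intro integrable_mult_left integrable_real_indicator) (auto simp: emeasure_bounded_finite[simplified])
  show "AE x in lborel. norm (w x) \<le> norm (indicator (cball 0 A) x * b)"
   using bA by (intro AE_I2) (auto simp: indicator_def not_le)
 qed simp
qed

lemma conv_integrable:
 assumes "tame w" "continuous_on UNIV g"
 shows "integrable lborel (\<lambda>\<sigma>. g (heis_mult \<xi> (- \<sigma>)) * w \<sigma>)"
proof (intro tame_integrable tame_mult_continuous assms)
 show "continuous_on UNIV (\<lambda>\<sigma>. g (heis_mult \<xi> (- \<sigma>)))"
  by (rule continuous_on_compose2[OF assms(2)]) (auto intro!: continuous_intros)
qed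

text \<open>Differentiability, uniform on bounded sets: the partial derivatives are uniformly
  continuous on a slightly larger ball, and the mean value inequality is applied to g minus its
  linear part at x.\<close>

lemma smooth_uniform_expansion:
 fixes g :: "'a::euclidean_space => real"
 assumes g: "smooth g" and e: "0 < e"
 shows "\<exists>d>0. \<forall>x h. norm x \<le> B \<and> norm h < d --> \<bar>g (x + h) - g x - frechet_derivative g (at x) h\<bar> \<le> e * norm h"
proof -
 let ?D = "\<lambda>b x. frechet_derivative g (at x) b"
 \<comment> \<open>The error is shared among the coordinate directions.\<close>
 define e' where "e' = e / DIM('a)"
 have e': "0 < e'" using e by (simp add: e'_def)
 have "\<exists>d>0. \<forall>x\<in>cball 0 (B + 1). \<forall>y\<in>cball 0 (B + 1). dist y x < d --> dist (?D b y) (?D b x) < e'" for b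
 proof -
  have "uniformly_continuous_on (cball 0 (B + 1)) (?D b)"
   by (intro compact_uniformly_continuous continuous_on_subset[OF smooth_continuous[OF smooth_deriv[OF g]]]) auto
  then show ?thesis using e' unfolding uniformly_continuous_on_def by blast
 qed
 then obtain d where d: "\<And>b. 0 < d b" "\<And>b x y. x \<in> cball 0 (B + 1) ==> y \<in> cball 0 (B + 1) ==> dist y x < d b ==> dist (?D b y) (?D b x) < e'"
  by metis
 define \<delta> where "\<delta> = Min (insert 1 (d ` Basis))"
 have "0 < \<delta>" "\<delta> \<le> 1" using d(1) by (auto simp: \<delta>_def)
 moreover have "\<delta> \<le> d b" if "b \<in> Basis" for b unfolding \<delta>_def using that by (intro Min_le) auto
 ultimately have \<delta>: "0 < \<delta>" "\<delta> \<le> 1" "\<And>b. b \<in> Basis ==> \<delta> \<le> d b" by blast+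
 show ?thesis
 proof (intro exI[of _ \<delta>] conjI \<delta>(1) allI impI; elim conjE)
  fix x h :: 'a assume x: "norm x \<le> B" and h: "norm h < \<delta>"
  define F where "F = (\<lambda>y. g y - ?D y x)"
  let ?L = "frechet_derivative g (at x)"
  have L: "bounded_linear ?L" using smooth_has_derivative[OF g] by (rule has_derivative_bounded_linear)
  have "norm ((g (x + h) - ?L (x + h)) - (g x - ?L x)) \<le> e * norm ((x + h) - x)"
  proof (rule differentiable_bound[of "closed_segment x (x + h)" "\<lambda>y. g y - ?L y" "\<lambda>y v. frechet_derivative g (at y) v - ?L v"])
   fix y assume "y \<in> closed_segment x (x + h)"
   then have yx: "norm (y - x) \<le> norm h"
    using segment_bound(1)[of y x "x + h"] by simp
   show "((\<lambda>y. g y - ?L y) has_derivative (\<lambda>v. frechet_derivative g (at y) v - ?L v)) (at y within closed_segment x (x + h))"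
    by (intro has_derivative_diff has_derivative_at_withinI[OF smooth_has_derivative[OF g]] bounded_linear_imp_has_derivative L)
   have yin: "y \<in> cball 0 (B + 1)" "x \<in> cball 0 (B + 1)"
    using x yx h \<delta> norm_triangle_ineq[of x "y - x"] by auto
   show "onorm (\<lambda>v. frechet_derivative g (at y) v - ?L v) \<le> e"
   proof (rule onorm_le)
    fix v :: 'a
    have l1: "linear (frechet_derivative g (at y))" "linear ?L"
     using smooth_has_derivative[OF g] has_derivative_linear by blast+
    have "frechet_derivative g (at y) v - ?L v = (\<Sum>b\<in>Basis. (v \<bullet> b) * (?D b y - ?D b x))"
    proof -
     have "frechet_derivative g (at y) v = (\<Sum>b\<in>Basis. (v \<bullet> b) * ?D b y)" "?L v = (\<Sum>b\<in>Basis. (v \<bullet> b) * ?D b x)"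
      using Linear_Algebra.linear_componentwise[OF l1(1), of v 1] Linear_Algebra.linear_componentwise[OF l1(2), of v 1] by simp_all
     then show ?thesis by (simp add: sum_subtractf right_diff_distrib)
    qed
    also have "norm \<dots> \<le> (\<Sum>b\<in>(Basis :: 'a set). norm v * e')"
    proof (rule sum_norm_le)
     fix b :: 'a assume b: "b \<in> Basis"
     have "\<bar>?D b y - ?D b x\<bar> < e'"
      using d(2)[OF yin(2,1), of b] yx h \<delta>(3)[OF b] by (simp add: dist_norm)
     then show "norm ((v \<bullet> b) * (?D b y - ?D b x)) \<le> norm v * e'"
      unfolding real_norm_def abs_mult using Basis_le_norm[OF b, of v] by (intro mult_mono) auto
    qed
    also have "\<dots> = e * norm v" by (simp add: e'_def)
    finally show "norm (frechet_derivative g (at y) v - ?L v) \<le> e * norm v" .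
   qed
  qed auto
  then show "\<bar>g (x + h) - g x - ?L h\<bar> \<le> e * norm h"
   using linear_add[OF bounded_linear.linear[OF L], of x h] by (simp add: algebra_simps)
 qed
qed

text \<open>A Euclidean step h of the base point moves the argument by h minus a vertical vector
  that depends on \<sigma>; hence the extra vertical derivative in the derivative of a
  convolution.\<close>

lemma conv_shift: "heis_mult (\<xi> + h) (- \<sigma>) = heis_mult \<xi> (- \<sigma>) + (h - omega h \<sigma> *\<^sub>R tvec)"
 by (simp add: heis_mult_eq omega_def tvec_def prod_eq_iff inner_add_left inner_add_right algebra_simps)

lemma abs_omega_le: "\<bar>omega a b\<bar> \<le> 4 * norm a * norm b"
proof -
 have n1: "norm (fst x) \<le> norm x" and n2: "norm (snd x) \<le> norm x" for x :: "'a heis"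
  by (metis norm_fst_le prod.collapse) (metis norm_snd_le prod.collapse)
 have n3: "norm (fst (snd x)) \<le> norm x" for x :: "'a heis"
  using n2[of x] norm_fst_le[of "fst (snd x)" "snd (snd x)"] by simp
 have "\<bar>fst b \<bullet> fst (snd a)\<bar> \<le> norm b * norm a" "\<bar>fst a \<bullet> fst (snd b)\<bar> \<le> norm a * norm b"
  by (rule order_trans[OF Cauchy_Schwarz_ineq2], rule mult_mono[OF n1 n3], simp, simp)+
 then show ?thesis unfolding omega_def mult.assoc mult.commute[of "norm b" "norm a"] by linarith
qed

lemma continuous_omega: "continuous_on S (\<lambda>x. omega v x)"
 unfolding omega_def by (intro continuous_intros)

text \<open>The derivative is again a sum of convolutions, of derivatives of g with w and of the
  vertical derivative of g with \<open>omega v\<close> times w. Differentiation under the integral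
  is justified by the uniform expansion of g on the bounded set of arguments that occur.\<close>

lemma conv_has_derivative:
 fixes g :: "'n::finite heis => real"
 assumes g: "smooth g" and w: "tame w"
 shows "(conv g w has_derivative (\<lambda>v. conv (\<lambda>x. frechet_derivative g (at x) v) w \<xi>
  + (- 1) * conv (\<lambda>x. frechet_derivative g (at x) tvec) (\<lambda>\<sigma>. omega v \<sigma> * w \<sigma>) \<xi>)) (at \<xi>)"
proof -
 let ?x = "\<lambda>\<sigma>. heis_mult \<xi> (- \<sigma>)"
 let ?G = "\<lambda>v \<sigma>. frechet_derivative g (at (?x \<sigma>)) v"
 define F where "F = (\<lambda>v. LBINT \<sigma>. ?G (v - omega v \<sigma> *\<^sub>R tvec) \<sigma> * w \<sigma>)"
 have lin: "linear (\<lambda>v. ?G v \<sigma>)" for \<sigma>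
  using smooth_has_derivative[OF g] has_derivative_linear by blast
 have split: "?G (v - omega v \<sigma> *\<^sub>R tvec) \<sigma> * w \<sigma> = ?G v \<sigma> * w \<sigma> + (- 1) * (?G tvec \<sigma> * (omega v \<sigma> * w \<sigma>))" for v \<sigma>
  by (simp add: linear_diff[OF lin] linear_scale[OF lin] algebra_simps)
 have cD: "continuous_on UNIV (\<lambda>x. frechet_derivative g (at x) v)" for v
  by (intro smooth_continuous smooth_deriv g)
 have i1: "integrable lborel (\<lambda>\<sigma>. ?G v \<sigma> * w \<sigma>)" for v by (rule conv_integrable[OF w cD])
 have i2: "integrable lborel (\<lambda>\<sigma>. ?G tvec \<sigma> * (omega v \<sigma> * w \<sigma>))" for v
  by (rule conv_integrable[OF tame_mult_continuous[OF w continuous_omega] cD])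
 have iF: "integrable lborel (\<lambda>\<sigma>. ?G (v - omega v \<sigma> *\<^sub>R tvec) \<sigma> * w \<sigma>)" for v
  unfolding split by (intro Bochner_Integration.integrable_add integrable_mult_right i1 i2)
 have Feq: "F v = conv (\<lambda>x. frechet_derivative g (at x) v) w \<xi>
  + (- 1) * conv (\<lambda>x. frechet_derivative g (at x) tvec) (\<lambda>\<sigma>. omega v \<sigma> * w \<sigma>) \<xi>" for v
  unfolding F_def split conv_def using i1 i2 by simp
 have om: "omega (v + v') \<sigma> = omega v \<sigma> + omega v' \<sigma>" "omega (c *\<^sub>R v) \<sigma> = c * omega v \<sigma>" for v v' c \<sigma>
  by (simp_all add: omega_def inner_add_left inner_add_right algebra_simps)
 have "linear F"
 proof (rule linearI)
  show "F (v + v') = F v + F v'" for v v'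
  proof -
   have "?G ((v + v') - omega (v + v') \<sigma> *\<^sub>R tvec) \<sigma> * w \<sigma>
    = ?G (v - omega v \<sigma> *\<^sub>R tvec) \<sigma> * w \<sigma> + ?G (v' - omega v' \<sigma> *\<^sub>R tvec) \<sigma> * w \<sigma>" for \<sigma>
    unfolding split by (simp add: linear_add[OF lin] om algebra_simps)
   then show ?thesis unfolding F_def using iF by simp
  qed
  show "F (c *\<^sub>R v) = c *\<^sub>R F v" for c v
  proof -
   have "?G (c *\<^sub>R v - omega (c *\<^sub>R v) \<sigma> *\<^sub>R tvec) \<sigma> * w \<sigma> = c * (?G (v - omega v \<sigma> *\<^sub>R tvec) \<sigma> * w \<sigma>)" for \<sigma>
    unfolding split by (simp add: linear_scale[OF lin] om algebra_simps)
   then show ?thesis unfolding F_def by (simp only: integral_mult_right_zero real_scaleR_def)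
  qed
 qed
 then have bl: "bounded_linear F" by (simp add: linear_conv_bounded_linear)
 obtain b A where bA: "0 < b" "0 < A" "\<And>x. \<bar>w x\<bar> \<le> b" "\<And>x. A < norm x ==> w x = 0"
  using tame_bounds[OF w] by blast
 have [measurable]: "w \<in> \<B>" using w by (rule tame_measurable)
 define W where "W = (LBINT \<sigma>. \<bar>w \<sigma>\<bar>)"
 have W0: "0 \<le> W" by (simp add: W_def)
 \<comment> \<open>On the support of w the moved argument differs by at most (1 + 4 A) |h|, since
   |omega h \<sigma>| \<le> 4 |h| |\<sigma>|.\<close>
 define C where "C = 1 + 4 * A"
 have C: "1 \<le> C" using bA by (simp add: C_def)
 have "bounded (?x ` cball 0 A)"
  by (intro compact_imp_bounded compact_continuous_image continuous_intros) auto
 then obtain B where "\<forall>y\<in>?x ` cball 0 A. norm y \<le> B" unfolding bounded_iff by blast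
 then have B: "norm (?x \<sigma>) \<le> B" if "norm \<sigma> \<le> A" for \<sigma> using that by simp
 have "(conv g w has_derivative F) (at \<xi>)"
  unfolding has_derivative_at_alt
 proof (intro conjI bl allI impI)
  fix e :: real assume e: "0 < e"
  define e' where "e' = e / (C * (W + 1))"
  have e': "0 < e'" using e C W0 by (simp add: e'_def)
  obtain d where d: "0 < d" "\<And>x h. norm x \<le> B ==> norm h < d ==> \<bar>g (x + h) - g x - frechet_derivative g (at x) h\<bar> \<le> e' * norm h"
   using smooth_uniform_expansion[OF g e', of B] by blast
  show "\<exists>d>0. \<forall>y. norm (y - \<xi>) < d --> norm (conv g w y - conv g w \<xi> - F (y - \<xi>)) \<le> e * norm (y - \<xi>)"
  proof (intro exI[of _ "d / C"] conjI allI impI)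
   show "0 < d / C" using d C by simp
   fix y assume y: "norm (y - \<xi>) < d / C"
   define h where "h = y - \<xi>"
   let ?h = "\<lambda>\<sigma>. h - omega h \<sigma> *\<^sub>R tvec"
   have hn: "norm (?h \<sigma>) \<le> C * norm h" if "norm \<sigma> \<le> A" for \<sigma>
   proof -
    have "norm (?h \<sigma>) \<le> norm h + \<bar>omega h \<sigma>\<bar>"
     using norm_triangle_ineq4[of h "omega h \<sigma> *\<^sub>R tvec"] by (simp add: tvec_def norm_Pair)
    also have "\<bar>omega h \<sigma>\<bar> \<le> 4 * norm h * norm \<sigma>" by (rule abs_omega_le)
    also have "4 * norm h * norm \<sigma> \<le> 4 * norm h * A" using that by (intro mult_left_mono) auto
    finally show ?thesis by (simp add: C_def algebra_simps)
   qed
   have ptw: "\<bar>g (heis_mult y (- \<sigma>)) * w \<sigma> - g (?x \<sigma>) * w \<sigma> - ?G (?h \<sigma>) \<sigma> * w \<sigma>\<bar> \<le> (e' * (C * norm h)) * \<bar>w \<sigma>\<bar>" for \<sigma>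
   proof (cases "norm \<sigma> \<le> A")
    case True
    have "C * norm h < d" using y C by (simp add: h_def field_simps)
    then have "norm (?h \<sigma>) < d" using hn[OF True] by linarith
    then have "\<bar>g (?x \<sigma> + ?h \<sigma>) - g (?x \<sigma>) - ?G (?h \<sigma>) \<sigma>\<bar> \<le> e' * norm (?h \<sigma>)"
     by (intro d(2) B[OF True])
    also have "\<dots> \<le> e' * (C * norm h)" using hn[OF True] e' by (intro mult_left_mono) auto
    finally have "\<bar>g (?x \<sigma> + ?h \<sigma>) - g (?x \<sigma>) - ?G (?h \<sigma>) \<sigma>\<bar> * \<bar>w \<sigma>\<bar> \<le> (e' * (C * norm h)) * \<bar>w \<sigma>\<bar>"
     by (rule mult_right_mono) simp
    moreover have "heis_mult y (- \<sigma>) = ?x \<sigma> + ?h \<sigma>" using conv_shift[of \<xi> h \<sigma>] by (simp add: h_def)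
    ultimately show ?thesis unfolding abs_mult[symmetric] by (simp add: left_diff_distrib)
   next
    case False
    then show ?thesis using bA by simp
   qed
   have cg: "continuous_on UNIV g" by (rule smooth_continuous[OF g])
   have "conv g w y - conv g w \<xi> - F h = (LBINT \<sigma>. g (heis_mult y (- \<sigma>)) * w \<sigma> - g (?x \<sigma>) * w \<sigma> - ?G (?h \<sigma>) \<sigma> * w \<sigma>)"
    unfolding conv_def F_def using conv_integrable[OF w cg] iF by simp
   also have "norm \<dots> \<le> (LBINT \<sigma>. (e' * (C * norm h)) * \<bar>w \<sigma>\<bar>)"
   proof (rule order_trans[OF integral_norm_bound integral_mono])
    show "integrable lborel (\<lambda>\<sigma>. norm (g (heis_mult y (- \<sigma>)) * w \<sigma> - g (?x \<sigma>) * w \<sigma> - ?G (?h \<sigma>) \<sigma> * w \<sigma>))"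
     by (intro integrable_norm Bochner_Integration.integrable_diff conv_integrable[OF w cg] iF)
    show "integrable lborel (\<lambda>\<sigma>. (e' * (C * norm h)) * \<bar>w \<sigma>\<bar>)"
     by (intro integrable_mult_right integrable_abs tame_integrable[OF w])
   qed (use ptw in auto)
   also have "\<dots> = (e' * (C * norm h)) * W" by (simp add: W_def)
   also have "\<dots> = e * (W / (W + 1)) * norm h"
   proof -
    have "e' * C = e / (W + 1)" using C by (simp add: e'_def)
    then have "(e' * C) * norm h * W = (e / (W + 1)) * norm h * W" by (simp only:)
    then show ?thesis by (simp add: mult_ac)
   qed
   also have "\<dots> \<le> e * 1 * norm h" using e W0 by (intro mult_right_mono mult_left_mono) auto
   finally show "norm (conv g w y - conv g w \<xi> - F (y - \<xi>)) \<le> e * norm (y - \<xi>)" by (simp add: h_def)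
  qed
 qed
 then show ?thesis unfolding Feq[abs_def, symmetric] by (simp add: Feq)
qed

text \<open>The induction keeps both g and w arbitrary, because one differentiation changes
  both.\<close>

lemma smooth_conv:
 fixes g :: "'n::finite heis => real"
 assumes "smooth g" "tame w"
 shows "smooth (conv g w)"
proof -
 have "Ck_on k UNIV (conv g w)" for k
  using assms
 proof (induction k arbitrary: g w)
  case 0
  have "conv g w differentiable (at x)" for x
   using conv_has_derivative[OF 0] unfolding differentiable_def by blast
  then show ?case by (simp add: differentiable_UNIV_continuous)
 next
  case (Suc k)
  show ?case
  proof (rule Ck_SucI[OF conv_has_derivative[OF Suc.prems]])
   show "Ck_on k UNIV (\<lambda>x. conv (\<lambda>x. frechet_derivative g (at x) v) w x
    + (- 1) * conv (\<lambda>x. frechet_derivative g (at x) tvec) (\<lambda>\<sigma>. omega v \<sigma> * w \<sigma>) x)" for v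
    by (intro Ck_add Ck_mult Ck_const Suc.IH smooth_deriv Suc.prems tame_mult_continuous continuous_omega)
  qed
 qed
 then show ?thesis by (simp add: smooth_def)
qed

lemma conv_eq:
 fixes g :: "'n::finite heis => real"
 assumes [measurable]: "g \<in> \<B>" "w \<in> \<B>"
 shows "conv g w \<xi> = (LBINT \<zeta>. g \<zeta> * w (heis_mult (- \<zeta>) \<xi>))"
proof -
 have "(LBINT \<zeta>. g \<zeta> * w (heis_mult (- \<zeta>) \<xi>)) = (LINT \<zeta>|distr lborel borel (\<lambda>\<sigma>. heis_mult \<xi> (- \<sigma>)). g \<zeta> * w (heis_mult (- \<zeta>) \<xi>))"
  by (simp add: lborel_distr_heis_mult_minus)
 also have "\<dots> = (LBINT \<sigma>. g (heis_mult \<xi> (- \<sigma>)) * w (heis_mult (- (heis_mult \<xi> (- \<sigma>))) \<xi>))"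
  by (rule integral_distr) measurable
 also have "\<dots> = conv g w \<xi>"
  by (simp add: conv_def heis_mult_uminus heis_mult_assoc)
 finally show ?thesis by simp
qed


section \<open>The energy form\<close>

lemma borel_measurable_fst' [measurable (raw)]:
 fixes f :: "'a => 'b::second_countable_topology \<times> 'c::second_countable_topology"
 shows "f \<in> borel_measurable M ==> (\<lambda>x. fst (f x)) \<in> borel_measurable M"
 by (rule borel_measurable_continuous_on[where f = fst]) (auto intro!: continuous_intros)

lemma borel_measurable_snd' [measurable (raw)]:
 fixes f :: "'a => 'b::second_countable_topology \<times> 'c::second_countable_topology"
 shows "f \<in> borel_measurable M ==> (\<lambda>x. snd (f x)) \<in> borel_measurable M"
 by (rule borel_measurable_continuous_on[where f = snd]) (auto intro!: continuous_intros)

lemma nn_integral_lborel_pair: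
 fixes f :: "'a::euclidean_space \<times> 'b::euclidean_space => ennreal"
 assumes "f \<in> \<B>"
 shows "(NNINT z. f z) = (NNINT x. (NNINT y. f (x, y)))"
proof -
 have "f \<in> borel_measurable (lborel \<Otimes>\<^sub>M lborel)" using assms by (simp add: lborel_prod)
 from lborel.nn_integral_fst[OF this] show ?thesis by (simp add: lborel_prod)
qed

lemma nn_integral_lborel_swap:
 fixes f :: "'a::euclidean_space \<times> 'b::euclidean_space => ennreal"
 assumes [measurable]: "f \<in> \<B>"
 shows "(NNINT z. f (snd z, fst z)) = (NNINT z. f z)"
proof -
 have [measurable]: "f \<in> borel_measurable (borel \<Otimes>\<^sub>M borel)" using assms by (simp add: borel_prod)
 have "(\<lambda>z::'b \<times> 'a. f (snd z, fst z)) \<in> \<B>" by measurable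
 then have "(NNINT z. f (snd z, fst z)) = (NNINT y. (NNINT x. f (x, y)))"
  by (subst nn_integral_lborel_pair) auto
 also have "\<dots> = (NNINT x. (NNINT y. f (x, y)))"
  by (rule lborel_pair.Fubini') measurable
 also have "\<dots> = (NNINT z. f z)" by (simp add: nn_integral_lborel_pair)
 finally show ?thesis .
qed

lemma lborel_distr_swap: "distr lborel borel (\<lambda>z. (snd z, fst z)) = (lborel :: ('a::euclidean_space \<times> 'a) measure)"
 by (rule distr_eq_lborelI) (auto simp: nn_integral_lborel_swap)

lemma nn_integral_heis_mult_pair:
 fixes f :: "'n::finite heis \<times> 'n heis => ennreal"
 assumes [measurable]: "f \<in> \<B>"
 shows "(NNINT z. f (heis_mult a (fst z), heis_mult a (snd z))) = (NNINT z. f z)"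
proof -
 have [measurable]: "f \<in> borel_measurable (borel \<Otimes>\<^sub>M borel)" using assms by (simp add: borel_prod)
 have "(\<lambda>z. f (heis_mult a (fst z), heis_mult a (snd z))) \<in> \<B>" by measurable
 then have "(NNINT z. f (heis_mult a (fst z), heis_mult a (snd z)))
  = (NNINT x. (NNINT y. f (heis_mult a x, heis_mult a y)))"
  by (subst nn_integral_lborel_pair) auto
 also have "\<dots> = (NNINT x. (NNINT y. f (heis_mult a x, y)))"
 proof (rule nn_integral_cong)
  fix x
  show "(NNINT y. f (heis_mult a x, heis_mult a y)) = (NNINT y. f (heis_mult a x, y))"
   by (rule nn_integral_heis_mult[of "\<lambda>y. f (heis_mult a x, y)"]) measurable
 qed
 also have "\<dots> = (NNINT x. (NNINT y. f (x, y)))"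
  by (rule nn_integral_heis_mult[of "\<lambda>x. NNINT y. f (x, y)"]) measurable
 also have "\<dots> = (NNINT z. f z)" by (simp add: nn_integral_lborel_pair)
 finally show ?thesis .
qed

text \<open>The tangent line of the convex function |x|^p at a, from Young's inequality with the
  conjugate exponent; this is the form in which Jensen's inequality uses convexity.\<close>

lemma powr_tangent:
 fixes a x p :: real assumes p: "1 < p"
 shows "\<bar>a\<bar> powr p + p * Jp p a * (x - a) \<le> \<bar>x\<bar> powr p"
proof -
 define q where "q = p / (p - 1)"
 have q: "1 < q" using p by (simp add: q_def)
 have pq: "1 / p + 1 / q = 1" using p by (simp add: q_def field_simps)
 have "\<bar>x\<bar> * \<bar>a\<bar> powr (p - 1) \<le> \<bar>x\<bar> powr p / p + (\<bar>a\<bar> powr (p - 1)) powr q / q"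
  using p q pq by (intro Youngs_inequality) auto
 also have "(\<bar>a\<bar> powr (p - 1)) powr q = \<bar>a\<bar> powr p" using p by (simp add: powr_powr q_def)
 finally have "p * (\<bar>x\<bar> * \<bar>a\<bar> powr (p - 1)) \<le> p * (\<bar>x\<bar> powr p / p + \<bar>a\<bar> powr p / q)"
  using p by (intro mult_left_mono) auto
 also have "\<dots> = \<bar>x\<bar> powr p + (p - 1) * \<bar>a\<bar> powr p" using p by (simp add: q_def field_simps)
 finally have 1: "p * (\<bar>x\<bar> * \<bar>a\<bar> powr (p - 1)) \<le> \<bar>x\<bar> powr p + (p - 1) * \<bar>a\<bar> powr p" .
 have "Jp p a * x \<le> \<bar>Jp p a * x\<bar>" by simp
 also have "\<dots> = \<bar>x\<bar> * \<bar>a\<bar> powr (p - 1)" by (simp add: abs_mult abs_Jp)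
 finally have 2: "p * (Jp p a * x) \<le> p * (\<bar>x\<bar> * \<bar>a\<bar> powr (p - 1))" using p by (intro mult_left_mono) auto
 have 3: "Jp p a * a = \<bar>a\<bar> powr p"
 proof -
  have "0 \<le> Jp p a * a" by (simp add: Jp_def mult.assoc)
  then have "Jp p a * a = \<bar>Jp p a\<bar> * \<bar>a\<bar>" by (simp only: abs_mult[symmetric] abs_of_nonneg)
  then show ?thesis using powr_mult_base[of "\<bar>a\<bar>" "p - 1"] by (simp add: abs_Jp mult.commute)
 qed
 have 4: "p * Jp p a * (x - a) = p * (Jp p a * x) - p * (Jp p a * a)" by (simp add: algebra_simps)
 show ?thesis using 1 2 unfolding 4 3 left_diff_distrib by linarith
qed

text \<open>(a - b) - (c - d) = (a - c) - (b - d), so both factors have the same sign: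
  \<open>Jp\<close> is increasing and so is the positive part.\<close>

lemma Jp_mono_product:
 assumes "1 < p"
 shows "0 \<le> (Jp p (a - b) - Jp p (c - d)) * (max 0 (a - c) - max 0 (b - d))"
proof (cases "c - d \<le> a - b")
 case True
 then have "0 \<le> Jp p (a - b) - Jp p (c - d)" using Jp_mono[OF assms True] by simp
 moreover have "0 \<le> max 0 (a - c) - max 0 (b - d)" using True by linarith
 ultimately show ?thesis by simp
next
 case False
 then have "Jp p (a - b) - Jp p (c - d) \<le> 0" using Jp_mono[OF assms, of "a - b" "c - d"] by simp
 moreover have "max 0 (a - c) - max 0 (b - d) \<le> 0" using False by linarith
 ultimately show ?thesis by (rule mult_nonpos_nonpos)
qed

section \<open>Even convolution kernels, their tail weight and their energy\<close>

locale kernel_data =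
 fixes p \<gamma> L :: real and k :: "'n::finite heis => real"
 assumes p: "1 < p" and \<gamma>: "hom_dim TYPE('n) < \<gamma>" and L: "0 \<le> L"
  and k_measurable [measurable]: "k \<in> \<B>" and k_nonneg: "0 \<le> k \<eta>"
  and k_even: "k (- \<eta>) = k \<eta>" and k_le: "k \<eta> \<le> L * heis_norm \<eta> powr (- \<gamma>)"
begin

definition kk :: "'n heis => 'n heis => real" where
 "kk \<xi> \<eta> = k (heis_mult (- \<eta>) \<xi>)"

lemma kk_measurable [measurable (raw)]:
 "f \<in> borel_measurable M ==> g \<in> borel_measurable M ==> (\<lambda>x. kk (f x) (g x)) \<in> borel_measurable M"
 unfolding kk_def by measurable

lemma kk_commute: "kk \<xi> \<eta> = kk \<eta> \<xi>"
 unfolding kk_def by (metis k_even heis_mult_uminus minus_minus)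

lemma kk_translate [simp]: "kk (heis_mult \<zeta> \<xi>) (heis_mult \<zeta> \<eta>) = kk \<xi> \<eta>"
 by (simp add: kk_def)

lemma kk_nonneg [simp]: "0 \<le> kk \<xi> \<eta>"
 by (simp add: kk_def k_nonneg)

lemma kk_le: "kk \<xi> \<eta> \<le> L * heis_dist \<xi> \<eta> powr (- \<gamma>)"
 using k_le by (simp add: kk_def heis_dist_def)

definition weight :: "'n heis => real" where
 "weight \<eta> = 1 / (1 + heis_norm \<eta> powr \<gamma>)"

lemma weight_measurable [measurable]: "weight \<in> \<B>"
 unfolding weight_def by measurable

lemma weight_pos: "0 < weight \<eta>"
 by (simp add: weight_def add_pos_nonneg)

lemma \<gamma>_pos: "0 < \<gamma>"
 using \<gamma> hom_dim_ge[where 'n = 'n] by linarith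

lemma weight_integral: "(NNINT \<eta>. ennreal (weight \<eta>)) < \<infinity>"
proof -
 obtain C where C: "0 \<le> C" "\<And>R. 0 < R ==>
  (NNINT (\<xi>::'n heis). ennreal (heis_norm \<xi> powr ((hom_dim TYPE('n) - \<gamma>) - hom_dim TYPE('n))) * indicator {\<xi>. R \<le> heis_norm \<xi>} \<xi>)
   \<le> ennreal (C * R powr (hom_dim TYPE('n) - \<gamma>))"
  using nn_integral_heis_norm_powr[of "hom_dim TYPE('n) - \<gamma>", where 'n = 'n] \<gamma> by (auto cong: if_cong)
 have "(NNINT \<eta>. ennreal (weight \<eta>)) \<le> (NNINT \<eta>. indicator {\<eta>::'n heis. heis_norm \<eta> \<le> 1} \<eta>
  + ennreal (heis_norm \<eta> powr ((hom_dim TYPE('n) - \<gamma>) - hom_dim TYPE('n))) * indicator {\<eta>. 1 \<le> heis_norm \<eta>} \<eta>)"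
 proof (intro nn_integral_mono)
  fix \<eta> :: "'n heis"
  show "ennreal (weight \<eta>) \<le> indicator {\<eta>. heis_norm \<eta> \<le> 1} \<eta>
  + ennreal (heis_norm \<eta> powr ((hom_dim TYPE('n) - \<gamma>) - hom_dim TYPE('n))) * indicator {\<eta>. 1 \<le> heis_norm \<eta>} \<eta>"
  proof (cases "heis_norm \<eta> \<le> 1")
   case True
   have "weight \<eta> \<le> 1" unfolding weight_def by (simp add: divide_le_eq add_pos_nonneg)
   then have "ennreal (weight \<eta>) \<le> 1" by (metis ennreal_1 ennreal_leI)
   then show ?thesis using True by (simp add: add_increasing2)
  next
   case False
   have "weight \<eta> \<le> 1 / heis_norm \<eta> powr \<gamma>"
    unfolding weight_def using False by (intro divide_left_mono) (auto intro!: mult_pos_pos add_pos_nonneg)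
   then have "weight \<eta> \<le> heis_norm \<eta> powr ((hom_dim TYPE('n) - \<gamma>) - hom_dim TYPE('n))"
    by (simp add: powr_minus_divide)
   then show ?thesis using False by (simp add: ennreal_leI)
  qed
 qed
 also have "\<dots> = emeasure lborel {\<eta>::'n heis. heis_norm \<eta> \<le> 1}
  + (NNINT \<eta>. ennreal (heis_norm \<eta> powr ((hom_dim TYPE('n) - \<gamma>) - hom_dim TYPE('n))) * indicator {\<eta>::'n heis. 1 \<le> heis_norm \<eta>} \<eta>)"
  by (subst nn_integral_add) auto
 also have "\<dots> < \<infinity>"
 proof -
  have "emeasure lborel {\<eta>::'n heis. heis_norm \<eta> \<le> 1} < \<infinity>"
   using compact_heis_cball[of 0 1] by (auto dest!: compact_imp_bounded emeasure_bounded_finite)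
  moreover have "(NNINT \<eta>. ennreal (heis_norm \<eta> powr ((hom_dim TYPE('n) - \<gamma>) - hom_dim TYPE('n))) * indicator {\<eta>::'n heis. 1 \<le> heis_norm \<eta>} \<eta>) < \<infinity>"
   using C(2)[of 1] by (auto intro: le_less_trans)
  ultimately show ?thesis by (simp add: less_top[symmetric])
 qed
 finally show ?thesis .
qed

text \<open>For \<xi> in a fixed ball and d \<ge> \<epsilon> the distance d from \<xi> to \<eta>
  satisfies 1 + |\<eta>| \<le> (1 + B / \<epsilon>) d. The far kernel is thus dominated by one
  weight for all these \<xi>, which makes dominated convergence in \<xi> possible.\<close>

lemma weight_bound:
 assumes \<epsilon>: "0 < \<epsilon>"
 obtains C where "0 \<le> C" "\<And>\<xi> \<eta>. heis_dist \<xi> x0 \<le> A ==> \<epsilon> \<le> heis_dist \<xi> \<eta> ==> heis_dist \<xi> \<eta> powr (- \<gamma>) \<le> C * weight \<eta>"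
proof -
 define B where "B = 1 + heis_norm x0 + \<bar>A\<bar>"
 have B: "1 \<le> B" by (simp add: B_def)
 define m where "m = 1 + B / \<epsilon>"
 have m: "0 < m" using B \<epsilon> by (simp add: m_def add_pos_pos)
 show ?thesis
 proof (rule that[of "2 * m powr \<gamma>"])
  show "0 \<le> 2 * m powr \<gamma>" by simp
  fix \<xi> \<eta> :: "'n heis" assume d: "heis_dist \<xi> x0 \<le> A" "\<epsilon> \<le> heis_dist \<xi> \<eta>"
  let ?d = "heis_dist \<xi> \<eta>" and ?N = "heis_norm \<eta>"
  have dp: "0 < ?d" using d \<epsilon> by linarith
  have "?N \<le> heis_dist \<eta> \<xi> + heis_dist \<xi> 0" using heis_dist_triangle[of \<eta> 0 \<xi>] by simp
  moreover have "heis_dist \<xi> 0 \<le> heis_dist \<xi> x0 + heis_dist x0 0" by (rule heis_dist_triangle)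
  ultimately have "1 + ?N \<le> ?d + B" using d by (simp add: B_def heis_dist_commute[of \<eta> \<xi>])
  also have "\<dots> \<le> ?d + B / \<epsilon> * ?d"
  proof -
   have "B / \<epsilon> * \<epsilon> \<le> B / \<epsilon> * ?d" using d B \<epsilon> by (intro mult_left_mono) auto
   then show ?thesis using \<epsilon> by simp
  qed
  also have "\<dots> = m * ?d" by (simp add: m_def algebra_simps)
  finally have le: "1 + ?N \<le> m * ?d" .
  have "1 \<le> (1 + ?N) powr \<gamma>" using \<gamma>_pos by (intro ge_one_powr_ge_zero) auto
  moreover have "?N powr \<gamma> \<le> (1 + ?N) powr \<gamma>" using \<gamma>_pos by (intro powr_mono2) auto
  ultimately have "1 + ?N powr \<gamma> \<le> 2 * (1 + ?N) powr \<gamma>" by linarith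
  also have "\<dots> \<le> 2 * (m * ?d) powr \<gamma>" using le \<gamma>_pos by (intro mult_left_mono powr_mono2) auto
  also have "\<dots> = 2 * m powr \<gamma> * ?d powr \<gamma>" using m by (simp add: powr_mult)
  finally have "1 + ?N powr \<gamma> \<le> 2 * m powr \<gamma> * ?d powr \<gamma>" .
  then have "1 / ?d powr \<gamma> \<le> 2 * m powr \<gamma> / (1 + ?N powr \<gamma>)"
   using dp by (simp add: divide_simps add_pos_nonneg)
  then show "?d powr (- \<gamma>) \<le> 2 * m powr \<gamma> * weight \<eta>"
   by (simp add: weight_def powr_minus_divide)
 qed
qed

lemma weight_lower:
 obtains c where "0 < c" "\<And>\<eta>. heis_dist \<eta> x0 \<le> A ==> c \<le> weight \<eta>"
proof (rule that[of "1 / (1 + (\<bar>A\<bar> + heis_norm x0) powr \<gamma>)"])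
 show "0 < 1 / (1 + (\<bar>A\<bar> + heis_norm x0) powr \<gamma>)" by (simp add: add_pos_nonneg)
 fix \<eta> assume "heis_dist \<eta> x0 \<le> A"
 then have "heis_norm \<eta> \<le> \<bar>A\<bar> + heis_norm x0" using heis_dist_triangle[of \<eta> 0 x0] by simp
 then have "heis_norm \<eta> powr \<gamma> \<le> (\<bar>A\<bar> + heis_norm x0) powr \<gamma>" using \<gamma>_pos by (intro powr_mono2) auto
 then show "1 / (1 + (\<bar>A\<bar> + heis_norm x0) powr \<gamma>) \<le> weight \<eta>"
  unfolding weight_def by (intro divide_left_mono) (auto intro!: mult_pos_pos add_pos_nonneg)
qed

abbreviation tail :: "('n heis => real) => ennreal" where
 "tail u \<equiv> NNINT \<eta>. ennreal (\<bar>u \<eta>\<bar> powr (p - 1) * weight \<eta>)"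

abbreviation local_energy :: "('n heis => real) => 'n heis => real => ennreal" where
 "local_energy u x0 r \<equiv> NNINT z. ennreal (\<bar>u (fst z) - u (snd z)\<bar> powr p * kk (fst z) (snd z))
  * indicator {z. heis_dist (fst z) x0 < r \<and> heis_dist (snd z) x0 < r} z"

definition energy :: "('n heis => real) => ennreal" where
 "energy w = (NNINT z. ennreal (\<bar>w (fst z) - w (snd z)\<bar> powr p * kk (fst z) (snd z)))"

text \<open>Integrates the tangent inequality at the mean a, whose linear term averages to
  zero.\<close>

lemma jensen_conv:
 fixes \<rho> X :: "'n heis => real"
 assumes \<rho>: "tame \<rho>" "\<And>x. 0 \<le> \<rho> x" "(LBINT x. \<rho> x) = 1"
  and [measurable]: "X \<in> \<B>" and b: "\<And>x. \<bar>X x\<bar> \<le> b"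
 shows "ennreal (\<bar>LBINT x. \<rho> x * X x\<bar> powr p) \<le> (NNINT x. ennreal (\<rho> x * \<bar>X x\<bar> powr p))"
proof -
 have [measurable]: "\<rho> \<in> \<B>" using \<rho>(1) by (rule tame_measurable)
 have i0: "integrable lborel \<rho>" using \<rho>(1) by (rule tame_integrable)
 have bnd: "integrable lborel (\<lambda>x. \<rho> x * Y x)" if [measurable]: "Y \<in> \<B>" and "\<And>x. \<bar>Y x\<bar> \<le> c" for Y c
 proof (rule Bochner_Integration.integrable_bound)
  show "integrable lborel (\<lambda>x. c * \<rho> x)" using i0 by simp
  show "AE x in lborel. norm (\<rho> x * Y x) \<le> norm (c * \<rho> x)"
  proof (rule AE_I2)
   fix x
   have "\<bar>Y x\<bar> * \<rho> x \<le> c * \<rho> x" using that(2)[of x] \<rho>(2)[of x] by (rule mult_right_mono)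
   then show "norm (\<rho> x * Y x) \<le> norm (c * \<rho> x)" using \<rho>(2)[of x] mult_right_mono[OF abs_ge_self[of c] \<rho>(2)[of x]]
    by (simp add: abs_mult mult.commute)
  qed
 qed simp
 define a where "a = (LBINT x. \<rho> x * X x)"
 have iX: "integrable lborel (\<lambda>x. \<rho> x * X x)" by (rule bnd[OF _ b]) simp
 have iP: "integrable lborel (\<lambda>x. \<rho> x * \<bar>X x\<bar> powr p)"
  by (rule bnd[of _ "\<bar>b\<bar> powr p"]) (use p b in \<open>auto intro!: powr_mono2 intro: order_trans[OF _ abs_ge_self]\<close>)
 have "\<bar>a\<bar> powr p = (LBINT x. (\<bar>a\<bar> powr p - p * Jp p a * a) * \<rho> x + (p * Jp p a) * (\<rho> x * X x))"
  using i0 iX \<rho>(3) by (simp add: a_def[symmetric])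
 also have "\<dots> \<le> (LBINT x. \<rho> x * \<bar>X x\<bar> powr p)"
 proof (rule integral_mono)
  show "integrable lborel (\<lambda>x. (\<bar>a\<bar> powr p - p * Jp p a * a) * \<rho> x + (p * Jp p a) * (\<rho> x * X x))"
   using i0 iX by simp
  fix x
  have "\<rho> x * (\<bar>a\<bar> powr p + p * Jp p a * (X x - a)) \<le> \<rho> x * \<bar>X x\<bar> powr p"
   by (intro mult_left_mono powr_tangent p \<rho>)
  then show "(\<bar>a\<bar> powr p - p * Jp p a * a) * \<rho> x + (p * Jp p a) * (\<rho> x * X x) \<le> \<rho> x * \<bar>X x\<bar> powr p"
   by (simp add: algebra_simps)
 qed (rule iP)
 finally have "ennreal (\<bar>a\<bar> powr p) \<le> ennreal (LBINT x. \<rho> x * \<bar>X x\<bar> powr p)" by (rule ennreal_leI)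
 also have "\<dots> = (NNINT x. ennreal (\<rho> x * \<bar>X x\<bar> powr p))"
  using iP \<rho>(2) by (subst nn_integral_eq_integral) auto
 finally show ?thesis by (simp add: a_def)
qed

text \<open>The convolution is an average of left translates of w, all of the same energy by left
  invariance of the kernel and of the measure; convexity of the p-th power does the rest.\<close>

lemma energy_conv_le:
 assumes \<rho>: "tame \<rho>" "\<And>x. 0 \<le> \<rho> x" "(LBINT x. \<rho> x) = 1" "continuous_on UNIV \<rho>"
  and w: "tame w"
 shows "energy (conv \<rho> w) \<le> energy w"
proof -
 have [measurable]: "\<rho> \<in> \<B>" "w \<in> \<B>"
  using \<rho>(1) w by (auto intro: tame_measurable)
 obtain b where bA: "0 < b" "\<And>x. \<bar>w x\<bar> \<le> b" by (rule tame_bounds[OF w]) (rule that)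
 let ?X = "\<lambda>z \<zeta>. w (heis_mult (- \<zeta>) (fst z)) - w (heis_mult (- \<zeta>) (snd z))"
 have conv_diff: "conv \<rho> w \<xi> - conv \<rho> w \<eta> = (LBINT \<zeta>. \<rho> \<zeta> * ?X (\<xi>, \<eta>) \<zeta>)" for \<xi> \<eta>
 proof -
  have i: "integrable lborel (\<lambda>\<zeta>. \<rho> \<zeta> * w (heis_mult (- \<zeta>) \<xi>))" for \<xi>
  proof (rule Bochner_Integration.integrable_bound)
   show "integrable lborel (\<lambda>x. b * \<rho> x)" using tame_integrable[OF \<rho>(1)] by simp
   show "AE x in lborel. norm (\<rho> x * w (heis_mult (- x) \<xi>)) \<le> norm (b * \<rho> x)"
   proof (rule AE_I2)
    fix x
    have "\<bar>w (heis_mult (- x) \<xi>)\<bar> * \<rho> x \<le> b * \<rho> x" using bA(2) \<rho>(2)[of x] by (rule mult_right_mono)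
    then show "norm (\<rho> x * w (heis_mult (- x) \<xi>)) \<le> norm (b * \<rho> x)" using \<rho>(2)[of x] bA by (simp add: abs_mult mult.commute)
   qed
  qed measurable
  show ?thesis by (simp add: conv_eq right_diff_distrib i)
 qed
 have "energy (conv \<rho> w) = (NNINT z. ennreal (\<bar>LBINT \<zeta>. \<rho> \<zeta> * ?X z \<zeta>\<bar> powr p * kk (fst z) (snd z)))"
  unfolding energy_def conv_diff by simp
 also have "\<dots> \<le> (NNINT z. (NNINT \<zeta>. ennreal (\<rho> \<zeta>) * ennreal (\<bar>?X z \<zeta>\<bar> powr p * kk (fst z) (snd z))))"
 proof (intro nn_integral_mono)
  fix z :: "'n heis \<times> 'n heis"
  have b2: "\<bar>?X z x\<bar> \<le> 2 * b" for x
   using bA(2)[of "heis_mult (- x) (fst z)"] bA(2)[of "heis_mult (- x) (snd z)"] by linarith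
  have "ennreal (\<bar>LBINT \<zeta>. \<rho> \<zeta> * ?X z \<zeta>\<bar> powr p * kk (fst z) (snd z))
   = ennreal (\<bar>LBINT \<zeta>. \<rho> \<zeta> * ?X z \<zeta>\<bar> powr p) * ennreal (kk (fst z) (snd z))"
   by (simp add: ennreal_mult)
  also have "\<dots> \<le> (NNINT \<zeta>. ennreal (\<rho> \<zeta> * \<bar>?X z \<zeta>\<bar> powr p)) * ennreal (kk (fst z) (snd z))"
   by (intro mult_right_mono jensen_conv[OF \<rho>(1-3) _ b2]) auto
  also have "\<dots> = (NNINT \<zeta>. ennreal (\<rho> \<zeta> * \<bar>?X z \<zeta>\<bar> powr p) * ennreal (kk (fst z) (snd z)))"
   by (rule nn_integral_multc[symmetric]) measurable
  also have "\<dots> = (NNINT \<zeta>. ennreal (\<rho> \<zeta>) * ennreal (\<bar>?X z \<zeta>\<bar> powr p * kk (fst z) (snd z)))"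
   using \<rho>(2) by (intro nn_integral_cong) (simp add: ennreal_mult mult.assoc)
  finally show "ennreal (\<bar>LBINT \<zeta>. \<rho> \<zeta> * ?X z \<zeta>\<bar> powr p * kk (fst z) (snd z))
   \<le> (NNINT \<zeta>. ennreal (\<rho> \<zeta>) * ennreal (\<bar>?X z \<zeta>\<bar> powr p * kk (fst z) (snd z)))" .
 qed
 also have "\<dots> = (NNINT \<zeta>. (NNINT z. ennreal (\<rho> \<zeta>) * ennreal (\<bar>?X z \<zeta>\<bar> powr p * kk (fst z) (snd z))))"
  by (rule lborel_pair.Fubini') (simp add: lborel_prod split_beta')
 also have "\<dots> = (NNINT \<zeta>. ennreal (\<rho> \<zeta>) * energy w)"
 proof (rule nn_integral_cong)
  fix \<zeta> :: "'n heis"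
  have "(NNINT z. ennreal (\<rho> \<zeta>) * ennreal (\<bar>?X z \<zeta>\<bar> powr p * kk (fst z) (snd z)))
   = ennreal (\<rho> \<zeta>) * (NNINT z. ennreal (\<bar>?X z \<zeta>\<bar> powr p * kk (fst z) (snd z)))"
   by (rule nn_integral_cmult) measurable
  also have "(NNINT z. ennreal (\<bar>?X z \<zeta>\<bar> powr p * kk (fst z) (snd z)))
   = (NNINT z. ennreal (\<bar>?X z \<zeta>\<bar> powr p * kk (heis_mult (- \<zeta>) (fst z)) (heis_mult (- \<zeta>) (snd z))))"
   by simp
  also have "\<dots> = energy w"
   unfolding energy_def
   using nn_integral_heis_mult_pair[of "\<lambda>z. ennreal (\<bar>w (fst z) - w (snd z)\<bar> powr p * kk (fst z) (snd z))" "- \<zeta>"] by simp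
  finally show "(NNINT z. ennreal (\<rho> \<zeta>) * ennreal (\<bar>?X z \<zeta>\<bar> powr p * kk (fst z) (snd z))) = ennreal (\<rho> \<zeta>) * energy w" .
 qed
 also have "\<dots> = (NNINT \<zeta>. ennreal (\<rho> \<zeta>)) * energy w" by (rule nn_integral_multc) measurable
 also have "(NNINT \<zeta>. ennreal (\<rho> \<zeta>)) = 1"
  using tame_integrable[OF \<rho>(1)] \<rho>(2,3) by (subst nn_integral_eq_integral) auto
 finally show ?thesis by simp
qed

end


section \<open>Mollification of semicontinuous test functions\<close>

lemma tameI:
 fixes w :: "'n::finite heis => real"
 assumes "w \<in> \<B>" "\<And>x. \<bar>w x\<bar> \<le> b" "\<And>x. \<rho> < heis_dist x x0 ==> w x = 0"
 shows "tame w"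
proof -
 have "bounded {x. heis_dist x x0 \<le> \<rho>}" by (rule compact_imp_bounded[OF compact_heis_cball])
 then obtain A where A: "\<And>x. heis_dist x x0 \<le> \<rho> ==> norm x \<le> A" by (auto simp: bounded_iff)
 have "w x = 0" if "A < norm x" for x
 proof (rule assms(3), rule ccontr)
  assume "\<not> \<rho> < heis_dist x x0"
  then have "norm x \<le> A" by (intro A) simp
  then show False using that by simp
 qed
 then show ?thesis unfolding tame_def using assms(1,2) by blast
qed

lemma heis_norm_small:
 assumes "norm x \<le> s" "s \<le> 1" "2 * s\<^sup>2 \<le> \<rho> ^ 4" "0 \<le> \<rho>"
 shows "heis_norm x \<le> \<rho>"
proof -
 have s: "0 \<le> s" using assms(1) norm_ge_zero order_trans by blast
 have "(norm (horiz x))\<^sup>2 \<le> (norm x)\<^sup>2" "(vert x)\<^sup>2 \<le> (norm x)\<^sup>2" by (simp_all add: norm_heis_sq)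
 moreover have "(norm x)\<^sup>2 \<le> s\<^sup>2" using assms(1) by (intro power_mono) auto
 ultimately have h: "(norm (horiz x))\<^sup>2 \<le> s\<^sup>2" "(vert x)\<^sup>2 \<le> s\<^sup>2" by linarith+
 have "((norm (horiz x))\<^sup>2)\<^sup>2 \<le> (s\<^sup>2)\<^sup>2" by (rule power_mono[OF h(1)]) simp
 also have "(s\<^sup>2)\<^sup>2 \<le> s\<^sup>2" using s assms(2) by (simp add: power_decreasing)
 finally have "norm (horiz x) ^ 4 \<le> s\<^sup>2" by simp
 then have "heis_norm x ^ 4 \<le> \<rho> ^ 4" unfolding heis_norm_pow4 using h assms(3) by linarith
 then show ?thesis using assms(4) by (simp add: power_mono_iff)
qed

lemma heis_dist_left_mult: "heis_dist (heis_mult \<zeta> \<sigma>) \<sigma> = heis_norm (\<zeta> + (0, 0, 2 * omega \<zeta> \<sigma>))"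
proof -
 have "heis_mult (- \<sigma>) (heis_mult \<zeta> \<sigma>) = \<zeta> + (0, 0, 2 * omega \<zeta> \<sigma>)"
  by (simp add: heis_mult_eq omega_def prod_eq_iff inner_add_left inner_add_right inner_commute)
 then show ?thesis by (simp add: heis_dist_def)
qed

lemma norm_vertical: "norm ((0, 0, t) :: 'n::finite heis) = \<bar>t\<bar>"
 by (simp add: norm_Pair)

text \<open>Mollification moves points by left factors, while the metric is invariant only when both
  points are moved. The distance from \<open>heis_mult \<zeta> \<sigma>\<close> to \<sigma> contains
  omega \<zeta> \<sigma>, so it is small uniformly only for \<sigma> in a bounded set.\<close>

lemma left_translate_close:
 fixes x0 :: "'n::finite heis"
 assumes \<rho>: "0 < \<rho>"
 shows "\<exists>\<delta>>0. \<forall>\<zeta> \<sigma>. norm \<zeta> \<le> \<delta> \<and> heis_dist \<sigma> x0 \<le> \<rho> --> heis_dist (heis_mult \<zeta> \<sigma>) x0 \<le> 2 * \<rho>"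
proof -
 have "bounded {x. heis_dist x x0 \<le> \<rho>}" by (rule compact_imp_bounded[OF compact_heis_cball])
 then obtain A0 where A0: "\<And>x. heis_dist x x0 \<le> \<rho> ==> norm x \<le> A0" by (auto simp: bounded_iff)
 define A where "A = max 0 A0"
 have A: "0 \<le> A" "\<And>x. heis_dist x x0 \<le> \<rho> ==> norm x \<le> A" using A0 by (auto simp: A_def le_max_iff_disj)
 define s where "s = min 1 (\<rho>\<^sup>2 / 2)"
 have s: "0 < s" "s \<le> 1" using \<rho> by (auto simp: s_def)
 have "s\<^sup>2 \<le> (\<rho>\<^sup>2 / 2)\<^sup>2" using s by (intro power_mono) (auto simp: s_def)
 also have "\<dots> = \<rho> ^ 4 / 4" by (simp add: power_divide)
 finally have s2: "2 * s\<^sup>2 \<le> \<rho> ^ 4" using zero_le_power2[of s] by linarith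
 \<comment> \<open>The displacement has Euclidean norm at most (1 + 8 A) |\<zeta>|, and Euclidean
   norm s still gives homogeneous norm at most \<rho>.\<close>
 define \<delta> where "\<delta> = s / (1 + 8 * A)"
 have \<delta>: "0 < \<delta>" using s A by (simp add: \<delta>_def add_pos_nonneg)
 show ?thesis
 proof (intro exI[of _ \<delta>] conjI \<delta> allI impI; elim conjE)
  fix \<zeta> \<sigma> :: "'n heis" assume z: "norm \<zeta> \<le> \<delta>" and d: "heis_dist \<sigma> x0 \<le> \<rho>"
  have "norm (\<zeta> + (0, 0, 2 * omega \<zeta> \<sigma>)) \<le> norm \<zeta> + 2 * \<bar>omega \<zeta> \<sigma>\<bar>"
   using norm_triangle_ineq[of \<zeta> "(0, 0, 2 * omega \<zeta> \<sigma>)"] norm_vertical[of "2 * omega \<zeta> \<sigma>", where 'n = 'n]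
   by (simp add: abs_mult)
  also have "\<dots> \<le> norm \<zeta> + 2 * (4 * norm \<zeta> * norm \<sigma>)" by (intro add_left_mono mult_left_mono abs_omega_le) simp
  also have "\<dots> \<le> norm \<zeta> + 2 * (4 * norm \<zeta> * A)" using A(2)[OF d] by (intro add_left_mono mult_left_mono) auto
  also have "\<dots> = norm \<zeta> * (1 + 8 * A)" by (simp add: algebra_simps)
  also have "\<dots> \<le> \<delta> * (1 + 8 * A)" using z A by (intro mult_right_mono) auto
  also have "\<dots> = s" using A by (simp add: \<delta>_def)
  finally have "heis_norm (\<zeta> + (0, 0, 2 * omega \<zeta> \<sigma>)) \<le> \<rho>"
   by (rule heis_norm_small) (use s s2 \<rho> in auto)
  then show "heis_dist (heis_mult \<zeta> \<sigma>) x0 \<le> 2 * \<rho>"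
   using heis_dist_triangle[of "heis_mult \<zeta> \<sigma>" x0 \<sigma>] d unfolding heis_dist_left_mult by linarith
 qed
qed

lemma AE_notin_open:
 fixes S :: "'a::euclidean_space set"
 assumes "AE x in lborel. x \<notin> S" "open S"
 shows "S = {}"
proof (rule ccontr)
 assume "S \<noteq> {}"
 then have "\<not> negligible S" using open_not_negligible assms(2) by blast
 moreover have "S \<in> null_sets lborel"
  using assms by (subst (asm) AE_iff_null_sets[symmetric]) auto
 then have "S \<in> null_sets lebesgue" by (rule null_sets_completionI)
 ultimately show False by (simp add: negligible_iff_null_sets)
qed

lemma mollifier_exists:
 assumes \<delta>: "0 < \<delta>"
 obtains \<rho> :: "'a::euclidean_space => real" where "smooth \<rho>" "tame \<rho>" "\<And>x. 0 \<le> \<rho> x"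
  "\<And>x. \<delta> \<le> norm x ==> \<rho> x = 0" "(LBINT x. \<rho> x) = 1"
proof -
 let ?b = "bump 0 (\<delta>\<^sup>2) :: 'a => real"
 have sm: "smooth ?b" by (simp add: smooth_def Ck_bump)
 have z: "?b x = 0" if "\<delta> \<le> norm x" for x
 proof (rule bump_eq_0)
  have "\<delta>\<^sup>2 \<le> (norm x)\<^sup>2" using that \<delta> by (intro power_mono) auto
  then show "\<delta>\<^sup>2 \<le> x \<bullet> x" by (simp add: dot_square_norm)
 qed
 have [measurable]: "?b \<in> \<B>" by (intro borel_measurable_continuous_onI smooth_continuous sm)
 have le1: "\<bar>?b x\<bar> \<le> 1" for x
  using bump_nonneg[of 0 "\<delta>\<^sup>2" x] by (simp add: bump_def flat_def)
 have tm: "tame ?b" unfolding tame_def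
 proof (intro conjI)
  show "\<exists>b. \<forall>x. \<bar>?b x\<bar> \<le> b" using le1 by blast
  show "\<exists>A. \<forall>x. A < norm x --> ?b x = 0" using z by (meson less_imp_le)
 qed simp
 define c where "c = (LBINT x. ?b x)"
 have "c \<noteq> 0"
 proof
  assume "c = 0"
  then have "AE x in lborel. ?b x = 0"
   using integral_nonneg_eq_0_iff_AE[OF tame_integrable[OF tm]] bump_nonneg by (auto simp: c_def)
  then have "AE x in lborel. x \<notin> ball (0::'a) \<delta>"
  proof (eventually_elim)
   case (elim x)
   show ?case
   proof
    assume "x \<in> ball 0 \<delta>"
    then have "(norm x)\<^sup>2 < \<delta>\<^sup>2" by (intro power_strict_mono) auto
    then have "0 < ?b x" by (intro bump_pos) (simp add: dot_square_norm)
    then show False using elim by simp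
   qed
  qed
  then have "ball (0::'a) \<delta> = {}" by (rule AE_notin_open) simp
  then show False using \<delta> by simp
 qed
 moreover have "0 \<le> c" unfolding c_def by (intro integral_nonneg_AE AE_I2 bump_nonneg)
 ultimately have c: "0 < c" by simp
 show ?thesis
 proof (rule that[of "\<lambda>x. (1 / c) * ?b x"])
  show "smooth (\<lambda>x. (1 / c) * ?b x)" by (intro smooth_mult smooth_const sm)
  show "tame (\<lambda>x. (1 / c) * ?b x)" by (rule tame_mult_continuous[OF tm]) simp
  show "(LBINT x. (1 / c) * ?b x) = 1" using c by (simp add: c_def[symmetric])
  show "0 \<le> (1 / c) * ?b x" for x by (intro mult_nonneg_nonneg bump_nonneg) (use c in simp)
 qed (use z in auto)
qed

lemma conv_integral:
 fixes \<rho> w :: "'n::finite heis => real"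
 assumes \<rho>: "tame \<rho>" "\<And>x. 0 \<le> \<rho> x" "(LBINT x. \<rho> x) = 1" and w: "tame w" "\<And>x. 0 \<le> w x"
 shows "(NNINT \<xi>. ennreal (conv \<rho> w \<xi>)) = (NNINT \<xi>. ennreal (w \<xi>))"
proof -
 have [measurable]: "\<rho> \<in> \<B>" "w \<in> \<B>"
  using \<rho>(1) w(1) by (auto intro: tame_measurable)
 obtain b where b: "0 < b" "\<And>x. \<bar>w x\<bar> \<le> b" by (rule tame_bounds[OF w(1)]) (rule that)
 have eq: "ennreal (conv \<rho> w \<xi>) = (NNINT \<zeta>. ennreal (\<rho> \<zeta>) * ennreal (w (heis_mult (- \<zeta>) \<xi>)))" for \<xi>
 proof -
  have i: "integrable lborel (\<lambda>\<zeta>. \<rho> \<zeta> * w (heis_mult (- \<zeta>) \<xi>))"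
  proof (rule Bochner_Integration.integrable_bound)
   show "integrable lborel (\<lambda>x. b * \<rho> x)" using tame_integrable[OF \<rho>(1)] by simp
   show "AE x in lborel. norm (\<rho> x * w (heis_mult (- x) \<xi>)) \<le> norm (b * \<rho> x)"
   proof (rule AE_I2)
    fix x
    have "\<bar>w (heis_mult (- x) \<xi>)\<bar> * \<rho> x \<le> b * \<rho> x" using b(2) \<rho>(2)[of x] by (rule mult_right_mono)
    then show "norm (\<rho> x * w (heis_mult (- x) \<xi>)) \<le> norm (b * \<rho> x)" using \<rho>(2)[of x] b by (simp add: abs_mult mult.commute)
   qed
  qed measurable
  have "ennreal (conv \<rho> w \<xi>) = ennreal (LBINT \<zeta>. \<rho> \<zeta> * w (heis_mult (- \<zeta>) \<xi>))" by (simp add: conv_eq)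
  also have "\<dots> = (NNINT \<zeta>. ennreal (\<rho> \<zeta> * w (heis_mult (- \<zeta>) \<xi>)))"
   using i \<rho>(2) w(2) by (subst nn_integral_eq_integral) auto
  also have "\<dots> = (NNINT \<zeta>. ennreal (\<rho> \<zeta>) * ennreal (w (heis_mult (- \<zeta>) \<xi>)))"
   using \<rho>(2) w(2) by (intro nn_integral_cong) (simp add: ennreal_mult)
  finally show ?thesis .
 qed
 have "(NNINT \<xi>. ennreal (conv \<rho> w \<xi>)) = (NNINT \<zeta>. (NNINT \<xi>. ennreal (\<rho> \<zeta>) * ennreal (w (heis_mult (- \<zeta>) \<xi>))))"
  unfolding eq by (rule lborel_pair.Fubini') (simp add: lborel_prod split_beta')
 also have "\<dots> = (NNINT \<zeta>. ennreal (\<rho> \<zeta>) * (NNINT \<xi>. ennreal (w \<xi>)))"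
 proof (rule nn_integral_cong)
  fix \<zeta> :: "'n heis"
  show "(NNINT \<xi>. ennreal (\<rho> \<zeta>) * ennreal (w (heis_mult (- \<zeta>) \<xi>))) = ennreal (\<rho> \<zeta>) * (NNINT \<xi>. ennreal (w \<xi>))"
   by (subst nn_integral_cmult) (auto simp: nn_integral_heis_mult[of "\<lambda>x. ennreal (w x)"])
 qed
 also have "\<dots> = (NNINT \<zeta>. ennreal (\<rho> \<zeta>)) * (NNINT \<xi>. ennreal (w \<xi>))" by (rule nn_integral_multc) measurable
 also have "(NNINT \<zeta>. ennreal (\<rho> \<zeta>)) = 1"
  using tame_integrable[OF \<rho>(1)] \<rho>(2,3) by (subst nn_integral_eq_integral) auto
 finally show ?thesis by simp
qed

lemma conv_bounds:
 fixes \<rho> w :: "'n::finite heis => real"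
 assumes \<rho>: "tame \<rho>" "\<And>x. 0 \<le> \<rho> x" "(LBINT x. \<rho> x) = 1" and w: "tame w"
  and le: "\<And>\<zeta>. \<rho> \<zeta> \<noteq> 0 ==> 0 \<le> w (heis_mult (- \<zeta>) \<xi>) \<and> w (heis_mult (- \<zeta>) \<xi>) \<le> c"
 shows "0 \<le> conv \<rho> w \<xi>" "conv \<rho> w \<xi> \<le> c"
proof -
 have [measurable]: "\<rho> \<in> \<B>" "w \<in> \<B>"
  using \<rho>(1) w(1) by (auto intro: tame_measurable)
 have eq: "conv \<rho> w \<xi> = (LBINT \<zeta>. \<rho> \<zeta> * w (heis_mult (- \<zeta>) \<xi>))" by (simp add: conv_eq)
 have nn: "0 \<le> \<rho> \<zeta> * w (heis_mult (- \<zeta>) \<xi>)" for \<zeta> using le[of \<zeta>] \<rho>(2)[of \<zeta>] by (cases "\<rho> \<zeta> = 0") auto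
 show "0 \<le> conv \<rho> w \<xi>" unfolding eq by (intro integral_nonneg_AE AE_I2 nn)
 have up: "\<rho> \<zeta> * w (heis_mult (- \<zeta>) \<xi>) \<le> c * \<rho> \<zeta>" for \<zeta>
  using le[of \<zeta>] \<rho>(2)[of \<zeta>] mult_left_mono[of "w (heis_mult (- \<zeta>) \<xi>)" c "\<rho> \<zeta>"]
  by (cases "\<rho> \<zeta> = 0") (auto simp: mult.commute)
 have ic: "integrable lborel (\<lambda>\<zeta>. c * \<rho> \<zeta>)" using tame_integrable[OF \<rho>(1)] by simp
 have "conv \<rho> w \<xi> \<le> (LBINT \<zeta>. c * \<rho> \<zeta>)"
  unfolding eq
 proof (rule integral_mono)
  show "integrable lborel (\<lambda>\<zeta>. \<rho> \<zeta> * w (heis_mult (- \<zeta>) \<xi>))"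
   by (rule Bochner_Integration.integrable_bound[OF ic])
    (use nn up in \<open>auto intro!: AE_I2 intro: order_trans[OF _ abs_ge_self]\<close>)
 qed (use ic up in auto)
 then show "conv \<rho> w \<xi> \<le> c" using \<rho>(3) by simp
qed

text \<open>For an upper semicontinuous function the positive part of the error tends to \<open>0\<close> pointwise; since the
 integrals agree, this already gives convergence in \<open>L\<^sup>1\<close>.\<close>
lemma usc_mollify:
 fixes w :: "'n::finite heis => real"
 assumes w: "w \<in> \<B>" "\<And>x. 0 \<le> w x" "\<And>x. w x \<le> 1" "\<And>x. \<rho> < heis_dist x x0 ==> w x = 0"
  and \<rho>: "0 < \<rho>" and usc: "\<And>c. 0 < c ==> open {x. w x < c}"
 obtains m :: "nat => 'n heis => real" where "\<And>n. smooth (m n)" "\<And>n. tame (m n)" "\<And>n x. 0 \<le> m n x" "\<And>n. (LBINT x. m n x) = 1"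
  "\<And>n x. 0 \<le> conv (m n) w x" "\<And>n x. conv (m n) w x \<le> 1" "\<And>n x. 2 * \<rho> < heis_dist x x0 ==> conv (m n) w x = 0"
  "(\<lambda>n. LBINT x. \<bar>conv (m n) w x - w x\<bar>) \<longlonglongrightarrow> 0"
proof -
 have [measurable]: "w \<in> \<B>" by (rule w)
 have tw: "tame w" by (rule tameI[of w 1 \<rho> x0]) (use w in \<open>auto simp: abs_le_iff intro: order_trans[of _ 0]\<close>)
 obtain \<delta> where \<delta>: "0 < \<delta>" "\<And>\<zeta> \<sigma>. norm \<zeta> \<le> \<delta> ==> heis_dist \<sigma> x0 \<le> \<rho> ==> heis_dist (heis_mult \<zeta> \<sigma>) x0 \<le> 2 * \<rho>"
  using left_translate_close[OF \<rho>, of x0] by blast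
 define d where "d = (\<lambda>n. \<delta> / real (Suc n))"
 have d: "0 < d n" "d n \<le> \<delta>" for n using \<delta> by (simp_all add: d_def divide_le_eq)
 have d0: "d \<longlonglongrightarrow> 0" unfolding d_def by (intro LIMSEQ_Suc lim_const_over_n)
 have "\<exists>m :: 'n heis => real. smooth m \<and> tame m \<and> (\<forall>x. 0 \<le> m x) \<and> (\<forall>x. d n \<le> norm x --> m x = 0) \<and> (LBINT x. m x) = 1" for n
  by (rule mollifier_exists[OF d(1)[of n]]) blast
 then obtain m :: "nat => 'n heis => real" where m: "\<And>n. smooth (m n)" "\<And>n. tame (m n)" "\<And>n x. 0 \<le> m n x"
  "\<And>n x. d n \<le> norm x ==> m n x = 0" "\<And>n. (LBINT x. m n x) = 1" by metis
 let ?c = "\<lambda>n. conv (m n) w"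
 have c01: "0 \<le> ?c n x" "?c n x \<le> 1" for n x
  using conv_bounds[OF m(2)[of n] m(3) m(5) tw, of x 1] w by auto
 have supp: "?c n x = 0" if "2 * \<rho> < heis_dist x x0" for n x
 proof -
  have "w (heis_mult (- \<zeta>) x) = 0" if mz: "m n \<zeta> \<noteq> 0" for \<zeta>
  proof (rule w(4), rule ccontr)
   assume "\<not> \<rho> < heis_dist (heis_mult (- \<zeta>) x) x0"
   moreover have "norm \<zeta> \<le> \<delta>" using m(4)[of n \<zeta>] mz d(2)[of n] by linarith
   ultimately have "heis_dist (heis_mult \<zeta> (heis_mult (- \<zeta>) x)) x0 \<le> 2 * \<rho>" by (intro \<delta>(2)) auto
   then show False using \<open>2 * \<rho> < heis_dist x x0\<close> by simp
  qed
  then show ?thesis using conv_bounds[OF m(2)[of n] m(3) m(5) tw, of x 0] by (simp add: antisym)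
 qed
 have cc: "continuous_on UNIV (?c n)" for n by (intro smooth_continuous smooth_conv m tw)
 have [measurable]: "?c n \<in> \<B>" for n by (intro borel_measurable_continuous_onI cc)
 have tc: "tame (?c n)" for n
  by (rule tameI[of _ 1 "2 * \<rho>" x0]) (use c01 supp in \<open>auto simp: abs_le_iff intro: order_trans[of _ 0]\<close>)
 have ic: "integrable lborel (?c n)" and iw: "integrable lborel w" for n by (intro tame_integrable tc tw)+
 have pw: "(\<lambda>n. max 0 (?c n x - w x)) \<longlonglongrightarrow> 0" for x
 proof (rule LIMSEQ_I)
  fix e :: real assume e: "0 < e"
  have wx: "0 < w x + e" using w(2)[of x] e by linarith
  \<comment> \<open>Semicontinuity at x gives w < w x + e / 2 at all points averaged by a
    concentrated mollifier, so the average overshoots w x by at most e / 2.\<close>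
  have "open ((\<lambda>\<zeta>. heis_mult (- \<zeta>) x) -` {y. w y < w x + e / 2})"
   using e w(2)[of x] by (intro open_vimage usc continuous_intros) auto
  moreover have "0 \<in> (\<lambda>\<zeta>. heis_mult (- \<zeta>) x) -` {y. w y < w x + e / 2}" using e by simp
  ultimately obtain t where t: "0 < t" "ball 0 t \<subseteq> (\<lambda>\<zeta>. heis_mult (- \<zeta>) x) -` {y. w y < w x + e / 2}"
   by (meson openE)
  obtain N where N: "\<And>n. n \<ge> N ==> d n < t" using LIMSEQ_D[OF d0 t(1)] d(1) by fastforce
  show "\<exists>N. \<forall>n\<ge>N. norm (max 0 (?c n x - w x) - 0) < e"
  proof (intro exI[of _ N] allI impI)
   fix n assume n: "N \<le> n"
   have "?c n x \<le> w x + e / 2"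
   proof (rule conv_bounds(2)[OF m(2)[of n] m(3) m(5) tw])
    fix \<zeta> assume "m n \<zeta> \<noteq> 0"
    then have "\<zeta> \<in> ball 0 t" using m(4)[of n \<zeta>] N[OF n] by force
    then have "w (heis_mult (- \<zeta>) x) < w x + e / 2" using t by blast
    then show "0 \<le> w (heis_mult (- \<zeta>) x) \<and> w (heis_mult (- \<zeta>) x) \<le> w x + e / 2" using w(2) by simp
   qed
   then show "norm (max 0 (?c n x - w x) - 0) < e" using e by simp
  qed
 qed
 let ?I = "\<lambda>x. indicator {x. heis_dist x x0 \<le> 2 * \<rho>} x :: real"
 have iI: "integrable lborel ?I"
  using compact_heis_cball[of x0 "2 * \<rho>"] by (intro integrable_real_indicator) (auto dest!: compact_imp_bounded emeasure_bounded_finite)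
 have bd: "max 0 (?c n x - w x) \<le> ?I x" for n x
 proof (cases "heis_dist x x0 \<le> 2 * \<rho>")
  case True
  then show ?thesis using c01[of n x] w(2)[of x] by simp
 next
  case False
  then show ?thesis using supp[of x n] w(2)[of x] by simp
 qed
 have "(\<lambda>n. LBINT x. max 0 (?c n x - w x)) \<longlonglongrightarrow> (LINT (x::'n heis)|lborel. (0::real))"
  by (rule integral_dominated_convergence[where w = ?I]) (use pw iI bd in auto)
 then have l: "(\<lambda>n. 2 * (LBINT x. max 0 (?c n x - w x))) \<longlonglongrightarrow> 0"
  using tendsto_mult_right_zero by fastforce
 have eqI: "(LBINT x. ?c n x) = (LBINT x. w x)" for n
 proof -
  have "ennreal (LBINT x. ?c n x) = ennreal (LBINT x. w x)"
   using conv_integral[OF m(2)[of n] m(3) m(5) tw w(2)] nn_integral_eq_integral[OF ic, of n] nn_integral_eq_integral[OF iw] c01 w(2) by simp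
  moreover have "0 \<le> (LBINT x. ?c n x)" "0 \<le> (LBINT x. w x)"
   using c01 w(2) by (auto intro!: integral_nonneg_AE)
  ultimately show ?thesis by simp
 qed
 have "(LBINT x. \<bar>?c n x - w x\<bar>) = 2 * (LBINT x. max 0 (?c n x - w x))" for n
 proof -
  \<comment> \<open>The integrals of the mollified and of the original function agree, so the
    absolute error integrates to twice its positive part.\<close>
  have abs_eq: "\<bar>t\<bar> = 2 * max 0 t - t" for t :: real by (simp add: max_def)
  have im: "integrable lborel (\<lambda>x. max 0 (?c n x - w x))"
   by (intro integrable_max Bochner_Integration.integrable_diff ic iw) simp
  have "(LBINT x. \<bar>?c n x - w x\<bar>) = (LBINT x. 2 * max 0 (?c n x - w x) - (?c n x - w x))"
   by (intro Bochner_Integration.integral_cong refl abs_eq)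
  also have "\<dots> = 2 * (LBINT x. max 0 (?c n x - w x)) - ((LBINT x. ?c n x) - (LBINT x. w x))"
   using im ic iw by simp
  finally show ?thesis by (simp add: eqI)
 qed
 then show ?thesis using l by (intro that[of m]) (simp_all add: m c01 supp)
qed


section \<open>Testing with semicontinuous functions\<close>

lemma AE_lborel_fst:
 fixes P :: "'a::euclidean_space => bool"
 assumes "AE x in lborel. P x"
 shows "AE z in (lborel :: ('a \<times> 'b::euclidean_space) measure). P (fst z)"
proof -
 obtain N where N: "{x. \<not> P x} \<subseteq> N" "emeasure lborel N = 0" "N \<in> sets lborel"
  using AE_E[OF assms] by auto
 have [measurable]: "N \<in> sets borel" using N by simp
 have "emeasure lborel {z :: 'a \<times> 'b. fst z \<in> N} = (NNINT z. indicator {z :: 'a \<times> 'b. fst z \<in> N} z)" by (simp add: nn_integral_indicator)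
 also have "\<dots> = (NNINT x. (NNINT y. indicator {z :: 'a \<times> 'b. fst z \<in> N} (x, y)))"
  by (rule nn_integral_lborel_pair) measurable
 also have "\<dots> = (NNINT x. (NNINT (y::'b). indicator N x))"
  by (intro nn_integral_cong) (simp add: indicator_def)
 also have "\<dots> = (NNINT x. indicator N x * emeasure lborel (UNIV :: 'b set))" by simp
 also have "\<dots> = emeasure lborel N * emeasure lborel (UNIV :: 'b set)"
  by (subst nn_integral_multc) (auto simp: nn_integral_indicator)
 finally have "emeasure lborel {z :: 'a \<times> 'b. fst z \<in> N} = 0" using N by simp
 then have "{z :: 'a \<times> 'b. fst z \<in> N} \<in> null_sets lborel" by (intro null_setsI) auto
 then show ?thesis using N(1) by (intro AE_I'[of "{z :: 'a \<times> 'b. fst z \<in> N}"]) auto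
qed

lemma AE_lborel_snd:
 fixes P :: "'b::euclidean_space => bool"
 assumes "AE x in lborel. P x"
 shows "AE z in (lborel :: ('a::euclidean_space \<times> 'b) measure). P (snd z)"
proof -
 obtain N where N: "{x. \<not> P x} \<subseteq> N" "emeasure lborel N = 0" "N \<in> sets lborel"
  using AE_E[OF assms] by auto
 have [measurable]: "N \<in> sets borel" using N by simp
 have "emeasure lborel {z :: 'a \<times> 'b. snd z \<in> N} = (NNINT z. indicator {z :: 'a \<times> 'b. snd z \<in> N} z)" by (simp add: nn_integral_indicator)
 also have "\<dots> = (NNINT x. (NNINT y. indicator {z :: 'a \<times> 'b. snd z \<in> N} (x, y)))"
  by (rule nn_integral_lborel_pair) measurable
 also have "\<dots> = (NNINT (x::'a). (NNINT y. indicator N y))"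
  by (intro nn_integral_cong) (simp add: indicator_def)
 also have "\<dots> = 0" using N by (simp add: nn_integral_indicator)
 finally have "emeasure lborel {z :: 'a \<times> 'b. snd z \<in> N} = 0" .
 then have "{z :: 'a \<times> 'b. snd z \<in> N} \<in> null_sets lborel" by (intro null_setsI) auto
 then show ?thesis using N(1) by (intro AE_I'[of "{z :: 'a \<times> 'b. snd z \<in> N}"]) auto
qed

lemma nn_integral_lborel_product:
 fixes f :: "'a::euclidean_space => ennreal" and g :: "'b::euclidean_space => ennreal"
 assumes [measurable]: "f \<in> \<B>" "g \<in> \<B>"
 shows "(NNINT z. f (fst z) * g (snd z)) = (NNINT x. f x) * (NNINT y. g y)"
proof -
 have "(NNINT z. f (fst z) * g (snd z)) = (NNINT x. (NNINT y. f x * g y))"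
  by (subst nn_integral_lborel_pair) auto
 also have "\<dots> = (NNINT x. f x * (NNINT y. g y))"
  by (intro nn_integral_cong nn_integral_cmult) auto
 also have "\<dots> = (NNINT x. f x) * (NNINT y. g y)" by (rule nn_integral_multc) auto
 finally show ?thesis .
qed

context kernel_data
begin

text \<open>With the first point in a ball and the second at distance at least \<epsilon>, the
  kernel is bounded by the weight of the second point, and the double integral splits into products
  of single integrals.\<close>

lemma far_finite:
 fixes h :: "'n heis => real"
 assumes [measurable]: "h \<in> \<B>" and h0: "\<And>x. 0 \<le> h x"
  and hw: "(NNINT \<eta>. ennreal (h \<eta> * weight \<eta>)) < \<infinity>" and \<epsilon>: "0 < \<epsilon>"
 shows "(NNINT z. ennreal ((h (fst z) + h (snd z)) * kk (fst z) (snd z))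
   * indicator {z. heis_dist (fst z) x0 \<le> A \<and> \<epsilon> \<le> heis_dist (fst z) (snd z)} z) < \<infinity>"
proof -
 obtain C where C: "0 \<le> C" "\<And>\<xi> \<eta>. heis_dist \<xi> x0 \<le> A ==> \<epsilon> \<le> heis_dist \<xi> \<eta> ==> heis_dist \<xi> \<eta> powr (- \<gamma>) \<le> C * weight \<eta>"
  by (rule weight_bound[OF \<epsilon>]) (rule that)
 obtain c where c: "0 < c" "\<And>\<eta>. heis_dist \<eta> x0 \<le> A ==> c \<le> weight \<eta>"
  by (rule weight_lower) (rule that)
 let ?B = "{x. heis_dist x x0 \<le> A}"
 let ?I = "\<lambda>x. indicator ?B x :: ennreal"
 have LC: "0 \<le> L * C" using L C by simp
 have hB: "(NNINT x. ennreal (h x) * ?I x) < \<infinity>"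
 proof -
  have "(NNINT x. ennreal (h x) * ?I x) \<le> (NNINT x. ennreal (1 / c) * ennreal (h x * weight x))"
  proof (intro nn_integral_mono)
   fix x
   show "ennreal (h x) * ?I x \<le> ennreal (1 / c) * ennreal (h x * weight x)"
   proof (cases "heis_dist x x0 \<le> A")
    case True
    have "h x * c \<le> h x * weight x" using c(2)[OF True] h0 by (intro mult_left_mono) auto
    then have "h x \<le> (1 / c) * (h x * weight x)" using c(1) by (simp add: field_simps)
    then show ?thesis using True c(1) h0[of x] weight_pos[of x]
     by (simp add: ennreal_mult[symmetric] ennreal_leI)
   qed simp
  qed
  also have "\<dots> = ennreal (1 / c) * (NNINT x. ennreal (h x * weight x))" by (rule nn_integral_cmult) measurable
  also have "\<dots> < \<infinity>" using hw by (simp add: ennreal_mult_less_top)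
  finally show ?thesis .
 qed
 have B: "(NNINT x. ?I x) < \<infinity>"
  using compact_heis_cball[of x0 A] by (auto simp: nn_integral_indicator dest!: compact_imp_bounded emeasure_bounded_finite)
 have "(NNINT z. ennreal ((h (fst z) + h (snd z)) * kk (fst z) (snd z))
   * indicator {z. heis_dist (fst z) x0 \<le> A \<and> \<epsilon> \<le> heis_dist (fst z) (snd z)} z)
  \<le> (NNINT z. ennreal (L * C) * ((ennreal (h (fst z)) * ?I (fst z)) * ennreal (weight (snd z)) + ?I (fst z) * ennreal (h (snd z) * weight (snd z))))"
 proof (intro nn_integral_mono)
  fix z :: "'n heis \<times> 'n heis"
  show "ennreal ((h (fst z) + h (snd z)) * kk (fst z) (snd z))
   * indicator {z. heis_dist (fst z) x0 \<le> A \<and> \<epsilon> \<le> heis_dist (fst z) (snd z)} z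
   \<le> ennreal (L * C) * ((ennreal (h (fst z)) * ?I (fst z)) * ennreal (weight (snd z)) + ?I (fst z) * ennreal (h (snd z) * weight (snd z)))"
  proof (cases "heis_dist (fst z) x0 \<le> A \<and> \<epsilon> \<le> heis_dist (fst z) (snd z)")
   case True
   have "kk (fst z) (snd z) \<le> L * heis_dist (fst z) (snd z) powr (- \<gamma>)" by (rule kk_le)
   also have "\<dots> \<le> L * (C * weight (snd z))" using True L C by (intro mult_left_mono) auto
   finally have "(h (fst z) + h (snd z)) * kk (fst z) (snd z) \<le> (h (fst z) + h (snd z)) * (L * (C * weight (snd z)))"
    using h0 by (intro mult_left_mono) auto
   also have "\<dots> = (L * C) * (h (fst z) * weight (snd z) + h (snd z) * weight (snd z))" by (simp add: algebra_simps)
   finally have "ennreal ((h (fst z) + h (snd z)) * kk (fst z) (snd z)) \<le> ennreal ((L * C) * (h (fst z) * weight (snd z) + h (snd z) * weight (snd z)))"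
    by (rule ennreal_leI)
   also have "\<dots> = ennreal (L * C) * (ennreal (h (fst z)) * ennreal (weight (snd z)) + ennreal (h (snd z) * weight (snd z)))"
    using LC h0 weight_pos[of "snd z"] by (simp add: ennreal_mult[symmetric] ennreal_plus[symmetric] del: ennreal_plus)
   finally show ?thesis using True by simp
  qed simp
 qed
 also have "\<dots> = ennreal (L * C) * ((NNINT z. (ennreal (h (fst z)) * ?I (fst z)) * ennreal (weight (snd z)))
   + (NNINT z. ?I (fst z) * ennreal (h (snd z) * weight (snd z))))"
  by (subst nn_integral_cmult, measurable, subst nn_integral_add) auto
 also have "(NNINT z. (ennreal (h (fst z)) * ?I (fst z)) * ennreal (weight (snd z)))
   = (NNINT x. ennreal (h x) * ?I x) * (NNINT y. ennreal (weight y))"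
  by (rule nn_integral_lborel_product) measurable
 also have "(NNINT z. ?I (fst z) * ennreal (h (snd z) * weight (snd z)))
   = (NNINT x. ?I x) * (NNINT y. ennreal (h y * weight y))"
  by (rule nn_integral_lborel_product) measurable
 also have "ennreal (L * C) * ((NNINT x. ennreal (h x) * ?I x) * (NNINT y. ennreal (weight y))
   + (NNINT x. ?I x) * (NNINT y. ennreal (h y * weight y))) < \<infinity>"
  using hB B hw weight_integral by (simp add: ennreal_mult_less_top)
 finally show ?thesis .
qed

lemma abs_Jp_diff_le: "\<bar>Jp p (a - b)\<bar> \<le> 2 powr (p - 1) * (\<bar>a\<bar> powr (p - 1) + \<bar>b\<bar> powr (p - 1))"
 unfolding abs_Jp using p by (intro abs_diff_powr_le) simp

lemma far_integrable:
 fixes v :: "'n heis => real"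
 assumes [measurable]: "v \<in> \<B>"
  and hw: "tail v < \<infinity>" and \<epsilon>: "0 < \<epsilon>"
 shows "integrable lborel (\<lambda>z. Jp p (v (fst z) - v (snd z)) * kk (fst z) (snd z)
   * indicator {z. heis_dist (fst z) x0 \<le> A \<and> \<epsilon> \<le> heis_dist (fst z) (snd z)} z)"
proof (rule integrableI_bounded)
 let ?S = "{z :: 'n heis \<times> 'n heis. heis_dist (fst z) x0 \<le> A \<and> \<epsilon> \<le> heis_dist (fst z) (snd z)}"
 let ?h = "\<lambda>x. \<bar>v x\<bar> powr (p - 1)"
 have "(NNINT z. ennreal (norm (Jp p (v (fst z) - v (snd z)) * kk (fst z) (snd z) * indicator ?S z)))
  \<le> (NNINT z. ennreal (2 powr (p - 1)) * (ennreal ((?h (fst z) + ?h (snd z)) * kk (fst z) (snd z)) * indicator ?S z))"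
 proof (intro nn_integral_mono)
  fix z :: "'n heis \<times> 'n heis"
  have "\<bar>Jp p (v (fst z) - v (snd z))\<bar> * kk (fst z) (snd z) \<le> (2 powr (p - 1) * (?h (fst z) + ?h (snd z))) * kk (fst z) (snd z)"
   by (intro mult_right_mono abs_Jp_diff_le) simp
  then show "ennreal (norm (Jp p (v (fst z) - v (snd z)) * kk (fst z) (snd z) * indicator ?S z))
   \<le> ennreal (2 powr (p - 1)) * (ennreal ((?h (fst z) + ?h (snd z)) * kk (fst z) (snd z)) * indicator ?S z)"
   by (auto simp: indicator_def abs_mult ennreal_mult[symmetric] mult.assoc intro!: ennreal_leI)
 qed
 also have "\<dots> = ennreal (2 powr (p - 1)) * (NNINT z. ennreal ((?h (fst z) + ?h (snd z)) * kk (fst z) (snd z)) * indicator ?S z)"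
  by (rule nn_integral_cmult) measurable
 also have "\<dots> < \<infinity>"
  using far_finite[of ?h, OF _ _ hw \<epsilon>, of x0 A] by (simp add: ennreal_mult_less_top)
 finally show "(NNINT z. ennreal (norm (Jp p (v (fst z) - v (snd z)) * kk (fst z) (snd z) * indicator ?S z))) < \<infinity>" .
qed measurable

lemma integrable_lborel_swap:
 fixes f :: "'a::euclidean_space \<times> 'a => real"
 assumes "integrable lborel f" shows "integrable lborel (\<lambda>z. f (snd z, fst z))"
proof -
 have [measurable]: "f \<in> \<B>" using assms by auto
 have "integrable (distr lborel borel (\<lambda>z. (snd z, fst z))) f" by (simp add: lborel_distr_swap assms)
 then show ?thesis by (subst (asm) integrable_distr_eq) auto
qed

lemma young_pointwise: "0 \<le> a ==> 0 \<le> b ==> a powr (p - 1) * b \<le> a powr p + b powr p"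
proof -
 assume ab: "0 \<le> a" "0 \<le> b"
 have e: "x * x powr (p - 1) = x powr p" if "0 \<le> x" for x using powr_mult_base[OF that, of "p - 1"] by simp
 show ?thesis
 proof (cases "a \<le> b")
  case True
  have "a powr (p - 1) * b \<le> b powr (p - 1) * b" using True ab p by (intro mult_right_mono powr_mono2) auto
  then show ?thesis using e[OF ab(2)] by (simp add: mult.commute add_increasing)
 next
  case False
  have "a powr (p - 1) * b \<le> a powr (p - 1) * a" using False by (intro mult_left_mono) auto
  then show ?thesis using e[OF ab(1)] by (simp add: mult.commute add_increasing2)
 qed
qed

text \<open>Pairs in the larger ball are handled by Young's inequality. If one point is outside it
  and the other within A, their distance is at least r1 - A and the far bound applies. For all
  remaining pairs the increment of \<phi> is zero. The majorant \<open>g\<close> serves all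
  admissible \<phi>, whose energy density is the only other term.\<close>

lemma form_dominated:
 fixes v :: "'n heis => real"
 assumes [measurable]: "v \<in> \<B>"
  and hw: "tail v < \<infinity>"
  and loc: "local_energy v x0 r1 < \<infinity>"
  and A: "A < r1"
 obtains g where "integrable lborel g" "\<And>z. 0 \<le> g z"
  "\<forall>\<phi> z. (\<forall>x. 0 \<le> \<phi> x \<and> \<phi> x \<le> 1 \<and> (A < heis_dist x x0 --> \<phi> x = 0)) -->
   \<bar>Jp p (v (fst z) - v (snd z)) * (\<phi> (fst z) - \<phi> (snd z)) * kk (fst z) (snd z)\<bar>
    \<le> g z + \<bar>\<phi> (fst z) - \<phi> (snd z)\<bar> powr p * kk (fst z) (snd z)"
proof -
 define \<epsilon> where "\<epsilon> = r1 - A"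
 have \<epsilon>: "0 < \<epsilon>" using A by (simp add: \<epsilon>_def)
 let ?J = "\<lambda>z. Jp p (v (fst z) - v (snd z)) * kk (fst z) (snd z)"
 let ?U = "{z. heis_dist (fst z) x0 < r1 \<and> heis_dist (snd z) x0 < r1}"
 let ?S = "{z. heis_dist (fst z) x0 \<le> A \<and> \<epsilon> \<le> heis_dist (fst z) (snd z)}"
 let ?g1 = "\<lambda>z. \<bar>v (fst z) - v (snd z)\<bar> powr p * kk (fst z) (snd z) * indicator ?U z"
 let ?g2 = "\<lambda>z. \<bar>?J z * indicator ?S z\<bar>"
 let ?g3 = "\<lambda>z. \<bar>?J (snd z, fst z) * indicator ?S (snd z, fst z)\<bar>"
 have i1: "integrable lborel ?g1"
 proof (rule integrableI_bounded)
  have "(NNINT z. ennreal (norm (?g1 z))) = (NNINT z. ennreal (\<bar>v (fst z) - v (snd z)\<bar> powr p * kk (fst z) (snd z)) * indicator ?U z)"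
   by (intro nn_integral_cong) (auto simp: indicator_def)
  then show "(NNINT z. ennreal (norm (?g1 z))) < \<infinity>" using loc by simp
 qed measurable
 have i2': "integrable lborel (\<lambda>z. ?J z * indicator ?S z)" by (rule far_integrable[OF assms(1) hw \<epsilon>])
 have i2: "integrable lborel ?g2" by (intro integrable_abs i2')
 have i3: "integrable lborel ?g3" by (intro integrable_abs integrable_lborel_swap i2')
 show ?thesis
 proof (rule that[of "\<lambda>z. ?g1 z + ?g2 z + ?g3 z"])
  show "integrable lborel (\<lambda>z. ?g1 z + ?g2 z + ?g3 z)" by (intro Bochner_Integration.integrable_add i1 i2 i3)
  have g1: "0 \<le> ?g1 z" for z by simp
  show "0 \<le> ?g1 z + ?g2 z + ?g3 z" for z using g1[of z] by simp
  show "\<forall>\<phi> z. (\<forall>x. 0 \<le> \<phi> x \<and> \<phi> x \<le> 1 \<and> (A < heis_dist x x0 --> \<phi> x = 0)) -->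
   \<bar>Jp p (v (fst z) - v (snd z)) * (\<phi> (fst z) - \<phi> (snd z)) * kk (fst z) (snd z)\<bar>
    \<le> ?g1 z + ?g2 z + ?g3 z + \<bar>\<phi> (fst z) - \<phi> (snd z)\<bar> powr p * kk (fst z) (snd z)"
  proof (intro allI impI)
  fix \<phi> :: "'n heis => real" and z :: "'n heis \<times> 'n heis"
  assume "\<forall>x. 0 \<le> \<phi> x \<and> \<phi> x \<le> 1 \<and> (A < heis_dist x x0 --> \<phi> x = 0)"
  then have \<phi>: "\<And>x. 0 \<le> \<phi> x" "\<And>x. \<phi> x \<le> 1" "\<And>x. A < heis_dist x x0 ==> \<phi> x = 0" by auto
  let ?D = "\<phi> (fst z) - \<phi> (snd z)"
  have D1: "\<bar>?D\<bar> \<le> 1" using \<phi>(1)[of "fst z"] \<phi>(1)[of "snd z"] \<phi>(2)[of "fst z"] \<phi>(2)[of "snd z"] by linarith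
  have nn: "0 \<le> \<bar>?D\<bar> powr p * kk (fst z) (snd z)" by simp
  have le: "\<bar>Jp p (v (fst z) - v (snd z)) * ?D * kk (fst z) (snd z)\<bar> \<le> \<bar>?J z\<bar>"
  proof -
   have "\<bar>Jp p (v (fst z) - v (snd z)) * ?D * kk (fst z) (snd z)\<bar> = \<bar>?J z\<bar> * \<bar>?D\<bar>" by (simp add: abs_mult)
   also have "\<dots> \<le> \<bar>?J z\<bar> * 1" using D1 by (intro mult_left_mono) auto
   finally show ?thesis by simp
  qed
  have Jsw: "\<bar>?J (snd z, fst z)\<bar> = \<bar>?J z\<bar>"
   using kk_commute[of "fst z" "snd z"] by (simp add: abs_mult abs_Jp abs_minus_commute)
  show "\<bar>Jp p (v (fst z) - v (snd z)) * ?D * kk (fst z) (snd z)\<bar> \<le> ?g1 z + ?g2 z + ?g3 z + \<bar>?D\<bar> powr p * kk (fst z) (snd z)"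
  proof (cases "z \<in> ?U")
   case True
   have "\<bar>Jp p (v (fst z) - v (snd z)) * ?D * kk (fst z) (snd z)\<bar> = (\<bar>v (fst z) - v (snd z)\<bar> powr (p - 1) * \<bar>?D\<bar>) * kk (fst z) (snd z)"
    by (simp add: abs_mult abs_Jp)
   also have "\<dots> \<le> (\<bar>v (fst z) - v (snd z)\<bar> powr p + \<bar>?D\<bar> powr p) * kk (fst z) (snd z)"
    by (intro mult_right_mono young_pointwise) auto
   also have "\<dots> = ?g1 z + \<bar>?D\<bar> powr p * kk (fst z) (snd z)" using True by (simp add: distrib_right)
   finally show ?thesis using abs_ge_zero[of "?J z * indicator ?S z"] abs_ge_zero[of "?J (snd z, fst z) * indicator ?S (snd z, fst z)"] by linarith
  next
   case False
   then consider "r1 \<le> heis_dist (fst z) x0" | "r1 \<le> heis_dist (snd z) x0" by force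
   then show ?thesis
   proof cases
    case 1
    show ?thesis
    proof (cases "heis_dist (snd z) x0 \<le> A")
     case T: True
     have "\<epsilon> \<le> heis_dist (snd z) (fst z)"
      using heis_dist_triangle[of "fst z" x0 "snd z"] 1 T by (simp add: \<epsilon>_def heis_dist_commute)
     then have "?g3 z = \<bar>?J z\<bar>" using T Jsw by simp
     then show ?thesis using le nn g1[of z] abs_ge_zero[of "?J z * indicator ?S z"] by linarith
    next
     case F: False
     then have "?D = 0" using \<phi>(3)[of "fst z"] \<phi>(3)[of "snd z"] 1 A by simp
     then show ?thesis using nn g1[of z] by simp
    qed
   next
    case 2
    show ?thesis
    proof (cases "heis_dist (fst z) x0 \<le> A")
     case T: True
     have "\<epsilon> \<le> heis_dist (fst z) (snd z)"
      using heis_dist_triangle[of "snd z" x0 "fst z"] 2 T by (simp add: \<epsilon>_def heis_dist_commute)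
     then have "?g2 z = \<bar>?J z\<bar>" using T by simp
     then show ?thesis using le nn g1[of z] abs_ge_zero[of "?J (snd z, fst z) * indicator ?S (snd z, fst z)"] by linarith
    next
     case F: False
     then have "?D = 0" using \<phi>(3)[of "fst z"] \<phi>(3)[of "snd z"] 2 A by simp
     then show ?thesis using nn g1[of z] by simp
    qed
   qed
  qed
  qed
 qed
qed

definition form :: "('n heis => real) => ('n heis => real) => real" where
 "form v \<phi> = (LBINT z. Jp p (v (fst z) - v (snd z)) * (\<phi> (fst z) - \<phi> (snd z)) * kk (fst z) (snd z))"

lemma energy_integrable:
 assumes [measurable]: "\<phi> \<in> \<B>" and e: "energy \<phi> < \<infinity>"
 shows "integrable lborel (\<lambda>z. \<bar>\<phi> (fst z) - \<phi> (snd z)\<bar> powr p * kk (fst z) (snd z))"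
  "ennreal (LBINT z. \<bar>\<phi> (fst z) - \<phi> (snd z)\<bar> powr p * kk (fst z) (snd z)) = energy \<phi>"
proof -
 show i: "integrable lborel (\<lambda>z. \<bar>\<phi> (fst z) - \<phi> (snd z)\<bar> powr p * kk (fst z) (snd z))"
  by (rule integrableI_bounded) (use e in \<open>auto simp: energy_def\<close>)
 show "ennreal (LBINT z. \<bar>\<phi> (fst z) - \<phi> (snd z)\<bar> powr p * kk (fst z) (snd z)) = energy \<phi>"
  unfolding energy_def by (rule nn_integral_eq_integral[OF i, symmetric]) simp
qed

lemma form_integrable:
 fixes v w :: "'n heis => real"
 assumes v [measurable]: "v \<in> \<B>"
  and hw: "tail v < \<infinity>"
  and loc: "local_energy v x0 r1 < \<infinity>"
  and A: "A < r1"
  and w [measurable]: "w \<in> \<B>"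
  and w': "\<And>x. 0 \<le> w x" "\<And>x. w x \<le> 1" "\<And>x. A < heis_dist x x0 ==> w x = 0"
  and ew: "energy w < \<infinity>"
 shows "integrable lborel (\<lambda>z. Jp p (v (fst z) - v (snd z)) * (w (fst z) - w (snd z)) * kk (fst z) (snd z))"
proof -
 obtain g where g: "integrable lborel g"
  and dom: "\<forall>\<phi> z. (\<forall>x. 0 \<le> \<phi> x \<and> \<phi> x \<le> 1 \<and> (A < heis_dist x x0 --> \<phi> x = 0)) -->
   \<bar>Jp p (v (fst z) - v (snd z)) * (\<phi> (fst z) - \<phi> (snd z)) * kk (fst z) (snd z)\<bar>
    \<le> g z + \<bar>\<phi> (fst z) - \<phi> (snd z)\<bar> powr p * kk (fst z) (snd z)"
  by (rule form_dominated[OF v hw loc A]) (rule that)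
 have d: "\<bar>Jp p (v (fst z) - v (snd z)) * (w (fst z) - w (snd z)) * kk (fst z) (snd z)\<bar>
    \<le> g z + \<bar>w (fst z) - w (snd z)\<bar> powr p * kk (fst z) (snd z)" for z
  using dom w' by blast
 show ?thesis
  by (rule Bochner_Integration.integrable_bound[OF Bochner_Integration.integrable_add[OF g energy_integrable(1)[OF w ew]]])
   (auto intro!: AE_I2 order_trans[OF d abs_ge_self])
qed

text \<open>Fatou's lemma applies to the nonnegative functions \<open>g + |D\<phi>|\<^sup>p k - J D\<phi>\<close>; Jensen's inequality bounds the energies
 of the mollified functions, so no strong convergence in the fractional space is needed.\<close>
lemma weak_extension:
 fixes v w f :: "'n heis => real"
 assumes v [measurable]: "v \<in> \<B>"
  and hw: "tail v < \<infinity>"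
  and loc: "local_energy v x0 r1 < \<infinity>"
  and \<rho>: "0 < \<rho>" "2 * \<rho> < r1"
  and w: "w \<in> \<B>" "\<And>x. 0 \<le> w x" "\<And>x. w x \<le> 1" "\<And>x. \<rho> < heis_dist x x0 ==> w x = 0"
  and usc: "\<And>c. 0 < c ==> open {x. w x < c}" and ew: "energy w < \<infinity>"
  and f [measurable]: "f \<in> \<B>" and fb: "\<And>x. \<bar>f x\<bar> \<le> b"
  and weak: "\<And>\<phi>. smooth \<phi> ==> (\<And>x. 0 \<le> \<phi> x) ==> (\<And>x. 2 * \<rho> < heis_dist x x0 ==> \<phi> x = 0)
   ==> (LBINT x. f x * \<phi> x) \<le> form v \<phi>"
 shows "(LBINT x. f x * w x) \<le> form v w"
proof -
 have [measurable]: "w \<in> \<B>" by (rule w)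
 have tw: "tame w" by (rule tameI[of w 1 \<rho> x0]) (use w in \<open>auto simp: abs_le_iff intro: order_trans[of _ 0]\<close>)
 obtain m :: "nat => 'n heis => real" where m: "\<And>n. smooth (m n)" "\<And>n. tame (m n)" "\<And>n x. 0 \<le> m n x" "\<And>n. (LBINT x. m n x) = 1"
  and c: "\<And>n x. 0 \<le> conv (m n) w x" "\<And>n x. conv (m n) w x \<le> 1" "\<And>n x. 2 * \<rho> < heis_dist x x0 ==> conv (m n) w x = 0"
  and l1: "(\<lambda>n. LBINT x. \<bar>conv (m n) w x - w x\<bar>) \<longlonglongrightarrow> 0"
  by (rule usc_mollify[OF w \<rho>(1) usc]) (assumption | rule that)+
 let ?c = "\<lambda>n. conv (m n) w"
 have sc: "smooth (?c n)" for n by (intro smooth_conv m tw)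
 have [measurable]: "?c n \<in> \<B>" for n by (intro borel_measurable_continuous_onI smooth_continuous sc)
 have tc: "tame (?c n)" for n
  by (rule tameI[of _ 1 "2 * \<rho>" x0]) (use c in \<open>auto simp: abs_le_iff intro: order_trans[of _ 0]\<close>)
 have iw: "integrable lborel w" and ic: "integrable lborel (?c n)" for n by (intro tame_integrable tw tc)+
 \<comment> \<open>Convergence in L^1 gives pointwise convergence almost everywhere only along a
   subsequence.\<close>
 have "\<exists>r::nat=>nat. strict_mono r \<and> (AE x in lborel. (\<lambda>n. ?c (r n) x - w x) \<longlonglongrightarrow> 0)"
  using l1 ic iw by (intro tendsto_L1_AE_subseq) auto
 then obtain r :: "nat => nat" where r: "strict_mono r" "AE x in lborel. (\<lambda>n. ?c (r n) x - w x) \<longlonglongrightarrow> 0" by blast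
 have ae: "AE x in lborel. (\<lambda>n. ?c (r n) x) \<longlonglongrightarrow> w x"
  using r(2) by eventually_elim (simp add: LIM_zero_iff)
 define \<phi> where "\<phi> = (\<lambda>n. ?c (r n))"
 have \<phi>: "smooth (\<phi> n)" "0 \<le> \<phi> n x" "\<phi> n x \<le> 1" "2 * \<rho> < heis_dist x x0 ==> \<phi> n x = 0" for n x
  using sc c by (auto simp: \<phi>_def)
 have [measurable]: "\<phi> n \<in> \<B>" for n by (simp add: \<phi>_def)
 obtain g where g: "integrable lborel g" "\<And>z. 0 \<le> g z"
  and dom0: "\<forall>\<phi> z. (\<forall>x. 0 \<le> \<phi> x \<and> \<phi> x \<le> 1 \<and> (2 * \<rho> < heis_dist x x0 --> \<phi> x = 0)) -->
   \<bar>Jp p (v (fst z) - v (snd z)) * (\<phi> (fst z) - \<phi> (snd z)) * kk (fst z) (snd z)\<bar>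
    \<le> g z + \<bar>\<phi> (fst z) - \<phi> (snd z)\<bar> powr p * kk (fst z) (snd z)"
  by (rule form_dominated[OF v hw loc \<rho>(2)]) (rule that)
 have dom: "\<bar>Jp p (v (fst z) - v (snd z)) * (\<phi> (fst z) - \<phi> (snd z)) * kk (fst z) (snd z)\<bar>
    \<le> g z + \<bar>\<phi> (fst z) - \<phi> (snd z)\<bar> powr p * kk (fst z) (snd z)"
  if "\<And>x. 0 \<le> \<phi> x" "\<And>x. \<phi> x \<le> 1" "\<And>x. 2 * \<rho> < heis_dist x x0 ==> \<phi> x = 0" for \<phi> z
  using dom0 that by blast
 have [measurable]: "g \<in> \<B>" using g(1) by auto
 let ?P = "\<lambda>\<phi> z. \<bar>\<phi> (fst z) - \<phi> (snd z)\<bar> powr p * kk (fst z) (snd z)"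
 let ?J = "\<lambda>\<phi> z. Jp p (v (fst z) - v (snd z)) * (\<phi> (fst z) - \<phi> (snd z)) * kk (fst z) (snd z)"
 let ?E = "\<lambda>\<phi> z. g z + ?P \<phi> z - ?J \<phi> z"
 have w2: "w x = 0" if "2 * \<rho> < heis_dist x x0" for x using w(4)[of x] that \<rho> by simp
 have e\<phi>: "energy (\<phi> n) \<le> energy w" for n
  unfolding \<phi>_def by (intro energy_conv_le m tw smooth_continuous)
 then have e\<phi>': "energy (\<phi> n) < \<infinity>" for n using ew by (rule le_less_trans)
 have iP: "integrable lborel (?P (\<phi> n))" "integrable lborel (?P w)" for n
  using energy_integrable(1)[OF _ e\<phi>'] energy_integrable(1)[OF _ ew] by auto
 have iJ: "integrable lborel (?J (\<phi> n))" "integrable lborel (?J w)" for n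
 proof -
  show "integrable lborel (?J (\<phi> n))"
   by (rule form_integrable[OF v hw loc \<rho>(2) _ _ _ _ e\<phi>']) (use \<phi> in auto)
  show "integrable lborel (?J w)"
   by (rule form_integrable[OF v hw loc \<rho>(2) _ _ _ _ ew]) (use w w2 in auto)
 qed
 have iE: "integrable lborel (?E (\<phi> n))" "integrable lborel (?E w)" for n
  by (intro Bochner_Integration.integrable_diff Bochner_Integration.integrable_add g iP iJ)+
 have E0: "0 \<le> ?E (\<phi> n) z" "0 \<le> ?E w z" for n z
  using dom[of "\<phi> n" z] dom[of w z] \<phi> w w2 by (fastforce simp: abs_le_iff)+
 let ?G = "LBINT z. g z" and ?e = "LBINT z. ?P w z"
 let ?F = "\<lambda>n. LBINT x. f x * \<phi> n x" and ?Fw = "LBINT x. f x * w x"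
 have Pe: "(LBINT z. ?P (\<phi> n) z) \<le> ?e" for n
 proof -
  have "ennreal (LBINT z. ?P (\<phi> n) z) \<le> ennreal ?e"
   using energy_integrable(2)[OF _ e\<phi>'] energy_integrable(2)[OF _ ew] e\<phi>[of n] by simp
  moreover have "0 \<le> ?e" by (intro integral_nonneg_AE AE_I2) simp
  ultimately show ?thesis by (simp add: ennreal_le_iff)
 qed
 \<comment> \<open>Jensen's inequality bounds the energy term by that of w, and the weak inequality
   bounds the form from below by \<open>?F n\<close>.\<close>
 have En: "(LBINT z. ?E (\<phi> n) z) \<le> ?G + ?e - ?F n" for n
 proof -
  have "(LBINT z. ?E (\<phi> n) z) = ?G + (LBINT z. ?P (\<phi> n) z) - form v (\<phi> n)"
   using g(1) iP iJ by (simp add: form_def)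
  moreover have "?F n \<le> form v (\<phi> n)" by (rule weak) (use \<phi> in auto)
  ultimately show ?thesis using Pe[of n] by linarith
 qed
 have En0: "0 \<le> (LBINT z. ?E (\<phi> n) z)" for n by (intro integral_nonneg_AE AE_I2 E0)
 have limF: "?F \<longlonglongrightarrow> ?Fw"
 proof -
  have i1: "integrable lborel (\<lambda>x. f x * u x)" if "integrable lborel u" for u
  proof (rule Bochner_Integration.integrable_bound)
   show "integrable lborel (\<lambda>x. b * u x)" using that by simp
   show "AE x in lborel. norm (f x * u x) \<le> norm (b * u x)"
   proof (rule AE_I2)
    fix x
    have "\<bar>f x\<bar> \<le> \<bar>b\<bar>" using fb[of x] by linarith
    then show "norm (f x * u x) \<le> norm (b * u x)" by (simp add: abs_mult mult_right_mono)
   qed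
  qed (use that in auto)
  have nb: "norm (?F n - ?Fw) \<le> b * (LBINT x. \<bar>?c (r n) x - w x\<bar>)" for n
  proof -
   have i\<phi>: "integrable lborel (\<phi> n)" using ic by (simp add: \<phi>_def)
   have "?F n - ?Fw = (LBINT x. f x * (\<phi> n x - w x))"
    using i1[OF i\<phi>] i1[OF iw] by (simp add: right_diff_distrib)
   also have "norm \<dots> \<le> (LBINT x. norm (f x * (\<phi> n x - w x)))" by (rule integral_norm_bound)
   also have "\<dots> \<le> (LBINT x. b * \<bar>\<phi> n x - w x\<bar>)"
   proof (rule integral_mono)
    show "integrable lborel (\<lambda>x. norm (f x * (\<phi> n x - w x)))"
     by (intro integrable_norm i1 Bochner_Integration.integrable_diff i\<phi> iw)
    show "integrable lborel (\<lambda>x. b * \<bar>\<phi> n x - w x\<bar>)"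
     by (intro integrable_mult_right integrable_abs Bochner_Integration.integrable_diff i\<phi> iw)
    show "norm (f x * (\<phi> n x - w x)) \<le> b * \<bar>\<phi> n x - w x\<bar>" for x
     using fb[of x] by (simp add: abs_mult mult_right_mono)
   qed
   finally show ?thesis by (simp add: \<phi>_def)
  qed
  have "(\<lambda>n. LBINT x. \<bar>?c (r n) x - w x\<bar>) \<longlonglongrightarrow> 0"
   using LIMSEQ_subseq_LIMSEQ[OF l1 r(1)] by (simp add: o_def)
  then have lb: "(\<lambda>n. b * (LBINT x. \<bar>?c (r n) x - w x\<bar>)) \<longlonglongrightarrow> 0"
   by (rule tendsto_mult_right_zero)
  have "(\<lambda>n. ?F n - ?Fw) \<longlonglongrightarrow> 0"
   by (rule Lim_null_comparison[OF _ lb]) (intro always_eventually allI nb)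
  then show ?thesis by (rule LIM_zero_cancel)
 qed
 have limE: "AE z in lborel. (\<lambda>n. ?E (\<phi> n) z) \<longlonglongrightarrow> ?E w z"
  using AE_lborel_fst[OF ae] AE_lborel_snd[OF ae]
 proof eventually_elim
  case (elim z)
  have a: "(\<lambda>n. \<phi> n (fst z)) \<longlonglongrightarrow> w (fst z)" "(\<lambda>n. \<phi> n (snd z)) \<longlonglongrightarrow> w (snd z)" using elim by (simp_all add: \<phi>_def)
  have pw: "(\<lambda>n. \<bar>\<phi> n (fst z) - \<phi> n (snd z)\<bar> powr p) \<longlonglongrightarrow> \<bar>w (fst z) - w (snd z)\<bar> powr p"
   using p by (intro tendsto_powr2 tendsto_intros a) auto
  show ?case by (intro tendsto_diff tendsto_add tendsto_mult tendsto_const pw a)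
 qed
 have "ennreal (LBINT z. ?E w z) = (NNINT z. ennreal (?E w z))"
  by (rule nn_integral_eq_integral[OF iE(2), symmetric]) (rule AE_I2, rule E0(2))
 also have "\<dots> = (NNINT z. liminf (\<lambda>n. ennreal (?E (\<phi> n) z)))"
 proof (rule nn_integral_cong_AE)
  show "AE z in lborel. ennreal (?E w z) = liminf (\<lambda>n. ennreal (?E (\<phi> n) z))"
   using limE
  proof eventually_elim
   case (elim z)
   then have "(\<lambda>n. ennreal (?E (\<phi> n) z)) \<longlonglongrightarrow> ennreal (?E w z)" by (rule tendsto_ennrealI)
   then show ?case by (intro lim_imp_Liminf[symmetric]) auto
  qed
 qed
 also have "\<dots> \<le> liminf (\<lambda>n. (NNINT z. ennreal (?E (\<phi> n) z)))" by (rule nn_integral_liminf) measurable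
 also have "\<dots> \<le> liminf (\<lambda>n. ennreal (?G + ?e - ?F n))"
 proof (rule Liminf_mono, rule always_eventually, rule allI)
  fix n
  have "(NNINT z. ennreal (?E (\<phi> n) z)) = ennreal (LBINT z. ?E (\<phi> n) z)"
   by (rule nn_integral_eq_integral[OF iE(1)]) (rule AE_I2, rule E0(1))
  also have "\<dots> \<le> ennreal (?G + ?e - ?F n)" by (intro ennreal_leI En)
  finally show "(NNINT z. ennreal (?E (\<phi> n) z)) \<le> ennreal (?G + ?e - ?F n)" .
 qed
 also have "\<dots> = ennreal (?G + ?e - ?Fw)"
  by (intro lim_imp_Liminf tendsto_ennrealI tendsto_diff tendsto_const limF) simp
 finally have "ennreal (LBINT z. ?E w z) \<le> ennreal (?G + ?e - ?Fw)" .
 \<comment> \<open>\<open>ennreal\<close> sends negative reals to 0, so this sign is needed to read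
   the preceding inequality in the reals.\<close>
 moreover have "0 \<le> ?G + ?e - ?Fw"
 proof (rule LIMSEQ_le_const)
  show "(\<lambda>n. ?G + ?e - ?F n) \<longlonglongrightarrow> ?G + ?e - ?Fw" by (intro tendsto_diff tendsto_const limF)
  show "\<exists>N. \<forall>n\<ge>N. 0 \<le> ?G + ?e - ?F n" using En En0 order_trans by blast
 qed
 ultimately have "(LBINT z. ?E w z) \<le> ?G + ?e - ?Fw" by (simp add: ennreal_le_iff)
 moreover have "(LBINT z. ?E w z) = ?G + ?e - form v w"
  using g(1) iP iJ by (simp add: form_def)
 ultimately show ?thesis by linarith
qed

end


section \<open>Comparison\<close>

context kernel_data
begin

text \<open>The integrand is at most a constant times the distance to the power p - \<gamma>, and p
  - \<gamma> > -Q makes this locally integrable.\<close>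

lemma local_energy_lipschitz:
 fixes \<psi> :: "'n heis => real"
 assumes [measurable]: "\<psi> \<in> \<B>" and C: "0 \<le> C"
  and lip: "\<And>x y. heis_dist x x0 < r1 ==> heis_dist y x0 < r1 ==> \<bar>\<psi> x - \<psi> y\<bar> \<le> C * heis_dist x y"
  and \<gamma>': "\<gamma> < hom_dim TYPE('n) + p" and r1: "0 < r1"
 shows "local_energy \<psi> x0 r1 < \<infinity>"
proof -
 define \<alpha> where "\<alpha> = hom_dim TYPE('n) + p - \<gamma>"
 have \<alpha>: "0 < \<alpha>" using \<gamma>' by (simp add: \<alpha>_def)
 obtain c where c: "0 \<le> c" "\<And>R. 0 < R ==>
  (NNINT (\<xi>::'n heis). ennreal (heis_norm \<xi> powr (\<alpha> - hom_dim TYPE('n))) * indicator {\<xi>. heis_norm \<xi> \<le> R} \<xi>)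
   \<le> ennreal (c * R powr \<alpha>)"
  using nn_integral_heis_norm_powr[of \<alpha>, where 'n = 'n] \<alpha> by (auto cong: if_cong)
 let ?B = "{x::'n heis. heis_dist x x0 < r1}"
 let ?h = "\<lambda>\<zeta>::'n heis. ennreal (C powr p * L) * (ennreal (heis_norm \<zeta> powr (\<alpha> - hom_dim TYPE('n))) * indicator {\<xi>. heis_norm \<xi> \<le> 2 * r1} \<zeta>)"
 have B: "(NNINT x. indicator ?B x) < \<infinity>"
 proof -
  have "bounded ?B" by (rule bounded_subset[OF compact_imp_bounded[OF compact_heis_cball[of x0 r1]]]) auto
  then show ?thesis by (subst nn_integral_indicator) (auto dest!: emeasure_bounded_finite)
 qed
 have e: "(NNINT \<zeta>. ?h \<zeta>) < \<infinity>"
  using c(2)[of "2 * r1"] r1 by (subst nn_integral_cmult) (auto simp: ennreal_mult_less_top intro: le_less_trans)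
 have "local_energy \<psi> x0 r1
  \<le> (NNINT z. indicator ?B (fst z) * ?h (heis_mult (- fst z) (snd z)))"
 proof (intro nn_integral_mono)
  fix z :: "'n heis \<times> 'n heis"
  let ?d = "heis_dist (fst z) (snd z)"
  show "ennreal (\<bar>\<psi> (fst z) - \<psi> (snd z)\<bar> powr p * kk (fst z) (snd z))
    * indicator {z. heis_dist (fst z) x0 < r1 \<and> heis_dist (snd z) x0 < r1} z
   \<le> indicator ?B (fst z) * ?h (heis_mult (- fst z) (snd z))"
  proof (cases "heis_dist (fst z) x0 < r1 \<and> heis_dist (snd z) x0 < r1")
   case True
   have d: "heis_norm (heis_mult (- fst z) (snd z)) = ?d" by (simp add: heis_dist_def[symmetric] heis_dist_commute)
   have d2: "?d \<le> 2 * r1" using heis_dist_triangle[of "fst z" "snd z" x0] True by (simp add: heis_dist_commute)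
   have "\<bar>\<psi> (fst z) - \<psi> (snd z)\<bar> powr p \<le> (C * ?d) powr p"
    using lip[of "fst z" "snd z"] True p by (intro powr_mono2) auto
   also have "\<dots> = C powr p * ?d powr p" using C by (simp add: powr_mult)
   finally have "\<bar>\<psi> (fst z) - \<psi> (snd z)\<bar> powr p * kk (fst z) (snd z) \<le> (C powr p * ?d powr p) * (L * ?d powr (- \<gamma>))"
    by (intro mult_mono kk_le) auto
   also have "\<dots> = (C powr p * L) * (?d powr (\<alpha> - hom_dim TYPE('n)))"
    by (simp add: \<alpha>_def powr_add[symmetric] mult_ac)
   finally have "ennreal (\<bar>\<psi> (fst z) - \<psi> (snd z)\<bar> powr p * kk (fst z) (snd z)) \<le> ennreal ((C powr p * L) * (?d powr (\<alpha> - hom_dim TYPE('n))))"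
    by (rule ennreal_leI)
   also have "\<dots> = ennreal (C powr p * L) * ennreal (?d powr (\<alpha> - hom_dim TYPE('n)))" using L by (intro ennreal_mult) auto
   finally show ?thesis using True d2 by (simp add: d)
  qed simp
 qed
 also have "\<dots> = (NNINT x. indicator ?B x * (NNINT y. ?h (heis_mult (- x) y)))"
  by (subst nn_integral_lborel_pair, measurable) (auto intro!: nn_integral_cong nn_integral_cmult)
 also have "\<dots> = (NNINT x. indicator ?B x * (NNINT \<zeta>. ?h \<zeta>))"
  by (subst nn_integral_heis_mult) auto
 also have "\<dots> = (NNINT x. indicator ?B x) * (NNINT \<zeta>. ?h \<zeta>)" by (rule nn_integral_multc) measurable
 also have "\<dots> < \<infinity>" using B e by (simp add: ennreal_mult_less_top)
 finally show ?thesis .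
qed

text \<open>Within the larger ball the positive part does not increase differences of \<psi> - v. A
  pair not contained in that ball matters only if one point lies within A of the centre, so the
  points are \<epsilon> apart; there |w| \<le> 1 and the far bound with the constant function 1
  applies.\<close>

lemma energy_pos_part:
 fixes v \<psi> :: "'n heis => real"
 assumes v [measurable]: "v \<in> \<B>" and \<psi> [measurable]: "\<psi> \<in> \<B>"
  and lv: "local_energy v x0 r1 < \<infinity>"
  and l\<psi>: "local_energy \<psi> x0 r1 < \<infinity>"
  and A: "A < r1" and w: "w = (\<lambda>x. max 0 (\<psi> x - v x))"
  and w1: "\<And>x. w x \<le> 1" and wA: "\<And>x. A < heis_dist x x0 ==> w x = 0"
 shows "energy w < \<infinity>"
proof -
 define \<epsilon> where "\<epsilon> = r1 - A"
 have \<epsilon>: "0 < \<epsilon>" using A by (simp add: \<epsilon>_def)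
 have [measurable]: "w \<in> \<B>" unfolding w by measurable
 let ?U = "{z::'n heis \<times> 'n heis. heis_dist (fst z) x0 < r1 \<and> heis_dist (snd z) x0 < r1}"
 let ?S = "{z::'n heis \<times> 'n heis. heis_dist (fst z) x0 \<le> A \<and> \<epsilon> \<le> heis_dist (fst z) (snd z)}"
 let ?E = "\<lambda>u z. ennreal (\<bar>u (fst z) - u (snd z)\<bar> powr p * kk (fst z) (snd z)) * indicator ?U z"
 let ?F = "\<lambda>z::'n heis \<times> 'n heis. ennreal ((1 + 1) * kk (fst z) (snd z)) * indicator ?S z"
 have F: "(NNINT z. ?F z) < \<infinity>"
  by (rule far_finite[where h = "\<lambda>_. 1"]) (use weight_integral \<epsilon> in auto)
 have split: "(NNINT z. c * (a z + b z) + (d z + e z))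
   = c * ((NNINT z. a z) + (NNINT z. b z)) + ((NNINT z. d z) + (NNINT z. e z))"
  if [measurable]: "a \<in> \<B>" "b \<in> \<B>" "d \<in> \<B>" "e \<in> \<B>"
  for a b d e :: "'n heis \<times> 'n heis => ennreal" and c
  by (simp add: nn_integral_add nn_integral_cmult)
 define EP where "EP = ?E \<psi>"
 define EV where "EV = ?E v"
 define FF where "FF = ?F"
 have m [measurable]: "EP \<in> \<B>" "EV \<in> \<B>" "FF \<in> \<B>"
  unfolding EP_def EV_def FF_def by measurable
 have "energy w \<le> (NNINT z. ennreal (2 powr p) * (EP z + EV z) + (FF z + FF (snd z, fst z)))"
  unfolding energy_def
 proof (intro nn_integral_mono)
  fix z :: "'n heis \<times> 'n heis"
  let ?D = "\<bar>w (fst z) - w (snd z)\<bar>"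
  have w0: "0 \<le> w x" for x by (simp add: w)
  have D1: "?D \<le> 1" using w0[of "fst z"] w0[of "snd z"] w1[of "fst z"] w1[of "snd z"] by linarith
  then have "?D powr p \<le> 1" using p by (intro powr_le1) auto
  then have D2: "?D powr p * kk (fst z) (snd z) \<le> (1 + 1) * kk (fst z) (snd z)" by (intro mult_right_mono) auto
  show "ennreal (?D powr p * kk (fst z) (snd z)) \<le> ennreal (2 powr p) * (EP z + EV z) + (FF z + FF (snd z, fst z))"
  proof (cases "z \<in> ?U")
   case True
   have "?D \<le> \<bar>\<psi> (fst z) - \<psi> (snd z) - (v (fst z) - v (snd z))\<bar>" by (simp add: w)
   then have "?D powr p \<le> \<bar>\<psi> (fst z) - \<psi> (snd z) - (v (fst z) - v (snd z))\<bar> powr p" using p by (intro powr_mono2) auto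
   also have "\<dots> \<le> 2 powr p * (\<bar>\<psi> (fst z) - \<psi> (snd z)\<bar> powr p + \<bar>v (fst z) - v (snd z)\<bar> powr p)"
    using p by (intro abs_diff_powr_le) auto
   finally have "?D powr p * kk (fst z) (snd z) \<le> 2 powr p * (\<bar>\<psi> (fst z) - \<psi> (snd z)\<bar> powr p + \<bar>v (fst z) - v (snd z)\<bar> powr p) * kk (fst z) (snd z)"
    by (rule mult_right_mono) simp
   then have "ennreal (?D powr p * kk (fst z) (snd z)) \<le> ennreal (2 powr p * (\<bar>\<psi> (fst z) - \<psi> (snd z)\<bar> powr p * kk (fst z) (snd z) + \<bar>v (fst z) - v (snd z)\<bar> powr p * kk (fst z) (snd z)))"
    by (intro ennreal_leI) (simp add: algebra_simps)
   also have "\<dots> = ennreal (2 powr p) * (?E \<psi> z + ?E v z)"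
    using True by (simp add: ennreal_mult)
   finally show ?thesis unfolding EP_def EV_def by (rule order_trans) (simp add: add_increasing2)
  next
   case False
   then consider "r1 \<le> heis_dist (fst z) x0" | "r1 \<le> heis_dist (snd z) x0" by force
   then show ?thesis
   proof cases
    case 1
    show ?thesis
    proof (cases "heis_dist (snd z) x0 \<le> A")
     case T: True
     have "\<epsilon> \<le> heis_dist (snd z) (fst z)"
      using heis_dist_triangle[of "fst z" x0 "snd z"] 1 T by (simp add: \<epsilon>_def heis_dist_commute)
     then have "ennreal (?D powr p * kk (fst z) (snd z)) \<le> ?F (snd z, fst z)"
      using T D2 kk_commute[of "fst z" "snd z"] by (simp add: ennreal_leI)
     then show ?thesis unfolding FF_def by (rule order_trans) (simp add: add_increasing add_increasing2)
    next
     case F: False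
     then have "?D = 0" using wA[of "fst z"] wA[of "snd z"] 1 A by simp
     then show ?thesis using p by simp
    qed
   next
    case 2
    show ?thesis
    proof (cases "heis_dist (fst z) x0 \<le> A")
     case T: True
     have "\<epsilon> \<le> heis_dist (fst z) (snd z)"
      using heis_dist_triangle[of "snd z" x0 "fst z"] 2 T by (simp add: \<epsilon>_def heis_dist_commute)
     then have "ennreal (?D powr p * kk (fst z) (snd z)) \<le> ?F z"
      using T D2 by (simp add: ennreal_leI)
     then show ?thesis unfolding FF_def by (rule order_trans) (simp add: add_increasing add_increasing2)
    next
     case F: False
     then have "?D = 0" using wA[of "fst z"] wA[of "snd z"] 2 A by simp
     then show ?thesis using p by simp
    qed
   qed
  qed
 qed
 also have "\<dots> = ennreal (2 powr p) * ((NNINT z. EP z) + (NNINT z. EV z))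
  + ((NNINT z. FF z) + (NNINT z. FF (snd z, fst z)))"
  by (rule split; measurable)
 also have "\<dots> < \<infinity>"
  unfolding nn_integral_lborel_swap[OF m(3)] using F lv l\<psi> by (simp add: EP_def EV_def FF_def ennreal_mult_less_top)
 finally show ?thesis .
qed

section \<open>Truncated operators and the comparison argument\<close>

text \<open>Half of the truncated operator; the factor 2 of the principal value is supplied where
  the two are compared.\<close>

definition trunc_op :: "('n heis => real) => 'n heis => real => real" where
 "trunc_op \<psi> \<xi> \<epsilon> = (LBINT \<eta>. Jp p (\<psi> \<xi> - \<psi> \<eta>) * kk \<xi> \<eta> * indicator {\<eta>. \<epsilon> \<le> heis_dist \<xi> \<eta>} \<eta>)"

text \<open>Away from the diagonal the two terms of the test increment are separately integrable.
  Exchanging the variables carries one into the other, since \<open>Jp\<close> is odd and the kernel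
  symmetric, hence the factor 2.\<close>

lemma trunc_form:
 fixes \<psi> w :: "'n heis => real"
 assumes \<psi> [measurable]: "\<psi> \<in> \<B>"
  and hw: "tail \<psi> < \<infinity>" and \<epsilon>: "0 < \<epsilon>"
  and w [measurable]: "w \<in> \<B>"
  and w': "\<And>x. 0 \<le> w x" "\<And>x. w x \<le> 1" "\<And>x. A < heis_dist x x0 ==> w x = 0"
 shows "integrable lborel (\<lambda>z. Jp p (\<psi> (fst z) - \<psi> (snd z)) * (w (fst z) - w (snd z)) * kk (fst z) (snd z)
    * indicator {z. \<epsilon> \<le> heis_dist (fst z) (snd z)} z)"
  and "integrable lborel (\<lambda>\<xi>. w \<xi> * trunc_op \<psi> \<xi> \<epsilon>)"
  and "(LBINT z. Jp p (\<psi> (fst z) - \<psi> (snd z)) * (w (fst z) - w (snd z)) * kk (fst z) (snd z)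
    * indicator {z. \<epsilon> \<le> heis_dist (fst z) (snd z)} z) = 2 * (LBINT \<xi>. w \<xi> * trunc_op \<psi> \<xi> \<epsilon>)"
proof -
 let ?T = "\<lambda>z. Jp p (\<psi> (fst z) - \<psi> (snd z)) * (w (fst z) - w (snd z)) * kk (fst z) (snd z) * indicator {z. \<epsilon> \<le> heis_dist (fst z) (snd z)} z"
 let ?F = "\<lambda>z. Jp p (\<psi> (fst z) - \<psi> (snd z)) * kk (fst z) (snd z)
   * indicator {z. heis_dist (fst z) x0 \<le> A \<and> \<epsilon> \<le> heis_dist (fst z) (snd z)} z"
 define G where "G = (\<lambda>z. w (fst z) * (Jp p (\<psi> (fst z) - \<psi> (snd z)) * kk (fst z) (snd z)
   * indicator {\<eta>. \<epsilon> \<le> heis_dist (fst z) \<eta>} (snd z)))"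
 have iF: "integrable lborel ?F" by (rule far_integrable[OF \<psi> hw \<epsilon>])
 have GF: "G z = w (fst z) * ?F z" for z
  using w'(3)[of "fst z"] by (auto simp: G_def indicator_def)
 have iG: "integrable lborel G"
 proof (rule Bochner_Integration.integrable_bound[OF iF])
  have "G = (\<lambda>z. w (fst z) * ?F z)" using GF by blast
  moreover have "(\<lambda>z. w (fst z) * ?F z) \<in> borel_measurable lborel" by measurable
  ultimately show "G \<in> borel_measurable lborel" by simp
  show "AE z in lborel. norm (G z) \<le> norm (?F z)"
  proof (rule AE_I2)
   fix z
   have "\<bar>w (fst z)\<bar> * \<bar>?F z\<bar> \<le> 1 * \<bar>?F z\<bar>" using w' by (intro mult_right_mono) auto
   then show "norm (G z) \<le> norm (?F z)" by (simp add: GF abs_mult)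
  qed
 qed
 have iGs: "integrable lborel (\<lambda>z. G (snd z, fst z))" by (rule integrable_lborel_swap[OF iG])
 have T: "?T = (\<lambda>z. G z + G (snd z, fst z))"
 proof
  fix z :: "'n heis \<times> 'n heis"
  have "Jp p (\<psi> (snd z) - \<psi> (fst z)) = - Jp p (\<psi> (fst z) - \<psi> (snd z))" using Jp_minus[of p "\<psi> (fst z) - \<psi> (snd z)"] by simp
  then show "?T z = G z + G (snd z, fst z)"
   using heis_dist_commute[of "fst z" "snd z"] kk_commute[of "fst z" "snd z"]
   by (simp add: G_def indicator_def algebra_simps)
 qed
 show "integrable lborel ?T" unfolding T by (intro Bochner_Integration.integrable_add iG iGs)
 have gs: "(LBINT z. G (snd z, fst z)) = (LBINT z. G z)"
 proof -
  have [measurable]: "G \<in> \<B>" using iG by auto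
  have "(LBINT z. G z) = (LINT z|distr lborel borel (\<lambda>z. (snd z, fst z)). G z)" by (simp add: lborel_distr_swap)
  also have "\<dots> = (LBINT z. G (snd z, fst z))" by (rule integral_distr) auto
  finally show ?thesis by simp
 qed
 have iG': "integrable (lborel \<Otimes>\<^sub>M lborel) G" using iG by (simp add: lborel_prod)
 have c: "(LBINT \<eta>. G (\<xi>, \<eta>)) = w \<xi> * trunc_op \<psi> \<xi> \<epsilon>" for \<xi>
  unfolding G_def trunc_op_def by simp
 show "integrable lborel (\<lambda>\<xi>. w \<xi> * trunc_op \<psi> \<xi> \<epsilon>)"
  using lborel_pair.integrable_fst'[OF iG'] by (simp add: c)
 have "(LBINT z. G z) = (LBINT \<xi>. w \<xi> * trunc_op \<psi> \<xi> \<epsilon>)"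
  using lborel_pair.integral_fst'[OF iG'] by (simp add: c lborel_prod)
 then show "(LBINT z. ?T z) = 2 * (LBINT \<xi>. w \<xi> * trunc_op \<psi> \<xi> \<epsilon>)"
  unfolding T using iG iGs gs by simp
qed

text \<open>The inequality for \<psi> is assumed for truncated operators with all small \<epsilon>,
  so only absolutely convergent integrals are symmetrised. By monotonicity the truncated form of v
  at w is at most that of \<psi>, hence at most the integral of (f - \<delta>) w. For \<epsilon> to
  0 it tends to the full form, which is at least the integral of f w; so \<delta> times the integral
  of w is not positive.\<close>

lemma comparison:
 fixes v w \<psi> f :: "'n heis => real"
 assumes v [measurable]: "v \<in> \<B>"
  and hw: "tail v < \<infinity>"
  and loc: "local_energy v x0 r1 < \<infinity>"
  and \<rho>: "0 < \<rho>" "2 * \<rho> < r1"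
  and w: "w = (\<lambda>x. max 0 (\<psi> x - v x))" "\<And>x. w x \<le> 1" "\<And>x. \<rho> < heis_dist x x0 ==> w x = 0"
  and usc: "\<And>c. 0 < c ==> open {x. w x < c}" and ew: "energy w < \<infinity>"
  and f [measurable]: "f \<in> \<B>" and fb: "\<And>x. \<bar>f x\<bar> \<le> b"
  and weak: "\<And>\<phi>. smooth \<phi> ==> (\<And>x. 0 \<le> \<phi> x) ==> (\<And>x. 2 * \<rho> < heis_dist x x0 ==> \<phi> x = 0)
   ==> (LBINT x. f x * \<phi> x) \<le> form v \<phi>"
  and \<psi> [measurable]: "\<psi> \<in> \<B>"
  and h\<psi>: "tail \<psi> < \<infinity>"
  and \<delta>: "0 < \<delta>" and \<epsilon>0: "0 < \<epsilon>0"
  and op: "\<And>\<epsilon> \<xi>. 0 < \<epsilon> ==> \<epsilon> \<le> \<epsilon>0 ==> heis_dist \<xi> x0 \<le> \<rho> ==> 2 * trunc_op \<psi> \<xi> \<epsilon> \<le> f \<xi> - \<delta>"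
 shows "AE x in lborel. \<psi> x \<le> v x"
proof -
 have wm [measurable]: "w \<in> \<B>" unfolding w by measurable
 have w0: "0 \<le> w x" for x by (simp add: w)
 have 1: "(LBINT x. f x * w x) \<le> form v w"
  by (rule weak_extension[OF v hw loc \<rho> wm w0 w(2) w(3) usc ew f fb weak]) auto
 let ?T = "\<lambda>u \<epsilon> z. Jp p (u (fst z) - u (snd z)) * (w (fst z) - w (snd z)) * kk (fst z) (snd z)
    * indicator {z. \<epsilon> \<le> heis_dist (fst z) (snd z)} z"
 let ?J = "\<lambda>z. Jp p (v (fst z) - v (snd z)) * (w (fst z) - w (snd z)) * kk (fst z) (snd z)"
 have iJ: "integrable lborel ?J"
  by (rule form_integrable[OF v hw loc _ wm w0 w(2) w(3) ew]) (use \<rho> in auto)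
 let ?e = "\<lambda>n. \<epsilon>0 / (real n + 1)"
 have lim: "(\<lambda>n. LBINT z. ?T v (?e n) z) \<longlonglongrightarrow> form v w"
  unfolding form_def
 proof (rule integral_dominated_convergence[where w = "\<lambda>z. norm (?J z)"])
  show "integrable lborel (\<lambda>z. norm (?J z))" by (rule integrable_norm[OF iJ])
  show "AE z in lborel. (\<lambda>n. ?T v (?e n) z) \<longlonglongrightarrow> ?J z"
  proof (rule AE_I2)
   fix z :: "'n heis \<times> 'n heis"
   show "(\<lambda>n. ?T v (?e n) z) \<longlonglongrightarrow> ?J z"
   proof (cases "fst z = snd z")
    case False
    then have "0 < heis_dist (fst z) (snd z)" using heis_dist_nonneg[of "fst z" "snd z"] by (metis heis_dist_eq_0 less_eq_real_def)
    moreover have "?e \<longlonglongrightarrow> 0"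
     using LIMSEQ_Suc[OF lim_const_over_n[of \<epsilon>0]] by (simp add: add.commute)
    ultimately have "\<forall>\<^sub>F n in sequentially. ?e n < heis_dist (fst z) (snd z)" by (intro order_tendstoD(2))
    then have "\<forall>\<^sub>F n in sequentially. ?T v (?e n) z = ?J z" by eventually_elim simp
    then show ?thesis by (rule tendsto_eventually)
   qed simp
  qed
  show "AE z in lborel. norm (?T v (?e n) z) \<le> norm (?J z)" for n
   by (rule AE_I2) (simp add: indicator_def)
 qed measurable
 have le: "(LBINT z. ?T v (?e n) z) \<le> (LBINT x. (f x - \<delta>) * w x)" for n
 proof -
  have e: "0 < ?e n" "?e n \<le> \<epsilon>0" using \<epsilon>0 by (auto simp: divide_simps)
  have "(LBINT z. ?T v (?e n) z) \<le> (LBINT z. ?T \<psi> (?e n) z)"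
  proof (rule integral_mono)
   show "integrable lborel (?T v (?e n))" by (rule trunc_form(1)[OF v hw e(1) wm w0 w(2,3)])
   show "integrable lborel (?T \<psi> (?e n))" by (rule trunc_form(1)[OF \<psi> h\<psi> e(1) wm w0 w(2,3)])
   fix z :: "'n heis \<times> 'n heis"
   have "0 \<le> (Jp p (\<psi> (fst z) - \<psi> (snd z)) - Jp p (v (fst z) - v (snd z))) * (w (fst z) - w (snd z))"
    unfolding w(1) by (rule Jp_mono_product[OF p])
   then have "0 \<le> (Jp p (\<psi> (fst z) - \<psi> (snd z)) - Jp p (v (fst z) - v (snd z))) * (w (fst z) - w (snd z)) * (kk (fst z) (snd z)
    * indicator {z. ?e n \<le> heis_dist (fst z) (snd z)} z)" by (rule mult_nonneg_nonneg) simp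
   then show "?T v (?e n) z \<le> ?T \<psi> (?e n) z" by (simp add: algebra_simps)
  qed
  also have "\<dots> = 2 * (LBINT \<xi>. w \<xi> * trunc_op \<psi> \<xi> (?e n))" by (rule trunc_form(3)[OF \<psi> h\<psi> e(1) wm w0 w(2,3)])
  also have "\<dots> = (LBINT \<xi>. 2 * (w \<xi> * trunc_op \<psi> \<xi> (?e n)))" by simp
  also have "\<dots> \<le> (LBINT x. (f x - \<delta>) * w x)"
  proof (rule integral_mono)
   show "integrable lborel (\<lambda>\<xi>. 2 * (w \<xi> * trunc_op \<psi> \<xi> (?e n)))"
    by (intro integrable_mult_right trunc_form(2)[OF \<psi> h\<psi> e(1) wm w0 w(2,3)])
   show "integrable lborel (\<lambda>x. (f x - \<delta>) * w x)"
   proof (rule tame_integrable, rule tameI[of _ "\<bar>b\<bar> + \<delta>" \<rho> x0])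
    fix x
    have "\<bar>f x - \<delta>\<bar> * \<bar>w x\<bar> \<le> (\<bar>b\<bar> + \<delta>) * 1"
     using fb[of x] \<delta> w0[of x] w(2)[of x] by (intro mult_mono) auto
    then show "\<bar>(f x - \<delta>) * w x\<bar> \<le> \<bar>b\<bar> + \<delta>" by (simp add: abs_mult)
   qed (use w(3) in auto)
   fix x
   show "2 * (w x * trunc_op \<psi> x (?e n)) \<le> (f x - \<delta>) * w x"
   proof (cases "heis_dist x x0 \<le> \<rho>")
    case True
    then have "2 * trunc_op \<psi> x (?e n) * w x \<le> (f x - \<delta>) * w x" by (intro mult_right_mono op e w0)
    then show ?thesis by (simp add: mult_ac)
   qed (use w(3) in auto)
  qed
  finally show ?thesis .
 qed
 have "form v w \<le> (LBINT x. (f x - \<delta>) * w x)" by (rule LIMSEQ_le_const2[OF lim]) (use le in blast)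
 with 1 have A: "(LBINT x. f x * w x) \<le> (LBINT x. (f x - \<delta>) * w x)" by linarith
 have iw: "integrable lborel w"
  by (rule tame_integrable, rule tameI[of _ 1 \<rho> x0]) (use w0 w(2,3) in auto)
 have ifw: "integrable lborel (\<lambda>x. f x * w x)"
 proof (rule tame_integrable, rule tameI[of _ "\<bar>b\<bar>" \<rho> x0])
  fix x
  have "\<bar>f x\<bar> * \<bar>w x\<bar> \<le> \<bar>b\<bar> * 1"
   using fb[of x] w0[of x] w(2)[of x] by (intro mult_mono) auto
  then show "\<bar>f x * w x\<bar> \<le> \<bar>b\<bar>" by (simp add: abs_mult)
 qed (use w(3) in auto)
 have "(LBINT x. (f x - \<delta>) * w x) = (LBINT x. f x * w x) - \<delta> * (LBINT x. w x)"
  using iw ifw by (simp add: left_diff_distrib)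
 with A \<delta> have "(LBINT x. w x) \<le> 0" by (simp add: mult_le_0_iff)
 moreover have "0 \<le> (LBINT x. w x)" by (intro integral_nonneg_AE AE_I2 w0)
 ultimately have "(LBINT x. w x) = 0" by simp
 then have "AE x in lborel. w x = 0" using integral_nonneg_eq_0_iff_AE[OF iw] w0 by simp
 then show ?thesis by eventually_elim (auto simp: w(1) max_def split: if_splits)
qed

end


section \<open>The operator applied to touching functions\<close>

lemma tendsto_heis_dist_zero:
 fixes x :: "'b => 'n::finite heis"
 assumes "((\<lambda>n. heis_dist (x n) x0) \<longlongrightarrow> 0) F"
 shows "(x \<longlongrightarrow> x0) F"
proof (rule topological_tendstoI)
 fix S assume "open S" "x0 \<in> S"
 then obtain r where r: "0 < r" "heis_ball x0 r \<subseteq> S" using heis_ball_subset_open by metis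
 have "\<forall>\<^sub>F n in F. heis_dist (x n) x0 < r" using assms r(1) by (rule order_tendstoD(2))
 then show "\<forall>\<^sub>F n in F. x n \<in> S" by eventually_elim (use r(2) in \<open>auto simp: mem_heis_ball\<close>)
qed

text \<open>At 0 the factor |x|^(p - 2) may be unbounded, but |Jp p x| = |x|^(p - 1) tends to
  zero.\<close>

lemma isCont_Jp:
 assumes "1 < p"
 shows "isCont (Jp p) a"
proof (cases "a = 0")
 case True
 have "((\<lambda>x. \<bar>x\<bar> powr (p - 1)) \<longlongrightarrow> 0) (at (0::real))"
 proof (rule tendsto_zero_powrI[OF _ tendsto_const])
  show "((\<lambda>x. \<bar>x\<bar>) \<longlongrightarrow> 0) (at (0::real))" using tendsto_rabs[OF tendsto_ident_at[of "0::real" UNIV]] by simp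
 qed (use assms in auto)
 then have "(Jp p \<longlongrightarrow> 0) (at 0)"
  by (rule Lim_null_comparison[rotated]) (simp add: abs_Jp)
 then show ?thesis using True by (simp add: isCont_def)
next
 case False
 then show ?thesis unfolding Jp_def by (intro continuous_intros) auto
qed

lemma near_int_substitution:
 fixes \<xi> :: "'n::finite heis"
 assumes [measurable]: "\<psi> \<in> \<B>" "\<kappa> \<in> \<B>" and even: "\<And>\<zeta>. \<kappa> (- \<zeta>) = \<kappa> \<zeta>"
 shows "near_int p \<psi> \<xi> \<kappa> = (LBINT \<eta>. Jp p (\<psi> \<xi> - \<psi> \<eta>) * \<kappa> (heis_mult (- \<eta>) \<xi>))"
proof -
 have e: "\<kappa> (heis_mult (- \<eta>) \<xi>) = \<kappa> (heis_mult (- \<xi>) \<eta>)" for \<eta>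
  using even[of "heis_mult (- \<xi>) \<eta>"] by (simp add: heis_mult_uminus)
 let ?f = "\<lambda>\<eta>. Jp p (\<psi> \<xi> - \<psi> \<eta>) * \<kappa> (heis_mult (- \<xi>) \<eta>)"
 have "(LBINT \<eta>. ?f \<eta>) = (LINT \<eta>|distr lborel borel (heis_mult \<xi>). ?f \<eta>)"
  by (simp add: lborel_distr_heis_mult)
 also have "\<dots> = (LBINT \<eta>. ?f (heis_mult \<xi> \<eta>))" by (rule integral_distr) measurable
 finally show ?thesis by (simp add: near_int_def e)
qed

locale kernel_data_cont = kernel_data p \<gamma> L k
 for p \<gamma> L and k :: "'n::finite heis => real" +
 assumes k_cont: "continuous_on (- {0}) k"
begin

text \<open>One majorant for all base points in a ball and all bounded central values, as needed for
  continuity in both.\<close>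

lemma op_dominated:
 fixes \<Phi> :: "'n heis => real"
 assumes [measurable]: "\<Phi> \<in> \<B>"
  and hw: "tail \<Phi> < \<infinity>" and \<epsilon>: "0 < \<epsilon>" and B: "0 \<le> B"
 obtains g where "integrable lborel g"
  "\<forall>\<xi> \<tau> \<eta>. heis_dist \<xi> x0 \<le> A \<and> \<bar>\<tau>\<bar> \<le> B \<and> \<epsilon> \<le> heis_dist \<xi> \<eta> --> \<bar>Jp p (\<tau> - \<Phi> \<eta>)\<bar> * kk \<xi> \<eta> \<le> g \<eta>"
proof -
 obtain C where C: "0 \<le> C" "\<And>\<xi> \<eta>. heis_dist \<xi> x0 \<le> A ==> \<epsilon> \<le> heis_dist \<xi> \<eta> ==> heis_dist \<xi> \<eta> powr (- \<gamma>) \<le> C * weight \<eta>"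
  by (rule weight_bound[OF \<epsilon>]) (rule that)
 define g where "g = (\<lambda>\<eta>. 2 powr (p - 1) * L * C * (B powr (p - 1) * weight \<eta> + \<bar>\<Phi> \<eta>\<bar> powr (p - 1) * weight \<eta>))"
 show ?thesis
 proof (rule that[of g])
  have "integrable lborel (\<lambda>\<eta>. \<bar>\<Phi> \<eta>\<bar> powr (p - 1) * weight \<eta>)" "integrable lborel weight"
   by (rule integrableI_bounded; use hw weight_integral weight_pos in \<open>simp add: less_imp_le\<close>)+
  then show "integrable lborel g" unfolding g_def by (intro integrable_mult_right Bochner_Integration.integrable_add)
  show "\<forall>\<xi> \<tau> \<eta>. heis_dist \<xi> x0 \<le> A \<and> \<bar>\<tau>\<bar> \<le> B \<and> \<epsilon> \<le> heis_dist \<xi> \<eta> --> \<bar>Jp p (\<tau> - \<Phi> \<eta>)\<bar> * kk \<xi> \<eta> \<le> g \<eta>"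
  proof (intro allI impI)
   fix \<xi> \<eta> :: "'n heis" and \<tau>
   assume a: "heis_dist \<xi> x0 \<le> A \<and> \<bar>\<tau>\<bar> \<le> B \<and> \<epsilon> \<le> heis_dist \<xi> \<eta>"
   have "kk \<xi> \<eta> \<le> L * heis_dist \<xi> \<eta> powr (- \<gamma>)" by (rule kk_le)
   also have "\<dots> \<le> L * (C * weight \<eta>)" using C(2) a L by (intro mult_left_mono) auto
   finally have 1: "kk \<xi> \<eta> \<le> L * (C * weight \<eta>)" .
   have "\<bar>Jp p (\<tau> - \<Phi> \<eta>)\<bar> \<le> 2 powr (p - 1) * (\<bar>\<tau>\<bar> powr (p - 1) + \<bar>\<Phi> \<eta>\<bar> powr (p - 1))" by (rule abs_Jp_diff_le)
   also have "\<dots> \<le> 2 powr (p - 1) * (B powr (p - 1) + \<bar>\<Phi> \<eta>\<bar> powr (p - 1))"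
    using a p by (intro mult_left_mono add_right_mono powr_mono2) auto
   finally have "\<bar>Jp p (\<tau> - \<Phi> \<eta>)\<bar> * kk \<xi> \<eta> \<le> (2 powr (p - 1) * (B powr (p - 1) + \<bar>\<Phi> \<eta>\<bar> powr (p - 1))) * (L * (C * weight \<eta>))"
    using 1 by (intro mult_mono) auto
   also have "\<dots> = g \<eta>" by (simp add: g_def algebra_simps)
   finally show "\<bar>Jp p (\<tau> - \<Phi> \<eta>)\<bar> * kk \<xi> \<eta> \<le> g \<eta>" .
  qed
 qed
qed

lemma op_integrable:
 fixes \<Phi> :: "'n heis => real"
 assumes \<Phi> [measurable]: "\<Phi> \<in> \<B>"
  and hw: "tail \<Phi> < \<infinity>" and \<epsilon>: "0 < \<epsilon>"
  and c [measurable]: "c \<in> \<B>" and cb: "\<And>\<eta>. \<bar>c \<eta>\<bar> \<le> kk \<xi> \<eta>" "\<And>\<eta>. heis_dist \<xi> \<eta> < \<epsilon> ==> c \<eta> = 0"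
 shows "integrable lborel (\<lambda>\<eta>. Jp p (\<tau> - \<Phi> \<eta>) * c \<eta>)"
proof -
 obtain g where g: "integrable lborel g"
  "\<forall>\<xi>' \<tau>' \<eta>. heis_dist \<xi>' \<xi> \<le> 0 \<and> \<bar>\<tau>'\<bar> \<le> \<bar>\<tau>\<bar> \<and> \<epsilon> \<le> heis_dist \<xi>' \<eta> --> \<bar>Jp p (\<tau>' - \<Phi> \<eta>)\<bar> * kk \<xi>' \<eta> \<le> g \<eta>"
  by (rule op_dominated[OF \<Phi> hw \<epsilon> abs_ge_zero]) (rule that)
 show ?thesis
 proof (rule Bochner_Integration.integrable_bound)
  show "integrable lborel (\<lambda>\<eta>. \<bar>g \<eta>\<bar>)" using g(1) by simp
  show "AE \<eta> in lborel. norm (Jp p (\<tau> - \<Phi> \<eta>) * c \<eta>) \<le> norm \<bar>g \<eta>\<bar>"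
  proof (rule AE_I2)
   fix \<eta>
   show "norm (Jp p (\<tau> - \<Phi> \<eta>) * c \<eta>) \<le> norm \<bar>g \<eta>\<bar>"
   proof (cases "heis_dist \<xi> \<eta> < \<epsilon>")
    case False
    have "\<bar>Jp p (\<tau> - \<Phi> \<eta>)\<bar> * \<bar>c \<eta>\<bar> \<le> \<bar>Jp p (\<tau> - \<Phi> \<eta>)\<bar> * kk \<xi> \<eta>" using cb(1) by (intro mult_left_mono) auto
    also have "\<dots> \<le> g \<eta>" using g(2) False by simp
    finally show ?thesis by (simp add: abs_mult)
   qed (simp add: cb(2))
  qed
 qed measurable
qed

section \<open>Splitting the operator into a near and a far part\<close>

text \<open>A continuous transition between R and 2 R in place of an indicator keeps the far kernel
  continuous on the whole group.\<close>

definition ramp :: "real => 'n heis => real" where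
 "ramp R \<zeta> = min 1 (max 0 (2 - heis_norm \<zeta> / R))"

lemma ramp_bounds: "0 \<le> ramp R \<zeta>" "ramp R \<zeta> \<le> 1"
 by (auto simp: ramp_def)

lemma ramp_eq: "0 < R ==> heis_norm \<zeta> \<le> R ==> ramp R \<zeta> = 1" "0 < R ==> 2 * R \<le> heis_norm \<zeta> ==> ramp R \<zeta> = 0"
proof -
 assume R: "0 < R"
 show "heis_norm \<zeta> \<le> R ==> ramp R \<zeta> = 1"
 proof -
  assume "heis_norm \<zeta> \<le> R"
  then have "heis_norm \<zeta> / R \<le> 1" using R by simp
  then show ?thesis by (simp add: ramp_def)
 qed
 show "2 * R \<le> heis_norm \<zeta> ==> ramp R \<zeta> = 0"
 proof -
  assume "2 * R \<le> heis_norm \<zeta>"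
  then have "2 \<le> heis_norm \<zeta> / R" using R by (simp add: field_simps)
  then show ?thesis by (simp add: ramp_def)
 qed
qed

lemma ramp_measurable [measurable]: "ramp R \<in> \<B>"
 unfolding ramp_def by measurable

lemma continuous_ramp: "continuous_on S (ramp R)"
 unfolding ramp_def by (cases "R = 0") (auto intro!: continuous_intros)

definition kfar :: "real => 'n heis => real" where
 "kfar R \<zeta> = k \<zeta> * (1 - ramp R \<zeta>)"

lemma kfar_measurable [measurable]: "kfar R \<in> \<B>"
 unfolding kfar_def by measurable

lemma kfar_nonneg: "0 \<le> kfar R \<zeta>"
 using ramp_bounds[of R \<zeta>] by (simp add: kfar_def k_nonneg)

lemma kfar_le: "kfar R \<zeta> \<le> k \<zeta>"
 unfolding kfar_def using ramp_bounds[of R \<zeta>] by (intro mult_left_le k_nonneg) auto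

lemma kfar_eq_0: "0 < R ==> heis_norm \<zeta> \<le> R ==> kfar R \<zeta> = 0"
 by (simp add: kfar_def ramp_eq)

lemma continuous_kfar:
 assumes "0 < R"
 shows "continuous_on UNIV (kfar R)"
proof -
 have "continuous_on ({\<zeta>. heis_norm \<zeta> < R} \<union> - {0}) (kfar R)"
 proof (rule continuous_on_open_Un)
  show "open {\<zeta>::'n heis. heis_norm \<zeta> < R}" by (intro open_Collect_less continuous_intros)
  show "continuous_on {\<zeta>. heis_norm \<zeta> < R} (kfar R)"
   using assms by (auto intro: continuous_on_eq[OF continuous_on_const[of _ 0]] simp: kfar_eq_0)
  show "continuous_on (- {0}) (kfar R)" unfolding kfar_def by (intro continuous_intros k_cont continuous_ramp)
 qed auto
 moreover have "{\<zeta>::'n heis. heis_norm \<zeta> < R} \<union> - {0} = UNIV" using assms by auto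
 ultimately show ?thesis by simp
qed

text \<open>The central value \<tau> is a variable of its own, because the lift changes the value at
  the centre while the function under the integral can be kept fixed.\<close>

definition far_op :: "('n heis => real) => real => 'n heis => real => real" where
 "far_op \<Phi> R \<xi> \<tau> = (LBINT \<eta>. Jp p (\<tau> - \<Phi> \<eta>) * kfar R (heis_mult (- \<eta>) \<xi>))"

lemma far_op_integrable:
 assumes "\<Phi> \<in> \<B>"
  and "tail \<Phi> < \<infinity>" and R: "0 < R"
 shows "integrable lborel (\<lambda>\<eta>. Jp p (\<tau> - \<Phi> \<eta>) * kfar R (heis_mult (- \<eta>) \<xi>))"
 by (rule op_integrable[OF assms, where \<xi> = \<xi>])
  (use kfar_le kfar_nonneg R in \<open>auto simp: kk_def heis_dist_def kfar_eq_0\<close>)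

lemma tendsto_far_op:
 fixes \<Phi> :: "'n heis => real"
 assumes \<Phi> [measurable]: "\<Phi> \<in> \<B>"
  and hw: "tail \<Phi> < \<infinity>" and R: "0 < R"
  and lim: "x \<longlonglongrightarrow> x0" "t \<longlonglongrightarrow> \<tau>0" and bd: "\<And>n. heis_dist (x n) x0 \<le> 1" "\<And>n. \<bar>t n\<bar> \<le> \<bar>\<tau>0\<bar> + 1"
 shows "(\<lambda>n. far_op \<Phi> R (x n) (t n)) \<longlonglongrightarrow> far_op \<Phi> R x0 \<tau>0"
proof -
 obtain g where g: "integrable lborel g"
  "\<forall>\<xi>' \<tau>' \<eta>. heis_dist \<xi>' x0 \<le> 1 \<and> \<bar>\<tau>'\<bar> \<le> \<bar>\<tau>0\<bar> + 1 \<and> R \<le> heis_dist \<xi>' \<eta> --> \<bar>Jp p (\<tau>' - \<Phi> \<eta>)\<bar> * kk \<xi>' \<eta> \<le> g \<eta>"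
  by (rule op_dominated[OF \<Phi> hw R, of "\<bar>\<tau>0\<bar> + 1" x0 1]) (simp, rule that)
 show ?thesis
  unfolding far_op_def
 proof (rule integral_dominated_convergence[where w = "\<lambda>\<eta>. \<bar>g \<eta>\<bar>"])
  show "integrable lborel (\<lambda>\<eta>. \<bar>g \<eta>\<bar>)" using g(1) by simp
  show "AE \<eta> in lborel. (\<lambda>n. Jp p (t n - \<Phi> \<eta>) * kfar R (heis_mult (- \<eta>) (x n))) \<longlonglongrightarrow> Jp p (\<tau>0 - \<Phi> \<eta>) * kfar R (heis_mult (- \<eta>) x0)"
  proof (intro AE_I2 tendsto_mult)
   fix \<eta>
   have "isCont (Jp p) (\<tau>0 - \<Phi> \<eta>)" using p by (rule isCont_Jp)
   then show "(\<lambda>n. Jp p (t n - \<Phi> \<eta>)) \<longlonglongrightarrow> Jp p (\<tau>0 - \<Phi> \<eta>)"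
    by (rule isCont_tendsto_compose) (intro tendsto_intros lim)
   have "continuous_on UNIV (\<lambda>x. kfar R (heis_mult (- \<eta>) x))"
    by (intro continuous_on_compose2[OF continuous_kfar[OF R]] continuous_intros) auto
   then have "isCont (\<lambda>x. kfar R (heis_mult (- \<eta>) x)) x0" by (simp add: continuous_on_eq_continuous_at)
   then show "(\<lambda>n. kfar R (heis_mult (- \<eta>) (x n))) \<longlonglongrightarrow> kfar R (heis_mult (- \<eta>) x0)"
    by (rule isCont_tendsto_compose) (rule lim)
  qed
  show "AE \<eta> in lborel. norm (Jp p (t n - \<Phi> \<eta>) * kfar R (heis_mult (- \<eta>) (x n))) \<le> \<bar>g \<eta>\<bar>" for n
  proof (rule AE_I2)
   fix \<eta>
   show "norm (Jp p (t n - \<Phi> \<eta>) * kfar R (heis_mult (- \<eta>) (x n))) \<le> \<bar>g \<eta>\<bar>"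
   proof (cases "R \<le> heis_dist (x n) \<eta>")
    case True
    have "\<bar>Jp p (t n - \<Phi> \<eta>)\<bar> * kfar R (heis_mult (- \<eta>) (x n)) \<le> \<bar>Jp p (t n - \<Phi> \<eta>)\<bar> * kk (x n) \<eta>"
     using kfar_le by (intro mult_left_mono) (auto simp: kk_def)
    also have "\<dots> \<le> g \<eta>" using g(2) True bd by blast
    finally show ?thesis using kfar_nonneg by (simp add: abs_mult)
   qed (use R in \<open>simp add: kfar_eq_0 heis_dist_def\<close>)
  qed
 qed measurable
qed

lemma far_op_upper:
 fixes \<Phi> :: "'n heis => real"
 assumes \<Phi>: "\<Phi> \<in> \<B>"
  and hw: "tail \<Phi> < \<infinity>" and R: "0 < R" and \<delta>: "0 < \<delta>"
 shows "\<exists>\<rho>>0. \<forall>\<xi> \<tau>. heis_dist \<xi> x0 \<le> \<rho> \<and> \<bar>\<tau> - \<tau>0\<bar> \<le> \<rho> --> far_op \<Phi> R \<xi> \<tau> \<le> far_op \<Phi> R x0 \<tau>0 + \<delta>"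
proof (rule ccontr)
 assume "\<not> ?thesis"
 then have "\<exists>\<xi> \<tau>. heis_dist \<xi> x0 \<le> 1 / (real n + 1) \<and> \<bar>\<tau> - \<tau>0\<bar> \<le> 1 / (real n + 1) \<and> far_op \<Phi> R x0 \<tau>0 + \<delta> < far_op \<Phi> R \<xi> \<tau>" for n
  by (metis add_pos_nonneg divide_pos_pos not_le of_nat_0_le_iff add.commute zero_less_one)
 then obtain x t where xt: "\<And>n. heis_dist (x n) x0 \<le> 1 / (real n + 1)" "\<And>n. \<bar>t n - \<tau>0\<bar> \<le> 1 / (real n + 1)"
  "\<And>n. far_op \<Phi> R x0 \<tau>0 + \<delta> < far_op \<Phi> R (x n) (t n)" by metis
 have e: "(\<lambda>n. 1 / (real n + 1)) \<longlonglongrightarrow> 0" using LIMSEQ_Suc[OF lim_const_over_n[of 1]] by (simp add: add.commute)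
 have l1: "x \<longlonglongrightarrow> x0"
  by (rule tendsto_heis_dist_zero, rule tendsto_sandwich[OF _ _ tendsto_const e]) (use xt(1) in auto)
 have l2: "t \<longlonglongrightarrow> \<tau>0"
  by (rule LIM_zero_cancel, rule Lim_null_comparison[OF _ e]) (use xt(2) in auto)
 have le1: "1 / (real n + 1) \<le> 1" for n by simp
 have "(\<lambda>n. far_op \<Phi> R (x n) (t n)) \<longlonglongrightarrow> far_op \<Phi> R x0 \<tau>0"
 proof (rule tendsto_far_op[OF \<Phi> hw R l1 l2])
  show "heis_dist (x n) x0 \<le> 1" for n using xt(1)[of n] le1[of n] by linarith
  show "\<bar>t n\<bar> \<le> \<bar>\<tau>0\<bar> + 1" for n using xt(2)[of n] le1[of n] by linarith
 qed
 then have "far_op \<Phi> R x0 \<tau>0 + \<delta> \<le> far_op \<Phi> R x0 \<tau>0"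
  by (rule LIMSEQ_le_const) (use xt(3) less_imp_le in blast)
 then show False using \<delta> by simp
qed

text \<open>The near kernel carries the truncation and lives up to radius 2 R, where the ramp ends.
  The far kernel already vanishes up to R \<ge> \<epsilon>, so it does not depend on
  \<epsilon>.\<close>

lemma trunc_op_split:
 fixes \<psi> :: "'n heis => real"
 assumes \<psi> [measurable]: "\<psi> \<in> \<B>"
  and hw: "tail \<psi> < \<infinity>" and \<epsilon>: "0 < \<epsilon>" "\<epsilon> \<le> R"
 obtains \<kappa> where "near_kernel L \<gamma> (2 * R) \<kappa>" "trunc_op \<psi> \<xi> \<epsilon> = near_int p \<psi> \<xi> \<kappa> + far_op \<psi> R \<xi> (\<psi> \<xi>)"
proof
 have R: "0 < R" using \<epsilon> by linarith
 let ?\<kappa> = "\<lambda>\<zeta>. k \<zeta> * ramp R \<zeta> * indicator {\<zeta>. \<epsilon> \<le> heis_norm \<zeta>} \<zeta>"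
 have k1: "0 \<le> ?\<kappa> \<zeta>" "?\<kappa> \<zeta> \<le> k \<zeta>" "?\<kappa> (- \<zeta>) = ?\<kappa> \<zeta>" for \<zeta>
  using ramp_bounds[of R \<zeta>] k_nonneg[of \<zeta>] k_even[of \<zeta>]
  by (auto simp: indicator_def ramp_def intro: mult_left_le)
 have "?\<kappa> \<zeta> \<le> L * heis_norm \<zeta> powr (- \<gamma>)" for \<zeta> using k1(2)[of \<zeta>] k_le[of \<zeta>] by linarith
 then show "near_kernel L \<gamma> (2 * R) ?\<kappa>"
  unfolding near_kernel_def using k1 \<epsilon> R ramp_eq(2)[of R]
  by (intro conjI allI exI[of _ \<epsilon>]) auto
 have n: "near_int p \<psi> \<xi> ?\<kappa> = (LBINT \<eta>. Jp p (\<psi> \<xi> - \<psi> \<eta>) * ?\<kappa> (heis_mult (- \<eta>) \<xi>))"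
  by (rule near_int_substitution) (use k1 in auto)
 have i1: "integrable lborel (\<lambda>\<eta>. Jp p (\<psi> \<xi> - \<psi> \<eta>) * ?\<kappa> (heis_mult (- \<eta>) \<xi>))"
  by (rule op_integrable[OF \<psi> hw \<epsilon>(1), where \<xi> = \<xi>]) (use k1 in \<open>auto simp: kk_def heis_dist_def\<close>)
 have e: "kk \<xi> \<eta> * indicator {\<eta>. \<epsilon> \<le> heis_dist \<xi> \<eta>} \<eta> = ?\<kappa> (heis_mult (- \<eta>) \<xi>) + kfar R (heis_mult (- \<eta>) \<xi>)" for \<eta>
 proof (cases "\<epsilon> \<le> heis_dist \<xi> \<eta>")
  case False
  then show ?thesis using kfar_eq_0[OF R, of "heis_mult (- \<eta>) \<xi>"] \<epsilon> by (simp add: heis_dist_def)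
 qed (simp add: heis_dist_def kk_def kfar_def algebra_simps)
 have "trunc_op \<psi> \<xi> \<epsilon> = (LBINT \<eta>. Jp p (\<psi> \<xi> - \<psi> \<eta>) * ?\<kappa> (heis_mult (- \<eta>) \<xi>) + Jp p (\<psi> \<xi> - \<psi> \<eta>) * kfar R (heis_mult (- \<eta>) \<xi>))"
  unfolding trunc_op_def mult.assoc e distrib_left ..
 also have "\<dots> = near_int p \<psi> \<xi> ?\<kappa> + far_op \<psi> R \<xi> (\<psi> \<xi>)"
  unfolding n far_op_def by (rule Bochner_Integration.integral_add[OF i1 far_op_integrable[OF \<psi> hw R]])
 finally show "trunc_op \<psi> \<xi> \<epsilon> = near_int p \<psi> \<xi> ?\<kappa> + far_op \<psi> R \<xi> (\<psi> \<xi>)" .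
qed

text \<open>The difference of two truncations is a near integral over an annulus, again with an even
  kernel vanishing near the unit. Uniform smallness with \<theta> = 0 is therefore the Cauchy
  criterion for the principal value.\<close>

lemma trunc_op_limit:
 fixes \<Phi> g :: "'n heis => real"
 assumes \<Phi> [measurable]: "\<Phi> \<in> \<B>"
  and hw: "tail \<Phi> < \<infinity>"
  and \<gamma>': "\<gamma> = hom_dim TYPE('n) + s * p" and nu: "near_uniform p s L r x0 g"
  and g: "\<And>x. x \<in> heis_ball x0 r ==> \<Phi> x = g x"
 shows "\<exists>l. (trunc_op \<Phi> x0 \<longlongrightarrow> l) (at_right 0)"
proof -
 have C: "\<exists>R>0. \<forall>a b. 0 < a \<and> a \<le> b \<and> b \<le> R --> \<bar>trunc_op \<Phi> x0 a - trunc_op \<Phi> x0 b\<bar> \<le> \<delta>" if "0 < \<delta>" for \<delta>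
 proof -
  obtain R0 where R0: "0 < R0" "\<forall>R. 0<R\<and>R\<le>R0 --> (\<exists>\<rho>0>0. \<forall>\<rho>. 0<\<rho>\<and>\<rho>\<le>\<rho>0 --> (\<exists>\<theta>0>0. near_small p s L r x0 g \<delta> R \<rho> \<theta>0))"
   using nu \<open>0 < \<delta>\<close> unfolding near_uniform_def by blast
  have b1: "\<bar>near_int p \<Phi> x0 \<kappa>\<bar> \<le> \<delta>" if \<kappa>: "near_kernel L \<gamma> R0 \<kappa>" for \<kappa>
  proof -
   obtain \<rho>0 where \<rho>0: "0 < \<rho>0" "\<forall>\<rho>. 0<\<rho>\<and>\<rho>\<le>\<rho>0 --> (\<exists>\<theta>0>0. near_small p s L r x0 g \<delta> R0 \<rho> \<theta>0)"
    using R0(2) R0(1) by (metis order_refl)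
   obtain \<theta>0 where \<theta>0: "0 < \<theta>0" "near_small p s L r x0 g \<delta> R0 \<rho>0 \<theta>0"
    using \<rho>0(2) \<rho>0(1) by (metis order_refl)
   show ?thesis
    by (rule \<theta>0(2)[rule_format, of 0]) (use \<theta>0(1) \<rho>0(1) g \<kappa> in \<open>auto simp: \<gamma>'\<close>)
  qed
  have "\<bar>trunc_op \<Phi> x0 a - trunc_op \<Phi> x0 b\<bar> \<le> \<delta>" if ab: "0 < a" "a \<le> b" "b \<le> R0" for a b
  proof -
   let ?\<kappa> = "\<lambda>\<zeta>. k \<zeta> * indicator {\<zeta>. a \<le> heis_norm \<zeta> \<and> heis_norm \<zeta> < b} \<zeta>"
   have k1: "0 \<le> ?\<kappa> \<zeta>" "?\<kappa> \<zeta> \<le> k \<zeta>" "?\<kappa> (- \<zeta>) = ?\<kappa> \<zeta>" for \<zeta>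
    using k_nonneg[of \<zeta>] k_even[of \<zeta>] by (auto simp: indicator_def)
   have "?\<kappa> \<zeta> \<le> L * heis_norm \<zeta> powr (- \<gamma>)" for \<zeta> using k1(2)[of \<zeta>] k_le[of \<zeta>] by linarith
   then have "near_kernel L \<gamma> R0 ?\<kappa>"
    unfolding near_kernel_def using k1 ab by (intro conjI allI exI[of _ a]) auto
   then have b: "\<bar>near_int p \<Phi> x0 ?\<kappa>\<bar> \<le> \<delta>" by (rule b1)
   let ?T = "\<lambda>\<epsilon> \<eta>. Jp p (\<Phi> x0 - \<Phi> \<eta>) * (kk x0 \<eta> * indicator {\<eta>. \<epsilon> \<le> heis_dist x0 \<eta>} \<eta>)"
   have iT: "integrable lborel (?T \<epsilon>)" if "0 < \<epsilon>" for \<epsilon>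
    by (rule op_integrable[OF \<Phi> hw that, where \<xi> = x0]) (auto simp: indicator_def)
   have "trunc_op \<Phi> x0 a - trunc_op \<Phi> x0 b = (LBINT \<eta>. ?T a \<eta> - ?T b \<eta>)"
    unfolding trunc_op_def using iT[of a] iT[of b] ab by (simp add: mult.assoc)
   also have "\<dots> = (LBINT \<eta>. Jp p (\<Phi> x0 - \<Phi> \<eta>) * ?\<kappa> (heis_mult (- \<eta>) x0))"
    using ab by (intro Bochner_Integration.integral_cong) (auto simp: indicator_def kk_def heis_dist_def)
   also have "\<dots> = near_int p \<Phi> x0 ?\<kappa>"
    by (rule near_int_substitution[symmetric]) (use k1 in auto)
   finally show ?thesis using b by simp
  qed
  then show ?thesis using R0(1) by blast
 qed
 let ?e = "\<lambda>n. 1 / (real n + 1)"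
 have e0: "?e \<longlonglongrightarrow> 0" using LIMSEQ_Suc[OF lim_const_over_n[of 1]] by (simp add: add.commute)
 have ep: "0 < ?e n" for n by simp
 have ev: "\<exists>N. \<forall>n\<ge>N. ?e n \<le> R" if "0 < R" for R
  using order_tendstoD(2)[OF e0 that] unfolding eventually_sequentially by (meson less_imp_le)
 have "Cauchy (\<lambda>n. trunc_op \<Phi> x0 (?e n))"
 proof (rule metric_CauchyI)
  fix \<delta> :: real assume \<delta>: "0 < \<delta>"
  obtain R where R: "0 < R" "\<forall>a b. 0 < a \<and> a \<le> b \<and> b \<le> R --> \<bar>trunc_op \<Phi> x0 a - trunc_op \<Phi> x0 b\<bar> \<le> \<delta> / 2"
   using C[of "\<delta> / 2"] \<delta> by auto
  obtain N where N: "\<forall>n\<ge>N. ?e n \<le> R" using ev[OF R(1)] by blast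
  have "dist (trunc_op \<Phi> x0 (?e m)) (trunc_op \<Phi> x0 (?e n)) < \<delta>" if mn: "N \<le> m" "N \<le> n" for m n
  proof (cases "?e m \<le> ?e n")
   case True
   then have "\<bar>trunc_op \<Phi> x0 (?e m) - trunc_op \<Phi> x0 (?e n)\<bar> \<le> \<delta> / 2" using R(2) ep N mn by blast
   then show ?thesis using \<delta> by (simp add: dist_real_def)
  next
   case False
   then have "\<bar>trunc_op \<Phi> x0 (?e n) - trunc_op \<Phi> x0 (?e m)\<bar> \<le> \<delta> / 2"
    by (intro R(2)[rule_format] conjI ep N[rule_format] mn) (simp add: not_le less_imp_le)
   then show ?thesis using \<delta> by (simp add: dist_real_def abs_minus_commute)
  qed
  then show "\<exists>M. \<forall>m\<ge>M. \<forall>n\<ge>M. dist (trunc_op \<Phi> x0 (?e m)) (trunc_op \<Phi> x0 (?e n)) < \<delta>" by blast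
 qed
 then obtain l where l: "(\<lambda>n. trunc_op \<Phi> x0 (?e n)) \<longlonglongrightarrow> l" using Cauchy_convergent convergent_def by blast
 have "(trunc_op \<Phi> x0 \<longlongrightarrow> l) (at_right 0)"
 proof (rule tendstoI)
  fix \<delta> :: real assume \<delta>: "0 < \<delta>"
  obtain R where R: "0 < R" "\<forall>a b. 0 < a \<and> a \<le> b \<and> b \<le> R --> \<bar>trunc_op \<Phi> x0 a - trunc_op \<Phi> x0 b\<bar> \<le> \<delta> / 2"
   using C[of "\<delta> / 2"] \<delta> by auto
  have "dist (trunc_op \<Phi> x0 \<epsilon>) l < \<delta>" if \<epsilon>: "0 < \<epsilon>" "\<epsilon> < R" for \<epsilon>
  proof -
   obtain N where N: "\<forall>n\<ge>N. ?e n \<le> \<epsilon>" using ev[OF \<epsilon>(1)] by blast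
   have "(\<lambda>n. \<bar>trunc_op \<Phi> x0 (?e n) - trunc_op \<Phi> x0 \<epsilon>\<bar>) \<longlonglongrightarrow> \<bar>l - trunc_op \<Phi> x0 \<epsilon>\<bar>" by (intro tendsto_intros l)
   moreover have "\<forall>n\<ge>N. \<bar>trunc_op \<Phi> x0 (?e n) - trunc_op \<Phi> x0 \<epsilon>\<bar> \<le> \<delta> / 2"
    using R(2) ep N \<epsilon> by (meson less_imp_le)
   ultimately have "\<bar>l - trunc_op \<Phi> x0 \<epsilon>\<bar> \<le> \<delta> / 2" by (intro LIMSEQ_le_const2) blast+
   then show ?thesis using \<delta> by (simp add: dist_real_def abs_minus_commute)
  qed
  then show "\<forall>\<^sub>F \<epsilon> in at_right 0. dist (trunc_op \<Phi> x0 \<epsilon>) l < \<delta>"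
   using R(1) by (auto simp: eventually_at_right_field)
 qed
 then show ?thesis ..
qed

end


context kernel_data_cont
begin

text \<open>Jets at y bound the increment to x by a multiple of the distance. The limits on
  \<open>r2\<close> put that distance below r / 8 and below 1, where the jets of g and of the cutoff
  are available.\<close>

lemma admissible_lipschitz:
 assumes r: "0 < r" and C2: "Ck_on 2 (heis_ball x0 r) g" and \<rho>: "0 < \<rho>" "\<rho> \<le> 1"
  and x: "\<And>x. x \<in> heis_ball x0 r ==> \<psi> x = g x + \<theta> * cutoff x0 \<rho> x"
  and r2: "r2 \<le> r / 32" "r2 \<le> 1 / 4"
 obtains C where "0 \<le> C" "\<And>x y. heis_dist x x0 < r2 ==> heis_dist y x0 < r2 ==> \<bar>\<psi> x - \<psi> y\<bar> \<le> C * heis_dist x (y :: 'n heis)"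
proof -
 interpret C2_function "heis_ball x0 r" g by unfold_locales (simp, rule C2)
 obtain M where M: "0 \<le> M" "\<And>\<xi> R. heis_dist \<xi> x0 \<le> r / 8 ==> R \<le> r / 8 ==> jet g \<xi> (hgr g \<xi>) M R \<and> norm (hgr g \<xi>) \<le> M"
  by (rule jet_uniform[OF r, of x0]) (simp add: mem_heis_ball, rule that)
 obtain M' where M': "0 \<le> M'" "\<And>\<xi>. heis_dist \<xi> x0 \<le> 1 ==> \<exists>g. jet (cutoff x0 \<rho>) \<xi> g M' 1 \<and> norm g \<le> M'"
  by (rule jet_cutoff[OF \<rho>, of x0]) (rule that)
 have jl: "\<bar>u (heis_mult \<xi> \<eta>) - u \<xi>\<bar> \<le> 2 * m * heis_norm \<eta>"
  if "jet u \<xi> h m R" "norm h \<le> m" "heis_norm \<eta> < R" "heis_norm \<eta> \<le> 1" "0 \<le> m" for u :: "'n heis => real" and \<xi> h m R \<eta>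
 proof -
  have "\<bar>u (heis_mult \<xi> \<eta>) - u \<xi> - h \<bullet> horiz \<eta>\<bar> \<le> m * (heis_norm \<eta>)\<^sup>2" using that by (simp add: jet_def)
  moreover have "m * (heis_norm \<eta>)\<^sup>2 \<le> m * heis_norm \<eta>"
   using that by (intro mult_left_mono) (auto simp: power2_eq_square mult_left_le)
  moreover have "\<bar>h \<bullet> horiz \<eta>\<bar> \<le> norm h * heis_norm \<eta>" by (rule inner_horiz_bound)
  moreover have "norm h * heis_norm \<eta> \<le> m * heis_norm \<eta>" using that by (intro mult_right_mono) auto
  ultimately show ?thesis by linarith
 qed
 show ?thesis
 proof (rule that[of "2 * M + \<bar>\<theta>\<bar> * (2 * M')"])
  show "0 \<le> 2 * M + \<bar>\<theta>\<bar> * (2 * M')" using M M' by simp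
  fix x' y :: "'n heis" assume xy: "heis_dist x' x0 < r2" "heis_dist y x0 < r2"
  define \<eta> where "\<eta> = heis_mult (- y) x'"
  have x'e: "x' = heis_mult y \<eta>" by (simp add: \<eta>_def)
  have N: "heis_norm \<eta> = heis_dist x' y" by (simp add: \<eta>_def heis_dist_def)
  have "heis_dist x' y < 2 * r2" using heis_dist_triangle[of x' y x0] xy by (simp add: heis_dist_commute)
  then have Nl: "heis_norm \<eta> < r / 8" "heis_norm \<eta> < 1" using r2 r N by linarith+
  have yl: "heis_dist y x0 \<le> r / 8" "heis_dist y x0 \<le> 1" "heis_dist y x0 < r" "heis_dist x' x0 < r" using xy r2 r by linarith+
  have 1: "\<bar>g x' - g y\<bar> \<le> 2 * M * heis_norm \<eta>"
   unfolding x'e using M(2)[OF yl(1) order_refl] Nl M(1) by (intro jl[where R = "r / 8" and h = "hgr g y"]) auto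
  obtain h where h: "jet (cutoff x0 \<rho>) y h M' 1" "norm h \<le> M'" using M'(2)[OF yl(2)] by blast
  have 2: "\<bar>cutoff x0 \<rho> x' - cutoff x0 \<rho> y\<bar> \<le> 2 * M' * heis_norm \<eta>"
   unfolding x'e by (rule jl[OF h]) (use Nl M'(1) in auto)
  have "\<psi> x' - \<psi> y = (g x' - g y) + \<theta> * (cutoff x0 \<rho> x' - cutoff x0 \<rho> y)"
   using x[of x'] x[of y] yl by (simp add: mem_heis_ball algebra_simps)
  then have "\<bar>\<psi> x' - \<psi> y\<bar> \<le> \<bar>g x' - g y\<bar> + \<bar>\<theta>\<bar> * \<bar>cutoff x0 \<rho> x' - cutoff x0 \<rho> y\<bar>"
   by (metis abs_mult abs_triangle_ineq)
  also have "\<dots> \<le> 2 * M * heis_norm \<eta> + \<bar>\<theta>\<bar> * (2 * M' * heis_norm \<eta>)"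
   using 1 2 by (intro add_mono mult_left_mono) auto
  finally show "\<bar>\<psi> x' - \<psi> y\<bar> \<le> (2 * M + \<bar>\<theta>\<bar> * (2 * M')) * heis_dist x' y" by (simp add: N algebra_simps)
 qed
qed

text \<open>If the principal value were too small, the supersolution would stay above the touching function lifted by a
 small multiple of a cutoff, so that the two could not touch.\<close>
lemma touching_lift:
 fixes v \<Phi> f :: "'n heis => real" and \<phi> :: "'n heis => ereal"
 defines "g \<equiv> \<lambda>x. real_of_ereal (\<phi> x)"
 assumes \<gamma>': "\<gamma> = hom_dim TYPE('n) + s * p" and s: "0 < s" "s < 1" and r: "0 < r"
  and adm: "visc_admissible s p \<phi> x0 r"
  and \<Phi> [measurable]: "\<Phi> \<in> \<B>"
  and \<Phi>g: "\<And>x. x \<in> heis_ball x0 r ==> \<Phi> x = g x"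
  and h\<Phi>: "tail \<Phi> < \<infinity>"
  and v [measurable]: "v \<in> \<B>"
  and hv: "tail v < \<infinity>"
  and r1: "0 < r1" "r1 \<le> r"
  and loc: "local_energy v x0 r1 < \<infinity>"
  and le: "\<And>x. \<Phi> x \<le> v x"
  and lsc: "\<And>h. continuous_on (heis_ball x0 r) h ==> (\<And>x. x \<in> heis_ball x0 r ==> h x < \<Phi> x + 1)
   ==> open {x \<in> heis_ball x0 r. h x < v x}"
  and f: "continuous_on (heis_ball x0 r) f"
  and weak: "\<And>\<phi> \<rho>. smooth \<phi> ==> (\<And>x. 0 \<le> \<phi> x) ==> \<rho> < r1 ==> (\<And>x. \<rho> < heis_dist x x0 ==> \<phi> x = 0)
   ==> (LBINT x. f x * \<phi> x) \<le> form v \<phi>"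
  and l: "(trunc_op \<Phi> x0 \<longlongrightarrow> l) (at_right 0)" and lf: "2 * l < f x0"
 shows "\<exists>\<rho>>0. \<exists>\<theta>>0. AE x in lborel. heis_dist x x0 < \<rho> --> \<Phi> x + \<theta> \<le> v x"
proof -
 have C2: "Ck_on 2 (heis_ball x0 r) g" using adm unfolding visc_admissible_def g_def Let_def by blast
 have cg: "continuous_on (heis_ball x0 r) g"
  by (rule C2_function.continuous_u) (unfold_locales, simp, rule C2)
 have x0: "x0 \<in> heis_ball x0 r" using r by (simp add: mem_heis_ball)
 have nu: "near_uniform p s L r x0 g" unfolding g_def by (rule near_uniform_admissible[OF p s L r adm])
 \<comment> \<open>The budget: the far part at \<open>x0\<close> is at most l + 2 \<delta>, its
   variation and the near part cost \<delta> each, so twice the operator is at most 2 l + 8 \<delta>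
   = f x0 - 8 \<delta>. The oscillation of f takes 7 \<delta>, and \<delta> is left.\<close>
 define \<delta> where "\<delta> = (f x0 - 2 * l) / 16"
 have \<delta>: "0 < \<delta>" using lf by (simp add: \<delta>_def)
 obtain R0 where R0: "0 < R0" "\<forall>R. 0 < R \<and> R \<le> R0 --> (\<exists>\<rho>0>0. \<forall>\<rho>. 0 < \<rho> \<and> \<rho> \<le> \<rho>0 -->
  (\<exists>\<theta>0>0. near_small p s L r x0 g \<delta> R \<rho> \<theta>0))"
  using nu \<delta> unfolding near_uniform_def by blast
 \<comment> \<open>The near part reaches to 2 R, which must not exceed \<open>R0\<close>.\<close>
 define R where "R = R0 / 2"
 have R: "0 < R" "2 * R = R0" using R0 by (auto simp: R_def)
 obtain \<rho>n where \<rho>n: "0 < \<rho>n" "\<forall>\<rho>. 0 < \<rho> \<and> \<rho> \<le> \<rho>n -->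
  (\<exists>\<theta>0>0. near_small p s L r x0 g \<delta> (2 * R) \<rho> \<theta>0)"
  using R0(2)[rule_format, of "2 * R"] R R0(1) by auto
 define G where "G = far_op \<Phi> R x0 (\<Phi> x0)"
 \<comment> \<open>One small \<epsilon> suffices: the truncated operator is below l + \<delta>, and
   removing its near part costs another \<delta>.\<close>
 have G: "G \<le> l + 2 * \<delta>"
 proof -
  have "\<forall>\<^sub>F \<epsilon> in at_right 0. trunc_op \<Phi> x0 \<epsilon> < l + \<delta>" using l \<delta> by (intro order_tendstoD(2)) auto
  moreover have "\<forall>\<^sub>F \<epsilon> in at_right 0. \<epsilon> < R \<and> 0 < \<epsilon>" using R(1) by (auto simp: eventually_at_right_field)
  ultimately have "\<forall>\<^sub>F \<epsilon> in at_right 0. trunc_op \<Phi> x0 \<epsilon> < l + \<delta> \<and> \<epsilon> < R \<and> 0 < \<epsilon>" by (rule eventually_conj)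
  then obtain \<epsilon> where \<epsilon>: "trunc_op \<Phi> x0 \<epsilon> < l + \<delta>" "\<epsilon> < R" "0 < \<epsilon>"
   using eventually_happens'[OF trivial_limit_at_right_real] by blast
  obtain \<kappa> where \<kappa>: "near_kernel L \<gamma> (2 * R) \<kappa>" "trunc_op \<Phi> x0 \<epsilon> = near_int p \<Phi> x0 \<kappa> + far_op \<Phi> R x0 (\<Phi> x0)"
   by (rule trunc_op_split[OF \<Phi> h\<Phi> \<epsilon>(3), of R x0]) (use \<epsilon>(2) in simp, rule that)
  obtain \<theta>0 where \<theta>0: "0 < \<theta>0" "near_small p s L r x0 g \<delta> (2 * R) \<rho>n \<theta>0"
   using \<rho>n(2)[rule_format, of \<rho>n] \<rho>n(1) by auto
  have "\<bar>near_int p \<Phi> x0 \<kappa>\<bar> \<le> \<delta>"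
   by (rule \<theta>0(2)[rule_format, of 0]) (use \<theta>0(1) \<rho>n(1) \<Phi>g \<kappa>(1) in \<open>auto simp: \<gamma>'\<close>)
  then show ?thesis using \<epsilon>(1) \<kappa>(2) unfolding G_def by linarith
 qed
 obtain \<rho>f where \<rho>f: "0 < \<rho>f" "\<forall>\<xi> \<tau>. heis_dist \<xi> x0 \<le> \<rho>f \<and> \<bar>\<tau> - \<Phi> x0\<bar> \<le> \<rho>f --> far_op \<Phi> R \<xi> \<tau> \<le> G + \<delta>"
  using far_op_upper[OF \<Phi> h\<Phi> R(1) \<delta>] unfolding G_def by blast
 obtain \<rho>c where \<rho>c: "0 < \<rho>c" "\<And>x. heis_dist x x0 < \<rho>c ==> x \<in> heis_ball x0 r \<and> \<bar>f x - f x0\<bar> < 7 * \<delta> \<and> \<bar>g x - g x0\<bar> < \<rho>f / 2"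
 proof -
  let ?S = "heis_ball x0 r \<inter> (\<lambda>x. (f x, g x)) -` (ball (f x0) (7 * \<delta>) \<times> ball (g x0) (\<rho>f / 2))"
  have "open ?S" using f cg by (intro continuous_open_preimage continuous_on_Pair open_Times open_heis_ball) auto
  moreover have "x0 \<in> ?S" using x0 \<delta> \<rho>f by simp
  ultimately obtain q where q: "0 < q" "heis_ball x0 q \<subseteq> ?S" by (rule heis_ball_subset_open)
  show ?thesis
   by (rule that[OF q(1)]) (use q(2) in \<open>auto simp: mem_heis_ball[symmetric] subset_iff dist_real_def abs_minus_commute\<close>)
 qed
 define r2 where "r2 = min r1 (min (r / 32) (1 / 4))"
 have r2: "0 < r2" "r2 \<le> r1" "r2 \<le> r / 32" "r2 \<le> 1 / 4" using r r1 by (auto simp: r2_def)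
 define \<rho> where "\<rho> = min (min \<rho>n \<rho>f) (min (\<rho>c / 2) (r2 / 4))"
 have \<rho>: "0 < \<rho>" "\<rho> \<le> \<rho>n" "\<rho> \<le> \<rho>f" "\<rho> < \<rho>c" "2 * \<rho> < r2" "\<rho> \<le> 1" "\<rho> < r"
  using \<rho>n(1) \<rho>f(1) \<rho>c(1) r2 r by (auto simp: \<rho>_def)
 obtain \<theta>0 where \<theta>0: "0 < \<theta>0" "near_small p s L r x0 g \<delta> (2 * R) \<rho> \<theta>0"
  using \<rho>n(2) \<rho> by blast
 \<comment> \<open>\<theta> \<le> \<rho>f / 2 keeps the raised value at \<xi> within \<rho>f of
   \<open>\<Phi> x0\<close>; \<theta> < 1 keeps the lift below \<Phi> + 1, the range in which
   \<open>lsc\<close> is available.\<close>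
 define \<theta> where "\<theta> = min \<theta>0 (min (\<rho>f / 2) (1 / 2))"
 have \<theta>: "0 < \<theta>" "\<theta> \<le> \<theta>0" "\<theta> \<le> \<rho>f / 2" "\<theta> < 1" using \<theta>0(1) \<rho>f(1) by (auto simp: \<theta>_def)
 define \<psi> where "\<psi> = (\<lambda>x. \<Phi> x + \<theta> * cutoff x0 \<rho> x)"
 have [measurable]: "cutoff x0 \<rho> \<in> \<B>" by (intro borel_measurable_continuous_onI continuous_cutoff)
 have \<psi> [measurable]: "\<psi> \<in> \<B>" unfolding \<psi>_def by measurable
 have \<psi>g: "\<And>x. x \<in> heis_ball x0 r ==> \<psi> x = g x + \<theta> * cutoff x0 \<rho> x" using \<Phi>g by (simp add: \<psi>_def)
 have \<theta>c: "0 \<le> \<theta> * cutoff x0 \<rho> x" "\<theta> * cutoff x0 \<rho> x \<le> \<theta>" for x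
  using \<theta>(1) cutoff_nonneg[of x0 \<rho> x] cutoff_le_1[of x0 \<rho> x] by (auto intro: mult_left_le)
 have h\<psi>: "tail \<psi> < \<infinity>"
 proof -
  have "tail \<psi>
   \<le> (NNINT \<eta>. ennreal (2 powr (p - 1)) * (ennreal (\<bar>\<Phi> \<eta>\<bar> powr (p - 1) * weight \<eta>) + ennreal (weight \<eta>)))"
  proof (rule nn_integral_mono)
   fix \<eta> :: "'n heis"
   have "\<bar>\<psi> \<eta>\<bar> powr (p - 1) \<le> 2 powr (p - 1) * (\<bar>\<Phi> \<eta>\<bar> powr (p - 1) + \<bar>- (\<theta> * cutoff x0 \<rho> \<eta>)\<bar> powr (p - 1))"
    using abs_diff_powr_le[of "p - 1" "\<Phi> \<eta>" "- (\<theta> * cutoff x0 \<rho> \<eta>)"] p by (simp add: \<psi>_def)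
   also have "\<dots> \<le> 2 powr (p - 1) * (\<bar>\<Phi> \<eta>\<bar> powr (p - 1) + 1)"
    using \<theta>c[of \<eta>] \<theta>(4) p by (intro mult_left_mono add_left_mono powr_le1) auto
   finally have "\<bar>\<psi> \<eta>\<bar> powr (p - 1) * weight \<eta> \<le> 2 powr (p - 1) * (\<bar>\<Phi> \<eta>\<bar> powr (p - 1) + 1) * weight \<eta>"
    using weight_pos[of \<eta>] by (intro mult_right_mono) auto
   also have "\<dots> = 2 powr (p - 1) * (\<bar>\<Phi> \<eta>\<bar> powr (p - 1) * weight \<eta> + weight \<eta>)" by (simp add: algebra_simps)
   finally have "ennreal (\<bar>\<psi> \<eta>\<bar> powr (p - 1) * weight \<eta>) \<le> ennreal (2 powr (p - 1) * (\<bar>\<Phi> \<eta>\<bar> powr (p - 1) * weight \<eta> + weight \<eta>))"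
    by (rule ennreal_leI)
   then show "ennreal (\<bar>\<psi> \<eta>\<bar> powr (p - 1) * weight \<eta>) \<le> ennreal (2 powr (p - 1)) * (ennreal (\<bar>\<Phi> \<eta>\<bar> powr (p - 1) * weight \<eta>) + ennreal (weight \<eta>))"
    using weight_pos[of \<eta>] by (simp add: ennreal_mult)
  qed
  also have "\<dots> = ennreal (2 powr (p - 1)) * (tail \<Phi> + (NNINT \<eta>. ennreal (weight \<eta>)))"
   by (subst nn_integral_cmult, measurable, subst nn_integral_add) auto
  also have "\<dots> < \<infinity>" using h\<Phi> weight_integral by (simp add: ennreal_mult_less_top)
  finally show ?thesis .
 qed
 let ?U = "\<lambda>a. {z::'n heis \<times> 'n heis. heis_dist (fst z) x0 < a \<and> heis_dist (snd z) x0 < a}"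
 have loc2: "(NNINT z. ennreal (\<bar>v (fst z) - v (snd z)\<bar> powr p * kk (fst z) (snd z)) * indicator (?U r2) z) < \<infinity>"
  by (rule le_less_trans[OF nn_integral_mono loc]) (use r2(2) in \<open>auto intro!: mult_left_mono simp: indicator_def\<close>)
 define w where "w = (\<lambda>x. max 0 (\<psi> x - v x))"
 have w1: "w x \<le> 1" for x using le[of x] \<theta>c[of x] \<theta>(4) by (simp add: w_def \<psi>_def)
 have w0: "w x = 0" if "\<rho> \<le> heis_dist x x0" for x
  using le[of x] cutoff_eq_0[OF that \<rho>(1)] by (simp add: w_def \<psi>_def)
 obtain C where C: "0 \<le> C" "\<And>x y. heis_dist x x0 < r2 ==> heis_dist y x0 < r2 ==> \<bar>\<psi> x - \<psi> y\<bar> \<le> C * heis_dist x y"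
  by (rule admissible_lipschitz[OF r C2 \<rho>(1,6) \<psi>g r2(3,4)]) (assumption, rule that)
 have "s * p < p" using s p by simp
 then have \<gamma>p: "\<gamma> < hom_dim TYPE('n) + p" by (simp add: \<gamma>')
 have l\<psi>: "(NNINT z. ennreal (\<bar>\<psi> (fst z) - \<psi> (snd z)\<bar> powr p * kk (fst z) (snd z)) * indicator (?U r2) z) < \<infinity>"
  by (rule local_energy_lipschitz[OF \<psi> C \<gamma>p r2(1)])
 have ew: "energy w < \<infinity>"
  by (rule energy_pos_part[OF v \<psi> loc2 l\<psi> _ w_def w1, of \<rho>]) (use \<rho> w0 in auto)
 have usc: "open {x. w x < c}" if c: "0 < c" for c
 proof -
  have "{x. w x < c} = {x \<in> heis_ball x0 r. \<psi> x - c < v x} \<union> - {x. heis_dist x x0 \<le> \<rho>}"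
  proof (rule set_eqI)
   fix x
   have "w x < c \<longleftrightarrow> \<psi> x - c < v x" using c by (auto simp: w_def)
   then show "x \<in> {x. w x < c} \<longleftrightarrow> x \<in> {x \<in> heis_ball x0 r. \<psi> x - c < v x} \<union> - {x. heis_dist x x0 \<le> \<rho>}"
    using w0[of x] c \<rho>(7) by (cases "heis_dist x x0 \<le> \<rho>") (auto simp: mem_heis_ball)
  qed
  moreover have "open {x \<in> heis_ball x0 r. \<psi> x - c < v x}"
  proof (rule lsc)
   have "continuous_on (heis_ball x0 r) (\<lambda>x. g x + \<theta> * cutoff x0 \<rho> x - c)" by (intro continuous_intros cg continuous_cutoff)
   then show "continuous_on (heis_ball x0 r) (\<lambda>x. \<psi> x - c)" by (rule continuous_on_eq) (simp add: \<psi>g)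
   show "\<psi> x - c < \<Phi> x + 1" for x using \<theta>c[of x] \<theta>(4) c by (simp add: \<psi>_def)
  qed
  moreover have "open (- {x. heis_dist x x0 \<le> \<rho>})" by (rule open_Compl[OF closed_heis_cball])
  ultimately show ?thesis by (simp add: open_Un)
 qed
 \<comment> \<open>f is controlled only in the ball of contact; cutting it off outside a compact
   ball gives a bounded Borel function with the same integrals against the test functions.\<close>
 let ?B = "{x. heis_dist x x0 \<le> 2 * \<rho>}"
 define F where "F = (\<lambda>x. indicator ?B x *\<^sub>R f x)"
 have B: "?B \<subseteq> heis_ball x0 r" using \<rho>(5) r2 r by (auto simp: mem_heis_ball)
 have F [measurable]: "F \<in> \<B>"
  unfolding F_def using closed_heis_cball by (intro borel_measurable_continuous_on_indicator continuous_on_subset[OF f B]) auto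
 obtain b where b: "\<And>x. x \<in> ?B ==> \<bar>f x\<bar> \<le> b"
 proof -
  have "compact (f ` ?B)" by (intro compact_continuous_image continuous_on_subset[OF f B] compact_heis_cball)
  then have "bounded (f ` ?B)" by (rule compact_imp_bounded)
  then show ?thesis using that by (auto simp: bounded_iff)
 qed
 have Fb: "\<bar>F x\<bar> \<le> \<bar>b\<bar>" for x using b[of x] by (auto simp: F_def indicator_def)
 have "AE x in lborel. \<psi> x \<le> v x"
 proof (rule comparison[OF v hv loc2 \<rho>(1,5) w_def w1 _ usc ew F Fb _ \<psi> h\<psi> \<delta> R(1)])
  show "w x = 0" if "\<rho> < heis_dist x x0" for x using w0 that by simp
  show "(LBINT x. F x * \<phi> x) \<le> form v \<phi>"
   if \<phi>: "smooth \<phi>" "\<And>x. 0 \<le> \<phi> x" "\<And>x. 2 * \<rho> < heis_dist x x0 ==> \<phi> x = 0" for \<phi>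
  proof -
   have "(LBINT x. F x * \<phi> x) = (LBINT x. f x * \<phi> x)"
    using \<phi>(3) by (intro Bochner_Integration.integral_cong) (auto simp: F_def indicator_def)
   also have "\<dots> \<le> form v \<phi>" by (rule weak[OF \<phi>(1,2) _ \<phi>(3)]) (use \<rho>(5) r2(2) in auto)
   finally show ?thesis .
  qed
  fix \<epsilon> \<xi> assume \<epsilon>: "0 < \<epsilon>" "\<epsilon> \<le> R" and \<xi>: "heis_dist \<xi> x0 \<le> \<rho>"
  obtain \<kappa> where \<kappa>: "near_kernel L \<gamma> (2 * R) \<kappa>" "trunc_op \<psi> \<xi> \<epsilon> = near_int p \<psi> \<xi> \<kappa> + far_op \<psi> R \<xi> (\<psi> \<xi>)"
   by (rule trunc_op_split[OF \<psi> h\<psi> \<epsilon>]) (rule that)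
  have n: "\<bar>near_int p \<psi> \<xi> \<kappa>\<bar> \<le> \<delta>"
   by (rule \<theta>0(2)[rule_format, of \<theta>]) (use \<theta> \<xi> \<psi>g \<kappa>(1) in \<open>auto simp: \<gamma>'\<close>)
  have c: "\<xi> \<in> heis_ball x0 r" "\<bar>f \<xi> - f x0\<bar> < 7 * \<delta>" "\<bar>g \<xi> - g x0\<bar> < \<rho>f / 2" using \<rho>c(2)[of \<xi>] \<xi> \<rho>(4) by auto
  \<comment> \<open>The lift only raises values, and raising the function away from the centre
    lowers the operator.\<close>
  have "far_op \<psi> R \<xi> (\<psi> \<xi>) \<le> far_op \<Phi> R \<xi> (\<psi> \<xi>)"
   unfolding far_op_def
  proof (rule integral_mono[OF far_op_integrable[OF \<psi> h\<psi> R(1)] far_op_integrable[OF \<Phi> h\<Phi> R(1)]])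
   fix \<eta>
   show "Jp p (\<psi> \<xi> - \<psi> \<eta>) * kfar R (heis_mult (- \<eta>) \<xi>) \<le> Jp p (\<psi> \<xi> - \<Phi> \<eta>) * kfar R (heis_mult (- \<eta>) \<xi>)"
    using \<theta>c(1)[of \<eta>] p by (intro mult_right_mono kfar_nonneg Jp_mono) (auto simp: \<psi>_def)
  qed
  also have "\<dots> \<le> G + \<delta>"
  proof (rule \<rho>f(2)[rule_format], rule conjI)
   show "heis_dist \<xi> x0 \<le> \<rho>f" using \<xi> \<rho>(3) by linarith
   show "\<bar>\<psi> \<xi> - \<Phi> x0\<bar> \<le> \<rho>f" using c \<theta>c[of \<xi>] \<theta>(3) \<psi>g[of \<xi>] \<Phi>g[OF x0] by linarith
  qed
  finally have far: "far_op \<psi> R \<xi> (\<psi> \<xi>) \<le> G + \<delta>" .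
  have "16 * \<delta> = f x0 - 2 * l" by (simp add: \<delta>_def)
  then have "2 * trunc_op \<psi> \<xi> \<epsilon> \<le> f x0 - 8 * \<delta>" using n far \<kappa>(2) G by linarith
  moreover have "F \<xi> = f \<xi>" using \<xi> \<rho>(1) by (simp add: F_def)
  ultimately show "2 * trunc_op \<psi> \<xi> \<epsilon> \<le> F \<xi> - \<delta>" using c(2) by linarith
 qed
 then have "AE x in lborel. heis_dist x x0 < \<rho> / 2 --> \<Phi> x + \<theta> \<le> v x"
 proof eventually_elim
  case (elim x)
  show ?case
  proof
   assume "heis_dist x x0 < \<rho> / 2"
   then have "cutoff x0 \<rho> x = 1" by (intro cutoff_eq_1 \<rho>(1)) simp
   then show "\<Phi> x + \<theta> \<le> v x" using elim by (simp add: \<psi>_def)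
  qed
 qed
 then show ?thesis using \<rho>(1) \<theta>(1) half_gt_zero by blast
qed

end


section \<open>Representatives\<close>

lemma AE_lebesgue_iff: "(AE x in lebesgue. P x) \<longleftrightarrow> (AE x in lborel. P (x :: 'a::euclidean_space))"
 by (rule AE_completion_iff)

text \<open>The definitions integrate over the completed measure, the estimates work with Borel
  functions; this passes between the two.\<close>

lemma lebesgue_representative:
 fixes F G :: "'a::euclidean_space => real"
 assumes F: "F \<in> \<B>" and ae: "AE x in lborel. F x = G x"
 shows "integrable lebesgue G \<longleftrightarrow> integrable lborel F" "(LINT x|lebesgue. G x) = (LBINT x. F x)"
proof -
 have F': "F \<in> borel_measurable lborel" using F by simp
 have Fl: "F \<in> borel_measurable lebesgue" by (rule measurable_completion[OF F'])
 have ae': "AE x in lebesgue. F x = G x" using ae by (simp add: AE_lebesgue_iff)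
 have Gl: "G \<in> borel_measurable lebesgue" by (rule borel_measurable_AE[OF Fl ae'])
 show "integrable lebesgue G \<longleftrightarrow> integrable lborel F"
  using integrable_cong_AE[OF Fl Gl ae'] integrable_completion[OF F'] by simp
 show "(LINT x|lebesgue. G x) = (LBINT x. F x)"
  using integral_cong_AE[OF Fl Gl ae'] integral_completion[OF F'] by simp
qed

text \<open>Measurability and finiteness are given on compact sets only; they are assembled along an
  exhaustion by balls before a Borel version is chosen.\<close>

lemma Lm_weighted_representative:
 fixes u :: "'n::finite heis => ereal"
 assumes u: "Lm_weighted m \<delta> u"
 obtains v where "v \<in> \<B>" "AE x in lborel. u x = ereal (v x)"
  "(NNINT \<eta>. ennreal (\<bar>v \<eta>\<bar> powr m / (1 + heis_norm \<eta> powr (hom_dim TYPE('n) + \<delta>)))) < \<infinity>"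
proof -
 let ?f = "\<lambda>x. real_of_ereal (u x)"
 let ?B = "\<lambda>n::nat. cball (0::'n heis) (real n)"
 have B: "?B n \<inter> space lebesgue \<in> sets lebesgue" for n by simp
 have L: "Lm_on m (?B n) u" for n using u by (simp add: Lm_weighted_def)
 have mn: "(\<lambda>x. indicator (?B n) x *\<^sub>R ?f x) \<in> borel_measurable lebesgue" for n
 proof -
  have "?f \<in> borel_measurable (lebesgue_on (?B n))"
   by (rule measurable_compose[OF _ borel_measurable_real_of_ereal]) (use L[of n] in \<open>auto simp: Lm_on_def\<close>)
  then show ?thesis by (simp only: borel_measurable_restrict_space_iff[OF B])
 qed
 have ln: "(\<lambda>n. indicator (?B n) x *\<^sub>R ?f x) \<longlonglongrightarrow> ?f x" for x
 proof (rule tendsto_eventually)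
  obtain N :: nat where "norm x \<le> real N" using real_arch_simple by blast
  then show "\<forall>\<^sub>F n in sequentially. indicator (?B n) x *\<^sub>R ?f x = ?f x"
   unfolding eventually_sequentially by (intro exI[of _ N]) auto
 qed
 have "?f \<in> borel_measurable lebesgue" by (rule borel_measurable_LIMSEQ_real[OF ln mn])
 from completion_ex_borel_measurable_real[OF this]
 obtain v where v: "v \<in> borel_measurable lborel" "AE x in lborel. ?f x = v x" by blast
 have "AE x in lebesgue. \<forall>n. x \<in> ?B n --> \<bar>u x\<bar> \<noteq> \<infinity>"
  unfolding AE_all_countable using L AE_restrict_space_iff[OF B] by (simp add: Lm_on_def)
 then have "AE x in lborel. \<bar>u x\<bar> \<noteq> \<infinity>"
  unfolding AE_lebesgue_iff
 proof eventually_elim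
  case (elim x)
  obtain N :: nat where "norm x \<le> real N" using real_arch_simple by blast
  then show ?case using elim by auto
 qed
 with v(2) have ae: "AE x in lborel. u x = ereal (v x)"
  by eventually_elim (metis ereal_real)
 show ?thesis
 proof (rule that[OF _ ae])
  have "(NNINT \<eta>. ennreal (\<bar>v \<eta>\<bar> powr m / (1 + heis_norm \<eta> powr (hom_dim TYPE('n) + \<delta>))))
   = (NNINT \<eta>. ennreal (\<bar>?f \<eta>\<bar> powr m / (1 + heis_norm \<eta> powr (hom_dim TYPE('n) + \<delta>))))"
  proof (rule nn_integral_cong_AE)
   show "AE \<eta> in lborel. ennreal (\<bar>v \<eta>\<bar> powr m / (1 + heis_norm \<eta> powr (hom_dim TYPE('n) + \<delta>)))
    = ennreal (\<bar>?f \<eta>\<bar> powr m / (1 + heis_norm \<eta> powr (hom_dim TYPE('n) + \<delta>)))"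
    using v(2) by eventually_elim (simp only:)
  qed
  also have "\<dots> < \<infinity>" using u by (simp add: Lm_weighted_def nn_integral_completion)
  finally show "(NNINT \<eta>. ennreal (\<bar>v \<eta>\<bar> powr m / (1 + heis_norm \<eta> powr (hom_dim TYPE('n) + \<delta>)))) < \<infinity>" .
 qed (use v(1) in simp)
qed

lemma Lm_weighted_map:
 assumes u: "Lm_weighted m \<delta> u" and m: "0 \<le> m" and [measurable]: "G \<in> \<B>"
  and G: "\<And>a. \<bar>real_of_ereal (G a)\<bar> \<le> \<bar>real_of_ereal a\<bar>" "\<And>a. \<bar>a\<bar> \<noteq> \<infinity> ==> \<bar>G a\<bar> \<noteq> \<infinity>"
 shows "Lm_weighted m \<delta> (\<lambda>x. G (u x))"
 unfolding Lm_weighted_def Lm_on_def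
proof (intro conjI allI impI)
 have le: "\<bar>real_of_ereal (G a)\<bar> powr m \<le> \<bar>real_of_ereal a\<bar> powr m" for a by (rule powr_mono2[OF m abs_ge_zero G(1)])
 fix C :: "'a heis set" assume "compact C"
 then have L: "u \<in> borel_measurable (lebesgue_on C)" "AE \<xi> in lebesgue_on C. \<bar>u \<xi>\<bar> \<noteq> \<infinity>"
  "(\<integral>\<^sup>+\<xi>\<in>C. ennreal (\<bar>real_of_ereal (u \<xi>)\<bar> powr m) \<partial>lebesgue) < \<infinity>"
  using u by (auto simp: Lm_weighted_def Lm_on_def)
 show "(\<lambda>x. G (u x)) \<in> borel_measurable (lebesgue_on C)" using L(1) by measurable
 show "AE \<xi> in lebesgue_on C. \<bar>G (u \<xi>)\<bar> \<noteq> \<infinity>" using L(2) by eventually_elim (rule G(2))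
 show "(\<integral>\<^sup>+\<xi>\<in>C. ennreal (\<bar>real_of_ereal (G (u \<xi>))\<bar> powr m) \<partial>lebesgue) < \<infinity>"
  by (rule le_less_trans[OF nn_integral_mono L(3)]) (intro mult_right_mono ennreal_leI le, simp)
next
 have le: "\<bar>real_of_ereal (G a)\<bar> powr m \<le> \<bar>real_of_ereal a\<bar> powr m" for a by (rule powr_mono2[OF m abs_ge_zero G(1)])
 have fin: "(\<integral>\<^sup>+\<eta>. ennreal (\<bar>real_of_ereal (u \<eta>)\<bar> powr m / (1 + heis_norm \<eta> powr (hom_dim TYPE('a) + \<delta>))) \<partial>lebesgue) < \<infinity>"
  using u by (simp add: Lm_weighted_def)
 show "(\<integral>\<^sup>+\<eta>. ennreal (\<bar>real_of_ereal (G (u \<eta>))\<bar> powr m / (1 + heis_norm \<eta> powr (hom_dim TYPE('a) + \<delta>))) \<partial>lebesgue) < \<infinity>"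
  by (rule le_less_trans[OF nn_integral_mono fin]) (intro ennreal_leI divide_right_mono le, simp add: add_nonneg_nonneg)
qed

lemma Lm_weighted_uminus: "0 \<le> m ==> Lm_weighted m \<delta> u ==> Lm_weighted m \<delta> (\<lambda>x. - u x)"
 by (rule Lm_weighted_map) auto

lemma Lm_weighted_pos_part: "0 \<le> m ==> Lm_weighted m \<delta> u ==> Lm_weighted m \<delta> (\<lambda>x. max 0 (u x))"
proof (rule Lm_weighted_map[where G = "max 0"])
 show "\<bar>real_of_ereal (max 0 a)\<bar> \<le> \<bar>real_of_ereal a\<bar>" for a by (cases a) (auto simp: max_def)
 show "\<bar>max 0 a\<bar> \<noteq> \<infinity>" if "\<bar>a\<bar> \<noteq> \<infinity>" for a :: ereal using that by (cases a) (auto simp: max_def)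
qed auto

section \<open>The convolution kernel\<close>

text \<open>The values of K on the diagonal are unrestricted; the value 0 at the unit makes the
  convolution kernel nonnegative and Borel.\<close>

definition conv_kernel :: "('n::finite heis => 'n heis => real) => 'n heis => real" where
 "conv_kernel K \<zeta> = (if \<zeta> = 0 then 0 else K \<zeta> 0)"

lemma kernel_data_cont_conv_kernel:
 fixes K :: "'n::finite heis => 'n heis => real"
 assumes p: "1 < p" and s: "0 < s" and lam: "0 < lam" "lam \<le> Lam" and K: "heis_kernel s p lam Lam K"
 shows "kernel_data_cont p (hom_dim TYPE('n) + s * p) Lam (conv_kernel K)"
proof
 have K': "0 < K \<xi> \<eta>" "K \<xi> \<eta> \<le> Lam * heis_dist \<xi> \<eta> powr (- hom_dim TYPE('n) - s * p)" "K \<xi> \<eta> = K \<eta> \<xi>"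
  "K (heis_mult \<zeta> \<xi>) (heis_mult \<zeta> \<eta>) = K \<xi> \<eta>" if "\<xi> \<noteq> \<eta>" for \<xi> \<eta> \<zeta>
  using K that unfolding heis_kernel_def by blast+
 show "1 < p" by (rule p)
 show "hom_dim TYPE('n) < hom_dim TYPE('n) + s * p" using p s by simp
 show "0 \<le> Lam" using lam by simp
 have "continuous_on (- {0}) (\<lambda>\<zeta>. K \<zeta> 0)" using K by (simp add: heis_kernel_def)
 then show c: "continuous_on (- {0}) (conv_kernel K)"
  by (rule continuous_on_eq) (simp add: conv_kernel_def)
 have "(\<lambda>\<zeta>. indicator (- {0}) \<zeta> *\<^sub>R conv_kernel K \<zeta>) \<in> \<B>"
  using c by (intro borel_measurable_continuous_on_indicator) auto
 moreover have "(\<lambda>\<zeta>. indicator (- {0}) \<zeta> *\<^sub>R conv_kernel K \<zeta>) = conv_kernel K"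
  by (auto simp: fun_eq_iff indicator_def conv_kernel_def)
 ultimately show "conv_kernel K \<in> \<B>" by simp
 show "0 \<le> conv_kernel K \<eta>" for \<eta> using K'(1)[of \<eta> 0] by (simp add: conv_kernel_def less_imp_le)
 show "conv_kernel K (- \<eta>) = conv_kernel K \<eta>" for \<eta>
 proof (cases "\<eta> = 0")
  case False
  \<comment> \<open>Evenness comes from translating by \<eta> and then using the symmetry of
    K.\<close>
  have "K (- \<eta>) 0 = K (heis_mult \<eta> (- \<eta>)) (heis_mult \<eta> 0)" using K'(4)[of "- \<eta>" 0 \<eta>] False by simp
  also have "\<dots> = K \<eta> 0" using K'(3)[of 0 \<eta>] False by (simp add: heis_mult_inverse)
  finally show ?thesis using False by (simp add: conv_kernel_def)
 qed simp
 show "conv_kernel K \<eta> \<le> Lam * heis_norm \<eta> powr (- (hom_dim TYPE('n) + s * p))" for \<eta>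
 proof (cases "\<eta> = 0")
  case True
  then show ?thesis using lam by (simp add: conv_kernel_def)
 next
  case False
  have "- (hom_dim TYPE('n) + s * p) = - hom_dim TYPE('n) - s * p" by simp
  then show ?thesis using K'(2)[OF False] False by (simp only: conv_kernel_def if_False heis_dist_0)
 qed
qed

text \<open>On the diagonal the kernels may differ, but \<open>Jp p 0 = 0\<close>.\<close>

lemma (in kernel_data) Jp_kk:
 assumes K: "heis_kernel s p lam Lam K" and k: "k = conv_kernel K"
 shows "Jp p (a \<xi> - a \<eta>) * K \<xi> \<eta> = Jp p (a \<xi> - a \<eta>) * kk \<xi> \<eta>"
proof (cases "\<xi> = \<eta>")
 case False
 have "heis_mult (- \<eta>) \<xi> \<noteq> 0" using False heis_dist_eq_0[of \<xi> \<eta>] unfolding heis_dist_def by (metis heis_norm_0)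
 moreover have "K (heis_mult (- \<eta>) \<xi>) (heis_mult (- \<eta>) \<eta>) = K \<xi> \<eta>" using K False unfolding heis_kernel_def by blast
 ultimately have "K \<xi> \<eta> = kk \<xi> \<eta>" unfolding kk_def unfolding k conv_kernel_def by (simp add: heis_mult_inverse)
 then show ?thesis by simp
qed (simp add: Jp_0)

section \<open>Essential limits and sign changes\<close>

lemma lsc_on_open:
 assumes "open \<Omega>" "lsc_on \<Omega> u" "open B" "B \<subseteq> \<Omega>"
 shows "open {x \<in> B. a < u x}"
proof -
 have "openin (top_of_set \<Omega>) {x \<in> \<Omega>. a < u x}" using assms(2) by (simp add: lsc_on_def)
 then have "open {x \<in> \<Omega>. a < u x}" using assms(1) by (simp add: openin_open_eq)
 then have "open (B \<inter> {x \<in> \<Omega>. a < u x})" using assms(3) by blast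
 moreover have "B \<inter> {x \<in> \<Omega>. a < u x} = {x \<in> B. a < u x}" using assms(4) by blast
 ultimately show ?thesis by simp
qed

lemma usc_on_uminus: "usc_on \<Omega> u \<longleftrightarrow> lsc_on \<Omega> (\<lambda>x. - u x)"
proof -
 have eq: "{x \<in> \<Omega>. a < - u x} = {x \<in> \<Omega>. u x < - a}" for a
  by (auto simp: ereal_less_uminus_reorder)
 show ?thesis
 proof
  assume "usc_on \<Omega> u"
  then show "lsc_on \<Omega> (\<lambda>x. - u x)" unfolding usc_on_def lsc_on_def eq by blast
 next
  assume l: "lsc_on \<Omega> (\<lambda>x. - u x)"
  show "usc_on \<Omega> u"
   unfolding usc_on_def
  proof
   fix a
   show "openin (top_of_set \<Omega>) {x \<in> \<Omega>. u x < a}"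
    using l[unfolded lsc_on_def, rule_format, of "- a"] unfolding eq by simp
  qed
 qed
qed

lemma ess_liminf_uminus: "ess_liminf (\<lambda>x. - u x) \<xi> = - ess_limsup u \<xi>"
proof -
 have "{a. \<exists>r>0. AE \<eta> in lebesgue. \<eta> \<in> heis_ball \<xi> r --> a \<le> - u \<eta>}
  = uminus ` {a. \<exists>r>0. AE \<eta> in lebesgue. \<eta> \<in> heis_ball \<xi> r --> u \<eta> \<le> a}" (is "?A = uminus ` ?B")
 proof (rule set_eqI)
  fix a
  have "a \<le> - b \<longleftrightarrow> b \<le> - a" for b :: ereal by (cases a; cases b) auto
  then have "a \<in> ?A \<longleftrightarrow> - a \<in> ?B" by simp
  also have "\<dots> \<longleftrightarrow> a \<in> uminus ` ?B"
  proof
   assume "- a \<in> ?B"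
   then have "- (- a) \<in> uminus ` ?B" by (rule imageI)
   then show "a \<in> uminus ` ?B" by (simp only: ereal_uminus_uminus)
  next
   assume "a \<in> uminus ` ?B"
   then obtain b where "a = - b" "b \<in> ?B" by blast
   then show "- a \<in> ?B" by (simp only: ereal_uminus_uminus)
  qed
  finally show "a \<in> ?A \<longleftrightarrow> a \<in> uminus ` ?B" .
 qed
 then show ?thesis by (simp only: ess_liminf_def ess_limsup_def ereal_Sup_uminus_image_eq)
qed

text \<open>A nonempty open set is not null, so an almost everywhere lower bound near \<xi> also
  holds at \<xi>; continuity gives the other inequality.\<close>

lemma continuous_ess_liminf:
 fixes u :: "'n::finite heis => ereal"
 assumes \<Omega>: "open \<Omega>" and u: "continuous_on \<Omega> u" and \<xi>: "\<xi> \<in> \<Omega>"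
 shows "u \<xi> = ess_liminf u \<xi>"
proof (rule antisym)
 have o1: "open {x \<in> \<Omega>. u x \<in> S}" if "open S" for S
  using continuous_open_preimage[OF u \<Omega> that] by (simp add: vimage_def Int_def conj_commute)
 show "u \<xi> \<le> ess_liminf u \<xi>"
 proof (rule dense_le)
  fix a assume "a < u \<xi>"
  then have "\<xi> \<in> {x \<in> \<Omega>. u x \<in> {a<..}}" using \<xi> by simp
  then obtain r where r: "0 < r" "heis_ball \<xi> r \<subseteq> {x \<in> \<Omega>. u x \<in> {a<..}}"
   by (rule heis_ball_subset_open[OF o1[OF open_greaterThan]])
  have "\<forall>\<eta>. \<eta> \<in> heis_ball \<xi> r --> a \<le> u \<eta>" using r(2) by (auto simp: less_imp_le)
  then have "AE \<eta> in lebesgue. \<eta> \<in> heis_ball \<xi> r --> a \<le> u \<eta>" by (simp add: AE_I2)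
  then show "a \<le> ess_liminf u \<xi>" unfolding ess_liminf_def using r(1) by (intro Sup_upper) blast
 qed
 show "ess_liminf u \<xi> \<le> u \<xi>"
  unfolding ess_liminf_def
 proof (rule Sup_least)
  fix a assume "a \<in> {a. \<exists>r>0. AE \<eta> in lebesgue. \<eta> \<in> heis_ball \<xi> r --> a \<le> u \<eta>}"
  then obtain r where r: "0 < r" "AE \<eta> in lborel. \<eta> \<in> heis_ball \<xi> r --> a \<le> u \<eta>"
   unfolding mem_Collect_eq AE_lebesgue_iff by blast
  show "a \<le> u \<xi>"
  proof (rule ccontr)
   assume "\<not> a \<le> u \<xi>"
   then have "\<xi> \<in> {x \<in> \<Omega>. u x \<in> {..<a}} \<inter> heis_ball \<xi> r" using \<xi> r(1) by (simp add: mem_heis_ball)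
   moreover have "{x \<in> \<Omega>. u x \<in> {..<a}} \<inter> heis_ball \<xi> r = {}"
   proof (rule AE_notin_open)
    show "AE x in lborel. x \<notin> {x \<in> \<Omega>. u x \<in> {..<a}} \<inter> heis_ball \<xi> r"
     using r(2) by eventually_elim auto
   qed (intro open_Int o1 open_lessThan open_heis_ball)
   ultimately show False by blast
  qed
 qed
qed

lemma continuous_on_lsc: "open \<Omega> ==> continuous_on \<Omega> u ==> lsc_on \<Omega> u"
 unfolding lsc_on_def using continuous_openin_preimage_gen[of \<Omega> u, OF _ open_greaterThan]
 by (simp add: vimage_def Int_def)

section \<open>Reflection between sub- and supersolutions\<close>

lemma weak_form_uminus: "weak_form K p (\<lambda>x. - u x) \<phi> = - weak_form K p u \<phi>"
proof -
 let ?F = "\<lambda>u. \<lambda>(\<xi>, \<eta>). Jp p (real_of_ereal (u \<xi>) - real_of_ereal (u \<eta>)) * (\<phi> \<xi> - \<phi> \<eta>) * K \<xi> \<eta>"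
 have eq: "Jp p (real_of_ereal (- u \<xi>) - real_of_ereal (- u \<eta>)) = - Jp p (real_of_ereal (u \<xi>) - real_of_ereal (u \<eta>))" for \<xi> \<eta>
  using Jp_minus[of p "real_of_ereal (u \<xi>) - real_of_ereal (u \<eta>)"] by simp
 have "?F (\<lambda>x. - u x) = (\<lambda>z. - ?F u z)"
  by (rule ext) (simp only: split_beta eq mult_minus_left)
 then show ?thesis by (simp only: weak_form_def Bochner_Integration.integral_minus)
qed

lemma Wsp_loc_uminus:
 assumes "Wsp_loc s p \<Omega> u" shows "Wsp_loc s p \<Omega> (\<lambda>x. - u x)"
 using assms unfolding Wsp_loc_def Wsp_on_def Lm_on_def
 by (simp add: abs_minus_commute borel_measurable_uminus_eq_ereal)

text \<open>Since \<open>Jp\<close> is odd, passing to -u and -f exchanges the two notions; the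
  statement on subsolutions rests on this.\<close>

lemma weak_subsolution_uminus:
 assumes p: "1 < p" and u: "weak_subsolution K s p \<Omega> f u"
 shows "weak_supersolution K s p \<Omega> (\<lambda>x. - f x) (\<lambda>x. - u x)"
 unfolding weak_supersolution_def
proof (intro conjI allI impI)
 show "Wsp_loc s p \<Omega> (\<lambda>x. - u x)" using u by (intro Wsp_loc_uminus) (simp add: weak_subsolution_def)
 show "Lm_weighted (p - 1) (s * p) (\<lambda>x. - u x)" using u p by (intro Lm_weighted_uminus) (auto simp: weak_subsolution_def)
 fix \<phi> assume "test_function \<Omega> \<phi> \<and> (\<forall>\<xi>. 0 \<le> \<phi> \<xi>)"
 then have "weak_form K p u \<phi> \<le> (LINT \<xi>:\<Omega>|lebesgue. f \<xi> * \<phi> \<xi>)" using u by (simp add: weak_subsolution_def)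
 then show "(LINT \<xi>:\<Omega>|lebesgue. - f \<xi> * \<phi> \<xi>) \<le> weak_form K p (\<lambda>x. - u x) \<phi>"
  by (simp add: weak_form_uminus set_lebesgue_integral_def)
qed

lemma has_op_uminus:
 assumes "has_op K p (\<lambda>x. - u x) \<xi> l" shows "has_op K p u \<xi> (- l)"
proof -
 let ?g = "\<lambda>\<eta>. Jp p (real_of_ereal (u \<xi>) - real_of_ereal (u \<eta>)) * K \<xi> \<eta>"
 have eq: "Jp p (real_of_ereal (- u \<xi>) - real_of_ereal (- u \<eta>)) = - Jp p (real_of_ereal (u \<xi>) - real_of_ereal (u \<eta>))" for \<eta>
  using Jp_minus[of p "real_of_ereal (u \<xi>) - real_of_ereal (u \<eta>)"] by simp
 have h: "\<forall>\<epsilon>>0. set_integrable lebesgue (- heis_ball \<xi> \<epsilon>) (\<lambda>\<eta>. - ?g \<eta>)"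
  "((\<lambda>\<epsilon>. 2 * (LINT \<eta>:- heis_ball \<xi> \<epsilon>|lebesgue. - ?g \<eta>)) \<longlongrightarrow> l) (at_right 0)"
  using assms unfolding has_op_def Let_def eq mult_minus_left by blast+
 have "\<forall>\<epsilon>>0. set_integrable lebesgue (- heis_ball \<xi> \<epsilon>) ?g"
  using h(1) by (simp add: set_integrable_def)
 moreover have "((\<lambda>\<epsilon>. 2 * (LINT \<eta>:- heis_ball \<xi> \<epsilon>|lebesgue. ?g \<eta>)) \<longlongrightarrow> - l) (at_right 0)"
  using tendsto_minus[OF h(2)] by (simp add: set_lebesgue_integral_def)
 ultimately show ?thesis by (simp add: has_op_def)
qed

lemma frechet_derivative_uminus:
 "f differentiable (at x) ==> frechet_derivative (\<lambda>x. - f x) (at x) = (\<lambda>v. - frechet_derivative f (at x) v)"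
 for f :: "'a::real_normed_vector => real"
 by (rule frechet_derivative_at[symmetric]) (auto simp: frechet_derivative_works intro: has_derivative_minus)

lemma Ck_on_cong:
 assumes "open D" "\<And>x. x \<in> D ==> f x = g x" "Ck_on k D f"
 shows "Ck_on k D g"
 using assms(2,3)
proof (induction k arbitrary: f g)
 case 0
 then show ?case by (auto intro: continuous_on_eq)
next
 case (Suc k)
 have d: "f differentiable (at x)" if "x \<in> D" for x using Suc.prems that by simp
 have e: "frechet_derivative f (at x) = frechet_derivative g (at x)" if "x \<in> D" for x
  using frechet_derivative_transform_within_open[OF d[OF that] assms(1) that] Suc.prems(1) by blast
 have "g differentiable (at x)" if "x \<in> D" for x
  using d[OF that] has_derivative_transform_within_open[OF _ assms(1) that] Suc.prems(1) unfolding differentiable_def by blast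
 moreover have "Ck_on k D (\<lambda>x. frechet_derivative g (at x) v)" for v
  by (rule Suc.IH[of "\<lambda>x. frechet_derivative f (at x) v"]) (use e Suc.prems in auto)
 ultimately show ?case by simp
qed

lemma Ck_on_uminus:
 assumes "open D" "Ck_on k D f"
 shows "Ck_on k D (\<lambda>x. - f x)"
 using assms(2)
proof (induction k arbitrary: f)
 case 0
 then show ?case by (auto intro: continuous_intros)
next
 case (Suc k)
 have "Ck_on k D (\<lambda>x. frechet_derivative (\<lambda>x. - f x) (at x) v)" for v
  by (rule Ck_on_cong[OF assms(1) _ Suc.IH[of "\<lambda>x. frechet_derivative f (at x) v"]])
   (use Suc.prems in \<open>auto simp: frechet_derivative_uminus\<close>)
 then show ?case using Suc.prems by simp
qed

context C2_function
begin

lemma hfield_uminus: "\<xi> \<in> D ==> hfield i (\<lambda>x. - u x) \<xi> = - hfield i u \<xi>"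
 using diff1 by (simp add: hfield_eq frechet_derivative_uminus)

lemma hgrad_uminus: "\<xi> \<in> D ==> hgrad (\<lambda>x. - u x) \<xi> = - hgrad u \<xi>"
 by (simp add: hgrad_def vec_eq_iff hfield_uminus)

lemma hhess_uminus:
 assumes "\<xi> \<in> D" shows "hhess (\<lambda>x. - u x) \<xi> = - hhess u \<xi>"
proof -
 have "frechet_derivative (hfield j (\<lambda>x. - u x)) (at \<xi>) = (\<lambda>v. - frechet_derivative (hfield j u) (at \<xi>) v)" for j
 proof -
  have d: "(\<lambda>x. - hfield j u x) differentiable (at \<xi>)"
   using hfield_differentiable[OF assms] by (rule differentiable_minus)
  have "frechet_derivative (hfield j (\<lambda>x. - u x)) (at \<xi>) = frechet_derivative (\<lambda>x. - hfield j u x) (at \<xi>)"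
   by (rule frechet_derivative_transform_within_open[OF d D assms, symmetric]) (simp add: hfield_uminus)
  then show ?thesis using frechet_derivative_uminus[OF hfield_differentiable[OF assms]] by simp
 qed
 then show ?thesis by (simp add: hhess_def vec_eq_iff hfield_eq[of _ "hfield _ _"])
qed

end

lemma visc_admissible_uminus:
 assumes p: "1 < p" and r: "0 < r" and a: "visc_admissible s p \<phi> x0 r"
 shows "visc_admissible s p (\<lambda>x. - \<phi> x) x0 r"
proof -
 let ?D = "heis_ball x0 r" and ?g = "\<lambda>x. real_of_ereal (\<phi> x)"
 have C2: "Ck_on 2 ?D ?g" using a by (simp add: visc_admissible_def Let_def)
 interpret C2_function ?D ?g by unfold_locales (simp, rule C2)
 have x0: "x0 \<in> ?D" using r by (simp add: mem_heis_ball)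
 have C2': "Ck_on 2 ?D (\<lambda>x. - ?g x)" by (rule Ck_on_uminus[OF _ C2]) simp
 have cr: "crit_set ?D (\<lambda>x. - ?g x) = crit_set ?D ?g" by (auto simp: crit_set_def hgrad_uminus)
 have b: "C2_beta \<beta> ?D (\<lambda>x. - ?g x)" if "C2_beta \<beta> ?D ?g" for \<beta>
 proof -
  have "(let d = heis_setdist \<xi> (crit_set ?D ?g) in min d 1 powr (\<beta> - 1) / norm (hgrad (\<lambda>x. - ?g x) \<xi>) + norm (hhess (\<lambda>x. - ?g x) \<xi>) / d powr (\<beta> - 2))
   = (let d = heis_setdist \<xi> (crit_set ?D ?g) in min d 1 powr (\<beta> - 1) / norm (hgrad ?g \<xi>) + norm (hhess ?g \<xi>) / d powr (\<beta> - 2))"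
   if "\<xi> \<in> ?D - crit_set ?D ?g" for \<xi>
   using that by (simp add: hgrad_uminus hhess_uminus)
  then show ?thesis using \<open>C2_beta \<beta> ?D ?g\<close> C2' unfolding C2_beta_def cr by (simp cong: image_cong_simp)
 qed
 have iso: "\<exists>\<delta>>0. \<forall>\<xi>\<in>heis_ball x0 \<delta>. hgrad (\<lambda>x. - ?g x) \<xi> = 0 --> \<xi> = x0"
  if "\<exists>\<delta>>0. \<forall>\<xi>\<in>heis_ball x0 \<delta>. hgrad ?g \<xi> = 0 --> \<xi> = x0"
 proof -
  obtain \<delta> where "0 < \<delta>" "\<forall>\<xi>\<in>heis_ball x0 \<delta>. hgrad ?g \<xi> = 0 --> \<xi> = x0" using \<open>\<exists>\<delta>>0. _ \<delta>\<close> by blast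
  \<comment> \<open>The radius is reduced to r because the gradients of g and -g are compared only
    where g is differentiable.\<close>
  then show ?thesis using r by (intro exI[of _ "min \<delta> r"]) (auto simp: mem_heis_ball hgrad_uminus)
 qed
 have z: "hgrad (\<lambda>x. - ?g x) x0 = 0 \<longleftrightarrow> hgrad ?g x0 = 0" using hgrad_uminus[OF x0] by simp
 have L: "Lm_weighted (p - 1) (s * p) (\<lambda>x. - \<phi> x)"
  by (rule Lm_weighted_uminus) (use p a in \<open>auto simp: visc_admissible_def Let_def\<close>)
 have fin: "\<forall>\<xi>\<in>?D. \<bar>- \<phi> \<xi>\<bar> \<noteq> \<infinity>" using a by (simp add: visc_admissible_def Let_def)
 have alt: "(p > 2 / (2 - s) \<or> hgrad ?g x0 \<noteq> 0) \<or>
    (1 < p \<and> p \<le> 2 / (2 - s) \<and> hgrad ?g x0 = 0 \<and>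
    (\<exists>\<delta>>0. \<forall>\<xi>\<in>heis_ball x0 \<delta>. hgrad ?g \<xi> = 0 --> \<xi> = x0) \<and>
    (\<exists>\<beta>>s * p / (p - 1). C2_beta \<beta> ?D ?g))"
  using a by (simp add: visc_admissible_def Let_def)
 have ru: "real_of_ereal (- a) = - real_of_ereal a" for a by (cases a) auto
 show ?thesis
  unfolding visc_admissible_def Let_def ru z
 proof (intro conjI fin C2' L)
  from alt show "(p > 2 / (2 - s) \<or> hgrad ?g x0 \<noteq> 0) \<or>
    (1 < p \<and> p \<le> 2 / (2 - s) \<and> hgrad ?g x0 = 0 \<and>
    (\<exists>\<delta>>0. \<forall>\<xi>\<in>heis_ball x0 \<delta>. hgrad (\<lambda>x. - ?g x) \<xi> = 0 --> \<xi> = x0) \<and>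
    (\<exists>\<beta>>s * p / (p - 1). C2_beta \<beta> ?D (\<lambda>x. - ?g x)))"
  proof
   assume B: "1 < p \<and> p \<le> 2 / (2 - s) \<and> hgrad ?g x0 = 0 \<and>
    (\<exists>\<delta>>0. \<forall>\<xi>\<in>heis_ball x0 \<delta>. hgrad ?g \<xi> = 0 --> \<xi> = x0) \<and>
    (\<exists>\<beta>>s * p / (p - 1). C2_beta \<beta> ?D ?g)"
   then have "\<exists>\<beta>>s * p / (p - 1). C2_beta \<beta> ?D (\<lambda>x. - ?g x)" using b by blast
   moreover have "\<exists>\<delta>>0. \<forall>\<xi>\<in>heis_ball x0 \<delta>. hgrad (\<lambda>x. - ?g x) \<xi> = 0 --> \<xi> = x0"
    by (rule iso) (use B in blast)
   ultimately show ?thesis using B by (intro disjI2 conjI) simp_all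
  qed (rule disjI1)
 qed
qed


section \<open>Weak supersolutions are viscosity supersolutions\<close>

text \<open>Passes from extended-valued u and \<phi> to real Borel functions v and \<Phi> for which
  the lifting argument is stated, and carries its conclusion back to the essential lower limit of
  u.\<close>

lemma weak_supersolution_touching:
 fixes u \<phi> :: "'n::finite heis => ereal" and f :: "'n heis => real"
 assumes s: "0 < s" "s < 1" and p1: "1 < p" and \<Omega>: "open \<Omega>" and f: "continuous_on \<Omega> f"
  and lam: "0 < lam" "lam \<le> Lam" and K: "heis_kernel s p lam Lam K"
  and u: "weak_supersolution K s p \<Omega> f u" and lsc: "lsc_on \<Omega> u" and ess: "\<And>\<xi>. \<xi> \<in> \<Omega> ==> u \<xi> = ess_liminf u \<xi>"
  and r: "0 < r" and ball: "heis_ball x0 r \<subseteq> \<Omega>" and \<phi>0: "\<phi> x0 = u x0" and \<phi>: "\<And>\<xi>. \<phi> \<xi> \<le> u \<xi>"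
  and adm: "visc_admissible s p \<phi> x0 r"
 shows "\<exists>l. has_op K p (\<lambda>\<xi>. if \<xi> \<in> heis_ball x0 r then \<phi> \<xi> else u \<xi>) x0 l \<and> l \<ge> f x0"
proof -
 let ?D = "heis_ball x0 r"
 define \<gamma> where "\<gamma> = hom_dim TYPE('n) + s * p"
 define k where "k = conv_kernel K"
 interpret kernel_data_cont p \<gamma> Lam k
  unfolding \<gamma>_def k_def by (rule kernel_data_cont_conv_kernel[OF p1 s(1) lam K])
 define g where "g = (\<lambda>x. real_of_ereal (\<phi> x))"
 have \<phi>g: "\<phi> x = ereal (g x)" if "x \<in> ?D" for x
  using adm that unfolding visc_admissible_def Let_def g_def by (simp add: ereal_real)
 have C2: "Ck_on 2 ?D g" using adm unfolding visc_admissible_def g_def Let_def by blast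
 have cg: "continuous_on ?D g"
  by (rule C2_function.continuous_u) (unfold_locales, simp, rule C2)
 have x0: "x0 \<in> ?D" using r by (simp add: mem_heis_ball)
 have Lu: "Lm_weighted (p - 1) (s * p) u" and Wu: "Wsp_loc s p \<Omega> u"
  using u by (simp_all add: weak_supersolution_def)
 have L\<phi>: "Lm_weighted (p - 1) (s * p) \<phi>" using adm by (simp add: visc_admissible_def Let_def)
 have wt: "a / (1 + heis_norm \<eta> powr (hom_dim TYPE('n) + s * p)) = a * weight \<eta>" for a \<eta>
  unfolding weight_def \<gamma>_def[symmetric] by simp
 obtain v' where v' [measurable]: "v' \<in> \<B>" and aev': "AE x in lborel. u x = ereal (v' x)"
  and iv': "tail v' < \<infinity>"
  by (rule Lm_weighted_representative[OF Lu, unfolded wt]) (rule that)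
 obtain \<phi>' where \<phi>' [measurable]: "\<phi>' \<in> \<B>" and ae\<phi>': "AE x in lborel. \<phi> x = ereal (\<phi>' x)"
  and i\<phi>': "tail \<phi>' < \<infinity>"
  by (rule Lm_weighted_representative[OF L\<phi>, unfolded wt]) (rule that)
 \<comment> \<open>Touching and semicontinuity are pointwise, so u keeps its own values in the ball,
   where lower semicontinuity makes it Borel. Elsewhere an almost everywhere version is
   enough.\<close>
 define U where "U = (\<lambda>x. if x \<in> ?D then u x else 0)"
 have [measurable]: "?D \<in> sets borel" by (rule borel_open[OF open_heis_ball])
 have U [measurable]: "U \<in> \<B>"
 proof (rule borel_measurableI_greater)
  fix a
  have "open {x \<in> ?D. a < u x}" by (rule lsc_on_open[OF \<Omega> lsc open_heis_ball ball])
  then have [measurable]: "{x \<in> ?D. a < u x} \<in> sets borel" by (rule borel_open)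
  have "{x \<in> space borel. a < U x} = {x \<in> ?D. a < u x} \<union> (if a < 0 then - ?D else {})" by (auto simp: U_def)
  also have "\<dots> \<in> sets borel" by simp
  finally show "{x \<in> space borel. a < U x} \<in> sets borel" .
 qed
 define G where "G = (\<lambda>x. indicator ?D x *\<^sub>R g x)"
 have G [measurable]: "G \<in> \<B>"
  unfolding G_def using cg by (intro borel_measurable_continuous_on_indicator) auto
 \<comment> \<open>Infinite values of u in the ball become g + 1: finite, still above the touching
   function, and invisible to the sets {h < v} as long as h < \<Phi> + 1.\<close>
 define v where "v = (\<lambda>x. if x \<in> ?D then (if U x = \<infinity> then G x + 1 else real_of_ereal (U x)) else v' x)"
 define \<Phi> where "\<Phi> = (\<lambda>x. if x \<in> ?D then G x else v' x)"
 have v [measurable]: "v \<in> \<B>" unfolding v_def by measurable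
 have \<Phi> [measurable]: "\<Phi> \<in> \<B>" unfolding \<Phi>_def by measurable
 have \<Phi>g: "\<Phi> x = g x" if "x \<in> ?D" for x using that by (simp add: \<Phi>_def G_def)
 have v_top: "v x = g x + 1" if "x \<in> ?D" "u x = \<infinity>" for x using that by (simp add: v_def U_def G_def)
 have v_real: "u x = ereal (v x)" if "x \<in> ?D" "u x \<noteq> \<infinity>" for x
 proof -
  have "u x \<noteq> -\<infinity>" using \<phi>[of x] \<phi>g[OF that(1)] by auto
  then show ?thesis using that by (cases "u x") (auto simp: v_def U_def)
 qed
 have vv': "AE x in lborel. v x = v' x"
  using aev'
 proof eventually_elim
  case (elim x)
  show ?case
  proof (cases "x \<in> ?D")
   case True
   then show ?thesis using v_real[OF True] elim by simp
  qed (simp add: v_def)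
 qed
 have aev: "AE x in lborel. u x = ereal (v x)"
  using aev' vv' by eventually_elim simp
 have hv: "tail v < \<infinity>"
 proof -
  have "tail v = tail v'"
  proof (rule nn_integral_cong_AE)
   show "AE \<eta> in lborel. ennreal (\<bar>v \<eta>\<bar> powr (p - 1) * weight \<eta>) = ennreal (\<bar>v' \<eta>\<bar> powr (p - 1) * weight \<eta>)"
    using vv' by eventually_elim simp
  qed
  then show ?thesis using iv' by simp
 qed
 have h\<Phi>: "tail \<Phi> < \<infinity>"
 proof -
  have "tail \<Phi>
   \<le> (NNINT \<eta>. ennreal (\<bar>\<phi>' \<eta>\<bar> powr (p - 1) * weight \<eta>) + ennreal (\<bar>v' \<eta>\<bar> powr (p - 1) * weight \<eta>))"
  proof (rule nn_integral_mono_AE)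
   show "AE \<eta> in lborel. ennreal (\<bar>\<Phi> \<eta>\<bar> powr (p - 1) * weight \<eta>)
    \<le> ennreal (\<bar>\<phi>' \<eta>\<bar> powr (p - 1) * weight \<eta>) + ennreal (\<bar>v' \<eta>\<bar> powr (p - 1) * weight \<eta>)"
    using ae\<phi>'
   proof eventually_elim
    case (elim x)
    show ?case
    proof (cases "x \<in> ?D")
     case True
     then have "\<Phi> x = \<phi>' x" using \<Phi>g \<phi>g[OF True] elim by simp
     then show ?thesis by (simp add: add_increasing2)
    next
     case False
     then have "\<Phi> x = v' x" by (simp add: \<Phi>_def)
     then show ?thesis by (simp add: add_increasing)
    qed
   qed
  qed
  also have "\<dots> = tail \<phi>' + tail v'"
   by (rule nn_integral_add) measurable
  also have "\<dots> < \<infinity>" using i\<phi>' iv' by simp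
  finally show ?thesis .
 qed
 have le: "\<Phi> x \<le> v x" for x
 proof (cases "x \<in> ?D")
  case True
  show ?thesis
  proof (cases "u x = \<infinity>")
   case F: False
   have "ereal (g x) \<le> ereal (v x)" using \<phi>[of x] \<phi>g[OF True] v_real[OF True F] by simp
   then show ?thesis using \<Phi>g[OF True] by simp
  qed (use v_top[OF True] \<Phi>g[OF True] in simp)
 qed (simp add: \<Phi>_def v_def)
 \<comment> \<open>Where u is infinite, v = g + 1 exceeds h. Elsewhere h < v means that some real q
   lies between h and u, which exhibits the set as a union of open sets.\<close>
 have lsc': "open {x \<in> ?D. h x < v x}" if h: "continuous_on ?D h" "\<And>x. x \<in> ?D ==> h x < \<Phi> x + 1" for h
 proof -
  have eq: "h x < v x \<longleftrightarrow> (\<exists>q. h x < q \<and> ereal q < u x)" if x: "x \<in> ?D" for x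
  proof (cases "u x = \<infinity>")
   case True
   then show ?thesis using h(2)[OF x] \<Phi>g[OF x] v_top[OF x True] by (auto intro: exI[of _ "h x + 1"])
  next
   case False
   then show ?thesis using v_real[OF x False] by (auto intro: less_trans dest: dense)
  qed
  have "{x \<in> ?D. h x < v x} = (\<Union>q. {x \<in> ?D. h x < q} \<inter> {x \<in> ?D. ereal q < u x})" using eq by blast
  moreover have o1: "open {x \<in> ?D. h x < q}" for q
   using continuous_open_preimage[OF h(1) open_heis_ball open_lessThan[of q]] by (simp add: vimage_def Int_def)
  moreover have o2: "open {x \<in> ?D. ereal q < u x}" for q by (rule lsc_on_open[OF \<Omega> lsc open_heis_ball ball])
  moreover have "open (\<Union>q. {x \<in> ?D. h x < q} \<inter> {x \<in> ?D. ereal q < u x})" by (intro open_UN ballI open_Int o1 o2)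
  ultimately show ?thesis by (simp only:)
 qed
 have fD: "continuous_on ?D f" by (rule continuous_on_subset[OF f ball])
 have r1: "0 < r / 2" "r / 2 \<le> r" using r by auto
 have cc: "closure S \<subseteq> {x. heis_dist x x0 \<le> \<rho>}" "compact (closure S)" if "S \<subseteq> {x. heis_dist x x0 \<le> \<rho>}" for S \<rho>
 proof -
  show 1: "closure S \<subseteq> {x. heis_dist x x0 \<le> \<rho>}" by (rule closure_minimal[OF that closed_heis_cball])
  show "compact (closure S)"
   using bounded_subset[OF compact_imp_bounded[OF compact_heis_cball] 1] by (simp add: compact_eq_bounded_closed)
 qed
 have cD: "{x. heis_dist x x0 \<le> \<rho>} \<subseteq> ?D" if "\<rho> < r" for \<rho> using that by (auto simp: mem_heis_ball)
 have loc: "local_energy v x0 (r / 2) < \<infinity>"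
 proof -
  let ?V = "heis_ball x0 (r / 2)"
  let ?H = "\<lambda>a x y. ennreal (\<bar>a x - a y\<bar> powr p / heis_dist x y powr \<gamma>)"
  have [measurable]: "?V \<in> sets borel" by (rule borel_open[OF open_heis_ball])
  have V: "?V \<subseteq> {x. heis_dist x x0 \<le> r / 2}" by (auto simp: mem_heis_ball)
  have "{x. heis_dist x x0 \<le> r / 2} \<subseteq> ?D" by (rule cD) (use r in simp)
  then have "closure ?V \<subseteq> \<Omega>" using cc(1)[OF V] ball by blast
  then have "Wsp_on s p ?V u" using Wu cc(2)[OF V] open_heis_ball unfolding Wsp_loc_def by blast
  then have fin: "(NNINT x. (NNINT y. ?H (\<lambda>x. real_of_ereal (u x)) x y * indicator ?V y) * indicator ?V x) < \<infinity>"
   by (simp add: Wsp_on_def nn_integral_completion \<gamma>_def)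
  have aer: "AE x in lborel. real_of_ereal (u x) = v x" using aev by eventually_elim simp
  have "(NNINT x. (NNINT y. ?H (\<lambda>x. real_of_ereal (u x)) x y * indicator ?V y) * indicator ?V x)
   = (NNINT x. (NNINT y. ?H v x y * indicator ?V y) * indicator ?V x)"
  proof (rule nn_integral_cong_AE)
   show "AE x in lborel. (NNINT y. ?H (\<lambda>x. real_of_ereal (u x)) x y * indicator ?V y) * indicator ?V x
    = (NNINT y. ?H v x y * indicator ?V y) * indicator ?V x"
    using aer
   proof eventually_elim
    case (elim x)
    have "(NNINT y. ?H (\<lambda>x. real_of_ereal (u x)) x y * indicator ?V y) = (NNINT y. ?H v x y * indicator ?V y)"
    proof (rule nn_integral_cong_AE)
     show "AE y in lborel. ?H (\<lambda>x. real_of_ereal (u x)) x y * indicator ?V y = ?H v x y * indicator ?V y"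
      using aer by eventually_elim (simp only: elim)
    qed
    then show ?case by (simp only:)
   qed
  qed
  with fin have fin': "(NNINT x. (NNINT y. ?H v x y * indicator ?V y) * indicator ?V x) < \<infinity>" by (simp only:)
  have pt: "ennreal (\<bar>v x - v y\<bar> powr p * kk x y) * indicator {z. heis_dist (fst z) x0 < r / 2 \<and> heis_dist (snd z) x0 < r / 2} (x, y)
    \<le> (ennreal Lam * (?H v x y * indicator ?V y)) * indicator ?V x" for x y
  proof (cases "x \<in> ?V \<and> y \<in> ?V")
   case True
   have "\<bar>v x - v y\<bar> powr p * kk x y \<le> \<bar>v x - v y\<bar> powr p * (Lam * heis_dist x y powr (- \<gamma>))"
    by (intro mult_left_mono kk_le) simp
   also have "\<dots> = Lam * (\<bar>v x - v y\<bar> powr p / heis_dist x y powr \<gamma>)" by (simp add: powr_minus_divide)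
   finally have "ennreal (\<bar>v x - v y\<bar> powr p * kk x y) \<le> ennreal Lam * ?H v x y"
    using L by (simp add: ennreal_mult[symmetric] ennreal_leI)
   then show ?thesis using True by (simp add: mem_heis_ball)
  next
   case False
   then have "(x, y) \<notin> {z. heis_dist (fst z) x0 < r / 2 \<and> heis_dist (snd z) x0 < r / 2}" by (simp add: mem_heis_ball)
   then show ?thesis by simp
  qed
  have "local_energy v x0 (r / 2)
   = (NNINT x. (NNINT y. ennreal (\<bar>v x - v y\<bar> powr p * kk x y)
    * indicator {z. heis_dist (fst z) x0 < r / 2 \<and> heis_dist (snd z) x0 < r / 2} (x, y)))"
   by (subst nn_integral_lborel_pair) auto
  also have "\<dots> \<le> (NNINT x. (NNINT y. (ennreal Lam * (?H v x y * indicator ?V y)) * indicator ?V x))"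
   by (intro nn_integral_mono pt)
  also have "\<dots> = (NNINT x. ennreal Lam * ((NNINT y. ?H v x y * indicator ?V y) * indicator ?V x))"
  proof (rule nn_integral_cong)
   fix x
   have "(NNINT y. (ennreal Lam * (?H v x y * indicator ?V y)) * indicator ?V x)
    = (NNINT y. ennreal Lam * (?H v x y * indicator ?V y)) * indicator ?V x" by (rule nn_integral_multc) measurable
   also have "(NNINT y. ennreal Lam * (?H v x y * indicator ?V y)) = ennreal Lam * (NNINT y. ?H v x y * indicator ?V y)"
    by (rule nn_integral_cmult) measurable
   finally show "(NNINT y. (ennreal Lam * (?H v x y * indicator ?V y)) * indicator ?V x)
    = ennreal Lam * ((NNINT y. ?H v x y * indicator ?V y) * indicator ?V x)" by (simp only: mult.assoc)
  qed
  also have "\<dots> = ennreal Lam * (NNINT x. (NNINT y. ?H v x y * indicator ?V y) * indicator ?V x)"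
   by (rule nn_integral_cmult) measurable
  also have "\<dots> < \<infinity>" using fin' by (simp add: ennreal_mult_less_top)
  finally show ?thesis .
 qed
 have weak: "(LBINT x. f x * \<eta> x) \<le> form v \<eta>"
  if \<eta>: "smooth \<eta>" "\<And>x. 0 \<le> \<eta> x" and \<rho>: "\<rho> < r / 2" and supp: "\<And>x. \<rho> < heis_dist x x0 ==> \<eta> x = 0" for \<eta> \<rho>
 proof -
  have \<eta>m [measurable]: "\<eta> \<in> \<B>" by (intro borel_measurable_continuous_onI smooth_continuous \<eta>(1))
  let ?B = "{x. heis_dist x x0 \<le> \<rho>}"
  have S: "{x. \<eta> x \<noteq> 0} \<subseteq> ?B" using supp by force
  have B: "?B \<subseteq> ?D" by (rule cD) (use \<rho> r in linarith)
  have "test_function \<Omega> \<eta>"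
   unfolding test_function_def using \<eta>(1) cc[OF S] B ball by (auto simp: smooth_def)
  then have w: "(LINT \<xi>:\<Omega>|lebesgue. f \<xi> * \<eta> \<xi>) \<le> weak_form K p u \<eta>"
   using u \<eta>(2) by (simp add: weak_supersolution_def)
  let ?F = "\<lambda>x. (indicator ?B x *\<^sub>R f x) * \<eta> x"
  have [measurable]: "(\<lambda>x. indicator ?B x *\<^sub>R f x) \<in> \<B>"
   using closed_heis_cball by (intro borel_measurable_continuous_on_indicator continuous_on_subset[OF fD B]) auto
  have "(LINT \<xi>:\<Omega>|lebesgue. f \<xi> * \<eta> \<xi>) = (LBINT x. ?F x)"
   unfolding set_lebesgue_integral_def
  proof (rule lebesgue_representative(2))
   show "?F \<in> \<B>" by measurable
   show "AE x in lborel. ?F x = indicator \<Omega> x *\<^sub>R (f x * \<eta> x)"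
   proof (rule AE_I2)
    fix x
    show "?F x = indicator \<Omega> x *\<^sub>R (f x * \<eta> x)"
    proof (cases "x \<in> ?B")
     case True
     then have "x \<in> \<Omega>" using B ball by blast
     then show ?thesis using True by simp
    qed (use supp[of x] in simp)
   qed
  qed
  also have "\<dots> = (LBINT x. f x * \<eta> x)"
  proof (rule Bochner_Integration.integral_cong[OF refl])
   fix x
   show "?F x = f x * \<eta> x" using supp[of x] by (cases "x \<in> ?B") auto
  qed
  finally have 1: "(LINT \<xi>:\<Omega>|lebesgue. f \<xi> * \<eta> \<xi>) = (LBINT x. f x * \<eta> x)" .
  have "weak_form K p u \<eta> = form v \<eta>"
   unfolding weak_form_def form_def
  proof (rule lebesgue_representative(2))
   show "(\<lambda>z. Jp p (v (fst z) - v (snd z)) * (\<eta> (fst z) - \<eta> (snd z)) * kk (fst z) (snd z)) \<in> \<B>"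
    by measurable
   show "AE z in lborel. Jp p (v (fst z) - v (snd z)) * (\<eta> (fst z) - \<eta> (snd z)) * kk (fst z) (snd z)
    = (case z of (\<xi>, \<zeta>) => Jp p (real_of_ereal (u \<xi>) - real_of_ereal (u \<zeta>)) * (\<eta> \<xi> - \<eta> \<zeta>) * K \<xi> \<zeta>)"
    using AE_lborel_fst[OF aev] AE_lborel_snd[OF aev]
   proof eventually_elim
    case (elim z)
    \<comment> \<open>\<open>Jp_kk\<close> equates the products with \<open>Jp\<close>, not the
      kernels; \<open>alg\<close> carries this past the test increment.\<close>
    have alg: "a * c = a * b ==> a * d * b = a * d * c" for a b c d :: real by auto
    show ?case unfolding split_beta elim real_of_ereal.simps by (rule alg[OF Jp_kk[OF K k_def]])
   qed
  qed
  with w 1 show ?thesis by simp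
 qed
 have nu: "near_uniform p s Lam r x0 g" unfolding g_def by (rule near_uniform_admissible[OF p1 s L r adm])
 obtain l where l: "(trunc_op \<Phi> x0 \<longlongrightarrow> l) (at_right 0)"
  using trunc_op_limit[OF \<Phi> h\<Phi> \<gamma>_def nu \<Phi>g] by blast
 define \<phi>r where "\<phi>r = (\<lambda>\<xi>. if \<xi> \<in> ?D then \<phi> \<xi> else u \<xi>)"
 have ae\<phi>r: "AE x in lborel. real_of_ereal (\<phi>r x) = \<Phi> x"
  using aev'
 proof eventually_elim
  case (elim x)
  show ?case using elim \<phi>g[of x] \<Phi>g[of x] by (cases "x \<in> ?D") (auto simp: \<phi>r_def \<Phi>_def)
 qed
 have \<phi>r0: "real_of_ereal (\<phi>r x0) = \<Phi> x0" using \<phi>g[OF x0] \<Phi>g[OF x0] x0 by (simp add: \<phi>r_def)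
 have op: "has_op K p \<phi>r x0 (2 * l)"
 proof -
  let ?g = "\<lambda>\<eta>. Jp p (real_of_ereal (\<phi>r x0) - real_of_ereal (\<phi>r \<eta>)) * K x0 \<eta>"
  let ?F = "\<lambda>\<epsilon> \<eta>. Jp p (\<Phi> x0 - \<Phi> \<eta>) * kk x0 \<eta> * indicator {\<eta>. \<epsilon> \<le> heis_dist x0 \<eta>} \<eta>"
  have Fm: "?F \<epsilon> \<in> \<B>" for \<epsilon> by measurable
  have Fae: "AE \<eta> in lborel. ?F \<epsilon> \<eta> = indicator (- heis_ball x0 \<epsilon>) \<eta> *\<^sub>R ?g \<eta>" for \<epsilon>
   using ae\<phi>r
  proof eventually_elim
   case (elim \<eta>)
   have "Jp p (\<Phi> x0 - \<Phi> \<eta>) * K x0 \<eta> = Jp p (\<Phi> x0 - \<Phi> \<eta>) * kk x0 \<eta>" by (rule Jp_kk[OF K k_def])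
   then show ?case unfolding \<phi>r0 elim by (auto simp: indicator_def mem_heis_ball heis_dist_commute[of \<eta> x0] not_less)
  qed
  have "set_integrable lebesgue (- heis_ball x0 \<epsilon>) ?g" if "0 < \<epsilon>" for \<epsilon>
  proof -
   have "integrable lborel (\<lambda>\<eta>. Jp p (\<Phi> x0 - \<Phi> \<eta>) * (kk x0 \<eta> * indicator {\<eta>. \<epsilon> \<le> heis_dist x0 \<eta>} \<eta>))"
    by (rule op_integrable[OF \<Phi> h\<Phi> that, where \<xi> = x0]) (auto simp: indicator_def)
   then have "integrable lborel (?F \<epsilon>)" by (simp only: mult.assoc)
   then show ?thesis unfolding set_integrable_def using lebesgue_representative(1)[OF Fm Fae] by blast
  qed
  moreover have "(LINT \<eta>:- heis_ball x0 \<epsilon>|lebesgue. ?g \<eta>) = trunc_op \<Phi> x0 \<epsilon>" for \<epsilon>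
   unfolding set_lebesgue_integral_def trunc_op_def by (rule lebesgue_representative(2)[OF Fm Fae])
  ultimately show ?thesis unfolding has_op_def Let_def using tendsto_mult[OF tendsto_const[of 2] l] by simp
 qed
 have "f x0 \<le> 2 * l"
 proof (rule ccontr)
  assume "\<not> f x0 \<le> 2 * l"
  then have lf: "2 * l < f x0" by simp
  have "\<exists>\<rho>>0. \<exists>\<theta>>0. AE x in lborel. heis_dist x x0 < \<rho> --> \<Phi> x + \<theta> \<le> v x"
   by (rule touching_lift[OF \<gamma>_def s r adm \<Phi> \<Phi>g[unfolded g_def] h\<Phi> v hv r1 loc le lsc' fD weak l lf])
  then obtain \<rho> \<theta> where \<rho>: "0 < \<rho>" "0 < \<theta>" "AE x in lborel. heis_dist x x0 < \<rho> --> \<Phi> x + \<theta> \<le> v x" by blast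
  \<comment> \<open>Of the gain \<theta> one half is spent on the variation of g near
    \<open>x0\<close>; the other half lifts the essential lower limit above u x0 = g x0.\<close>
  let ?a = "g x0 + \<theta> / 2"
  have "open (?D \<inter> g -` {g x0 - \<theta> / 2<..})" by (intro continuous_open_preimage cg open_heis_ball open_greaterThan)
  moreover have "x0 \<in> ?D \<inter> g -` {g x0 - \<theta> / 2<..}" using x0 \<rho>(2) by simp
  ultimately obtain q where q: "0 < q" "heis_ball x0 q \<subseteq> ?D \<inter> g -` {g x0 - \<theta> / 2<..}" by (rule heis_ball_subset_open)
  have "AE x in lebesgue. x \<in> heis_ball x0 (min q \<rho>) --> ereal ?a \<le> u x"
   unfolding AE_lebesgue_iff using \<rho>(3) aev
  proof eventually_elim
   case (elim x)
   show ?case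
   proof
    assume "x \<in> heis_ball x0 (min q \<rho>)"
    then have x: "x \<in> heis_ball x0 q" "heis_dist x x0 < \<rho>" by (simp_all add: mem_heis_ball)
    then have "x \<in> ?D" "g x0 - \<theta> / 2 < g x" using q(2) by auto
    moreover have "\<Phi> x + \<theta> \<le> v x" using elim(1) x(2) by blast
    ultimately have "?a \<le> v x" using \<Phi>g[of x] by simp
    then show "ereal ?a \<le> u x" unfolding elim(2) by simp
   qed
  qed
  then have "ereal ?a \<le> ess_liminf u x0"
   unfolding ess_liminf_def using q(1) \<rho>(1) by (intro Sup_upper CollectI exI[of _ "min q \<rho>"] conjI) auto
  also have "\<dots> = ereal (g x0)" using ess[of x0] x0 ball \<phi>0 \<phi>g[OF x0] by auto
  finally show False using \<rho>(2) by simp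
 qed
 with op show ?thesis unfolding \<phi>r_def by blast
qed

lemma weak_supersolution_viscosity:
 fixes u :: "'n::finite heis => ereal"
 assumes s: "0 < s" "s < 1" and p1: "1 < p" and \<Omega>: "open \<Omega>" and f: "continuous_on \<Omega> f"
  and lam: "0 < lam" "lam \<le> Lam" and K: "heis_kernel s p lam Lam K"
  and u: "weak_supersolution K s p \<Omega> f u" and lsc: "lsc_on \<Omega> u" and ess: "\<And>\<xi>. \<xi> \<in> \<Omega> ==> u \<xi> = ess_liminf u \<xi>"
 shows "viscosity_supersolution K s p \<Omega> f u"
proof -
 have Lu: "Lm_weighted (p - 1) (s * p) u" using u by (simp add: weak_supersolution_def)
 obtain v where v: "AE x in lborel. u x = ereal (v x)" by (rule Lm_weighted_representative[OF Lu]) (rule that)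
 have "AE x in lebesgue. u x < \<infinity>" "AE x in lebesgue. x \<in> \<Omega> --> - \<infinity> < u x"
  unfolding AE_lebesgue_iff using v by (eventually_elim, simp)+
 moreover have "Lm_weighted (p - 1) (s * p) (\<lambda>\<xi>. max 0 (- u \<xi>))"
  using p1 Lu by (intro Lm_weighted_pos_part Lm_weighted_uminus) auto
 moreover have "\<exists>l. has_op K p (\<lambda>\<xi>. if \<xi> \<in> heis_ball x0 r then \<phi> \<xi> else u \<xi>) x0 l \<and> l \<ge> f x0"
  if "0 < r \<and> heis_ball x0 r \<subseteq> \<Omega> \<and> \<phi> x0 = u x0 \<and> (\<forall>\<xi>. \<phi> \<xi> \<le> u \<xi>) \<and> visc_admissible s p \<phi> x0 r" for \<phi> x0 r
  by (rule weak_supersolution_touching[OF s p1 \<Omega> f lam K u lsc ess]) (use that in auto)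
 ultimately show ?thesis unfolding viscosity_supersolution_def using lsc by blast
qed

lemma weak_subsolution_viscosity:
 fixes u :: "'n::finite heis => ereal"
 assumes s: "0 < s" "s < 1" and p1: "1 < p" and \<Omega>: "open \<Omega>" and f: "continuous_on \<Omega> f"
  and lam: "0 < lam" "lam \<le> Lam" and K: "heis_kernel s p lam Lam K"
  and u: "weak_subsolution K s p \<Omega> f u" and usc: "usc_on \<Omega> u" and ess: "\<And>\<xi>. \<xi> \<in> \<Omega> ==> u \<xi> = ess_limsup u \<xi>"
 shows "viscosity_subsolution K s p \<Omega> f u"
proof -
 have "viscosity_supersolution K s p \<Omega> (\<lambda>x. - f x) (\<lambda>x. - u x)"
 proof (rule weak_supersolution_viscosity[OF s p1 \<Omega> _ lam K])
  show "continuous_on \<Omega> (\<lambda>x. - f x)" by (intro continuous_intros f)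
  show "weak_supersolution K s p \<Omega> (\<lambda>x. - f x) (\<lambda>x. - u x)" by (rule weak_subsolution_uminus[OF p1 u])
  show "lsc_on \<Omega> (\<lambda>x. - u x)" using usc by (simp only: usc_on_uminus)
  show "- u \<xi> = ess_liminf (\<lambda>x. - u x) \<xi>" if "\<xi> \<in> \<Omega>" for \<xi> unfolding ess_liminf_uminus by (simp only: ess[OF that, symmetric])
 qed
 then have sup: "AE x in lebesgue. - u x < \<infinity>" "AE x in lebesgue. x \<in> \<Omega> --> - \<infinity> < - u x"
  "\<And>\<phi> x0 r. 0 < r \<and> heis_ball x0 r \<subseteq> \<Omega> \<and> \<phi> x0 = - u x0 \<and> (\<forall>\<xi>. \<phi> \<xi> \<le> - u \<xi>) \<and> visc_admissible s p \<phi> x0 r ==>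
   (\<exists>l. has_op K p (\<lambda>\<xi>. if \<xi> \<in> heis_ball x0 r then \<phi> \<xi> else - u \<xi>) x0 l \<and> l \<ge> - f x0)"
  "Lm_weighted (p - 1) (s * p) (\<lambda>\<xi>. max 0 (- (- u \<xi>)))"
  unfolding viscosity_supersolution_def by blast+
 have lt: "- a < \<infinity> \<longleftrightarrow> - \<infinity> < a" "- \<infinity> < - a \<longleftrightarrow> a < \<infinity>" for a :: ereal by (cases a; simp)+
 have "\<exists>l. has_op K p (\<lambda>\<xi>. if \<xi> \<in> heis_ball x0 r then \<phi> \<xi> else u \<xi>) x0 l \<and> l \<le> f x0"
  if h: "0 < r \<and> heis_ball x0 r \<subseteq> \<Omega> \<and> \<phi> x0 = u x0 \<and> (\<forall>\<xi>. \<phi> \<xi> \<ge> u \<xi>) \<and> visc_admissible s p \<phi> x0 r" for \<phi> x0 r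
 proof -
  have "\<exists>l. has_op K p (\<lambda>\<xi>. if \<xi> \<in> heis_ball x0 r then - \<phi> \<xi> else - u \<xi>) x0 l \<and> l \<ge> - f x0"
   by (rule sup(3)[of r x0 "\<lambda>x. - \<phi> x"]) (use h visc_admissible_uminus[OF p1, of r s \<phi> x0] in auto)
  then obtain l where l: "has_op K p (\<lambda>\<xi>. if \<xi> \<in> heis_ball x0 r then - \<phi> \<xi> else - u \<xi>) x0 l" "l \<ge> - f x0" by blast
  have "(\<lambda>\<xi>. if \<xi> \<in> heis_ball x0 r then - \<phi> \<xi> else - u \<xi>) = (\<lambda>\<xi>. - (if \<xi> \<in> heis_ball x0 r then \<phi> \<xi> else u \<xi>))"
   by (rule ext) simp
  with l(1) have "has_op K p (\<lambda>\<xi>. if \<xi> \<in> heis_ball x0 r then \<phi> \<xi> else u \<xi>) x0 (- l)"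
   by (intro has_op_uminus) (simp only:)
  then show ?thesis using l(2) by (intro exI[of _ "- l"] conjI) auto
 qed
 then show ?thesis
  unfolding viscosity_subsolution_def
  using sup(1,2,4) usc by (simp only: lt ereal_uminus_uminus) blast
qed

theorem theorem1p9:
  fixes s p lam Lam :: real
    and \<Omega> :: "'n::finite heis set"
    and f :: "'n heis \<Rightarrow> real"
    and K :: "'n heis \<Rightarrow> 'n heis \<Rightarrow> real"
    and u :: "'n heis \<Rightarrow> ereal"
  assumes "0 < s" and "s < 1" and "1 < p"
    and "open \<Omega>" and "continuous_on \<Omega> f"
    and "0 < lam" and "lam \<le> Lam" and "heis_kernel s p lam Lam K"
    and "Wsp_loc s p \<Omega> u" and "Lm_weighted (p - 1) (s * p) u"
  shows "(weak_subsolution K s p \<Omega> f u \<and> usc_on \<Omega> u \<and> (\<forall>\<xi>\<in>\<Omega>. u \<xi> = ess_limsup u \<xi>)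
            \<longrightarrow> viscosity_subsolution K s p \<Omega> f u) \<and>
         (weak_supersolution K s p \<Omega> f u \<and> lsc_on \<Omega> u \<and> (\<forall>\<xi>\<in>\<Omega>. u \<xi> = ess_liminf u \<xi>)
            \<longrightarrow> viscosity_supersolution K s p \<Omega> f u) \<and>
         (weak_solution K s p \<Omega> f u \<and> continuous_on \<Omega> u
            \<longrightarrow> viscosity_solution K s p \<Omega> f u)"
proof -
  note sub = weak_subsolution_viscosity[OF assms(1-8)] and super = weak_supersolution_viscosity[OF assms(1-8)]
  have "viscosity_solution K s p \<Omega> f u" if w: "weak_solution K s p \<Omega> f u" and c: "continuous_on \<Omega> u"
  proof -
    have c': "continuous_on \<Omega> (\<lambda>x. - u x)" by (rule continuous_on_compose2[OF continuous_uminus_ereal[of UNIV] c]) auto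
    \<comment> \<open>Continuity supplies the identification with the essential upper limit, by
      reflection from the lower one.\<close>
    have e: "u \<xi> = ess_limsup u \<xi>" if "\<xi> \<in> \<Omega>" for \<xi>
      using continuous_ess_liminf[OF assms(4) c' that] by (simp add: ess_liminf_uminus)
    have usc: "usc_on \<Omega> u" unfolding usc_on_uminus by (rule continuous_on_lsc[OF assms(4) c'])
    show ?thesis
      unfolding viscosity_solution_def
      using w sub[OF _ usc e] super[OF _ continuous_on_lsc[OF assms(4) c] continuous_ess_liminf[OF assms(4) c]]
      by (simp add: weak_solution_def)
  qed
  then show ?thesis using sub super by blast
qed

end
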